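(* Let $k\ge 7$ and let $\mathcal T$ be a conforming triangulation of a contractible planar polygonal domain $\Omega$. Then the following statements hold. (1) The divergence operator $\operatorname{div}:\Sigma_k^2\to Q_{k-1}^1$ is surjective for any such $\mathcal T$. (2) The divergence operator $\operatorname{div}:\Sigma_k^1\to Q_{k-1}^0$ is surjective for any such $\mathcal T$ that has no Type I singularities. (3) The divergence operator $\operatorname{div}:\Sigma_k^0\to Q_{k-1}^{-1}$ is surjective for any such $\mathcal T$ that has no Type I or Type II singularities. Moreover, for a general such $\mathcal T$: (2') $\dim Q_{k-1}^0-\dim \operatorname{div}\Sigma_k^1=|\mathcal V_I|$; (3') $\dim Q_{k-1}^{-1}-\dim\operatorname{div}\Sigma_k^0=|\mathcal V_{II}|+3|\mathcal V_I|$. Here $\mathcal V_I$ and $\mathcal V_{II}$ denote the sets of vertices with Type I, respectively Type II, singularities.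
   Context: $\mathbb S^2$ is the space of symmetric real $2\times2$ matrices; $\operatorname{div}$ of a matrix-valued function is taken row-wise. $\mathcal V$ is the set of vertices of $\mathcal T$. A piecewise smooth function is said to be in $C^r(\mathcal V)$ if, for all $0\le r'\le r$, its derivatives of order $r'$ are continuous at every vertex (i.e. the values at a vertex taken from all elements containing that vertex agree). Spaces: for $r=0,1,2$, $\Sigma_k^r=\{\sigma\in C^0(\overline\Omega;\mathbb S^2):\ \sigma|_T\in P_k(T;\mathbb S^2)\ \forall T\in\mathcal T,\ \sigma\in C^r(\mathcal V)\}$; $Q_{k-1}^{-1}=\{q\in L^2(\Omega;\mathbb R^2): q|_T\in P_{k-1}(T;\mathbb R^2)\ \forall T\in\mathcal T\}$; and for $r=0,1$, $Q_{k-1}^r=\{q\in Q_{k-1}^{-1}: q\in C^r(\mathcal V)\}$ (no continuity across edges is required). Singularities: a vertex has a Type I singularity if it is an interior vertex and all edges incident to it lie on at most two distinct lines. A vertex has a Type II singularity if it is an interior vertex and all edges incident to it lie on exactly three distinct lines. *)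

theory Defs
  imports "HOL-Analysis.Analysis" "HOL-Library.Function_Algebras"
begin

text \<open>Pointwise scalar multiplication; together with \<^theory>\<open>HOL-Library.Function_Algebras\<close> it
  makes function spaces real vector spaces, so that \<^const>\<open>dim\<close> applies to sets of functions.\<close>

instantiation "fun" :: (type, real_vector) real_vector
begin

definition scaleR_fun :: "real \<Rightarrow> ('a \<Rightarrow> 'b) \<Rightarrow> 'a \<Rightarrow> 'b"
  where "scaleR_fun c f = (\<lambda>x. c *\<^sub>R f x)"

instance
  by standard (auto simp: scaleR_fun_def plus_fun_def scaleR_add_right scaleR_add_left)

end


type_synonym point = "real ^ 2"
type_synonym mesh = "point set set"


subsection \<open>Domains and meshes\<close>

definition simple_closed_polygon :: "point set \<Rightarrow> bool" where
  "simple_closed_polygon P \<longleftrightarrow>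
     (\<exists>g. simple_path g \<and> pathfinish g = pathstart g \<and> path_image g = P) \<and>
     (\<exists>S. finite S \<and> P = (\<Union>(a, b)\<in>S. closed_segment a b))"

text \<open>Disjointness of the simple closed boundary polygons excludes slits, isolated boundary points
  and domains touching themselves at a boundary point. Holes are allowed.\<close>

definition polygonal_domain :: "point set \<Rightarrow> bool" where
  "polygonal_domain \<Omega> \<longleftrightarrow>
     open \<Omega> \<and> connected \<Omega> \<and> bounded \<Omega> \<and> \<Omega> \<noteq> {} \<and>
     (\<exists>\<P>. finite \<P> \<and> pairwise disjnt \<P> \<and> (\<forall>P\<in>\<P>. simple_closed_polygon P) \<and>
          frontier \<Omega> = \<Union>\<P>)"

text \<open>Elements are closed nondegenerate triangles. The library notion \<^const>\<open>triangulation\<close>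
  supplies finiteness and conformity: two elements meet in a common (possibly empty) face.\<close>

definition conforming_triangulation :: "mesh \<Rightarrow> point set \<Rightarrow> bool" where
  "conforming_triangulation \<T> \<Omega> \<longleftrightarrow>
     triangulation \<T> \<and> (\<forall>T\<in>\<T>. 2 simplex T) \<and> \<Union>\<T> = closure \<Omega>"

definition mesh_vertices :: "mesh \<Rightarrow> point set" where
  "mesh_vertices \<T> = {v. \<exists>T\<in>\<T>. v extreme_point_of T}"

definition mesh_edges :: "mesh \<Rightarrow> point set set" where
  "mesh_edges \<T> = {e. \<exists>T\<in>\<T>. e edge_of T}"

definition lines_at :: "mesh \<Rightarrow> point \<Rightarrow> point set set" where
  "lines_at \<T> v = {affine hull e | e. e \<in> mesh_edges \<T> \<and> v \<in> e}"

definition type_I_vertices :: "point set \<Rightarrow> mesh \<Rightarrow> point set" where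
  "type_I_vertices \<Omega> \<T> = {v \<in> mesh_vertices \<T>. v \<in> \<Omega> \<and> card (lines_at \<T> v) \<le> 2}"

definition type_II_vertices :: "point set \<Rightarrow> mesh \<Rightarrow> point set" where
  "type_II_vertices \<Omega> \<T> = {v \<in> mesh_vertices \<T>. v \<in> \<Omega> \<and> card (lines_at \<T> v) = 3}"


subsection \<open>Derivatives and smoothness at vertices\<close>

definition partial_deriv :: "2 \<Rightarrow> (point \<Rightarrow> 'b::real_normed_vector) \<Rightarrow> point \<Rightarrow> 'b" where
  "partial_deriv j f x = frechet_derivative f (at x) (axis j 1)"

text \<open>The value at a vertex, taken from an element, of a derivative of a piecewise smooth function
  is the limit from the interior of the element. The list \<open>js\<close> ranges over the
  iterated partial derivatives of order \<open>length js\<close>.\<close>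

definition smooth_at_vertices :: "nat \<Rightarrow> mesh \<Rightarrow> (point \<Rightarrow> 'b::real_normed_vector) \<Rightarrow> bool" where
  "smooth_at_vertices r \<T> f \<longleftrightarrow>
     (\<forall>v\<in>mesh_vertices \<T>. \<forall>js. length js \<le> r \<longrightarrow>
        (\<exists>l. \<forall>T\<in>\<T>. v \<in> T \<longrightarrow> (foldr partial_deriv js f \<longlongrightarrow> l) (at v within interior T)))"


subsection \<open>Finite element spaces\<close>

definition poly_maps :: "nat \<Rightarrow> (point \<Rightarrow> 'b::real_vector) set" where
  "poly_maps k =
     {p. \<exists>c. \<forall>x. p x = (\<Sum>(i, j) | i + j \<le> k. (x $ 1 ^ i * x $ 2 ^ j) *\<^sub>R c i j)}"

definition sym_matrices :: "(real ^ 2 ^ 2) set" where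
  "sym_matrices = {A. transpose A = A}"

definition L2_functions :: "point set \<Rightarrow> (point \<Rightarrow> real ^ 2) set" where
  "L2_functions \<Omega> =
     {q \<in> borel_measurable (lebesgue_on \<Omega>). integrable (lebesgue_on \<Omega>) (\<lambda>x. (norm (q x))\<^sup>2)}"

text \<open>Functions on the closure of \<open>\<Omega>\<close> are extended by zero.\<close>

definition Sigma_space :: "point set \<Rightarrow> mesh \<Rightarrow> nat \<Rightarrow> nat \<Rightarrow> (point \<Rightarrow> real ^ 2 ^ 2) set" where
  "Sigma_space \<Omega> \<T> k r =
     {\<sigma>. continuous_on (closure \<Omega>) \<sigma> \<and> (\<forall>x\<in>closure \<Omega>. \<sigma> x \<in> sym_matrices) \<and>
         (\<forall>x. x \<notin> closure \<Omega> \<longrightarrow> \<sigma> x = 0) \<and>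
         (\<forall>T\<in>\<T>. \<exists>p\<in>poly_maps k. \<forall>x\<in>T. \<sigma> x = p x) \<and>
         smooth_at_vertices r \<T> \<sigma>}"

text \<open>A piecewise polynomial class in \<open>L\<^sup>2(\<Omega>)\<close> is represented by its unique member that
  is polynomial on the interior of each element and zero elsewhere, in particular on the
  (null) union of the edges. Thus equality of functions below is equality in
  \<open>L\<^sup>2(\<Omega>)\<close>, and dimensions are those of spaces of classes.\<close>

definition mesh_interior :: "mesh \<Rightarrow> point set" where
  "mesh_interior \<T> = (\<Union>T\<in>\<T>. interior T)"

definition Q_broken :: "point set \<Rightarrow> mesh \<Rightarrow> nat \<Rightarrow> (point \<Rightarrow> real ^ 2) set" where
  "Q_broken \<Omega> \<T> m =
     {q \<in> L2_functions \<Omega>. (\<forall>x. x \<notin> mesh_interior \<T> \<longrightarrow> q x = 0) \<and>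
         (\<forall>T\<in>\<T>. \<exists>p\<in>poly_maps m. \<forall>x\<in>interior T. q x = p x)}"

definition Q_space :: "point set \<Rightarrow> mesh \<Rightarrow> nat \<Rightarrow> nat \<Rightarrow> (point \<Rightarrow> real ^ 2) set" where
  "Q_space \<Omega> \<T> m r = {q \<in> Q_broken \<Omega> \<T> m. smooth_at_vertices r \<T> q}"

text \<open>Row-wise divergence, computed element by element. On continuous piecewise polynomials
  this is the distributional divergence.\<close>

definition mesh_div :: "mesh \<Rightarrow> (point \<Rightarrow> real ^ 2 ^ 2) \<Rightarrow> point \<Rightarrow> real ^ 2" where
  "mesh_div \<T> \<sigma> x =
     (if x \<in> mesh_interior \<T>
      then (\<chi> i. \<Sum>j\<in>UNIV. partial_deriv j (\<lambda>y. \<sigma> y $ i $ j) x)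
      else 0)"

end

theory Submission
  imports Defs "HOL-Computational_Algebra.Polynomial"
begin

text \<open>
  Consider first one triangle and a vector polynomial \<open>q\<close> of degree \<open>k - 1\<close> whose values and first
  derivatives vanish at the three vertices. Symmetric matrices are combinations of the squares \<open>t t\<^sup>T\<close>
  of the edge vectors, and in this basis the divergence is a sum of tangential derivatives. Two
  equations for three functions leave enough freedom to solve \<open>div \<sigma> = q\<close> with a stress \<open>\<sigma>\<close> that
  vanishes to third order at the vertices and vanishes on two of the three edges
  (\<open>triangle_lift\<close>). The explicit corrections on the reference triangle have degree 7.

  On a mesh, the trace of \<open>\<sigma>\<close> on the third edge is continued to the neighbour across that edge. Modulo
  divergences, \<open>q\<close> has been moved to the neighbour, or has been removed if the edge is on the boundary.
  If some elements could not be emptied in this way, each of their edges would lie in another such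
  element, and their union would be a bounded nonempty set that is open and closed in the plane. So
  every piecewise polynomial with vanishing first-order jets at the vertices is a divergence
  (\<open>zero_jets_in_Dfam\<close>). A first-order jet that is common to all elements at a vertex is the divergence
  of a quadratic stress, cut off at the vertex. This proves surjectivity onto \<open>Q\<^sup>1\<close> (\<open>Dfam2_eq\<close>).

  For less smooth stresses the range is found by duality. A linear functional that vanishes on
  divergences depends, by the previous step, only on the values and the edge slopes at the vertices.
  Testing it with stresses concentrated at one edge or in one corner yields linear conditions on its
  weights at each vertex. A weight against values is transported from element to element around the
  vertex by its cubic form (\<open>Ann_cubic\<close>), which vanishes in the direction of every edge at the vertex.
  Hence the weight of an element is orthogonal to every edge off the two lines of that element: it is
  zero if the edges occupy four or more lines, unique up to a factor for three lines, and has two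
  degrees of freedom for two lines. Weights against slopes can cross an edge only if the adjacent
  edges are opposite on one line, so they exist exactly for two lines and are unique up to a factor
  (\<open>Ann2_zero\<close>, \<open>Ann2_typeI\<close>). Around a boundary vertex all weights vanish.

  Consequently the range for continuous stresses is cut out by one functional for each vertex of Type
  II and three for each vertex of Type I; for stresses of class one at the vertices one functional for
  each vertex of Type I remains (\<open>range0\<close>, \<open>range1\<close>). Hermite functions supported on single elements
  are dual to these functionals, so their number is the codimension (\<open>family_dims\<close>).

  All of this is done with families of polynomials indexed by elements. The last two parts identify
  these families with the finite element spaces, and the combinatorial singular vertices with those
  of the triangulation; that a boundary vertex is not interior to the closed domain is a consequence
  of the Jordan-Brouwer theorem (\<open>interior_closure_polygonal\<close>).
\<close>

section \<open>Polynomial maps of the plane\<close>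

lemma poly_maps_iff:
  "p \<in> poly_maps k \<longleftrightarrow>
     (\<exists>c. p = (\<lambda>x. \<Sum>z\<in>{z. fst z + snd z \<le> k}. (x $ 1 ^ fst z * x $ 2 ^ snd z) *\<^sub>R c (fst z) (snd z)))"
proof -
  have "{z. fst z + snd z \<le> k} = {(i, j). i + j \<le> k}" by auto
  then show ?thesis
    unfolding poly_maps_def by (simp add: case_prod_unfold fun_eq_iff)
qed

lemma finite_exponents: "finite {z :: nat \<times> nat. fst z + snd z \<le> k}"
  by (rule finite_subset[of _ "{..k} \<times> {..k}"]) auto

lemma poly_maps_zero [simp]: "(\<lambda>x. 0) \<in> poly_maps k"
  unfolding poly_maps_iff by (rule exI[of _ "\<lambda>_ _. 0"]) simp

lemma poly_maps_add:
  assumes "p \<in> poly_maps k" "q \<in> poly_maps k"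
  shows "(\<lambda>x. p x + q x) \<in> poly_maps k"
proof -
  from assms obtain c d where
    "p = (\<lambda>x. \<Sum>z\<in>{z. fst z + snd z \<le> k}. (x $ 1 ^ fst z * x $ 2 ^ snd z) *\<^sub>R c (fst z) (snd z))"
    "q = (\<lambda>x. \<Sum>z\<in>{z. fst z + snd z \<le> k}. (x $ 1 ^ fst z * x $ 2 ^ snd z) *\<^sub>R d (fst z) (snd z))"
    unfolding poly_maps_iff by blast
  then show ?thesis unfolding poly_maps_iff
    by (intro exI[of _ "\<lambda>i j. c i j + d i j"]) (simp add: scaleR_add_right sum.distrib)
qed

lemma poly_maps_linear:
  assumes "p \<in> poly_maps k" "linear L"
  shows "(\<lambda>x. L (p x)) \<in> poly_maps k"
proof -
  from assms(1) obtain c where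
    "p = (\<lambda>x. \<Sum>z\<in>{z. fst z + snd z \<le> k}. (x $ 1 ^ fst z * x $ 2 ^ snd z) *\<^sub>R c (fst z) (snd z))"
    unfolding poly_maps_iff by blast
  then show ?thesis unfolding poly_maps_iff
    by (intro exI[of _ "\<lambda>i j. L (c i j)"])
       (simp add: linear_sum[OF assms(2)] linear_scale[OF assms(2)])
qed

lemma poly_maps_scaleR: "p \<in> poly_maps k \<Longrightarrow> (\<lambda>x. r *\<^sub>R p x) \<in> poly_maps k"
  by (rule poly_maps_linear) simp_all

lemma poly_maps_cmult: "p \<in> poly_maps k \<Longrightarrow> (\<lambda>x. r * p x :: real) \<in> poly_maps k"
  using poly_maps_scaleR[of p k r] by simp

lemma poly_maps_uminus: "p \<in> poly_maps k \<Longrightarrow> (\<lambda>x. - p x) \<in> poly_maps k"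
  using poly_maps_scaleR[of p k "-1"] by simp

lemma poly_maps_diff:
  "p \<in> poly_maps k \<Longrightarrow> q \<in> poly_maps k \<Longrightarrow> (\<lambda>x. p x - q x) \<in> poly_maps k"
  using poly_maps_add[OF _ poly_maps_uminus, of p k q] by simp

lemma poly_maps_sum:
  "(\<And>i. i \<in> I \<Longrightarrow> p i \<in> poly_maps k) \<Longrightarrow> (\<lambda>x. \<Sum>i\<in>I. p i x) \<in> poly_maps k"
  by (induction I rule: infinite_finite_induct) (auto intro!: poly_maps_add)

lemma poly_maps_monomial:
  assumes "i + j \<le> k"
  shows "(\<lambda>x. (x $ 1 ^ i * x $ 2 ^ j) *\<^sub>R c) \<in> poly_maps k"
  unfolding poly_maps_iff
proof (intro exI[of _ "\<lambda>a b. if (a, b) = (i, j) then c else 0"] ext)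
  fix x :: point
  have "(\<Sum>z\<in>{z. fst z + snd z \<le> k}. (x $ 1 ^ fst z * x $ 2 ^ snd z) *\<^sub>R
          (if (fst z, snd z) = (i, j) then c else 0))
      = (\<Sum>z\<in>{z. fst z + snd z \<le> k}. if z = (i, j) then (x $ 1 ^ i * x $ 2 ^ j) *\<^sub>R c else 0)"
    by (rule sum.cong) (auto split: if_splits)
  also have "\<dots> = (x $ 1 ^ i * x $ 2 ^ j) *\<^sub>R c"
    using assms finite_exponents[of k] by (simp add: sum.delta)
  finally show "(x $ 1 ^ i * x $ 2 ^ j) *\<^sub>R c = (\<Sum>z\<in>{z. fst z + snd z \<le> k}. (x $ 1 ^ fst z * x $ 2 ^ snd z) *\<^sub>R
          (if (fst z, snd z) = (i, j) then c else 0))" by simp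
qed

lemma poly_maps_induct [consumes 1, case_names monomial zero add]:
  assumes "p \<in> poly_maps k"
    and mono: "\<And>i j c. i + j \<le> k \<Longrightarrow> P (\<lambda>x. (x $ 1 ^ i * x $ 2 ^ j) *\<^sub>R c)"
    and zero: "P (\<lambda>x. 0)"
    and add: "\<And>p q. p \<in> poly_maps k \<Longrightarrow> q \<in> poly_maps k \<Longrightarrow> P p \<Longrightarrow> P q \<Longrightarrow> P (\<lambda>x. p x + q x)"
  shows "P p"
proof -
  from assms(1) obtain c where p:
    "p = (\<lambda>x. \<Sum>z\<in>{z. fst z + snd z \<le> k}. (x $ 1 ^ fst z * x $ 2 ^ snd z) *\<^sub>R c (fst z) (snd z))"
    unfolding poly_maps_iff by blast
  have "P (\<lambda>x. \<Sum>z\<in>Z. (x $ 1 ^ fst z * x $ 2 ^ snd z) *\<^sub>R c (fst z) (snd z))"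
    if "finite Z" "Z \<subseteq> {z. fst z + snd z \<le> k}" for Z
    using that
  proof (induction Z rule: finite_induct)
    case empty
    then show ?case using zero by simp
  next
    case (insert z Z)
    have "(\<lambda>x :: point. \<Sum>z\<in>Z. (x $ 1 ^ fst z * x $ 2 ^ snd z) *\<^sub>R c (fst z) (snd z)) \<in> poly_maps k"
      using insert.prems by (intro poly_maps_sum poly_maps_monomial) auto
    then have "P (\<lambda>x. (x $ 1 ^ fst z * x $ 2 ^ snd z) *\<^sub>R c (fst z) (snd z)
        + (\<Sum>z\<in>Z. (x $ 1 ^ fst z * x $ 2 ^ snd z) *\<^sub>R c (fst z) (snd z)))"
      using insert by (intro add poly_maps_monomial mono) auto
    then show ?case using insert by simp
  qed
  from this[OF finite_exponents subset_refl] show ?thesis by (simp add: p)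
qed

lemma poly_maps_mono: "p \<in> poly_maps k \<Longrightarrow> k \<le> m \<Longrightarrow> p \<in> poly_maps m"
  by (induction p rule: poly_maps_induct) (auto intro!: poly_maps_monomial poly_maps_add)

lemma poly_maps_const [simp]: "(\<lambda>x. c) \<in> poly_maps k"
  using poly_maps_monomial[of 0 0 k c] by simp

lemma poly_maps_coord: "1 \<le> k \<Longrightarrow> (\<lambda>x. x $ i) \<in> poly_maps k"
  using poly_maps_monomial[of 1 0 k "1 :: real"] poly_maps_monomial[of 0 1 k "1 :: real"] exhaust_2[of i]
  by auto

lemma poly_maps_mult_scaleR:
  assumes "p \<in> poly_maps a" "q \<in> poly_maps b"
  shows "(\<lambda>x. p x *\<^sub>R q x) \<in> poly_maps (a + b)"
  using assms(1)
proof (induction p rule: poly_maps_induct)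
  case (monomial i j c)
  note ij = monomial
  from assms(2) show ?case
  proof (induction q rule: poly_maps_induct)
    case (monomial i' j' c')
    then have "(\<lambda>x :: point. (x $ 1 ^ (i + i') * x $ 2 ^ (j + j')) *\<^sub>R (c *\<^sub>R c')) \<in> poly_maps (a + b)"
      using ij by (intro poly_maps_monomial) auto
    then show ?case by (simp add: power_add mult_ac)
  next
    case zero
    then show ?case by simp
  next
    case (add p q)
    then show ?case by (simp add: scaleR_add_right poly_maps_add)
  qed
next
  case zero
  then show ?case by simp
next
  case (add p q)
  then show ?case by (simp add: scaleR_add_left poly_maps_add)
qed

lemma poly_maps_mult:
  "p \<in> poly_maps a \<Longrightarrow> q \<in> poly_maps b \<Longrightarrow> (\<lambda>x. p x * q x :: real) \<in> poly_maps (a + b)"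
  using poly_maps_mult_scaleR[of p a q b] by simp

lemma poly_maps_power:
  "p \<in> poly_maps a \<Longrightarrow> (\<lambda>x. p x ^ n :: real) \<in> poly_maps (a * n)"
  by (induction n) (auto intro: poly_maps_mult)

lemma poly_maps_comp_affine:
  assumes "p \<in> poly_maps k" "\<And>i. (\<lambda>x. \<Phi> x $ i) \<in> poly_maps 1"
  shows "(\<lambda>x. p (\<Phi> x)) \<in> poly_maps k"
  using assms(1)
proof (induction p rule: poly_maps_induct)
  case (monomial i j c)
  have "(\<lambda>x. \<Phi> x $ 1 ^ i * \<Phi> x $ 2 ^ j) \<in> poly_maps (1 * i + 1 * j)"
    by (intro poly_maps_mult poly_maps_power assms)
  from poly_maps_mult_scaleR[OF this poly_maps_const[of c 0]] show ?case
    using poly_maps_mono monomial by fastforce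
qed (auto intro: poly_maps_add)

subsection \<open>Partial derivatives of polynomials\<close>

lemma poly_maps_differentiable:
  fixes p :: "point \<Rightarrow> 'b::real_normed_vector"
  shows "p \<in> poly_maps k \<Longrightarrow> p differentiable at x"
proof (induction p rule: poly_maps_induct)
  case (monomial i j c)
  have "bounded_linear (\<lambda>x :: point. x $ n)" for n by (rule bounded_linear_vec_nth)
  then have *: "(\<lambda>x :: point. x $ n) differentiable at x" for n
    by (meson bounded_linear_imp_differentiable)
  have "((\<lambda>x :: point. x $ n ^ m) differentiable at x)" for n m
    by (induction m) (auto intro: differentiable_mult *)
  then have "(\<lambda>x :: point. x $ 1 ^ i * x $ 2 ^ j) differentiable at x"
    by (intro differentiable_mult)
  then show ?case by (intro differentiable_scaleR) auto
qed (auto intro: differentiable_add)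

lemma has_derivative_partials:
  fixes f :: "point \<Rightarrow> 'b::real_normed_vector"
  assumes "f differentiable at x"
  shows "(f has_derivative (\<lambda>h. \<Sum>j\<in>UNIV. h $ j *\<^sub>R partial_deriv j f x)) (at x)"
proof -
  have d: "(f has_derivative frechet_derivative f (at x)) (at x)"
    using assms frechet_derivative_works by blast
  then have l: "linear (frechet_derivative f (at x))"
    using has_derivative_linear by blast
  have "frechet_derivative f (at x) h = (\<Sum>j\<in>UNIV. h $ j *\<^sub>R partial_deriv j f x)" for h
  proof -
    have "h = (\<Sum>j\<in>UNIV. h $ j *\<^sub>R axis j 1)"
      by (simp add: vec_eq_iff axis_def if_distrib cong: if_cong)
    then have "frechet_derivative f (at x) h = frechet_derivative f (at x) (\<Sum>j\<in>UNIV. h $ j *\<^sub>R axis j 1)"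
      by simp
    then show ?thesis
      by (simp add: linear_sum[OF l] linear_scale[OF l] partial_deriv_def)
  qed
  then have "frechet_derivative f (at x) = (\<lambda>h. \<Sum>j\<in>UNIV. h $ j *\<^sub>R partial_deriv j f x)"
    by (rule ext)
  with d show ?thesis by simp
qed

lemma partial_deriv_eq:
  assumes "(f has_derivative f') (at x)"
  shows "partial_deriv j f x = f' (axis j 1)"
  using assms frechet_derivative_at partial_deriv_def by metis

lemma partial_deriv_add:
  fixes f g :: "point \<Rightarrow> 'b::real_normed_vector"
  assumes "\<And>x. f differentiable at x" "\<And>x. g differentiable at x"
  shows "partial_deriv j (\<lambda>x. f x + g x) = (\<lambda>x. partial_deriv j f x + partial_deriv j g x)"
proof
  fix x
  show "partial_deriv j (\<lambda>x. f x + g x) x = partial_deriv j f x + partial_deriv j g x"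
    using partial_deriv_eq[OF has_derivative_add[OF assms[unfolded frechet_derivative_works]], of j x]
    by (simp add: partial_deriv_def)
qed

lemma partial_deriv_linear:
  fixes f :: "point \<Rightarrow> 'b::real_normed_vector"
  assumes "\<And>x. f differentiable at x" "bounded_linear L"
  shows "partial_deriv j (\<lambda>x. L (f x)) = (\<lambda>x. L (partial_deriv j f x))"
proof
  fix x
  have "(f has_derivative frechet_derivative f (at x)) (at x)"
    using assms frechet_derivative_works by blast
  from bounded_linear.has_derivative[OF assms(2) this]
  show "partial_deriv j (\<lambda>x. L (f x)) x = L (partial_deriv j f x)"
    unfolding partial_deriv_def using frechet_derivative_at by metis
qed

lemma partial_deriv_mult_scaleR:
  fixes g :: "point \<Rightarrow> 'b::real_normed_vector"
  assumes "\<And>x. f differentiable at x" "\<And>x. g differentiable at x"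
  shows "partial_deriv j (\<lambda>x. f x *\<^sub>R g x) = (\<lambda>x. f x *\<^sub>R partial_deriv j g x + partial_deriv j f x *\<^sub>R g x)"
proof
  fix x
  have "((\<lambda>x. f x *\<^sub>R g x) has_derivative
      (\<lambda>h. f x *\<^sub>R frechet_derivative g (at x) h + frechet_derivative f (at x) h *\<^sub>R g x)) (at x)"
    by (intro has_derivative_scaleR) (use assms frechet_derivative_works in blast)+
  from partial_deriv_eq[OF this] show "partial_deriv j (\<lambda>x. f x *\<^sub>R g x) x = f x *\<^sub>R partial_deriv j g x + partial_deriv j f x *\<^sub>R g x"
    by (simp add: partial_deriv_def)
qed

lemma partial_deriv_const [simp]: "partial_deriv j (\<lambda>x. c) = (\<lambda>x. 0)"
  by (rule ext) (simp add: partial_deriv_def frechet_derivative_const)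

lemma partial_deriv_coord:
  "partial_deriv j (\<lambda>x. x $ i) = (\<lambda>x. if i = j then 1 else 0)"
proof
  fix x :: point
  have "((\<lambda>x :: point. x $ i) has_derivative (\<lambda>h. h $ i)) (at x)"
    using bounded_linear_imp_has_derivative bounded_linear_vec_nth by blast
  from partial_deriv_eq[OF this] show "partial_deriv j (\<lambda>x. x $ i) x = (if i = j then 1 else 0)"
    by (simp add: axis_def)
qed

lemma partial_deriv_monomial:
  "partial_deriv 1 (\<lambda>x. (x $ 1 ^ i * x $ 2 ^ j) *\<^sub>R c) = (\<lambda>x. (x $ 1 ^ (i - 1) * x $ 2 ^ j) *\<^sub>R (real i *\<^sub>R c))"
  "partial_deriv 2 (\<lambda>x. (x $ 1 ^ i * x $ 2 ^ j) *\<^sub>R c) = (\<lambda>x. (x $ 1 ^ i * x $ 2 ^ (j - 1)) *\<^sub>R (real j *\<^sub>R c))"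
proof -
  have c: "((\<lambda>x :: point. x $ n) has_derivative (\<lambda>h. h $ n)) (at x)" for n x
    using bounded_linear_imp_has_derivative bounded_linear_vec_nth by blast
  have *: "((\<lambda>x :: point. (x $ 1 ^ i * x $ 2 ^ j) *\<^sub>R c) has_derivative
     (\<lambda>h. (x $ 1 ^ i * (of_nat j * h $ 2 * x $ 2 ^ (j - 1))
         + of_nat i * h $ 1 * x $ 1 ^ (i - 1) * x $ 2 ^ j) *\<^sub>R c)) (at x)" for x
    by (intro has_derivative_scaleR_left has_derivative_mult has_derivative_power c)
  have ax: "axis (1::2) (1::real) $ 1 = 1" "axis (1::2) (1::real) $ 2 = 0"
     "axis (2::2) (1::real) $ 1 = 0" "axis (2::2) (1::real) $ 2 = 1" by (auto simp: axis_def)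
  show "partial_deriv 1 (\<lambda>x. (x $ 1 ^ i * x $ 2 ^ j) *\<^sub>R c) = (\<lambda>x. (x $ 1 ^ (i - 1) * x $ 2 ^ j) *\<^sub>R (real i *\<^sub>R c))"
    by (rule ext) (simp add: partial_deriv_eq[OF *] ax mult_ac)
  show "partial_deriv 2 (\<lambda>x. (x $ 1 ^ i * x $ 2 ^ j) *\<^sub>R c) = (\<lambda>x. (x $ 1 ^ i * x $ 2 ^ (j - 1)) *\<^sub>R (real j *\<^sub>R c))"
    by (rule ext) (simp add: partial_deriv_eq[OF *] ax mult_ac)
qed

lemma poly_maps_partial_deriv:
  fixes p :: "point \<Rightarrow> 'b::real_normed_vector"
  assumes "p \<in> poly_maps k"
  shows "partial_deriv j p \<in> poly_maps (k - 1)"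
  using assms
proof (induction p rule: poly_maps_induct)
  case (monomial a b c)
  have "partial_deriv 1 (\<lambda>x. (x $ 1 ^ a * x $ 2 ^ b) *\<^sub>R c) \<in> poly_maps (k - 1)"
  proof (cases a)
    case 0
    then show ?thesis unfolding partial_deriv_monomial by simp
  next
    case (Suc n)
    then show ?thesis unfolding partial_deriv_monomial
      using monomial by (intro poly_maps_monomial) auto
  qed
  moreover have "partial_deriv 2 (\<lambda>x. (x $ 1 ^ a * x $ 2 ^ b) *\<^sub>R c) \<in> poly_maps (k - 1)"
  proof (cases b)
    case 0
    then show ?thesis unfolding partial_deriv_monomial by simp
  next
    case (Suc n)
    then show ?thesis unfolding partial_deriv_monomial
      using monomial by (intro poly_maps_monomial) auto
  qed
  ultimately show ?case using exhaust_2[of j] by auto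
next
  case zero
  then show ?case by simp
next
  case (add p q)
  then show ?case
    by (simp add: partial_deriv_add poly_maps_differentiable[of _ k] poly_maps_add)
qed

lemma partial_deriv_commute:
  fixes p :: "point \<Rightarrow> 'b::real_normed_vector"
  assumes "p \<in> poly_maps k"
  shows "partial_deriv i (partial_deriv j p) = partial_deriv j (partial_deriv i p)"
proof -
  have "partial_deriv 1 (partial_deriv 2 p) = partial_deriv 2 (partial_deriv 1 p)"
    using assms
  proof (induction p rule: poly_maps_induct)
    case (monomial a b c)
    then show ?case by (simp only: partial_deriv_monomial) (simp add: mult_ac)
  next
    case (add p q)
    note pp = poly_maps_partial_deriv[OF add(1)] poly_maps_partial_deriv[OF add(2)]
    show ?case
      by (simp add: partial_deriv_add poly_maps_differentiable[OF add(1)] poly_maps_differentiable[OF add(2)]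
           poly_maps_differentiable[OF pp(1)] poly_maps_differentiable[OF pp(2)] add.IH)
  qed simp
  then show ?thesis using exhaust_2[of i] exhaust_2[of j] by auto
qed

text \<open>Antidifferentiation in one coordinate raises the degree by one; the constant of
  integration is fixed by vanishing on the line where that coordinate is zero.\<close>

lemma poly_maps_antiderivative:
  fixes p :: "point \<Rightarrow> 'b::real_normed_vector"
  assumes "p \<in> poly_maps k"
  shows "\<exists>P\<in>poly_maps (Suc k). partial_deriv j P = p \<and> (\<forall>x. x $ j = 0 \<longrightarrow> P x = 0)"
  using assms
proof (induction p rule: poly_maps_induct)
  case (monomial a b c)
  let ?P = "\<lambda>x :: point. (x $ 1 ^ (Suc a) * x $ 2 ^ b) *\<^sub>R (inverse (real (Suc a)) *\<^sub>R c)"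
  let ?Q = "\<lambda>x :: point. (x $ 1 ^ a * x $ 2 ^ (Suc b)) *\<^sub>R (inverse (real (Suc b)) *\<^sub>R c)"
  have "?P \<in> poly_maps (Suc k)" "?Q \<in> poly_maps (Suc k)"
    using monomial by (intro poly_maps_monomial; simp)+
  moreover have "partial_deriv 1 ?P = (\<lambda>x. (x $ 1 ^ a * x $ 2 ^ b) *\<^sub>R c)"
    by (simp only: partial_deriv_monomial) (simp del: of_nat_Suc)
  moreover have "partial_deriv 2 ?Q = (\<lambda>x. (x $ 1 ^ a * x $ 2 ^ b) *\<^sub>R c)"
    by (simp only: partial_deriv_monomial) (simp del: of_nat_Suc)
  moreover have "?P x = 0" if "x $ 1 = 0" for x using that by simp
  moreover have "?Q x = 0" if "x $ 2 = 0" for x using that by simp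
  ultimately have "\<exists>P\<in>poly_maps (Suc k). partial_deriv 1 P = (\<lambda>x. (x $ 1 ^ a * x $ 2 ^ b) *\<^sub>R c) \<and> (\<forall>x. x $ 1 = 0 \<longrightarrow> P x = 0)"
   "\<exists>P\<in>poly_maps (Suc k). partial_deriv 2 P = (\<lambda>x. (x $ 1 ^ a * x $ 2 ^ b) *\<^sub>R c) \<and> (\<forall>x. x $ 2 = 0 \<longrightarrow> P x = 0)"
    by blast+
  then show ?case using exhaust_2[of j] by metis
next
  case zero
  then show ?case by (intro bexI[of _ "\<lambda>x. 0"]) auto
next
  case (add p q)
  then obtain P Q where PQ: "P \<in> poly_maps (Suc k)" "Q \<in> poly_maps (Suc k)"
    "partial_deriv j P = p" "partial_deriv j Q = q"
    "\<forall>x. x $ j = 0 \<longrightarrow> P x = 0" "\<forall>x. x $ j = 0 \<longrightarrow> Q x = 0" by blast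
  then show ?case
    by (intro bexI[of _ "\<lambda>x. P x + Q x"] poly_maps_add)
       (auto simp: partial_deriv_add poly_maps_differentiable[OF PQ(1)] poly_maps_differentiable[OF PQ(2)])
qed

subsection \<open>Polynomials of unspecified degree\<close>

definition poly_map :: "(point \<Rightarrow> 'b::real_normed_vector) \<Rightarrow> bool" where
  "poly_map f \<longleftrightarrow> (\<exists>k. f \<in> poly_maps k)"

lemma poly_mapI: "f \<in> poly_maps k \<Longrightarrow> poly_map f"
  by (auto simp: poly_map_def)

lemma poly_map_const [simp]: "poly_map (\<lambda>x. c)"
  by (rule poly_mapI[OF poly_maps_const[of c 0]])

lemma poly_map_coord [simp]: "poly_map (\<lambda>x. x $ i)"
  by (rule poly_mapI[OF poly_maps_coord[of 1]]) simp

lemma poly_map_add: "poly_map f \<Longrightarrow> poly_map g \<Longrightarrow> poly_map (\<lambda>x. f x + g x)"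
proof -
  assume "poly_map f" "poly_map g"
  then obtain a b where "f \<in> poly_maps a" "g \<in> poly_maps b" by (auto simp: poly_map_def)
  then have "f \<in> poly_maps (max a b)" "g \<in> poly_maps (max a b)"
    by (auto intro: poly_maps_mono)
  then show ?thesis by (intro poly_mapI[OF poly_maps_add])
qed

lemma poly_map_linear: "poly_map f \<Longrightarrow> linear L \<Longrightarrow> poly_map (\<lambda>x. L (f x))"
  unfolding poly_map_def using poly_maps_linear by blast

lemma poly_map_scaleR: "poly_map f \<Longrightarrow> poly_map (\<lambda>x. r *\<^sub>R f x)"
  by (rule poly_map_linear) simp_all

lemma poly_map_uminus: "poly_map f \<Longrightarrow> poly_map (\<lambda>x. - f x)"
  using poly_map_scaleR[of f "-1"] by simp

lemma poly_map_diff: "poly_map f \<Longrightarrow> poly_map g \<Longrightarrow> poly_map (\<lambda>x. f x - g x)"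
  using poly_map_add[OF _ poly_map_uminus, of f g] by simp

lemma poly_map_sum: "(\<And>i. i \<in> I \<Longrightarrow> poly_map (f i)) \<Longrightarrow> poly_map (\<lambda>x. \<Sum>i\<in>I. f i x)"
  by (induction I rule: infinite_finite_induct) (auto intro!: poly_map_add)

lemma poly_map_mult_scaleR: "poly_map f \<Longrightarrow> poly_map g \<Longrightarrow> poly_map (\<lambda>x. f x *\<^sub>R g x)"
  unfolding poly_map_def using poly_maps_mult_scaleR by blast

lemma poly_map_mult: "poly_map f \<Longrightarrow> poly_map g \<Longrightarrow> poly_map (\<lambda>x. f x * g x :: real)"
  using poly_map_mult_scaleR[of f g] by simp

lemma poly_map_power: "poly_map f \<Longrightarrow> poly_map (\<lambda>x. f x ^ n :: real)"
  by (induction n) (auto intro: poly_map_mult)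

lemma poly_map_comp: "poly_map f \<Longrightarrow> (\<And>i. (\<lambda>x. \<Phi> x $ i) \<in> poly_maps 1) \<Longrightarrow> poly_map (\<lambda>x. f (\<Phi> x))"
  unfolding poly_map_def using poly_maps_comp_affine by blast

lemma poly_map_partial_deriv: "poly_map f \<Longrightarrow> poly_map (partial_deriv j f)"
  unfolding poly_map_def using poly_maps_partial_deriv by blast

lemma poly_map_differentiable: "poly_map f \<Longrightarrow> f differentiable at x"
  unfolding poly_map_def using poly_maps_differentiable by blast

lemma poly_map_iterated: "poly_map f \<Longrightarrow> poly_map (foldr partial_deriv js f)"
  by (induction js) (auto intro: poly_map_partial_deriv)

lemma poly_map_continuous: "poly_map f \<Longrightarrow> continuous_on S f"
  by (meson continuous_at_imp_continuous_on differentiable_imp_continuous_within poly_map_differentiable)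

lemmas pd_add = partial_deriv_add[OF poly_map_differentiable poly_map_differentiable]
lemmas pd_mult = partial_deriv_mult_scaleR[OF poly_map_differentiable poly_map_differentiable]
lemmas pd_linear = partial_deriv_linear[OF poly_map_differentiable]

lemma pd_scaleR: "poly_map f \<Longrightarrow> partial_deriv j (\<lambda>x. r *\<^sub>R f x) = (\<lambda>x. r *\<^sub>R partial_deriv j f x)"
  by (rule pd_linear) (auto intro: bounded_linear_scaleR_right)

lemma pd_uminus: "poly_map f \<Longrightarrow> partial_deriv j (\<lambda>x. - f x) = (\<lambda>x. - partial_deriv j f x)"
  using pd_scaleR[of f j "-1"] by simp

lemma pd_diff: "poly_map f \<Longrightarrow> poly_map g \<Longrightarrow> partial_deriv j (\<lambda>x. f x - g x) = (\<lambda>x. partial_deriv j f x - partial_deriv j g x)"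
  using pd_add[of f "\<lambda>x. - g x" j] by (simp add: pd_uminus poly_map_uminus)

lemma pd_mult_real: "poly_map f \<Longrightarrow> poly_map g \<Longrightarrow>
    partial_deriv j (\<lambda>x. f x * g x :: real) = (\<lambda>x. f x * partial_deriv j g x + partial_deriv j f x * g x)"
  using pd_mult[of f g j] by simp

lemma pd_commute: "poly_map f \<Longrightarrow> partial_deriv i (partial_deriv j f) = partial_deriv j (partial_deriv i f)"
  unfolding poly_map_def using partial_deriv_commute by blast

lemma pd_comp:
  assumes f: "poly_map f" and \<Phi>: "\<And>x. (\<Phi> has_derivative L) (at x)"
  shows "partial_deriv j (\<lambda>x. f (\<Phi> x)) = (\<lambda>x. \<Sum>i\<in>UNIV. L (axis j 1) $ i *\<^sub>R partial_deriv i f (\<Phi> x))"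
proof
  fix x
  have "((\<lambda>x. f (\<Phi> x)) has_derivative (\<lambda>h. \<Sum>i\<in>UNIV. L h $ i *\<^sub>R partial_deriv i f (\<Phi> x))) (at x)"
    using has_derivative_compose[OF \<Phi> has_derivative_partials[OF poly_map_differentiable[OF f]]] .
  from partial_deriv_eq[OF this] show
    "partial_deriv j (\<lambda>x. f (\<Phi> x)) x = (\<Sum>i\<in>UNIV. L (axis j 1) $ i *\<^sub>R partial_deriv i f (\<Phi> x))" .
qed

subsection \<open>Order of vanishing at a point\<close>

text \<open>Order of vanishing at \<open>v\<close>: \<open>van m v f\<close> says that the
  Taylor polynomial of degree \<open>m - 1\<close> of \<open>f\<close> at \<open>v\<close> is
  zero. It is phrased through iterated partial derivatives because smoothness at vertices
  is.\<close>

definition van :: "nat \<Rightarrow> point \<Rightarrow> (point \<Rightarrow> 'b::real_normed_vector) \<Rightarrow> bool" where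
  "van m v f \<longleftrightarrow> (\<forall>js. length js < m \<longrightarrow> foldr partial_deriv js f v = 0)"

lemma van_0 [simp]: "van 0 v f"
  by (simp add: van_def)

lemma van_Suc: "van (Suc m) v f \<longleftrightarrow> f v = 0 \<and> (\<forall>j. van m v (partial_deriv j f))"
proof
  assume *: "van (Suc m) v f"
  have "f v = 0" using *[unfolded van_def, rule_format, of "[]"] by simp
  moreover have "foldr partial_deriv js (partial_deriv j f) v = 0" if "length js < m" for js j
    using *[unfolded van_def, rule_format, of "js @ [j]"] that by simp
  ultimately show "f v = 0 \<and> (\<forall>j. van m v (partial_deriv j f))" by (auto simp: van_def)
next
  assume *: "f v = 0 \<and> (\<forall>j. van m v (partial_deriv j f))"
  show "van (Suc m) v f" unfolding van_def
  proof (intro allI impI)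
    fix js :: "2 list" assume "length js < Suc m"
    then show "foldr partial_deriv js f v = 0"
      using * by (cases js rule: rev_cases) (auto simp: van_def)
  qed
qed

lemma van_mono: "van m v f \<Longrightarrow> n \<le> m \<Longrightarrow> van n v f"
  by (auto simp: van_def)

lemma van_value: "van m v f \<Longrightarrow> 0 < m \<Longrightarrow> f v = 0"
  using van_Suc[of "m - 1" v f] by simp

lemma van_partial_deriv: "van m v f \<Longrightarrow> van (m - 1) v (partial_deriv j f)"
  using van_Suc[of "m - 1" v f] by (cases m) auto

lemma van_zero [simp]: "van m v (\<lambda>x. 0)"
  by (induction m) (auto simp: van_Suc)

lemma van_add: "poly_map f \<Longrightarrow> poly_map g \<Longrightarrow> van m v f \<Longrightarrow> van m v g \<Longrightarrow> van m v (\<lambda>x. f x + g x)"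
proof (induction m arbitrary: f g)
  case (Suc m)
  then show ?case by (auto simp: van_Suc pd_add intro!: Suc.IH poly_map_partial_deriv)
qed simp

lemma van_linear: "poly_map f \<Longrightarrow> bounded_linear L \<Longrightarrow> van m v f \<Longrightarrow> van m v (\<lambda>x. L (f x))"
proof (induction m arbitrary: f)
  case (Suc m)
  have "L 0 = 0" using Suc.prems(2) by (simp add: bounded_linear.linear linear_0)
  with Suc show ?case by (auto simp: van_Suc pd_linear intro!: Suc.IH poly_map_partial_deriv)
qed simp

lemma van_scaleR: "poly_map f \<Longrightarrow> van m v f \<Longrightarrow> van m v (\<lambda>x. r *\<^sub>R f x)"
  by (rule van_linear) (auto intro: bounded_linear_scaleR_right)

lemma van_uminus: "poly_map f \<Longrightarrow> van m v f \<Longrightarrow> van m v (\<lambda>x. - f x)"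
  using van_scaleR[of f m v "-1"] by simp

lemma van_diff: "poly_map f \<Longrightarrow> poly_map g \<Longrightarrow> van m v f \<Longrightarrow> van m v g \<Longrightarrow> van m v (\<lambda>x. f x - g x)"
  using van_add[of f "\<lambda>x. - g x" m v] by (simp add: van_uminus poly_map_uminus)

lemma van_sum: "(\<And>i. i \<in> I \<Longrightarrow> poly_map (f i)) \<Longrightarrow> (\<And>i. i \<in> I \<Longrightarrow> van m v (f i)) \<Longrightarrow>
    van m v (\<lambda>x. \<Sum>i\<in>I. f i x)"
  by (induction I rule: infinite_finite_induct) (auto intro!: van_add poly_map_sum)

lemma van_mult_scaleR:
  "poly_map f \<Longrightarrow> poly_map g \<Longrightarrow> van a v f \<Longrightarrow> van b v g \<Longrightarrow> van (a + b) v (\<lambda>x. f x *\<^sub>R g x)"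
proof (induction "a + b" arbitrary: a b f g)
  case (Suc n)
  have "f v *\<^sub>R g v = 0"
    using Suc.hyps(2) Suc.prems van_value[of a v f] van_value[of b v g] by (cases a) auto
  moreover have "van n v (partial_deriv j (\<lambda>x. f x *\<^sub>R g x))" for j
  proof -
    have "van n v (\<lambda>x. f x *\<^sub>R partial_deriv j g x)"
    proof (cases b)
      case (Suc b')
      then have "van (a + b') v (\<lambda>x. f x *\<^sub>R partial_deriv j g x)"
        using Suc.prems Suc.hyps(2) van_partial_deriv[of b v g j]
        by (intro Suc.hyps(1) poly_map_partial_deriv) auto
      then show ?thesis using Suc Suc.hyps(2) by simp
    next
      case 0
      then have "van (n + 0) v (\<lambda>x. f x *\<^sub>R partial_deriv j g x)"
        using Suc.prems Suc.hyps(2) van_mono[of a v f n]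
        by (intro Suc.hyps(1) poly_map_partial_deriv) auto
      then show ?thesis by simp
    qed
    moreover have "van n v (\<lambda>x. partial_deriv j f x *\<^sub>R g x)"
    proof (cases a)
      case (Suc a')
      then have "van (a' + b) v (\<lambda>x. partial_deriv j f x *\<^sub>R g x)"
        using Suc.prems Suc.hyps(2) van_partial_deriv[of a v f j]
        by (intro Suc.hyps(1) poly_map_partial_deriv) auto
      then show ?thesis using Suc Suc.hyps(2) by simp
    next
      case 0
      then have "van (0 + n) v (\<lambda>x. partial_deriv j f x *\<^sub>R g x)"
        using Suc.prems Suc.hyps(2) van_mono[of b v g n]
        by (intro Suc.hyps(1) poly_map_partial_deriv) auto
      then show ?thesis by simp
    qed
    ultimately show ?thesis
      using Suc.prems by (auto simp: pd_mult intro!: van_add poly_map_mult_scaleR poly_map_partial_deriv)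
  qed
  ultimately show ?case by (subst Suc.hyps(2)[symmetric]) (auto simp: van_Suc)
qed auto

lemma van_mult:
  "poly_map f \<Longrightarrow> poly_map g \<Longrightarrow> van a v f \<Longrightarrow> van b v g \<Longrightarrow> van (a + b) v (\<lambda>x. f x * g x :: real)"
  using van_mult_scaleR[of f g a v b] by simp

lemma van_1I: "f v = 0 \<Longrightarrow> van 1 v f"
  using van_Suc[of 0 v f] by simp

lemma van_power: "poly_map f \<Longrightarrow> van a v f \<Longrightarrow> van (a * n) v (\<lambda>x. f x ^ n :: real)"
  by (induction n) (auto intro!: van_mult poly_map_power)

lemma van_comp:
  assumes \<Phi>: "\<And>x. (\<Phi> has_derivative L) (at x)" and aff: "\<And>i. (\<lambda>x. \<Phi> x $ i) \<in> poly_maps 1"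
  shows "poly_map f \<Longrightarrow> van m (\<Phi> v) f \<Longrightarrow> van m v (\<lambda>x. f (\<Phi> x))"
proof (induction m arbitrary: f)
  case (Suc m)
  have p: "poly_map (\<lambda>x. partial_deriv i f (\<Phi> x))" for i
    by (rule poly_map_comp[OF poly_map_partial_deriv[OF Suc.prems(1)] aff])
  have "van m v (\<lambda>x. partial_deriv i f (\<Phi> x))" for i
    using Suc.prems by (intro Suc.IH[of "partial_deriv i f"] poly_map_partial_deriv) (auto simp: van_Suc)
  then have "van m v (partial_deriv j (\<lambda>x. f (\<Phi> x)))" for j
    unfolding pd_comp[OF Suc.prems(1) \<Phi>]
    by (intro van_sum[of UNIV] van_scaleR[OF p] poly_map_scaleR[OF p])
  with Suc.prems show ?case by (auto simp: van_Suc)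
qed simp

subsection \<open>Directional derivatives and restriction to lines\<close>

definition dird :: "point \<Rightarrow> (point \<Rightarrow> 'b::real_normed_vector) \<Rightarrow> point \<Rightarrow> 'b" where
  "dird d f x = (\<Sum>j\<in>UNIV. d $ j *\<^sub>R partial_deriv j f x)"

lemma has_derivative_dird: "poly_map f \<Longrightarrow> (f has_derivative (\<lambda>h. dird h f x)) (at x)"
  unfolding dird_def by (rule has_derivative_partials[OF poly_map_differentiable])

lemma dird_eq: "(f has_derivative f') (at x) \<Longrightarrow> poly_map f \<Longrightarrow> dird d f x = f' d"
  using has_derivative_unique[OF has_derivative_dird] by metis

lemma poly_maps_dird: "f \<in> poly_maps k \<Longrightarrow> dird d f \<in> poly_maps (k - 1)"
  unfolding dird_def[abs_def] by (intro poly_maps_sum poly_maps_scaleR poly_maps_partial_deriv)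

lemma poly_map_dird: "poly_map f \<Longrightarrow> poly_map (dird d f)"
  unfolding poly_map_def using poly_maps_dird by blast

lemma partial_deriv_dird: "partial_deriv j f = dird (axis j 1) f"
  by (rule ext) (simp add: dird_def axis_def if_distrib[of "\<lambda>r. r *\<^sub>R _"] cong: if_cong)

lemma linear_dird_dir: "linear (\<lambda>d. dird d f x)"
  by (rule linearI) (simp_all add: dird_def scaleR_add_left sum.distrib scaleR_sum_right)

lemma dird_add: "poly_map f \<Longrightarrow> poly_map g \<Longrightarrow> dird d (\<lambda>x. f x + g x) = (\<lambda>x. dird d f x + dird d g x)"
  by (rule ext) (simp add: dird_def pd_add scaleR_add_right sum.distrib)

lemma dird_linear: "poly_map f \<Longrightarrow> bounded_linear L \<Longrightarrow> dird d (\<lambda>x. L (f x)) = (\<lambda>x. L (dird d f x))"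
  by (rule ext) (simp add: dird_def pd_linear linear_sum[OF bounded_linear.linear[of L]]
      linear_scale[OF bounded_linear.linear[of L]])

lemma dird_scaleR: "poly_map f \<Longrightarrow> dird d (\<lambda>x. r *\<^sub>R f x) = (\<lambda>x. r *\<^sub>R dird d f x)"
  by (rule dird_linear) (auto intro: bounded_linear_scaleR_right)

lemma dird_mult_scaleR: "poly_map f \<Longrightarrow> poly_map g \<Longrightarrow>
    dird d (\<lambda>x. f x *\<^sub>R g x) = (\<lambda>x. f x *\<^sub>R dird d g x + dird d f x *\<^sub>R g x)"
  by (rule ext) (simp add: dird_def pd_mult scaleR_add_right sum.distrib scaleR_sum_right scaleR_sum_left mult_ac)

lemma dird_two: "dird d f = (\<lambda>x. d $ 1 *\<^sub>R partial_deriv 1 f x + d $ 2 *\<^sub>R partial_deriv 2 f x)"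
  by (rule ext) (simp add: dird_def UNIV_2)

lemma dird_commute:
  assumes "poly_map f"
  shows "dird d (dird e f) = dird e (dird d f)"
proof -
  have p: "poly_map (\<lambda>x. r *\<^sub>R partial_deriv j f x)" for r j
    by (intro poly_map_scaleR poly_map_partial_deriv assms)
  have pd: "partial_deriv i (dird e f) = (\<lambda>x. e $ 1 *\<^sub>R partial_deriv i (partial_deriv 1 f) x
       + e $ 2 *\<^sub>R partial_deriv i (partial_deriv 2 f) x)" for e i
    unfolding dird_two pd_add[OF p p] pd_scaleR[OF poly_map_partial_deriv[OF assms]] ..
  have "partial_deriv 2 (partial_deriv 1 f) = partial_deriv 1 (partial_deriv 2 f)"
    by (rule pd_commute[OF assms])
  then show ?thesis
    unfolding dird_two[of _ "dird _ f"] pd by (intro ext) (simp add: algebra_simps)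
qed

lemma dird_comp:
  assumes "poly_map f" "\<And>x. (\<Phi> has_derivative L) (at x)" "\<And>i. (\<lambda>x. \<Phi> x $ i) \<in> poly_maps 1"
  shows "dird d (\<lambda>x. f (\<Phi> x)) = (\<lambda>x. dird (L d) f (\<Phi> x))"
  using dird_eq[OF has_derivative_compose[OF assms(2) has_derivative_dird[OF assms(1)]] poly_map_comp[OF assms(1,3)]]
  by (intro ext)

lemma van_dird: "poly_map f \<Longrightarrow> van m v f \<Longrightarrow> van (m - 1) v (dird d f)"
  unfolding dird_def[abs_def]
  by (intro van_sum van_scaleR poly_map_scaleR poly_map_partial_deriv van_partial_deriv)

lemma poly_maps_line:
  fixes f :: "point \<Rightarrow> real"
  assumes "f \<in> poly_maps k"
  shows "\<exists>P. degree P \<le> k \<and> (\<forall>t. poly P t = f (v + t *\<^sub>R d))"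
  using assms
proof (induction f rule: poly_maps_induct)
  case (monomial i j c)
  let ?P = "smult c ([:v $ 1, d $ 1:] ^ i * [:v $ 2, d $ 2:] ^ j)"
  have "degree ?P \<le> degree ([:v $ 1, d $ 1:] ^ i) + degree ([:v $ 2, d $ 2:] ^ j)"
    by (rule order_trans[OF degree_smult_le degree_mult_le])
  also have "\<dots> \<le> degree [:v $ 1, d $ 1:] * i + degree [:v $ 2, d $ 2:] * j"
    by (intro add_mono degree_power_le)
  also have "\<dots> \<le> 1 * i + 1 * j" by (intro add_mono mult_right_mono) auto
  finally have "degree ?P \<le> k" using monomial by simp
  then show ?case by (intro exI[of _ ?P]) (auto simp: mult_ac)
next
  case zero
  then show ?case by (intro exI[of _ 0]) auto
next
  case (add p q)
  then obtain P Q where "degree P \<le> k" "\<forall>t. poly P t = p (v + t *\<^sub>R d)"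
    "degree Q \<le> k" "\<forall>t. poly Q t = q (v + t *\<^sub>R d)" by blast
  then show ?case by (intro exI[of _ "P + Q"]) (auto intro: degree_add_le)
qed

lemma poly_line_pderiv:
  fixes f :: "point \<Rightarrow> real"
  assumes "poly_map f" "\<And>t. poly P t = f (v + t *\<^sub>R d)"
  shows "poly (pderiv P) t = dird d f (v + t *\<^sub>R d)"
proof -
  have "((\<lambda>t. v + t *\<^sub>R d) has_derivative (\<lambda>s. s *\<^sub>R d)) (at t)"
    by (auto intro!: derivative_eq_intros)
  from has_derivative_compose[OF this has_derivative_dird[OF assms(1)]]
  have "((\<lambda>t. f (v + t *\<^sub>R d)) has_derivative (\<lambda>s. dird (s *\<^sub>R d) f (v + t *\<^sub>R d))) (at t)" .
  moreover have "dird (s *\<^sub>R d) f (v + t *\<^sub>R d) = dird d f (v + t *\<^sub>R d) * s" for s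
    using linear_scale[OF linear_dird_dir[of f "v + t *\<^sub>R d"], of s d] by (simp add: mult_ac)
  ultimately have "(poly P has_field_derivative dird d f (v + t *\<^sub>R d)) (at t)"
    by (simp add: has_field_derivative_def assms(2)[symmetric])
  from DERIV_unique[OF poly_DERIV this] show ?thesis .
qed

text \<open>A zero of order \<open>m\<close> of a plane polynomial is a zero of order at least
  \<open>m\<close> of its restriction to a line, and for univariate polynomials this is
  divisibility.\<close>

lemma van_line_dvd:
  fixes f :: "point \<Rightarrow> real"
  assumes "poly_map f" "\<And>t. poly P t = f (v + t *\<^sub>R d)" "van m (v + t0 *\<^sub>R d) f"
  shows "[:- t0, 1:] ^ m dvd P"
  using assms
proof (induction m arbitrary: f P)
  case (Suc m)
  have "[:- t0, 1:] ^ m dvd pderiv P"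
    using Suc.prems van_dird[OF Suc.prems(1,3), of d]
    by (intro Suc.IH[of "dird d f"] poly_line_pderiv poly_map_dird) auto
  have root: "poly P t0 = 0" using Suc.prems(2) van_value[OF Suc.prems(3)] by simp
  show ?case
  proof (cases "P = 0 \<or> pderiv P = 0")
    case True
    then have "P = 0"
      using root pderiv_iszero[of P] by auto
    then show ?thesis by simp
  next
    case False
    then have "order t0 P = Suc (order t0 (pderiv P))"
      using root by (intro order_pderiv) (auto simp: order_root)
    moreover have "m \<le> order t0 (pderiv P)"
      using False \<open>[:- t0, 1:] ^ m dvd pderiv P\<close> by (simp add: order_divides)
    ultimately show ?thesis using False by (simp add: order_divides del: power_Suc)
  qed
qed simp

lemma poly_eq_on_segment:
  fixes P Q :: "real poly"
  assumes "\<And>t. 0 \<le> t \<Longrightarrow> t \<le> 1 \<Longrightarrow> poly P t = poly Q t"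
  shows "P = Q"
proof (rule ccontr)
  assume "P \<noteq> Q"
  then have "finite {t. poly (P - Q) t = 0}" by (intro poly_roots_finite) simp
  moreover have "{0..1 :: real} \<subseteq> {t. poly (P - Q) t = 0}" using assms by auto
  ultimately have "finite {0..(1::real)}" using finite_subset by blast
  then show False using infinite_Icc[of 0 "1 :: real"] by simp
qed

text \<open>Two polynomials that agree on a segment agree on its line, so their derivatives
  along the segment agree as well. Derivatives across the segment need not; this is why only
  tangential derivatives enter the conditions on weights below.\<close>

lemma dird_eq_of_segment_eq:
  fixes f g :: "point \<Rightarrow> real"
  assumes "poly_map f" "poly_map g" "\<And>x. x \<in> closed_segment v a \<Longrightarrow> f x = g x"
  shows "dird (a - v) f v = dird (a - v) g v"
    "dird (a - v) (dird (a - v) f) v = dird (a - v) (dird (a - v) g) v"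
proof -
  obtain P Q where P: "\<And>t. poly P t = f (v + t *\<^sub>R (a - v))" and Q: "\<And>t. poly Q t = g (v + t *\<^sub>R (a - v))"
    using assms(1,2) poly_maps_line unfolding poly_map_def by blast
  have "poly P t = poly Q t" if "0 \<le> t" "t \<le> 1" for t
    unfolding P Q using that by (intro assms(3)) (auto simp: closed_segment_def algebra_simps intro!: exI[of _ t])
  then have "P = Q" by (rule poly_eq_on_segment)
  note P1 = poly_line_pderiv[OF assms(1) P]
  note Q1 = poly_line_pderiv[OF assms(2) Q]
  note P2 = poly_line_pderiv[OF poly_map_dird[OF assms(1)] P1]
  note Q2 = poly_line_pderiv[OF poly_map_dird[OF assms(2)] Q1]
  show "dird (a - v) f v = dird (a - v) g v"
    "dird (a - v) (dird (a - v) f) v = dird (a - v) (dird (a - v) g) v"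
    using P1[of 0] Q1[of 0] P2[of 0] Q2[of 0] \<open>P = Q\<close> by auto
qed

text \<open>Restrict to the line through \<open>x0\<close> and \<open>x\<close>: the univariate
  restriction has infinitely many zeros.\<close>

lemma poly_map_eq_zero_of_open:
  fixes f :: "point \<Rightarrow> real"
  assumes "poly_map f" "open S" "x0 \<in> S" "\<And>x. x \<in> S \<Longrightarrow> f x = 0"
  shows "f x = 0"
proof -
  obtain P where P: "\<And>t. poly P t = f (x0 + t *\<^sub>R (x - x0))"
    using assms(1) poly_maps_line unfolding poly_map_def by blast
  have "open ((\<lambda>t. x0 + t *\<^sub>R (x - x0)) -` S)"
    using assms(2) by (intro open_vimage continuous_intros) auto
  moreover have "0 \<in> (\<lambda>t. x0 + t *\<^sub>R (x - x0)) -` S" using assms(3) by simp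
  ultimately have "infinite ((\<lambda>t. x0 + t *\<^sub>R (x - x0)) -` S)"
    using finite_imp_not_open by blast
  moreover have "(\<lambda>t. x0 + t *\<^sub>R (x - x0)) -` S \<subseteq> {t. poly P t = 0}"
    using assms(4) P by auto
  ultimately have "P = 0" using poly_roots_finite finite_subset by blast
  then show ?thesis using P[of 1] by simp
qed

section \<open>Lifting a divergence on one triangle\<close>

subsection \<open>Affine maps of the plane\<close>

definition pt :: "real \<Rightarrow> real \<Rightarrow> point" where
  "pt a b = (\<chi> i. if i = 1 then a else b)"

lemma pt_nth [simp]: "pt a b $ 1 = a" "pt a b $ 2 = b"
  by (simp_all add: pt_def)

lemma pt_eta [simp]: "pt (x $ 1) (x $ 2) = x"
  by (simp add: vec_eq_iff forall_2)

lemma point_eqI: "x $ 1 = y $ 1 \<Longrightarrow> x $ 2 = y $ 2 \<Longrightarrow> x = (y :: point)"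
  by (simp add: vec_eq_iff forall_2)

definition affmap :: "point \<Rightarrow> point \<Rightarrow> point \<Rightarrow> point \<Rightarrow> point" where
  "affmap v d e x = v + x $ 1 *\<^sub>R d + x $ 2 *\<^sub>R e"

lemma affmap_has_derivative: "(affmap v d e has_derivative (\<lambda>h. h $ 1 *\<^sub>R d + h $ 2 *\<^sub>R e)) (at x)"
proof -
  have c: "((\<lambda>x :: point. x $ n) has_derivative (\<lambda>h. h $ n)) (at x)" for n
    using bounded_linear_imp_has_derivative bounded_linear_vec_nth by blast
  show ?thesis unfolding affmap_def[abs_def]
    by (auto intro!: derivative_eq_intros c)
qed

lemma affmap_poly: "(\<lambda>x. affmap v d e x $ i) \<in> poly_maps 1"
  unfolding affmap_def using poly_maps_coord[of 1 1] poly_maps_coord[of 1 2]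
  by (auto intro!: poly_maps_add poly_maps_mult_scaleR[of _ 1 _ 0, simplified] simp: mult.commute[of _ "_ $ i"]
     intro: poly_maps_cmult)

lemma pd_comp_affmap:
  assumes "poly_map f"
  shows "partial_deriv 1 (\<lambda>x. f (affmap v d e x)) = (\<lambda>x. dird d f (affmap v d e x))"
    "partial_deriv 2 (\<lambda>x. f (affmap v d e x)) = (\<lambda>x. dird e f (affmap v d e x))"
  unfolding pd_comp[OF assms affmap_has_derivative] by (simp_all add: axis_def dird_def)

lemma poly_map_affmap: "poly_map f \<Longrightarrow> poly_map (\<lambda>x. f (affmap v d e x))"
  by (rule poly_map_comp[OF _ affmap_poly])

lemma poly_maps_affmap: "f \<in> poly_maps k \<Longrightarrow> (\<lambda>x. f (affmap v d e x)) \<in> poly_maps k"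
  by (rule poly_maps_comp_affine[OF _ affmap_poly])

lemma van_affmap: "poly_map f \<Longrightarrow> van m (affmap v d e x) f \<Longrightarrow> van m x (\<lambda>x. f (affmap v d e x))"
  by (rule van_comp[OF affmap_has_derivative affmap_poly])

lemma pd_power: "poly_map f \<Longrightarrow> partial_deriv j (\<lambda>x. f x ^ n :: real) = (\<lambda>x. real n * f x ^ (n - 1) * partial_deriv j f x)"
proof (induction n)
  case (Suc n)
  have "partial_deriv j (\<lambda>x. f x ^ Suc n) = partial_deriv j (\<lambda>x. f x * f x ^ n)" by simp
  also have "\<dots> = (\<lambda>x. f x * partial_deriv j (\<lambda>x. f x ^ n) x + partial_deriv j f x * f x ^ n)"
    using Suc.prems by (intro pd_mult_real poly_map_power)
  also have "\<dots> = (\<lambda>x. real (Suc n) * f x ^ (Suc n - 1) * partial_deriv j f x)"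
    using Suc by (cases n) (auto simp: algebra_simps)
  finally show ?case .
qed simp

lemma partial_deriv_coord_simps [simp]:
  "partial_deriv 1 (\<lambda>x. x $ 1) = (\<lambda>x. 1)" "partial_deriv 1 (\<lambda>x. x $ 2) = (\<lambda>x. 0)"
  "partial_deriv 2 (\<lambda>x. x $ 1) = (\<lambda>x. 0)" "partial_deriv 2 (\<lambda>x. x $ 2) = (\<lambda>x. 1)"
  by (simp_all add: partial_deriv_coord)

lemmas pd_simps = pd_add pd_diff pd_uminus pd_mult_real pd_power
lemmas poly_map_intros = poly_map_add poly_map_diff poly_map_uminus poly_map_mult poly_map_power poly_map_affmap
  poly_map_partial_deriv poly_map_dird

lemma van_2I:
  "s v = 0 \<Longrightarrow> partial_deriv 1 s v = 0 \<Longrightarrow> partial_deriv 2 s v = 0 \<Longrightarrow> van 2 v s"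
  using van_Suc[of 1 v s] van_Suc[of 0 v] by (auto simp: forall_2 numeral_2_eq_2)

lemma van_2D: "van 2 v s \<Longrightarrow> s v = 0" "van 2 v s \<Longrightarrow> partial_deriv j s v = 0"
  using van_Suc[of 1 v s] van_Suc[of 0 v] by (auto simp: numeral_2_eq_2)

lemma van_3I:
  assumes "poly_map s" "s v = 0" "van 2 v (partial_deriv 1 s)" "partial_deriv 2 s v = 0"
    "partial_deriv 2 (partial_deriv 2 s) v = 0"
  shows "van 3 v s"
proof -
  have "van 2 v (partial_deriv 2 s)"
    using assms pd_commute[OF assms(1), of 1 2] van_2D(2)[OF assms(3), of 2] by (intro van_2I) auto
  then show ?thesis using assms van_Suc[of 2 v s] by (simp add: forall_2 numeral_3_eq_3 numeral_2_eq_2)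
qed

lemma dird_zero_of_line:
  fixes s :: "point \<Rightarrow> real"
  assumes "poly_map s" "\<And>t. s (v + t *\<^sub>R d) = 0"
  shows "dird d s (v + t *\<^sub>R d) = 0"
proof -
  have "poly 0 t = s (v + t *\<^sub>R d)" for t using assms by simp
  from poly_line_pderiv[OF assms(1) this, of t] show ?thesis by simp
qed

text \<open>A polynomial that vanishes on a vertical line has vanishing vertical derivatives
  there.\<close>

lemma pd2_zero_of_column:
  fixes s :: "point \<Rightarrow> real"
  assumes "poly_map s" "\<And>x. x $ 1 = c \<Longrightarrow> s x = 0" "x $ 1 = c"
  shows "partial_deriv 2 s x = 0"
proof -
  have "s (x + t *\<^sub>R pt 0 1) = 0" for t
    using assms(2,3) by simp
  from dird_zero_of_line[OF assms(1) this, of 0] show ?thesis by (simp add: dird_two)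
qed

lemma zero_of_row:
  fixes s :: "point \<Rightarrow> real"
  assumes "poly_map s" "s (pt 0 c) = 0" "\<And>x. x $ 2 = c \<Longrightarrow> partial_deriv 1 s x = 0" "x $ 2 = c"
  shows "s x = 0"
proof -
  obtain P where P: "\<And>t. poly P t = s (pt 0 c + t *\<^sub>R pt 1 0)"
    using assms(1) poly_maps_line unfolding poly_map_def by blast
  have "poly (pderiv P) t = 0" for t
    using poly_line_pderiv[OF assms(1) P, of t] assms(3) by (simp add: dird_two)
  then have "pderiv P = 0" using poly_all_0_iff_0 by blast
  then obtain r where "P = [:r:]" using pderiv_iszero by blast
  moreover have "poly P 0 = 0" using P[of 0] assms(2) by simp
  ultimately have "s (pt 0 c + x $ 1 *\<^sub>R pt 1 0) = 0" using P[of "x $ 1"] by simp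
  moreover have "pt 0 c + x $ 1 *\<^sub>R pt 1 0 = x" using assms(4) by (intro point_eqI) auto
  ultimately show ?thesis by simp
qed

subsection \<open>The reference triangle\<close>

text \<open>Every monomial is divisible by \<open>x1^2 x2^2\<close>, so adding
  \<open>corr\<close> changes neither the values nor the first derivatives on the two axes. The
  six coefficients are the freedom needed for second-order conditions at the vertices (1,0) and
  (0,1). The total degree 7 is where the bound on \<open>k\<close> comes from.\<close>

definition corr :: "real \<Rightarrow> real \<Rightarrow> real \<Rightarrow> real \<Rightarrow> real \<Rightarrow> real \<Rightarrow> point \<Rightarrow> real" where
  "corr a b a' b' c c' x =
      a * (x $ 1 ^ 3 * x $ 2 ^ 2) + b * (x $ 1 ^ 4 * x $ 2 ^ 2)
    + a' * (x $ 1 ^ 2 * x $ 2 ^ 3) + b' * (x $ 1 ^ 2 * x $ 2 ^ 4)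
    + c * (x $ 1 ^ 4 * x $ 2 ^ 3) + c' * (x $ 1 ^ 3 * x $ 2 ^ 4)"

text \<open>The antiderivative in the first variable of \<open>corr\<close> differentiated along
  (1,-1), normalised to vanish on the axis \<open>x1 = 0\<close>.\<close>

definition corr_int :: "real \<Rightarrow> real \<Rightarrow> real \<Rightarrow> real \<Rightarrow> real \<Rightarrow> real \<Rightarrow> point \<Rightarrow> real" where
  "corr_int a b a' b' c c' x =
      a * (x $ 1 ^ 3 * x $ 2 ^ 2 - 1 / 2 * (x $ 1 ^ 4 * x $ 2))
    + b * (x $ 1 ^ 4 * x $ 2 ^ 2 - 2 / 5 * (x $ 1 ^ 5 * x $ 2))
    + a' * (x $ 1 ^ 2 * x $ 2 ^ 3 - x $ 1 ^ 3 * x $ 2 ^ 2)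
    + b' * (x $ 1 ^ 2 * x $ 2 ^ 4 - 4 / 3 * (x $ 1 ^ 3 * x $ 2 ^ 3))
    + c * (x $ 1 ^ 4 * x $ 2 ^ 3 - 3 / 5 * (x $ 1 ^ 5 * x $ 2 ^ 2))
    + c' * (x $ 1 ^ 3 * x $ 2 ^ 4 - x $ 1 ^ 4 * x $ 2 ^ 3)"

text \<open>The shear component whose first derivatives on the axes are forced: if all stress
  components vanish on both axes, then the first equation reads \<open>- partial_deriv 2 s =
  f\<close> on \<open>x2 = 0\<close> and the second reads \<open>- partial_deriv 1 s = g\<close>
  on \<open>x1 = 0\<close>.\<close>

definition base :: "(point \<Rightarrow> real) \<Rightarrow> (point \<Rightarrow> real) \<Rightarrow> point \<Rightarrow> real" where
  "base f g x = - (x $ 2 * f (pt (x $ 1) 0)) - x $ 1 * g (pt 0 (x $ 2))"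

lemma affmap_axes: "affmap 0 (pt 1 0) 0 x = pt (x $ 1) 0" "affmap 0 0 (pt 0 1) x = pt 0 (x $ 2)"
  by (auto simp: affmap_def intro!: point_eqI)

lemma restrict_axis1:
  assumes "poly_map f"
  shows "poly_map (\<lambda>x. f (pt (x $ 1) 0))" "f \<in> poly_maps k \<Longrightarrow> (\<lambda>x. f (pt (x $ 1) 0)) \<in> poly_maps k"
    "partial_deriv 1 (\<lambda>x. f (pt (x $ 1) 0)) = (\<lambda>x. partial_deriv 1 f (pt (x $ 1) 0))"
    "partial_deriv 2 (\<lambda>x. f (pt (x $ 1) 0)) = (\<lambda>x. 0)"
    "van m (pt (x $ 1) 0) f \<Longrightarrow> van m x (\<lambda>x. f (pt (x $ 1) 0))"
  using poly_map_affmap[OF assms, of 0 "pt 1 0" 0] poly_maps_affmap[of f k 0 "pt 1 0" 0]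
    pd_comp_affmap[OF assms, of 0 "pt 1 0" 0] van_affmap[OF assms, of m 0 "pt 1 0" 0 x]
  by (auto simp: affmap_axes dird_two)

lemma restrict_axis2:
  assumes "poly_map f"
  shows "poly_map (\<lambda>x. f (pt 0 (x $ 2)))" "f \<in> poly_maps k \<Longrightarrow> (\<lambda>x. f (pt 0 (x $ 2))) \<in> poly_maps k"
    "partial_deriv 1 (\<lambda>x. f (pt 0 (x $ 2))) = (\<lambda>x. 0)"
    "partial_deriv 2 (\<lambda>x. f (pt 0 (x $ 2))) = (\<lambda>x. partial_deriv 2 f (pt 0 (x $ 2)))"
    "van m (pt 0 (x $ 2)) f \<Longrightarrow> van m x (\<lambda>x. f (pt 0 (x $ 2)))"
  using poly_map_affmap[OF assms, of 0 0 "pt 0 1"] poly_maps_affmap[of f k 0 0 "pt 0 1"]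
    pd_comp_affmap[OF assms, of 0 0 "pt 0 1"] van_affmap[OF assms, of m 0 0 "pt 0 1" x]
  by (auto simp: affmap_axes dird_two)

lemma poly_maps_bimonomial: "i + j \<le> k \<Longrightarrow> (\<lambda>x :: point. r * (x $ 1 ^ i * x $ 2 ^ j) :: real) \<in> poly_maps k"
  using poly_maps_monomial[of i j k r] by (simp add: mult.commute)

lemma corr_poly: "7 \<le> k \<Longrightarrow> corr a b a' b' c c' \<in> poly_maps k"
  unfolding corr_def[abs_def] by (intro poly_maps_add poly_maps_bimonomial) auto

lemma corr_int_poly: "7 \<le> k \<Longrightarrow> corr_int a b a' b' c c' \<in> poly_maps k"
proof -
  assume k: "7 \<le> k"
  have eq: "(x :: point) $ 2 = x $ 2 ^ 1" "x $ 1 ^ 4 * x $ 2 ^ 3 = 1 * (x $ 1 ^ 4 * x $ 2 ^ 3)"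
     "x $ 1 ^ 3 * x $ 2 ^ 2 = 1 * (x $ 1 ^ 3 * x $ 2 ^ 2)" for x :: point by auto
  have m: "(\<lambda>x :: point. x $ 1 ^ i * x $ 2 ^ j :: real) \<in> poly_maps k" if "i + j \<le> k" for i j
    using poly_maps_bimonomial[OF that, of 1] by simp
  have m1: "(\<lambda>x :: point. x $ 1 ^ i * x $ 2 :: real) \<in> poly_maps k" if "i + 1 \<le> k" for i
    using m[of i 1] that by simp
  show ?thesis unfolding corr_int_def[abs_def] using k
    by (intro poly_maps_add poly_maps_diff poly_maps_cmult m m1) auto
qed

lemma base_poly:
  assumes "f \<in> poly_maps (k - 1)" "g \<in> poly_maps (k - 1)" "0 < k"
  shows "base f g \<in> poly_maps k"
proof -
  have m: "(\<lambda>x. x $ i * h x) \<in> poly_maps k" if "h \<in> poly_maps (k - 1)" for h :: "point \<Rightarrow> real" and i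
    using poly_maps_mult[OF poly_maps_coord[OF order_refl] that, of i] assms(3) by simp
  show ?thesis unfolding base_def[abs_def]
    by (intro poly_maps_diff poly_maps_uminus m restrict_axis1 restrict_axis2 poly_mapI[of _ "k - 1"] assms)
qed

lemma corr_poly_map [simp]: "poly_map (corr a b a' b' c c')" "poly_map (corr_int a b a' b' c c')"
  using corr_poly[OF order_refl] corr_int_poly[OF order_refl] poly_mapI by blast+

lemma pd_corr:
  "partial_deriv 1 (corr a b a' b' c c') = (\<lambda>x.
      a * (3 * x $ 1 ^ 2 * x $ 2 ^ 2) + b * (4 * x $ 1 ^ 3 * x $ 2 ^ 2)
    + a' * (2 * x $ 1 * x $ 2 ^ 3) + b' * (2 * x $ 1 * x $ 2 ^ 4)
    + c * (4 * x $ 1 ^ 3 * x $ 2 ^ 3) + c' * (3 * x $ 1 ^ 2 * x $ 2 ^ 4))"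
  "partial_deriv 2 (corr a b a' b' c c') = (\<lambda>x.
      a * (2 * x $ 1 ^ 3 * x $ 2) + b * (2 * x $ 1 ^ 4 * x $ 2)
    + a' * (3 * x $ 1 ^ 2 * x $ 2 ^ 2) + b' * (4 * x $ 1 ^ 2 * x $ 2 ^ 3)
    + c * (3 * x $ 1 ^ 4 * x $ 2 ^ 2) + c' * (4 * x $ 1 ^ 3 * x $ 2 ^ 3))"
  unfolding corr_def[abs_def]
   apply (simp only: pd_simps poly_map_intros poly_map_coord poly_map_const partial_deriv_coord_simps partial_deriv_const)
   apply (simp add: algebra_simps)
  apply (simp only: pd_simps poly_map_intros poly_map_coord poly_map_const partial_deriv_coord_simps partial_deriv_const)
  apply (simp add: algebra_simps)
  done

lemma pd_corr_int:
  "partial_deriv 1 (corr_int a b a' b' c c') =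
     (\<lambda>x. partial_deriv 1 (corr a b a' b' c c') x - partial_deriv 2 (corr a b a' b' c c') x)"
  unfolding corr_int_def[abs_def] pd_corr
  apply (simp only: pd_simps poly_map_intros poly_map_coord poly_map_const partial_deriv_coord_simps partial_deriv_const)
  apply (simp add: algebra_simps eval_nat_numeral)
  done

lemma pd_base:
  assumes f: "poly_map f" and g: "poly_map g"
  shows "partial_deriv 1 (base f g) = (\<lambda>x. - (x $ 2 * partial_deriv 1 f (pt (x $ 1) 0)) - g (pt 0 (x $ 2)))"
    "partial_deriv 2 (base f g) = (\<lambda>x. - f (pt (x $ 1) 0) - x $ 1 * partial_deriv 2 g (pt 0 (x $ 2)))"
  unfolding base_def[abs_def] using f g
  by (simp_all add: pd_simps poly_map_mult poly_map_uminus restrict_axis1 restrict_axis2)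

lemma van_coord: "x $ i = 0 \<Longrightarrow> van 1 x (\<lambda>x. x $ i)"
  by (rule van_1I)

lemma base_van_origin:
  assumes f: "poly_map f" "van 2 (pt 0 0) f" and g: "poly_map g" "van 2 (pt 0 0) g"
  shows "van 3 (pt 0 0) (base f g)"
proof -
  have "van (1 + 2) (pt 0 0) (\<lambda>x. x $ 2 * f (pt (x $ 1) 0))"
    by (intro van_mult van_coord restrict_axis1 f poly_map_coord) (simp_all add: f)
  moreover have "van (1 + 2) (pt 0 0) (\<lambda>x. x $ 1 * g (pt 0 (x $ 2)))"
    by (intro van_mult van_coord restrict_axis2 g poly_map_coord) (simp_all add: g)
  ultimately show ?thesis unfolding base_def[abs_def] using f g
    by (intro van_diff van_uminus poly_map_uminus poly_map_mult poly_map_coord restrict_axis1 restrict_axis2)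
      (auto simp: numeral_3_eq_3)
qed

lemma corr_van_origin: "van 3 (pt 0 0) (corr a b a' b' c c')"
proof -
  have v: "van 3 (pt 0 0) (\<lambda>x. r * (x $ 1 ^ i * x $ 2 ^ j) :: real)" if "3 \<le> i + j" for r i j
  proof -
    have "van (0 + (1 * i + 1 * j)) (pt 0 0) (\<lambda>x. r * (x $ 1 ^ i * x $ 2 ^ j))"
      by (intro van_mult van_power van_coord poly_map_mult poly_map_power poly_map_coord poly_map_const) auto
    then show ?thesis using van_mono that by fastforce
  qed
  have "poly_map (\<lambda>x :: point. r * (x $ 1 ^ i * x $ 2 ^ j) :: real)" for r i j
    by (intro poly_map_mult poly_map_power poly_map_coord poly_map_const)
  then show ?thesis unfolding corr_def[abs_def] by (intro van_add poly_map_add v) auto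
qed

text \<open>At the vertex (1,0) all derivatives of order at most two of \<open>base\<close>
  vanish, except the second derivative in the second variable; the condition on \<open>a +
  b\<close> makes \<open>corr\<close> cancel it.\<close>

lemma base_corr_van_e1:
  assumes k: "f \<in> poly_maps k" "g \<in> poly_maps k"
    and f: "van 2 (pt 0 0) f" "van 2 (pt 1 0) f" and g: "van 2 (pt 0 0) g" "van 2 (pt 1 0) g"
    and ab: "2 * (a + b) = partial_deriv 2 (partial_deriv 2 g) (pt 0 0)"
  shows "van 3 (pt 1 0) (\<lambda>x. base f g x + corr a b a' b' c c' x)" (is "van 3 _ ?s")
proof -
  have pf: "poly_map f" "poly_map g" using k poly_mapI by auto
  have pb: "poly_map (base f g)"
    unfolding base_def[abs_def] using pf
    by (intro poly_map_diff poly_map_uminus poly_map_mult poly_map_coord restrict_axis1 restrict_axis2)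
  have s1: "partial_deriv 1 ?s = (\<lambda>x. partial_deriv 1 (base f g) x + partial_deriv 1 (corr a b a' b' c c') x)"
   and s2: "partial_deriv 2 ?s = (\<lambda>x. partial_deriv 2 (base f g) x + partial_deriv 2 (corr a b a' b' c c') x)"
    by (intro pd_add pb corr_poly_map)+
  have b22: "partial_deriv 2 (partial_deriv 2 (base f g)) = (\<lambda>x. - (x $ 1 * partial_deriv 2 (partial_deriv 2 g) (pt 0 (x $ 2))))"
    unfolding pd_base[OF pf]
    using restrict_axis1[OF pf(1)] restrict_axis2[OF poly_map_partial_deriv[OF pf(2)]]
    by (simp add: pd_simps poly_map_mult poly_map_uminus)
  have c22: "partial_deriv 2 (partial_deriv 2 (corr a b a' b' c c')) (pt 1 0) = 2 * a + 2 * b"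
    unfolding pd_corr
    apply (simp only: pd_simps poly_map_intros poly_map_coord poly_map_const partial_deriv_coord_simps partial_deriv_const)
    apply simp
    done
  have s22: "partial_deriv 2 (partial_deriv 2 ?s) (pt 1 0) = 0"
    unfolding s2 pd_add[OF poly_map_partial_deriv[OF pb] poly_map_partial_deriv[OF corr_poly_map(1)]]
    using ab by (simp add: b22 c22)
  have v1: "van 2 (pt 1 0) (partial_deriv 1 (base f g))"
  proof -
    have "van (1 + 1) (pt 1 0) (\<lambda>x. x $ 2 * partial_deriv 1 f (pt (x $ 1) 0))"
      using van_partial_deriv[OF f(2), of 1]
      by (intro van_mult van_coord restrict_axis1 poly_map_coord poly_map_partial_deriv pf) simp_all
    moreover have "van 2 (pt 1 0) (\<lambda>x. g (pt 0 (x $ 2)))"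
      using g by (intro restrict_axis2 pf) auto
    ultimately show ?thesis unfolding pd_base[OF pf]
      using restrict_axis1[OF poly_map_partial_deriv[OF pf(1)]] restrict_axis2[OF pf(2)]
      by (intro van_diff van_uminus poly_map_uminus poly_map_mult poly_map_coord) (simp_all add: numeral_2_eq_2)
  qed
  have v2: "van 2 (pt 1 0) (partial_deriv 1 (corr a b a' b' c c'))"
    unfolding pd_corr
    apply (rule van_2I)
      apply simp
     apply (simp only: pd_simps poly_map_intros poly_map_coord poly_map_const partial_deriv_coord_simps partial_deriv_const)
     apply simp
    apply (simp only: pd_simps poly_map_intros poly_map_coord poly_map_const partial_deriv_coord_simps partial_deriv_const)
    apply simp
    done
  have "partial_deriv 2 ?s (pt 1 0) = 0"
    unfolding s2 pd_base[OF pf] pd_corr using van_2D[OF f(2)] van_2D[OF g(1)] by simp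
  moreover have "?s (pt 1 0) = 0"
    using van_2D(1)[OF f(2)] van_2D(1)[OF g(1)] by (simp add: base_def corr_def)
  moreover have "van 2 (pt 1 0) (partial_deriv 1 ?s)"
    unfolding s1 by (intro van_add v1 v2 poly_map_partial_deriv pb corr_poly_map)
  ultimately show ?thesis using s22 by (intro van_3I poly_map_add pb corr_poly_map)
qed

text \<open>Given the third component \<open>s\<close>, the first equation determines the first
  component \<open>t\<close> by integration from the axis \<open>x1 = 0\<close>. That
  \<open>t\<close> vanishes to third order at (1,0) amounts to two linear conditions on the
  coefficients of \<open>corr\<close>, with right-hand sides \<open>\<alpha>\<close> and
  \<open>\<beta>\<close> that depend on \<open>f\<close> and \<open>g\<close> only.\<close>

definition correctable :: "nat \<Rightarrow> (point \<Rightarrow> real) \<Rightarrow> (point \<Rightarrow> real) \<Rightarrow> real \<Rightarrow> real \<Rightarrow> bool" where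
  "correctable k f g \<alpha> \<beta> \<longleftrightarrow> (\<forall>a b a' b' c c' s. s = (\<lambda>x. base f g x + corr a b a' b' c c' x) \<longrightarrow>
      a / 2 + 2 * b / 5 = \<alpha> \<longrightarrow> 2 * a + 2 * b - 2 * a' - 6 / 5 * c = \<beta> \<longrightarrow>
      van 3 (pt 0 0) s \<longrightarrow> van 3 (pt 1 0) s \<longrightarrow> van 3 (pt 0 1) s \<longrightarrow>
      (\<exists>t\<in>poly_maps k. (\<forall>x. partial_deriv 1 t x + partial_deriv 1 s x - partial_deriv 2 s x = f x) \<and>
         (\<forall>x. x $ 1 = 0 \<or> x $ 2 = 0 \<longrightarrow> t x = 0) \<and> van 3 (pt 0 0) t \<and> van 3 (pt 1 0) t \<and> van 3 (pt 0 1) t))"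

text \<open>Integrate the first equation from the axis \<open>x1 = 0\<close>. On \<open>x2 =
  0\<close> the integrand is zero by the choice of \<open>base\<close>, so the integral vanishes
  on both axes; the only derivatives left to control at (1,0) are the first and the second one
  in the second variable.\<close>

lemma ref_half:
  assumes k: "7 \<le> k" "f \<in> poly_maps (k - 1)" "g \<in> poly_maps (k - 1)"
    and f: "van 2 (pt 0 0) f" "van 2 (pt 1 0) f" "van 2 (pt 0 1) f"
    and g: "van 2 (pt 0 0) g"
  shows "\<exists>\<alpha> \<beta>. correctable k f g \<alpha> \<beta>"
proof -
  have pf: "poly_map f" "poly_map g" using k poly_mapI by blast+
  have bk: "base f g \<in> poly_maps k" using k by (intro base_poly) auto
  then have pb: "poly_map (base f g)" by (rule poly_mapI)
  (* The part of the integrand that does not involve the coefficients of corr. *)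
  define F0 where "F0 x = f x - (partial_deriv 1 (base f g) x - partial_deriv 2 (base f g) x)" for x
  have "F0 \<in> poly_maps (k - 1)" unfolding F0_def[abs_def]
    by (intro poly_maps_diff poly_maps_partial_deriv bk k)
  from poly_maps_antiderivative[OF this, of 1] obtain P where P: "P \<in> poly_maps (Suc (k - 1))"
     "partial_deriv 1 P = F0" "\<And>x. x $ 1 = 0 \<Longrightarrow> P x = 0" by blast
  have Pk: "P \<in> poly_maps k" "poly_map P" using P(1) k(1) poly_mapI by auto
  show ?thesis unfolding correctable_def
  proof (rule exI[of _ "- partial_deriv 2 P (pt 1 0)"], rule exI[of _ "partial_deriv 2 (partial_deriv 2 P) (pt 1 0)"],
      intro allI impI)
    fix a b a' b' c c' s
    assume s: "s = (\<lambda>x. base f g x + corr a b a' b' c c' x)"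
      and al: "a / 2 + 2 * b / 5 = - partial_deriv 2 P (pt 1 0)"
      and be: "2 * a + 2 * b - 2 * a' - 6 / 5 * c = partial_deriv 2 (partial_deriv 2 P) (pt 1 0)"
      and v: "van 3 (pt 0 0) s" "van 3 (pt 1 0) s" "van 3 (pt 0 1) s"
    have ps: "poly_map s" unfolding s by (intro poly_map_add pb corr_poly_map)
    have ds: "partial_deriv j s = (\<lambda>x. partial_deriv j (base f g) x + partial_deriv j (corr a b a' b' c c') x)" for j
      unfolding s by (intro pd_add pb corr_poly_map)
    let ?J = "corr_int a b a' b' c c'"
    define t where "t x = P x - ?J x" for x
    have tk: "t \<in> poly_maps k" "poly_map t" unfolding t_def[abs_def]
      using Pk k(1) by (auto intro!: poly_maps_diff corr_int_poly poly_map_diff)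
    define F where "F x = f x - (partial_deriv 1 s x - partial_deriv 2 s x)" for x
    have d1: "partial_deriv 1 t = F"
      unfolding t_def[abs_def] pd_diff[OF Pk(2) corr_poly_map(2)] P(2) pd_corr_int
      by (rule ext) (simp add: F_def F0_def ds)
    have Fv: "van 2 p F" if "van 2 p f" "van 3 p s" for p
      unfolding F_def[abs_def] using that van_partial_deriv[OF that(2)]
      by (intro van_diff poly_map_diff poly_map_partial_deriv ps pf) auto
    have t0: "t x = 0" if "x $ 1 = 0" for x
      using P(3)[OF that] that by (simp add: t_def corr_int_def)
    have F0: "F x = 0" if "x $ 2 = 0" for x
      using that van_2D[OF f(1)] van_2D[OF g] pt_eta[of x]
      by (simp add: F_def ds pd_base[OF pf] pd_corr)
    have t1: "t x = 0" if "x $ 2 = 0" for x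
      using tk(2) _ _ that by (rule zero_of_row) (use t0 F0 d1 in auto)
    have col: "partial_deriv 2 t x = 0" "partial_deriv 2 (partial_deriv 2 t) x = 0" if "x $ 1 = 0" for x
    proof -
      have *: "partial_deriv 2 t x = 0" if "x $ 1 = 0" for x
        using tk(2) t0 that by (rule pd2_zero_of_column)
      then show "partial_deriv 2 t x = 0" using that .
      show "partial_deriv 2 (partial_deriv 2 t) x = 0"
        using poly_map_partial_deriv[OF tk(2)] * that by (rule pd2_zero_of_column)
    qed
    have J2: "partial_deriv 2 ?J = (\<lambda>x.
         a * (2 * (x $ 1 ^ 3 * x $ 2) - 1 / 2 * x $ 1 ^ 4)
       + b * (2 * (x $ 1 ^ 4 * x $ 2) - 2 / 5 * x $ 1 ^ 5)
       + a' * (3 * (x $ 1 ^ 2 * x $ 2 ^ 2) - 2 * (x $ 1 ^ 3 * x $ 2))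
       + b' * (4 * (x $ 1 ^ 2 * x $ 2 ^ 3) - 4 * (x $ 1 ^ 3 * x $ 2 ^ 2))
       + c * (3 * (x $ 1 ^ 4 * x $ 2 ^ 2) - 6 / 5 * (x $ 1 ^ 5 * x $ 2))
       + c' * (4 * (x $ 1 ^ 3 * x $ 2 ^ 3) - 3 * (x $ 1 ^ 4 * x $ 2 ^ 2)))"
      unfolding corr_int_def[abs_def]
      apply (simp only: pd_simps poly_map_intros poly_map_coord poly_map_const partial_deriv_coord_simps partial_deriv_const)
      apply (simp add: algebra_simps)
      done
    have J22: "partial_deriv 2 (partial_deriv 2 ?J) (pt 1 0) = 2 * a + 2 * b - 2 * a' - 6 / 5 * c"
      unfolding J2
      apply (simp only: pd_simps poly_map_intros poly_map_coord poly_map_const partial_deriv_coord_simps partial_deriv_const)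
      apply simp
      done
    have t2: "partial_deriv 2 t = (\<lambda>x. partial_deriv 2 P x - partial_deriv 2 ?J x)"
      unfolding t_def[abs_def] by (rule pd_diff[OF Pk(2) corr_poly_map(2)])
    have e1: "partial_deriv 2 t (pt 1 0) = 0"
      using al by (simp add: t2 J2)
    have e2: "partial_deriv 2 (partial_deriv 2 t) (pt 1 0) = 0"
      unfolding t2 pd_diff[OF poly_map_partial_deriv[OF Pk(2)] poly_map_partial_deriv[OF corr_poly_map(2)]]
      using be by (simp add: J22)
    show "\<exists>t\<in>poly_maps k. (\<forall>x. partial_deriv 1 t x + partial_deriv 1 s x - partial_deriv 2 s x = f x) \<and>
         (\<forall>x. x $ 1 = 0 \<or> x $ 2 = 0 \<longrightarrow> t x = 0) \<and> van 3 (pt 0 0) t \<and> van 3 (pt 1 0) t \<and> van 3 (pt 0 1) t"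
      using tk t0 t1 col e1 e2 Fv f v
      by (intro bexI[of _ t] conjI van_3I) (auto simp: d1, auto simp: F_def)
  qed
qed

text \<open>Exchanging the coordinates exchanges the two equations of the reference
  triangle.\<close>

definition swp :: "point \<Rightarrow> point" where "swp x = pt (x $ 2) (x $ 1)"

lemma swp_affmap: "swp = affmap 0 (pt 0 1) (pt 1 0)"
  by (rule ext, rule point_eqI) (simp_all add: swp_def affmap_def)

lemma swp_simps [simp]: "swp (swp x) = x" "swp (pt a b) = pt b a" "swp x $ 1 = x $ 2" "swp x $ 2 = x $ 1"
  by (simp_all add: swp_def)

lemma swp_poly:
  fixes f :: "point \<Rightarrow> real"
  shows "poly_map f \<Longrightarrow> poly_map (\<lambda>x. f (swp x))"
  "f \<in> poly_maps k \<Longrightarrow> (\<lambda>x. f (swp x)) \<in> poly_maps k"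
  "poly_map f \<Longrightarrow> van m (swp x) f \<Longrightarrow> van m x (\<lambda>x. f (swp x))"
  unfolding swp_affmap by (auto intro: poly_map_affmap poly_maps_affmap van_affmap)

lemma pd_swp:
  fixes f :: "point \<Rightarrow> real"
  shows "poly_map f \<Longrightarrow> partial_deriv 1 (\<lambda>x. f (swp x)) = (\<lambda>x. partial_deriv 2 f (swp x))"
  "poly_map f \<Longrightarrow> partial_deriv 2 (\<lambda>x. f (swp x)) = (\<lambda>x. partial_deriv 1 f (swp x))"
  using pd_comp_affmap[of f 0 "pt 0 1" "pt 1 0"] unfolding swp_affmap by (simp_all add: dird_two)

lemma base_corr_swp:
  fixes f g :: "point \<Rightarrow> real"
  shows "base f g (swp x) + corr a b a' b' c c' (swp x)
    = base (\<lambda>x. g (swp x)) (\<lambda>x. f (swp x)) x + corr a' b' a b c' c x"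
  by (simp add: base_def corr_def algebra_simps)

text \<open>The components \<open>s1\<close>, \<open>s2\<close>, \<open>s3\<close> multiply the
  squares of the edge vectors (1,0), (0,1) and (1,-1). They vanish on the two axes but
  \<open>s3\<close> stays free on the hypotenuse. The component \<open>s3\<close> is
  \<open>base\<close> plus \<open>corr\<close>; the first equation is then solved for
  \<open>s1\<close> and, by symmetry, the second one for \<open>s2\<close>. All second-order
  conditions at the vertices become six linear equations for the six coefficients of
  \<open>corr\<close>.\<close>

lemma reference_lift:
  fixes f g :: "point \<Rightarrow> real"
  assumes k: "7 \<le> k" "f \<in> poly_maps (k - 1)" "g \<in> poly_maps (k - 1)"
    and fv: "\<And>p. p \<in> {pt 0 0, pt 1 0, pt 0 1} \<Longrightarrow> van 2 p f"
    and gv: "\<And>p. p \<in> {pt 0 0, pt 1 0, pt 0 1} \<Longrightarrow> van 2 p g"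
  shows "\<exists>s1 s2 s3. s1 \<in> poly_maps k \<and> s2 \<in> poly_maps k \<and> s3 \<in> poly_maps k \<and>
      (\<forall>x. partial_deriv 1 s1 x + partial_deriv 1 s3 x - partial_deriv 2 s3 x = f x) \<and>
      (\<forall>x. partial_deriv 2 s2 x - partial_deriv 1 s3 x + partial_deriv 2 s3 x = g x) \<and>
      (\<forall>x. x $ 1 = 0 \<or> x $ 2 = 0 \<longrightarrow> s1 x = 0 \<and> s2 x = 0 \<and> s3 x = 0) \<and>
      (\<forall>p\<in>{pt 0 0, pt 1 0, pt 0 1}. van 3 p s1 \<and> van 3 p s2 \<and> van 3 p s3)"
proof -
  have pf: "poly_map f" "poly_map g" using k poly_mapI by blast+
  let ?f = "\<lambda>x. g (swp x)" and ?g = "\<lambda>x. f (swp x)"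
  have sk: "?f \<in> poly_maps (k - 1)" "?g \<in> poly_maps (k - 1)" by (rule swp_poly(2)[OF k(3)], rule swp_poly(2)[OF k(2)])
  have sv: "van 2 p ?f \<and> van 2 p ?g" if "p \<in> {pt 0 0, pt 1 0, pt 0 1}" for p
    using that fv gv pf by (auto intro!: swp_poly)
  obtain \<alpha> \<beta> where 1: "correctable k f g \<alpha> \<beta>"
    using ref_half[OF k fv fv fv gv] by auto
  obtain \<alpha>' \<beta>' where 2: "correctable k ?f ?g \<alpha>' \<beta>'"
    using ref_half[OF k(1) sk] sv by auto
  (* The value of a + b required by base_corr_van_e1. *)
  define \<gamma> where "\<gamma> = partial_deriv 2 (partial_deriv 2 g) (pt 0 0) / 2"
  define \<gamma>' where "\<gamma>' = partial_deriv 2 (partial_deriv 2 ?g) (pt 0 0) / 2"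
  (* Solve a + b = \<gamma> and a / 2 + 2 b / 5 = \<alpha>, likewise for the primed
     coefficients, and then the remaining two equations for c and c'. *)
  define a where "a = 10 * \<alpha> - 4 * \<gamma>"
  define b where "b = \<gamma> - a"
  define a' where "a' = 10 * \<alpha>' - 4 * \<gamma>'"
  define b' where "b' = \<gamma>' - a'"
  define c where "c = (2 * a + 2 * b - 2 * a' - \<beta>) * 5 / 6"
  define c' where "c' = (2 * a' + 2 * b' - 2 * a - \<beta>') * 5 / 6"
  define s where "s x = base f g x + corr a b a' b' c c' x" for x
  define s' where "s' x = base ?f ?g x + corr a' b' a b c' c x" for x
  have ss: "s (swp x) = s' x" for x unfolding s_def s'_def by (rule base_corr_swp)
  then have ss': "s' (swp x) = s x" for x using ss[of "swp x"] by simp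
  have sk': "s \<in> poly_maps k" unfolding s_def[abs_def]
    using k by (intro poly_maps_add base_poly corr_poly) auto
  have ps: "poly_map s" using sk' poly_mapI by auto
  have v0: "van 3 (pt 0 0) s" unfolding s_def[abs_def]
    using fv gv pf k by (intro van_add base_van_origin corr_van_origin corr_poly_map poly_mapI[OF base_poly]) auto
  have v1: "van 3 (pt 1 0) s" unfolding s_def[abs_def] using fv gv k
    by (intro base_corr_van_e1[of f "k - 1"]) (auto simp: b_def \<gamma>_def)
  have v1': "van 3 (pt 1 0) s'" unfolding s'_def[abs_def] using sv sk
    by (intro base_corr_van_e1[of _ "k - 1"]) (auto simp: b'_def \<gamma>'_def)
  have sw: "s = (\<lambda>x. s' (swp x))" "s' = (\<lambda>x. s (swp x))" using ss ss' by auto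
  have ps': "poly_map s'" using ps sw(2) swp_poly(1) by metis
  have v2: "van 3 (pt 0 1) s" unfolding sw(1) using v1' ps' by (intro swp_poly) auto
  have v0': "van 3 (pt 0 0) s'" "van 3 (pt 0 1) s'" unfolding sw(2) using v0 v1 ps by (auto intro!: swp_poly)
  have "a / 2 + 2 * b / 5 = \<alpha>" "2 * a + 2 * b - 2 * a' - 6 / 5 * c = \<beta>"
    "a' / 2 + 2 * b' / 5 = \<alpha>'" "2 * a' + 2 * b' - 2 * a - 6 / 5 * c' = \<beta>'"
    by (simp_all add: b_def c_def b'_def c'_def) (simp_all add: a_def a'_def field_simps)
  note eqs = this
  obtain t where t: "t \<in> poly_maps k" "\<And>x. partial_deriv 1 t x + partial_deriv 1 s x - partial_deriv 2 s x = f x"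
    "\<And>x. x $ 1 = 0 \<or> x $ 2 = 0 \<Longrightarrow> t x = 0" "van 3 (pt 0 0) t" "van 3 (pt 1 0) t" "van 3 (pt 0 1) t"
    using 1[unfolded correctable_def, rule_format, OF ext[OF s_def] eqs(1,2) v0 v1 v2] by blast
  obtain u where u: "u \<in> poly_maps k" "\<And>x. partial_deriv 1 u x + partial_deriv 1 s' x - partial_deriv 2 s' x = ?f x"
    "\<And>x. x $ 1 = 0 \<or> x $ 2 = 0 \<Longrightarrow> u x = 0" "van 3 (pt 0 0) u" "van 3 (pt 1 0) u" "van 3 (pt 0 1) u"
    using 2[unfolded correctable_def, rule_format, OF ext[OF s'_def] eqs(3,4) v0'(1) v1' v0'(2)] by blast
  have pu: "poly_map u" using u poly_mapI by auto
  have "partial_deriv 2 (\<lambda>x. u (swp x)) x - partial_deriv 1 s x + partial_deriv 2 s x = g x" for x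
    using u(2)[of "swp x"] unfolding sw(2) pd_swp[OF ps] pd_swp[OF pu] by simp
  moreover have "s x = 0" if "x $ 1 = 0 \<or> x $ 2 = 0" for x
    using that van_2D(1)[OF fv, of "pt 0 0"] van_2D(1)[OF gv, of "pt 0 0"]
    by (auto simp: s_def base_def corr_def)
  moreover have "\<forall>p\<in>{pt 0 0, pt 1 0, pt 0 1}. van 3 p t \<and> van 3 p (\<lambda>x. u (swp x)) \<and> van 3 p s"
    using t(4-6) u(4-6) v0 v1 v2 swp_poly(3)[OF pu] by simp
  moreover have "u (swp x) = 0" if "x $ 1 = 0 \<or> x $ 2 = 0" for x
    using u(3)[of "swp x"] that by auto
  moreover note t(1-3) sk' swp_poly(2)[OF u(1)]
  ultimately show ?thesis by blast
qed

subsection \<open>Barycentric coordinates\<close>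

text \<open>The cross product of plane vectors, that is, the oriented area of the parallelogram
  they span; it vanishes exactly when they are parallel.\<close>

definition cr :: "point \<Rightarrow> point \<Rightarrow> real" where "cr x y = x $ 1 * y $ 2 - x $ 2 * y $ 1"

text \<open>Triangles are represented by their vertex sets, without an ordering of the
  vertices.\<close>

definition tri :: "point set \<Rightarrow> bool" where
  "tri K \<longleftrightarrow> (\<exists>a b c. K = {a, b, c} \<and> cr (b - a) (c - a) \<noteq> 0)"

text \<open>The description operator makes the value independent of the order of the two other
  vertices. For a point that is not a vertex of \<open>K\<close> the coordinate is zero, which
  is the right value on every common edge of two elements.\<close>

definition bary :: "point set \<Rightarrow> point \<Rightarrow> point \<Rightarrow> real" where
  "bary K a x = (if a \<in> K
     then THE r. \<forall>b c. K = {a, b, c} \<longrightarrow> r = cr (b - x) (c - x) / cr (b - a) (c - a) else 0)"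

text \<open>The gradient of an affine function is constant; it is taken at the origin.\<close>

definition gr :: "point set \<Rightarrow> point \<Rightarrow> point" where
  "gr K a = (\<chi> j. partial_deriv j (bary K a) 0)"

lemma cr_perm:
  "cr (c - b) (a - b) = cr (b - a) (c - a)" "cr (c - a) (b - a) = - cr (b - a) (c - a)"
  by (simp_all add: cr_def algebra_simps)

lemma cr_distinct:
  assumes "cr (b - a) (c - a) \<noteq> 0" shows "a \<noteq> b" "b \<noteq> c" "a \<noteq> c"
  using assms by (auto simp: cr_def)

lemma bary_outside [simp]: "a \<notin> K \<Longrightarrow> bary K a = (\<lambda>x. 0)"
  by (rule ext) (simp add: bary_def)

lemma bary_eq:
  assumes K: "K = {a, b, c}" and D: "cr (b - a) (c - a) \<noteq> 0"
  shows "bary K a x = cr (b - x) (c - x) / cr (b - a) (c - a)"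
proof -
  have "(THE r. \<forall>b' c'. K = {a, b', c'} \<longrightarrow> r = cr (b' - x) (c' - x) / cr (b' - a) (c' - a))
     = cr (b - x) (c - x) / cr (b - a) (c - a)"
  proof (rule the_equality)
    show "\<forall>b' c'. K = {a, b', c'} \<longrightarrow>
        cr (b - x) (c - x) / cr (b - a) (c - a) = cr (b' - x) (c' - x) / cr (b' - a) (c' - a)"
    proof (intro allI impI)
      fix b' c' assume K': "K = {a, b', c'}"
      then have "b \<in> {a, b', c'}" "c \<in> {a, b', c'}" using K by blast+
      then have "(b' = b \<and> c' = c) \<or> (b' = c \<and> c' = b)"
        using cr_distinct[OF D] by auto
      moreover have "cr (c - x) (b - x) / cr (c - a) (b - a) = cr (b - x) (c - x) / cr (b - a) (c - a)"
        by (simp add: cr_perm(2)[of c x b] cr_perm(2)[of c a b])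
      ultimately show "cr (b - x) (c - x) / cr (b - a) (c - a) = cr (b' - x) (c' - x) / cr (b' - a) (c' - a)"
        by auto
    qed
  qed (use K in blast)
  then show ?thesis using K by (simp add: bary_def)
qed

lemma tri_at:
  assumes "tri K" "v \<in> K"
  obtains a b where "K = {v, a, b}" "cr (a - v) (b - v) \<noteq> 0"
proof -
  obtain a b c where K: "K = {a, b, c}" "cr (b - a) (c - a) \<noteq> 0" using assms(1) tri_def by auto
  have "cr (c - b) (a - b) \<noteq> 0" "cr (a - c) (b - c) \<noteq> 0"
    using K(2) by (auto simp: cr_def algebra_simps)
  then show thesis using K assms(2) that[of b c] that[of c a] that[of a b] by auto
qed

lemma tri_at2:
  assumes "tri K" "v \<in> K" "a \<in> K" "a \<noteq> v"
  obtains b where "K = {v, a, b}" "cr (a - v) (b - v) \<noteq> 0" "b \<noteq> v" "b \<noteq> a"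
proof -
  obtain c d where K: "K = {v, c, d}" "cr (c - v) (d - v) \<noteq> 0" using tri_at[OF assms(1,2)] .
  note cr_distinct[OF K(2)]
  then show thesis using K assms(3,4) that[of d] that[of c] cr_perm(2)[of d v c] by (auto simp: insert_commute)
qed

lemma tri_finite: "tri K \<Longrightarrow> finite K" by (auto simp: tri_def)

lemma tri_card: "tri K \<Longrightarrow> card K = 3"
  unfolding tri_def using cr_distinct by fastforce

lemma bary_poly:
  assumes "tri K" shows "bary K a \<in> poly_maps 1"
proof (cases "a \<in> K")
  case True
  then obtain b c where K: "K = {a, b, c}" "cr (b - a) (c - a) \<noteq> 0" using tri_at[OF assms] by metis
  have "bary K a = (\<lambda>x. (cr b c / cr (b - a) (c - a)) + ((b $ 2 - c $ 2) / cr (b - a) (c - a)) * x $ 1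
     + ((c $ 1 - b $ 1) / cr (b - a) (c - a)) * x $ 2)"
    by (rule ext, subst bary_eq[OF K], use K(2) in \<open>simp add: divide_simps\<close>) (simp add: cr_def algebra_simps)
  then show ?thesis by (simp only:) (intro poly_maps_add poly_maps_cmult poly_maps_coord poly_maps_const order_refl)
qed simp

lemma bary_poly_map [simp]: "tri K \<Longrightarrow> poly_map (bary K a)"
  using bary_poly poly_mapI by blast

lemma pd_bary:
  assumes "K = {a, b, c}" "cr (b - a) (c - a) \<noteq> 0"
  shows "partial_deriv 1 (bary K a) = (\<lambda>x. (b $ 2 - c $ 2) / cr (b - a) (c - a))"
    "partial_deriv 2 (bary K a) = (\<lambda>x. (c $ 1 - b $ 1) / cr (b - a) (c - a))"
proof -
  have eq: "bary K a = (\<lambda>x. (cr b c / cr (b - a) (c - a)) + ((b $ 2 - c $ 2) / cr (b - a) (c - a)) * x $ 1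
     + ((c $ 1 - b $ 1) / cr (b - a) (c - a)) * x $ 2)"
    by (rule ext, subst bary_eq[OF assms], use assms(2) in \<open>simp add: divide_simps\<close>) (simp add: cr_def algebra_simps)
  show "partial_deriv 1 (bary K a) = (\<lambda>x. (b $ 2 - c $ 2) / cr (b - a) (c - a))"
    "partial_deriv 2 (bary K a) = (\<lambda>x. (c $ 1 - b $ 1) / cr (b - a) (c - a))"
    unfolding eq by (simp_all only: pd_simps poly_map_intros poly_map_coord poly_map_const
       partial_deriv_coord_simps partial_deriv_const) simp_all
qed

lemma gr_nth:
  assumes "K = {a, b, c}" "cr (b - a) (c - a) \<noteq> 0"
  shows "gr K a $ 1 = (b $ 2 - c $ 2) / cr (b - a) (c - a)" "gr K a $ 2 = (c $ 1 - b $ 1) / cr (b - a) (c - a)"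
  by (simp_all add: gr_def pd_bary[OF assms])

lemma inner_point: "(x :: point) \<bullet> y = x $ 1 * y $ 1 + x $ 2 * y $ 2"
  by (simp add: inner_vec_def UNIV_2)

lemma inner_gr:
  assumes "K = {a, b, c}" "cr (b - a) (c - a) \<noteq> 0"
  shows "gr K a \<bullet> h = cr h (b - c) / cr (b - a) (c - a)"
  by (simp add: inner_point gr_nth[OF assms] add_divide_distrib[symmetric]) (simp add: cr_def algebra_simps)

lemma gr_outside [simp]: "a \<notin> K \<Longrightarrow> gr K a = 0"
  by (simp add: gr_def vec_eq_iff)

lemma pd_bary_gr: "tri K \<Longrightarrow> partial_deriv j (bary K a) = (\<lambda>x. gr K a $ j)"
proof (cases "a \<in> K")
  case True
  assume "tri K"
  then obtain b c where K: "K = {a, b, c}" "cr (b - a) (c - a) \<noteq> 0" using tri_at True by metis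
  show ?thesis using exhaust_2[of j] by (auto simp: gr_nth[OF K] pd_bary[OF K])
qed simp

lemma bary_affine: "tri K \<Longrightarrow> bary K a (x + h) = bary K a x + gr K a \<bullet> h"
proof (cases "a \<in> K")
  case True
  assume "tri K"
  then obtain b c where K: "K = {a, b, c}" "cr (b - a) (c - a) \<noteq> 0" using tri_at True by metis
  show ?thesis unfolding inner_gr[OF K] bary_eq[OF K] using K(2)
    by (simp add: add_divide_distrib[symmetric]) (simp add: cr_def algebra_simps)
qed simp

lemma bary_diff: "tri K \<Longrightarrow> bary K a y - bary K a x = gr K a \<bullet> (y - x)"
  using bary_affine[of K a x "y - x"] by simp

lemma bary_vertex:
  assumes "tri K" "b \<in> K" shows "bary K a b = (if a = b then 1 else 0)"
proof (cases "a \<in> K")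
  case True
  then obtain c d where K: "K = {a, c, d}" "cr (c - a) (d - a) \<noteq> 0" using tri_at[OF assms(1)] by metis
  have "bary K a a = 1" "bary K a c = 0" "bary K a d = 0"
    unfolding bary_eq[OF K] using K(2) by (simp_all add: cr_def)
  moreover have "b = a \<or> b = c \<or> b = d" using assms(2) K(1) by blast
  ultimately show ?thesis using cr_distinct[OF K(2)] by metis
qed (use assms in auto)

lemma sum_tri:
  assumes "K = {a, b, c}" "cr (b - a) (c - a) \<noteq> 0"
  shows "(\<Sum>z\<in>K. g z) = g a + (g b + g c)"
  using assms cr_distinct[OF assms(2)] by auto

lemma bary_sum:
  assumes "tri K" shows "(\<Sum>a\<in>K. bary K a x) = 1" "(\<Sum>a\<in>K. bary K a x *\<^sub>R a) = x"
proof -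
  obtain a b c where K: "K = {a, b, c}" "cr (b - a) (c - a) \<noteq> 0" using assms tri_def by auto
  have K2: "K = {b, c, a}" "cr (c - b) (a - b) \<noteq> 0" and K3: "K = {c, a, b}" "cr (a - c) (b - c) \<noteq> 0"
    using K by (auto simp: cr_def algebra_simps)
  have D: "cr (c - b) (a - b) = cr (b - a) (c - a)" "cr (a - c) (b - c) = cr (b - a) (c - a)"
    by (auto simp: cr_def algebra_simps)
  show "(\<Sum>a\<in>K. bary K a x) = 1"
    unfolding sum_tri[OF K] bary_eq[OF K] bary_eq[OF K2] bary_eq[OF K3] D
    using K(2) by (simp add: add_divide_distrib[symmetric]) (simp add: cr_def algebra_simps)
  show "(\<Sum>a\<in>K. bary K a x *\<^sub>R a) = x"
    unfolding sum_tri[OF K] bary_eq[OF K] bary_eq[OF K2] bary_eq[OF K3] D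
    using K(2) by (intro point_eqI; simp add: divide_simps) (simp_all add: cr_def algebra_simps)
qed

lemma bary_unique:
  assumes "tri K" "(\<Sum>a\<in>K. u a) = 1" "x = (\<Sum>a\<in>K. u a *\<^sub>R a)" "b \<in> K"
  shows "bary K b x = u b"
proof -
  have "x = (\<Sum>a\<in>K. u a *\<^sub>R (a - b)) + (\<Sum>a\<in>K. u a) *\<^sub>R b"
    unfolding assms(3) by (simp add: scaleR_sum_left sum.distrib[symmetric] algebra_simps)
  then have x: "x = b + (\<Sum>a\<in>K. u a *\<^sub>R (a - b))" using assms(2) by simp
  have "bary K b x = 1 + (\<Sum>a\<in>K. u a * (gr K b \<bullet> (a - b)))"
    unfolding x bary_affine[OF assms(1)] inner_sum_right
    by (simp add: bary_vertex[OF assms(1,4)])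
  also have "(\<Sum>a\<in>K. u a * (gr K b \<bullet> (a - b))) = (\<Sum>a\<in>K. u a * ((if a = b then 1 else 0) - 1))"
    by (rule sum.cong) (auto simp: bary_diff[OF assms(1), symmetric] bary_vertex[OF assms(1)] assms(4))
  also have "\<dots> = u b - 1"
    using assms(2,4) tri_finite[OF assms(1)]
    by (simp add: right_diff_distrib sum_subtractf if_distrib[of "\<lambda>r. u _ * r"] cong: if_cong)
  finally show ?thesis by simp
qed

lemma sum_extend_zero:
  fixes u :: "point \<Rightarrow> real"
  assumes "finite K" "L \<subseteq> K"
  shows "(\<Sum>a\<in>K. if a \<in> L then u a else 0) = (\<Sum>a\<in>L. u a)"
    "(\<Sum>a\<in>K. (if a \<in> L then u a else 0) *\<^sub>R a) = (\<Sum>a\<in>L. u a *\<^sub>R a)"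
  using assms by (intro sum.mono_neutral_cong_right; auto)+

lemma hull_iff:
  assumes "tri K" shows "x \<in> convex hull K \<longleftrightarrow> (\<forall>a\<in>K. 0 \<le> bary K a x)"
proof
  assume "x \<in> convex hull K"
  then obtain u where "\<forall>a\<in>K. 0 \<le> u a" "(\<Sum>a\<in>K. u a) = 1" "(\<Sum>a\<in>K. u a *\<^sub>R a) = x"
    using convex_hull_finite[OF tri_finite[OF assms]] by auto
  then show "\<forall>a\<in>K. 0 \<le> bary K a x" using bary_unique[OF assms, of u x] by simp
next
  assume "\<forall>a\<in>K. 0 \<le> bary K a x"
  then show "x \<in> convex hull K"
    unfolding convex_hull_finite[OF tri_finite[OF assms]]
    using bary_sum[OF assms] by (intro CollectI exI[of _ "\<lambda>a. bary K a x"]) auto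
qed

lemma subhull_iff:
  assumes "tri K" "L \<subseteq> K"
  shows "x \<in> convex hull L \<longleftrightarrow> x \<in> convex hull K \<and> (\<forall>a\<in>K - L. bary K a x = 0)"
proof
  assume *: "x \<in> convex hull L"
  have fin: "finite L" using assms tri_finite finite_subset by blast
  obtain u where u: "\<forall>a\<in>L. 0 \<le> u a" "(\<Sum>a\<in>L. u a) = 1" "(\<Sum>a\<in>L. u a *\<^sub>R a) = x"
    using * convex_hull_finite[OF fin] by auto
  let ?w = "\<lambda>a. if a \<in> L then u a else 0"
  have "(\<Sum>a\<in>K. ?w a) = 1" "x = (\<Sum>a\<in>K. ?w a *\<^sub>R a)"
    using u by (simp_all only: sum_extend_zero[OF tri_finite[OF assms(1)] assms(2)])
  from bary_unique[OF assms(1) this] have "bary K b x = ?w b" if "b \<in> K" for b using that by auto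
  then show "x \<in> convex hull K \<and> (\<forall>a\<in>K - L. bary K a x = 0)"
    using u(1) hull_iff[OF assms(1)] by auto
next
  assume *: "x \<in> convex hull K \<and> (\<forall>a\<in>K - L. bary K a x = 0)"
  have fin: "finite L" using assms tri_finite finite_subset by blast
  have "(\<Sum>a\<in>L. bary K a x) = (\<Sum>a\<in>K. bary K a x)" "(\<Sum>a\<in>L. bary K a x *\<^sub>R a) = (\<Sum>a\<in>K. bary K a x *\<^sub>R a)"
    using * assms(2) tri_finite[OF assms(1)] by (intro sum.mono_neutral_left; auto)+
  then show "x \<in> convex hull L"
    unfolding convex_hull_finite[OF fin] using bary_sum[OF assms(1)] * hull_iff[OF assms(1)] assms(2)
    by (intro CollectI exI[of _ "\<lambda>a. bary K a x"]) auto
qed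

lemma bary_eq_on_common:
  assumes "tri K" "tri K'" "x \<in> convex hull (K \<inter> K')"
  shows "bary K a x = bary K' a x"
proof -
  define S where "S = K \<inter> K'"
  have fin: "finite S" using assms tri_finite S_def by blast
  obtain u where u: "(\<Sum>a\<in>S. u a) = 1" "(\<Sum>a\<in>S. u a *\<^sub>R a) = x"
    using assms(3) convex_hull_finite[OF fin] unfolding S_def by auto
  let ?w = "\<lambda>a. if a \<in> S then u a else 0"
  have *: "bary L b x = ?w b" if "tri L" "S \<subseteq> L" for L b
  proof (cases "b \<in> L")
    case True
    have "(\<Sum>a\<in>L. ?w a) = 1" "x = (\<Sum>a\<in>L. ?w a *\<^sub>R a)"
      using u by (simp_all only: sum_extend_zero[OF tri_finite[OF that(1)] that(2)])
    from bary_unique[OF that(1) this True] show ?thesis .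
  qed (use that in auto)
  show ?thesis using *[OF assms(1)] *[OF assms(2)] by (simp add: S_def)
qed

lemma gr_edge:
  assumes "tri K" "v \<in> K" "c \<in> K" "c \<noteq> v" "b \<in> K"
  shows "gr K c \<bullet> (b - v) = (if b = c then 1 else 0)"
  using assms by (auto simp: bary_diff[symmetric] bary_vertex)

text \<open>The gradients of the barycentric coordinates of \<open>a\<close> and
  \<open>b\<close> are the basis dual to the edge vectors at \<open>v\<close>.\<close>

lemma edge_expansion:
  assumes "K = {v, a, b}" "cr (a - v) (b - v) \<noteq> 0"
  shows "h = (gr K a \<bullet> h) *\<^sub>R (a - v) + (gr K b \<bullet> h) *\<^sub>R (b - v)"
proof -
  have K2: "K = {a, b, v}" "cr (b - a) (v - a) \<noteq> 0" and K3: "K = {b, v, a}" "cr (v - b) (a - b) \<noteq> 0"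
    using assms by (auto simp: cr_def algebra_simps)
  have D: "cr (b - a) (v - a) = cr (a - v) (b - v)" "cr (v - b) (a - b) = cr (a - v) (b - v)"
    by (auto simp: cr_def algebra_simps)
  show ?thesis unfolding inner_gr[OF K2] inner_gr[OF K3] D
    using assms(2) by (intro point_eqI; simp add: divide_simps) (simp_all add: cr_def algebra_simps)
qed

subsection \<open>Row-wise divergence\<close>

text \<open>The row-wise divergence of one polynomial matrix field; it agrees with
  \<open>mesh_div\<close> on the interior of an element.\<close>

definition pdiv :: "(point \<Rightarrow> real ^ 2 ^ 2) \<Rightarrow> point \<Rightarrow> point" where
  "pdiv \<sigma> x = (\<chi> i. \<Sum>j\<in>UNIV. partial_deriv j (\<lambda>y. \<sigma> y $ i $ j) x)"

lemma bounded_linear_entry: "bounded_linear (\<lambda>A :: real ^ 2 ^ 2. A $ i $ j)"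
  using bounded_linear_compose[OF bounded_linear_vec_nth bounded_linear_vec_nth] .

lemma poly_map_entry:
  fixes \<sigma> :: "point \<Rightarrow> real ^ 2 ^ 2"
  shows "poly_map \<sigma> \<Longrightarrow> poly_map (\<lambda>y. \<sigma> y $ i $ j)"
  using poly_map_linear[OF _ bounded_linear.linear[OF bounded_linear_entry]] .

lemma pd_entry:
  fixes \<sigma> :: "point \<Rightarrow> real ^ 2 ^ 2"
  shows "poly_map \<sigma> \<Longrightarrow> partial_deriv l (\<lambda>y. \<sigma> y $ i $ j) = (\<lambda>x. partial_deriv l \<sigma> x $ i $ j)"
  by (rule pd_linear[OF _ bounded_linear_entry])

lemma pdiv_eq: "poly_map \<sigma> \<Longrightarrow> pdiv \<sigma> = (\<lambda>x. \<Sum>j\<in>UNIV. partial_deriv j \<sigma> x *v axis j 1)"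
  by (rule ext) (simp add: pdiv_def pd_entry vec_eq_iff matrix_vector_mult_def axis_def if_distrib cong: if_cong)

lemma matvec_linear: "bounded_linear (\<lambda>A :: real ^ 2 ^ 2. A *v d)"
  by (simp add: linear_conv_bounded_linear[symmetric] linear_iff matrix_vector_mult_add_rdistrib scaleR_matrix_vector_assoc)

lemma pdiv_add: "poly_map \<sigma> \<Longrightarrow> poly_map \<tau> \<Longrightarrow> pdiv (\<lambda>x. \<sigma> x + \<tau> x) = (\<lambda>x. pdiv \<sigma> x + pdiv \<tau> x)"
  by (rule ext) (simp add: pdiv_eq poly_map_add pd_add matrix_vector_mult_add_rdistrib sum.distrib)

lemma pdiv_scaleR: "poly_map \<sigma> \<Longrightarrow> pdiv (\<lambda>x. r *\<^sub>R \<sigma> x) = (\<lambda>x. r *\<^sub>R pdiv \<sigma> x)"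
  by (rule ext) (simp add: pdiv_eq poly_map_scaleR pd_scaleR scaleR_sum_right scaleR_matrix_vector_assoc)

lemma pdiv_diff: "poly_map \<sigma> \<Longrightarrow> poly_map \<tau> \<Longrightarrow> pdiv (\<lambda>x. \<sigma> x - \<tau> x) = (\<lambda>x. pdiv \<sigma> x - pdiv \<tau> x)"
  using pdiv_add[of \<sigma> "\<lambda>x. -1 *\<^sub>R \<tau> x"] pdiv_scaleR[of \<tau> "-1"] poly_map_uminus[of \<tau>] by simp

lemma pdiv_zero [simp]: "pdiv (\<lambda>x. 0) = (\<lambda>x. 0)"
  by (rule ext) (simp add: pdiv_def vec_eq_iff)

lemma poly_maps_pdiv: "\<sigma> \<in> poly_maps k \<Longrightarrow> pdiv \<sigma> \<in> poly_maps (k - 1)"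
  unfolding pdiv_eq[OF poly_mapI]
  by (intro poly_maps_sum poly_maps_linear[OF _ bounded_linear.linear[OF matvec_linear]] poly_maps_partial_deriv)

lemma poly_map_pdiv: "poly_map \<sigma> \<Longrightarrow> poly_map (pdiv \<sigma>)"
  unfolding poly_map_def using poly_maps_pdiv by blast

lemma van_pdiv: "poly_map \<sigma> \<Longrightarrow> van m v \<sigma> \<Longrightarrow> van (m - 1) v (pdiv \<sigma>)"
  unfolding pdiv_eq
  by (intro van_sum van_linear[OF _ matvec_linear] poly_map_linear[OF _ bounded_linear.linear[OF matvec_linear]]
     poly_map_partial_deriv van_partial_deriv)

text \<open>The divergence in the basis of edge vectors at \<open>v\<close>: each edge
  contributes its tangential derivative, applied to the gradient dual to it.\<close>

lemma pdiv_edges: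
  assumes "K = {v, a, b}" "cr (a - v) (b - v) \<noteq> 0" "poly_map \<sigma>"
  shows "pdiv \<sigma> = (\<lambda>x. dird (a - v) \<sigma> x *v gr K a + dird (b - v) \<sigma> x *v gr K b)"
proof
  fix x
  have e: "gr K a $ j *\<^sub>R (a - v) + gr K b $ j *\<^sub>R (b - v) = axis j 1" for j
    using edge_expansion[OF assms(1,2), of "axis j 1"] by (simp add: inner_axis)
  have f: "(a - v) $ i * gr K a $ j + (b - v) $ i * gr K b $ j = (if i = j then 1 else 0)" for i j
    using arg_cong[OF e[of j], of "\<lambda>z. z $ i"] by (simp add: axis_def mult.commute eq_commute)
  show "pdiv \<sigma> x = dird (a - v) \<sigma> x *v gr K a + dird (b - v) \<sigma> x *v gr K b"
  proof -
    let ?P = "partial_deriv 1 \<sigma> x" and ?Q = "partial_deriv 2 \<sigma> x"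
    have "dird (a - v) \<sigma> x *v gr K a + dird (b - v) \<sigma> x *v gr K b
      = ?P *v ((a - v) $ 1 *\<^sub>R gr K a + (b - v) $ 1 *\<^sub>R gr K b) + ?Q *v ((a - v) $ 2 *\<^sub>R gr K a + (b - v) $ 2 *\<^sub>R gr K b)"
      by (simp add: dird_two matrix_vector_mult_add_rdistrib matrix_vector_right_distrib scaleR_matrix_vector_assoc
         matrix_vector_mult_scaleR algebra_simps)
    also have "(a - v) $ 1 *\<^sub>R gr K a + (b - v) $ 1 *\<^sub>R gr K b = axis 1 1"
      using f[of 1] by (auto simp: vec_eq_iff axis_def eq_commute)
    also have "(a - v) $ 2 *\<^sub>R gr K a + (b - v) $ 2 *\<^sub>R gr K b = axis 2 1"
      using f[of 2] by (auto simp: vec_eq_iff axis_def eq_commute)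
    finally show ?thesis by (simp add: pdiv_eq[OF assms(3)] UNIV_2)
  qed
qed

text \<open>Fields along the squares \<open>t t^T\<close> have divergence the derivative along
  \<open>t\<close>, in direction \<open>t\<close>. The three edge vectors of a triangle give a
  basis of the symmetric matrices of this kind.\<close>

definition outer :: "point \<Rightarrow> real ^ 2 ^ 2" where "outer t = (\<chi> i j. t $ i * t $ j)"

lemma outer_sym: "outer t \<in> sym_matrices"
  by (simp add: outer_def sym_matrices_def transpose_def vec_eq_iff mult.commute)

lemma pdiv_outer:
  assumes "poly_map s" shows "pdiv (\<lambda>x. s x *\<^sub>R outer t) = (\<lambda>x. dird t s x *\<^sub>R t)"
proof -
  have "partial_deriv j (\<lambda>x. s x *\<^sub>R outer t) = (\<lambda>x. partial_deriv j s x *\<^sub>R outer t)" for j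
    by (subst pd_mult[OF assms poly_map_const]) simp
  then show ?thesis
    by (intro ext) (simp add: pdiv_eq poly_map_mult_scaleR assms dird_def UNIV_2 vec_eq_iff outer_def
      matrix_vector_mult_def axis_def algebra_simps)
qed

lemma sym_add: "A \<in> sym_matrices \<Longrightarrow> B \<in> sym_matrices \<Longrightarrow> A + B \<in> sym_matrices"
  and sym_scaleR: "A \<in> sym_matrices \<Longrightarrow> r *\<^sub>R A \<in> sym_matrices"
  and sym_zero [simp]: "0 \<in> sym_matrices"
  by (simp_all add: sym_matrices_def transpose_def vec_eq_iff)

text \<open>The divergence of a stress is the sum of the tangential derivatives of its three
  edge components. Transported to the reference triangle this is a system of two equations for
  three functions, which leaves enough freedom to make the stress vanish on two edges; it cannot
  be made to vanish on all three.\<close>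

lemma triangle_lift:
  assumes k: "7 \<le> k" "q \<in> poly_maps (k - 1)"
    and K: "K = {v0, v1, v2}" "cr (v1 - v0) (v2 - v0) \<noteq> 0"
    and q: "\<And>v. v \<in> K \<Longrightarrow> van 2 v q"
  shows "\<exists>\<sigma>\<in>poly_maps k. (\<forall>x. \<sigma> x \<in> sym_matrices) \<and> pdiv \<sigma> = q \<and> (\<forall>v\<in>K. van 3 v \<sigma>) \<and>
      (\<forall>x. bary K v1 x = 0 \<or> bary K v2 x = 0 \<longrightarrow> \<sigma> x = 0)"
proof -
  have tK: "tri K" using K tri_def by blast
  have pq: "poly_map q" using k poly_mapI by blast
  define t1 t2 where "t1 = v1 - v0" and "t2 = v2 - v0"
  define \<Psi> where "\<Psi> = affmap v0 t1 t2"
  define \<Phi> where "\<Phi> x = pt (bary K v1 x) (bary K v2 x)" for x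
  have dis: "v0 \<noteq> v1" "v1 \<noteq> v2" "v0 \<noteq> v2" using cr_distinct[OF K(2)] by auto
  have v0K: "v0 \<in> K" using K by simp
  have bg: "bary K v1 x = gr K v1 \<bullet> (x - v0)" "bary K v2 x = gr K v2 \<bullet> (x - v0)" for x
    using bary_diff[OF tK, of v1 x v0] bary_diff[OF tK, of v2 x v0] dis by (simp_all add: bary_vertex[OF tK v0K])
  have \<Psi>\<Phi>: "\<Psi> (\<Phi> x) = x" for x
    unfolding \<Psi>_def \<Phi>_def affmap_def t1_def t2_def bg pt_nth
    using edge_expansion[OF K, of "x - v0"] by (simp add: add.assoc)
  have \<Phi>p: "(\<lambda>x. \<Phi> x $ i) \<in> poly_maps 1" for i
    using exhaust_2[of i] bary_poly[OF tK] by (auto simp: \<Phi>_def)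
  let ?L = "\<lambda>h. pt (gr K v1 \<bullet> h) (gr K v2 \<bullet> h)"
  have bl: "bounded_linear ?L"
    by (simp add: linear_conv_bounded_linear[symmetric] linear_iff) (auto intro!: point_eqI simp: inner_add_right)
  have \<Phi>eq: "\<Phi> = (\<lambda>x. \<Phi> 0 + ?L x)"
    by (intro ext point_eqI) (simp_all add: \<Phi>_def bg inner_diff_right)
  have \<Phi>d: "(\<Phi> has_derivative ?L) (at x)" for x
    by (subst \<Phi>eq) (auto intro!: derivative_eq_intros bounded_linear_imp_has_derivative[OF bl])
  have L: "?L t1 = pt 1 0" "?L t2 = pt 0 1" "?L (t1 - t2) = pt 1 0 - pt 0 1"
  proof -
    have "v1 \<in> K" "v2 \<in> K" using K by auto
    then have "gr K v1 \<bullet> t1 = 1" "gr K v1 \<bullet> t2 = 0" "gr K v2 \<bullet> t1 = 0" "gr K v2 \<bullet> t2 = 1"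
      unfolding t1_def t2_def using dis by (simp_all add: gr_edge[OF tK v0K])
    then show "?L t1 = pt 1 0" "?L t2 = pt 0 1" "?L (t1 - t2) = pt 1 0 - pt 0 1"
      by (auto simp: inner_diff_right intro!: point_eqI)
  qed
  (* Components of q in the basis of edge vectors, pulled back to the reference triangle. *)
  define f where "f y = gr K v1 \<bullet> q (\<Psi> y)" for y
  define g where "g y = gr K v2 \<bullet> q (\<Psi> y)" for y
  have qk: "(\<lambda>y. q (\<Psi> y)) \<in> poly_maps (k - 1)" unfolding \<Psi>_def by (rule poly_maps_affmap[OF k(2)])
  have fk: "f \<in> poly_maps (k - 1)" "g \<in> poly_maps (k - 1)"
    unfolding f_def[abs_def] g_def[abs_def] by (intro poly_maps_linear[OF qk bounded_linear.linear[OF bounded_linear_inner_right]])+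
  have \<Psi>v: "\<Psi> p \<in> K" if "p \<in> {pt 0 0, pt 1 0, pt 0 1}" for p
    using that K by (auto simp: \<Psi>_def affmap_def t1_def t2_def)
  have vq: "van 2 p (\<lambda>y. q (\<Psi> y))" if "p \<in> {pt 0 0, pt 1 0, pt 0 1}" for p
    using q[OF \<Psi>v[OF that]] unfolding \<Psi>_def by (intro van_affmap pq)
  have fv: "van 2 p f" and gv: "van 2 p g" if "p \<in> {pt 0 0, pt 1 0, pt 0 1}" for p
    unfolding f_def[abs_def] g_def[abs_def]
    by (rule van_linear[OF poly_mapI[OF qk] bounded_linear_inner_right vq[OF that]])+
  have "\<exists>s1 s2 s3. s1 \<in> poly_maps k \<and> s2 \<in> poly_maps k \<and> s3 \<in> poly_maps k \<and>
      (\<forall>x. partial_deriv 1 s1 x + partial_deriv 1 s3 x - partial_deriv 2 s3 x = f x) \<and>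
      (\<forall>x. partial_deriv 2 s2 x - partial_deriv 1 s3 x + partial_deriv 2 s3 x = g x) \<and>
      (\<forall>x. x $ 1 = 0 \<or> x $ 2 = 0 \<longrightarrow> s1 x = 0 \<and> s2 x = 0 \<and> s3 x = 0) \<and>
      (\<forall>p\<in>{pt 0 0, pt 1 0, pt 0 1}. van 3 p s1 \<and> van 3 p s2 \<and> van 3 p s3)"
    using fv gv by (intro reference_lift[OF k(1) fk])
  then obtain s1 s2 s3 where s: "s1 \<in> poly_maps k" "s2 \<in> poly_maps k" "s3 \<in> poly_maps k"
      "\<forall>x. partial_deriv 1 s1 x + partial_deriv 1 s3 x - partial_deriv 2 s3 x = f x"
      "\<forall>x. partial_deriv 2 s2 x - partial_deriv 1 s3 x + partial_deriv 2 s3 x = g x"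
      "\<forall>x. x $ 1 = 0 \<or> x $ 2 = 0 \<longrightarrow> s1 x = 0 \<and> s2 x = 0 \<and> s3 x = 0"
      "\<forall>p\<in>{pt 0 0, pt 1 0, pt 0 1}. van 3 p s1 \<and> van 3 p s2 \<and> van 3 p s3"
    by (elim exE conjE)
  have ps: "poly_map s1" "poly_map s2" "poly_map s3" using s(1-3) by (auto intro: poly_mapI)
  have pc: "poly_map (\<lambda>x. s1 (\<Phi> x))" "poly_map (\<lambda>x. s2 (\<Phi> x))" "poly_map (\<lambda>x. s3 (\<Phi> x))"
    by (rule poly_map_comp[OF ps(1) \<Phi>p] poly_map_comp[OF ps(2) \<Phi>p] poly_map_comp[OF ps(3) \<Phi>p])+
  note dc = dird_comp[OF ps(1) \<Phi>d \<Phi>p] dird_comp[OF ps(2) \<Phi>d \<Phi>p] dird_comp[OF ps(3) \<Phi>d \<Phi>p]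
  have kc: "(\<lambda>x. s (\<Phi> x) *\<^sub>R outer t) \<in> poly_maps k" if "s \<in> poly_maps k" for s :: "point \<Rightarrow> real" and t
    using poly_maps_mult_scaleR[OF poly_maps_comp_affine[OF that \<Phi>p] poly_maps_const[of _ 0]] by simp
  (* The reference components, each along the square of its edge vector. *)
  define \<sigma> where "\<sigma> x = s1 (\<Phi> x) *\<^sub>R outer t1 + (s2 (\<Phi> x) *\<^sub>R outer t2 + s3 (\<Phi> x) *\<^sub>R outer (t1 - t2))" for x
  have "\<sigma> \<in> poly_maps k" unfolding \<sigma>_def[abs_def] by (intro poly_maps_add kc s)
  moreover have "\<sigma> x \<in> sym_matrices" for x
    unfolding \<sigma>_def by (intro sym_add sym_scaleR outer_sym)
  moreover have "pdiv \<sigma> = q"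
  proof
    fix x
    have "pdiv \<sigma> x = partial_deriv 1 s1 (\<Phi> x) *\<^sub>R t1 + (partial_deriv 2 s2 (\<Phi> x) *\<^sub>R t2
        + (partial_deriv 1 s3 (\<Phi> x) - partial_deriv 2 s3 (\<Phi> x)) *\<^sub>R (t1 - t2))"
      unfolding \<sigma>_def[abs_def]
      by (simp add: pdiv_add pdiv_outer poly_map_add poly_map_mult_scaleR pc dc L)
         (simp add: dird_two)
    also have "\<dots> = f (\<Phi> x) *\<^sub>R t1 + g (\<Phi> x) *\<^sub>R t2"
      by (simp only: s(4,5)[rule_format, of "\<Phi> x", symmetric]) (simp add: algebra_simps)
    also have "\<dots> = q x"
      unfolding f_def g_def \<Psi>\<Phi> using edge_expansion[OF K, of "q x"] by (simp add: t1_def t2_def)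
    finally show "pdiv \<sigma> x = q x" .
  qed
  moreover have "van 3 v \<sigma>" if "v \<in> K" for v
  proof -
    have "\<Phi> v \<in> {pt 0 0, pt 1 0, pt 0 1}"
    proof -
      have "v = v0 \<or> v = v1 \<or> v = v2" using that K(1) by blast
      then show ?thesis unfolding \<Phi>_def bary_vertex[OF tK that] using dis by auto
    qed
    then have "van 3 v (\<lambda>x. s1 (\<Phi> x))" "van 3 v (\<lambda>x. s2 (\<Phi> x))" "van 3 v (\<lambda>x. s3 (\<Phi> x))"
      using bspec[OF s(7), of "\<Phi> v"] van_comp[OF \<Phi>d \<Phi>p ps(1), of 3 v] van_comp[OF \<Phi>d \<Phi>p ps(2), of 3 v]
        van_comp[OF \<Phi>d \<Phi>p ps(3), of 3 v] by simp_all
    note vs = this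
    have "van (3 + 0) v (\<lambda>x. s1 (\<Phi> x) *\<^sub>R outer t1)" "van (3 + 0) v (\<lambda>x. s2 (\<Phi> x) *\<^sub>R outer t2)"
      "van (3 + 0) v (\<lambda>x. s3 (\<Phi> x) *\<^sub>R outer (t1 - t2))"
      by (rule van_mult_scaleR[OF pc(1) poly_map_const vs(1) van_0] van_mult_scaleR[OF pc(2) poly_map_const vs(2) van_0]
          van_mult_scaleR[OF pc(3) poly_map_const vs(3) van_0])+
    then show ?thesis unfolding \<sigma>_def[abs_def]
      by (intro van_add poly_map_add poly_map_mult_scaleR pc poly_map_const) auto
  qed
  moreover have "\<sigma> x = 0" if "bary K v1 x = 0 \<or> bary K v2 x = 0" for x
    using s(6)[rule_format, of "\<Phi> x"] that by (auto simp: \<sigma>_def \<Phi>_def)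
  ultimately show ?thesis by blast
qed

section \<open>Meshes of triangles\<close>

text \<open>Elements are represented by their vertex sets, so that a common face of two elements
  is spanned by the intersection of the sets; the converse of the inclusion in
  \<open>conform\<close> always holds.\<close>

locale mesh =
  fixes \<K> :: "point set set" and k :: nat
  assumes fin: "finite \<K>" and tris: "\<And>K. K \<in> \<K> \<Longrightarrow> tri K"
    and conform: "\<And>K K'. K \<in> \<K> \<Longrightarrow> K' \<in> \<K> \<Longrightarrow> convex hull K \<inter> convex hull K' \<subseteq> convex hull (K \<inter> K')"
    and k7: "7 \<le> k"

lemma open_move:
  fixes m d :: point
  assumes "open U" "m \<in> U"
  shows "\<exists>t>0. m + t *\<^sub>R d \<in> U"
proof -
  have "((\<lambda>t. m + t *\<^sub>R d) \<longlongrightarrow> m + 0 *\<^sub>R d) (at_right 0)"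
    by (intro tendsto_intros)
  then have "eventually (\<lambda>t. m + t *\<^sub>R d \<in> U) (at_right 0)"
    using assms by (intro topological_tendstoD) auto
  then have "eventually (\<lambda>t. m + t *\<^sub>R d \<in> U \<and> 0 < t) (at_right 0)"
    using eventually_at_right_less by (intro eventually_conj) auto
  then show ?thesis
    using eventually_happens[of _ "at_right (0::real)"] by force
qed

lemma open_bary_pos: "tri K \<Longrightarrow> open {x. 0 < bary K a x}"
  by (intro open_Collect_less continuous_on_const poly_map_continuous) auto

lemma hull_iff3:
  assumes "tri K" "K = {v, a, b}"
  shows "x \<in> convex hull K \<longleftrightarrow> 0 \<le> bary K v x \<and> 0 \<le> bary K a x \<and> 0 \<le> bary K b x"
proof -
  have "\<And>c. c \<in> K \<longleftrightarrow> c = v \<or> c = a \<or> c = b" using assms(2) by blast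
  then show ?thesis unfolding hull_iff[OF assms(1)] by auto
qed

lemma tri_subset_eq: "tri K \<Longrightarrow> tri K' \<Longrightarrow> K \<subseteq> K' \<Longrightarrow> K = K'"
  by (metis card_subset_eq tri_card tri_finite)

context mesh
begin

lemma bary_agree: "K \<in> \<K> \<Longrightarrow> K' \<in> \<K> \<Longrightarrow> x \<in> convex hull K \<Longrightarrow> x \<in> convex hull K' \<Longrightarrow> bary K a x = bary K' a x"
  using conform tris by (intro bary_eq_on_common) auto

lemma bary_zero_outside:
  assumes "K \<in> \<K>" "K' \<in> \<K>" "x \<in> convex hull K" "x \<in> convex hull K'" "c \<notin> K'"
  shows "bary K c x = 0"
  using bary_agree[OF assms(1-4), of c] assms(5) by simp

text \<open>An interior point of one element has no zero barycentric coordinate, so no vertex of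
  that element is missing from an element that contains the point.\<close>

lemma element_eqI:
  assumes "K \<in> \<K>" "K' \<in> \<K>" "x \<in> convex hull K'" "\<And>a. a \<in> K \<Longrightarrow> 0 < bary K a x"
  shows "K = K'"
proof -
  have "x \<in> convex hull K" using assms hull_iff[OF tris] by (auto intro: less_imp_le)
  then have "K \<subseteq> K'" using bary_zero_outside[OF assms(1,2) _ assms(3)] assms(4) by fastforce
  then show ?thesis using tri_subset_eq tris assms by blast
qed

text \<open>Both functions vanish on the common edge, hence they are proportional; were the
  factor positive, the elements would overlap near the midpoint of the edge.\<close>

lemma edge_sides:
  assumes "K \<in> \<K>" "K' \<in> \<K>" "K \<noteq> K'" and K: "K = {v, a, b}" "cr (a - v) (b - v) \<noteq> 0"
    and K': "K' = {v, a, b'}" "cr (a - v) (b' - v) \<noteq> 0"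
  shows "\<exists>\<kappa>>0. \<forall>x. bary K b x = - \<kappa> * bary K' b' x"
proof -
  have tK: "tri K" "tri K'" using assms tris by auto
  have KK: "K = {b, v, a}" "cr (v - b) (a - b) \<noteq> 0" and KK': "K' = {b', v, a}" "cr (v - b') (a - b') \<noteq> 0"
    using K K' by (auto simp: cr_def algebra_simps)
  define \<mu> where "\<mu> = cr (v - b') (a - b') / cr (v - b) (a - b)"
  have eq: "bary K b x = \<mu> * bary K' b' x" for x
    unfolding bary_eq[OF KK] bary_eq[OF KK'] \<mu>_def using KK(2) KK'(2) by simp
  have m0: "\<mu> \<noteq> 0" using KK(2) KK'(2) by (simp add: \<mu>_def)
  have "\<not> 0 < \<mu>"
  proof
    assume pos: "0 < \<mu>"
    let ?U = "{x. 0 < bary K v x} \<inter> {x. 0 < bary K a x} \<inter> {x. 0 < bary K' v x} \<inter> {x. 0 < bary K' a x}"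
    (* Midpoint of the common edge: moving towards b from here would enter both elements. *)
    let ?m = "v + (1/2) *\<^sub>R (a - v)"
    have va: "v \<in> K" "a \<in> K" "b \<in> K" "v \<in> K'" "a \<in> K'" using K K' by auto
    have dis: "v \<noteq> a" "v \<noteq> b" "a \<noteq> b" "v \<noteq> b'" "a \<noteq> b'" using cr_distinct[OF K(2)] cr_distinct[OF K'(2)] by auto
    have g: "gr L c \<bullet> (y - v) = bary L c y - bary L c v" if "tri L" for L c y using bary_diff[OF that] by simp
    have "bary L v ?m = 1/2 \<and> bary L a ?m = 1/2" if "tri L" "v \<in> L" "a \<in> L" for L
      using that dis by (simp add: bary_affine[OF that(1)] g[OF that(1)] bary_vertex[OF that(1)])
    note mid = this
    have "?m \<in> ?U" using mid[OF tK(1) va(1,2)] mid[OF tK(2) va(4,5)] by auto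
    moreover have "open ?U" by (intro open_Int open_bary_pos tK)
    ultimately obtain t where t: "0 < t" "?m + t *\<^sub>R (b - v) \<in> ?U" using open_move by blast
    let ?x = "?m + t *\<^sub>R (b - v)"
    have "bary K b ?x = t"
      using dis va by (simp add: bary_affine[OF tK(1)] g[OF tK(1)] bary_vertex[OF tK(1)])
    then have b: "0 < bary K b ?x" using t(1) by simp
    then have b': "0 < bary K' b' ?x" unfolding eq using pos by (simp add: zero_less_mult_iff)
    then have "\<And>c. c \<in> K \<Longrightarrow> 0 < bary K c ?x" "\<And>c. c \<in> K' \<Longrightarrow> 0 < bary K' c ?x"
      using t(2) K(1) K'(1) b b' by auto
    then have "K = K'"
      using hull_iff[OF tK(2)] by (intro element_eqI[OF assms(1,2), of ?x]) (auto intro: less_imp_le)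
    then show False using assms(3) by simp
  qed
  then show ?thesis using m0 eq by (intro exI[of _ "- \<mu>"]) auto
qed

text \<open>Near a relatively interior point of the common edge only the sign of the coordinate
  of the opposite vertex matters, and one of the two elements has the right sign.\<close>

lemma edge_interior:
  assumes "K \<in> \<K>" "K' \<in> \<K>" "K \<noteq> K'" "v \<in> K" "a \<in> K" "v \<in> K'" "a \<in> K'" "v \<noteq> a"
    and x: "x \<in> convex hull K" "0 < bary K v x" "0 < bary K a x" "\<And>c. c \<in> K \<Longrightarrow> c \<noteq> v \<Longrightarrow> c \<noteq> a \<Longrightarrow> bary K c x = 0"
  shows "x \<in> interior (convex hull K \<union> convex hull K')"
proof -
  have tK: "tri K" "tri K'" using assms tris by auto
  obtain b where K: "K = {v, a, b}" "cr (a - v) (b - v) \<noteq> 0" "b \<noteq> v" "b \<noteq> a"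
    using tri_at2[OF tK(1) assms(4,5)] assms(8) by metis
  obtain b' where K': "K' = {v, a, b'}" "cr (a - v) (b' - v) \<noteq> 0" "b' \<noteq> v" "b' \<noteq> a"
    using tri_at2[OF tK(2) assms(6,7)] assms(8) by metis
  obtain \<kappa> where \<kappa>: "0 < \<kappa>" "\<And>x. bary K b x = - \<kappa> * bary K' b' x"
    using edge_sides[OF assms(1-3) K(1,2) K'(1,2)] by blast
  let ?U = "{x. 0 < bary K v x} \<inter> {x. 0 < bary K a x} \<inter> {x. 0 < bary K' v x} \<inter> {x. 0 < bary K' a x}"
  have "open ?U" by (intro open_Int open_bary_pos tK)
  moreover have "x \<in> convex hull (K \<inter> K')"
    using x K K' by (subst subhull_iff[OF tK(1)]) auto
  then have "x \<in> ?U" using x(2,3) bary_eq_on_common[OF tK, of x] by simp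
  moreover have "?U \<subseteq> convex hull K \<union> convex hull K'"
  proof
    fix y assume y: "y \<in> ?U"
    show "y \<in> convex hull K \<union> convex hull K'"
    proof (cases "0 \<le> bary K b y")
      case True
      have "0 \<le> bary K c y" if "c \<in> K" for c
      proof -
        have "c = v \<or> c = a \<or> c = b" using that K(1) by blast
        then show ?thesis using y True by auto
      qed
      then show ?thesis by (auto simp: hull_iff[OF tK(1)])
    next
      case False
      then have "0 \<le> bary K' b' y" using \<kappa>(2)[of y] \<kappa>(1) by (auto simp: not_le mult_less_0_iff zero_less_mult_iff)
      moreover have "c = v \<or> c = a \<or> c = b'" if "c \<in> K'" for c using that K'(1) by blast
      ultimately have "0 \<le> bary K' c y" if "c \<in> K'" for c using that y by fastforce
      then show ?thesis by (auto simp: hull_iff[OF tK(2)])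
    qed
  qed
  ultimately show ?thesis using interiorI by blast
qed

lemma closed_hulls: "\<S> \<subseteq> \<K> \<Longrightarrow> closed (\<Union>K\<in>\<S>. convex hull K)"
proof (rule closed_UN)
  assume "\<S> \<subseteq> \<K>"
  then show "finite \<S>" using fin finite_subset by blast
  show "\<forall>K\<in>\<S>. closed (convex hull K)"
    using \<open>\<S> \<subseteq> \<K>\<close> tris by (auto intro!: compact_imp_closed finite_imp_compact_convex_hull tri_finite)
qed

text \<open>Otherwise only \<open>K\<close> contains points near \<open>x\<close>, and
  \<open>K\<close> lies on one side of the edge.\<close>

lemma neighbour_exists:
  assumes "K \<in> \<K>" and K: "v \<in> K" "a \<in> K" "v \<noteq> a"
    and x: "x \<in> convex hull K" "0 < bary K v x" "0 < bary K a x" "\<And>c. c \<in> K \<Longrightarrow> c \<noteq> v \<Longrightarrow> c \<noteq> a \<Longrightarrow> bary K c x = 0"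
    and int: "x \<in> interior (\<Union>K\<in>\<K>. convex hull K)"
  shows "\<exists>K'\<in>\<K>. K' \<noteq> K \<and> v \<in> K' \<and> a \<in> K'"
proof -
  have tK: "tri K" using assms tris by auto
  obtain b where b: "K = {v, a, b}" "cr (a - v) (b - v) \<noteq> 0" "b \<noteq> v" "b \<noteq> a"
    using tri_at2[OF tK K(1,2)] K(3) by metis
  let ?F = "\<Union>K\<in>{K''\<in>\<K>. \<not> (v \<in> K'' \<and> a \<in> K'')}. convex hull K"
  let ?U = "interior (\<Union>K\<in>\<K>. convex hull K) \<inter> - ?F"
  have "closed ?F" by (rule closed_hulls) auto
  then have "open ?U" by (intro open_Int open_interior open_Compl)
  moreover have "x \<notin> ?F"
  proof
    assume "x \<in> ?F"
    then obtain K'' where K'': "K'' \<in> \<K>" "\<not> (v \<in> K'' \<and> a \<in> K'')" "x \<in> convex hull K''" by blast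
    then show False using bary_zero_outside[OF assms(1) K''(1) x(1) K''(3)] x(2,3) by force
  qed
  ultimately obtain t where t: "0 < t" "x + t *\<^sub>R (v - b) \<in> ?U" using open_move[of ?U x] int by blast
  let ?y = "x + t *\<^sub>R (v - b)"
  obtain K' where K': "K' \<in> \<K>" "?y \<in> convex hull K'" using t(2) interior_subset by blast
  then have "v \<in> K' \<and> a \<in> K'" using t(2) by blast
  moreover have "bary K b ?y < 0"
  proof -
    have "b \<in> K" using b(1) by blast
    then have "gr K b \<bullet> (v - b) = - 1"
      using bary_diff[OF tK, of b v b] b(3) K(1) by (simp add: bary_vertex[OF tK])
    then show ?thesis using x(4)[of b] b(3,4) t(1) \<open>b \<in> K\<close> by (simp add: bary_affine[OF tK])
  qed
  then have "K' \<noteq> K" using K'(2) hull_iff[OF tK] b(1) by force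
  ultimately show ?thesis using K'(1) by blast
qed

text \<open>Of three elements at one edge two lie on the same side, and these overlap.\<close>

lemma at_most_two:
  assumes "K \<in> \<K>" "K' \<in> \<K>" "K'' \<in> \<K>" "v \<noteq> a" "v \<in> K" "a \<in> K" "v \<in> K'" "a \<in> K'" "v \<in> K''" "a \<in> K''"
    and "K \<noteq> K'" "K \<noteq> K''"
  shows "K' = K''"
proof (rule ccontr)
  assume ne: "K' \<noteq> K''"
  have tK: "tri K" "tri K'" "tri K''" using assms tris by auto
  obtain b where b: "K = {v, a, b}" "cr (a - v) (b - v) \<noteq> 0"
    using tri_at2[OF tK(1) assms(5,6)] assms(4) by metis
  obtain b' where b': "K' = {v, a, b'}" "cr (a - v) (b' - v) \<noteq> 0"
    using tri_at2[OF tK(2) assms(7,8)] assms(4) by metis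
  obtain b'' where b'': "K'' = {v, a, b''}" "cr (a - v) (b'' - v) \<noteq> 0"
    using tri_at2[OF tK(3) assms(9,10)] assms(4) by metis
  obtain r where r: "0 < r" "\<forall>x. bary K b x = - r * bary K' b' x"
    using edge_sides[OF assms(1,2) assms(11) b b'] by blast
  obtain s where s: "0 < s" "\<forall>x. bary K b x = - s * bary K'' b'' x"
    using edge_sides[OF assms(1,3) assms(12) b b''] by blast
  obtain t where t: "0 < t" "\<forall>x. bary K' b' x = - t * bary K'' b'' x"
    using edge_sides[OF assms(2,3) ne b' b''] by blast
  have "b \<in> K" using b(1) by blast
  then have "bary K b b = 1" by (simp add: bary_vertex[OF tK(1)])
  then have e: "1 = - r * bary K' b' b" "1 = - s * bary K'' b'' b" "bary K' b' b = - t * bary K'' b'' b"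
    using r s t by metis+
  then have "bary K' b' b < 0" "bary K'' b'' b < 0" using r(1) s(1)
    by (metis less_numeral_extra(1) minus_mult_commute mult.commute neg_0_less_iff_less zero_less_mult_pos)+
  then show False using e(3) t(1) by (metis mult_neg_neg neg_less_0_iff_less not_less_iff_gr_or_eq)
qed

text \<open>Move a little from the vertex in the direction of the sum of the two edge
  vectors.\<close>

lemma star_direction:
  assumes "K \<in> \<K>" "v \<in> K" "open U" "v \<in> U"
  shows "\<exists>y\<in>U. y \<noteq> v \<and> (\<forall>c\<in>K. 0 < bary K c y)"
proof -
  have tK: "tri K" using assms tris by auto
  obtain a b where K: "K = {v, a, b}" "cr (a - v) (b - v) \<noteq> 0" using tri_at[OF tK assms(2)] .
  have dis: "v \<noteq> a" "v \<noteq> b" "a \<noteq> b" using cr_distinct[OF K(2)] by auto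
  have "open (U \<inter> {x. 0 < bary K v x})" "v \<in> U \<inter> {x. 0 < bary K v x}"
    using assms(3,4) open_bary_pos[OF tK] by (auto simp: bary_vertex[OF tK assms(2)])
  then obtain t where t: "0 < t" "v + t *\<^sub>R ((a - v) + (b - v)) \<in> U \<inter> {x. 0 < bary K v x}"
    using open_move by blast
  let ?y = "v + t *\<^sub>R ((a - v) + (b - v))"
  have "a \<in> K" "b \<in> K" using K by auto
  then have "bary K a ?y = t" "bary K b ?y = t" unfolding bary_affine[OF tK] inner_scaleR_right inner_add_right
    using dis by (simp_all add: gr_edge[OF tK assms(2)] bary_vertex[OF tK assms(2)])
  then have "\<forall>c\<in>K. 0 < bary K c ?y" using t K(1) by auto
  moreover have "?y \<noteq> v" using \<open>bary K a ?y = t\<close> t(1) dis bary_vertex[OF tK assms(2), of a] by auto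
  ultimately show ?thesis using t(2) by blast
qed

text \<open>Every edge at \<open>v\<close> of the union is shared, so in a punctured disc around
  \<open>v\<close> the union is both open and closed. A punctured disc is connected, hence the
  union fills it and leaves no room for further elements at \<open>v\<close>.\<close>

lemma star_connected:
  assumes S: "\<S> \<subseteq> {K \<in> \<K>. v \<in> K}" "\<S> \<noteq> {}"
    and nb: "\<And>K a. K \<in> \<S> \<Longrightarrow> a \<in> K \<Longrightarrow> a \<noteq> v \<Longrightarrow> \<exists>K'\<in>\<S>. K' \<noteq> K \<and> a \<in> K'"
  shows "v \<in> interior (\<Union>K\<in>\<S>. convex hull K)" "\<S> = {K \<in> \<K>. v \<in> K}"
proof -
  let ?U = "\<Union>K\<in>\<S>. convex hull K"
  have tS: "tri K" "K \<in> \<K>" "v \<in> K" if "K \<in> \<S>" for K using that S tris by auto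
  have "finite \<S>" using finite_subset[OF _ fin, of \<S>] S by blast
  then have "open (\<Inter>K\<in>\<S>. {x. 0 < bary K v x})"
    using tS by (intro open_INT ballI open_bary_pos) auto
  moreover have "v \<in> (\<Inter>K\<in>\<S>. {x. 0 < bary K v x})" using tS by (auto simp: bary_vertex)
  ultimately obtain e where e: "0 < e" "ball v e \<subseteq> (\<Inter>K\<in>\<S>. {x. 0 < bary K v x})"
    using openE by blast
  let ?B = "ball v e - {v}"
  (* Points of the union near v, other than v, are interior to an element or to an edge at v,
     since their coordinate at v is positive. *)
  have key: "x \<in> interior ?U" if x: "x \<in> ?U" "x \<in> ball v e - {v}" for x
  proof -
    obtain K where K: "K \<in> \<S>" "x \<in> convex hull K" using x by blast
    obtain a b where ab: "K = {v, a, b}" "cr (a - v) (b - v) \<noteq> 0" using tri_at tS[OF K(1)] by metis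
    have dis: "v \<noteq> a" "v \<noteq> b" "a \<noteq> b" using cr_distinct[OF ab(2)] by auto
    have pv: "0 < bary K v x" using e(2) x(2) K(1) by auto
    have nn: "0 \<le> bary K a x" "0 \<le> bary K b x" using K(2) hull_iff[OF tS(1)[OF K(1)]] ab(1) by auto
    have edge: "x \<in> interior ?U" if c: "c \<in> K" "c \<noteq> v" "0 < bary K c x" "\<And>d. d \<in> K \<Longrightarrow> d \<noteq> v \<Longrightarrow> d \<noteq> c \<Longrightarrow> bary K d x = 0" for c
    proof -
      obtain K' where K': "K' \<in> \<S>" "K' \<noteq> K" "c \<in> K'" using nb[OF K(1) c(1,2)] by blast
      have "x \<in> interior (convex hull K \<union> convex hull K')"
        using c K' tS[OF K(1)] tS[OF K'(1)] K(2) pv by (intro edge_interior[of K K' v c]) auto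
      moreover have "convex hull K \<union> convex hull K' \<subseteq> ?U" using K(1) K'(1) by blast
      ultimately show ?thesis using interior_mono by blast
    qed
    consider "0 < bary K a x" "0 < bary K b x" | "bary K a x = 0" "bary K b x = 0"
      | "0 < bary K a x" "bary K b x = 0" | "bary K a x = 0" "0 < bary K b x" using nn by fastforce
    then show ?thesis
    proof cases
      case 1
      let ?W = "{x. 0 < bary K v x} \<inter> {x. 0 < bary K a x} \<inter> {x. 0 < bary K b x}"
      have "open ?W" by (intro open_Int open_bary_pos tS(1) K(1))
      moreover have "?W \<subseteq> convex hull K"
        by (auto simp: hull_iff3[OF tS(1)[OF K(1)] ab(1)])
      then have "?W \<subseteq> ?U" using K(1) by blast
      ultimately show ?thesis using 1 pv interiorI[of ?W x ?U] by blast
    next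
      case 2
      have "gr K a \<bullet> (x - v) = 0" "gr K b \<bullet> (x - v) = 0"
        using 2 dis by (simp_all add: bary_diff[OF tS(1)[OF K(1)], symmetric] bary_vertex[OF tS(1)[OF K(1)] tS(3)[OF K(1)]])
      then have "x - v = 0" using edge_expansion[OF ab, of "x - v"] by simp
      then show ?thesis using x(2) by simp
    next
      case 3
      then show ?thesis using edge[of a] ab(1) dis by auto
    next
      case 4
      then show ?thesis using edge[of b] ab(1) dis by auto
    qed
  qed
  have conn: "connected ?B"
  proof (rule connected_punctured_convex)
    have "aff_dim (ball v e) = int DIM(point)" using e(1) by (intro aff_dim_open) auto
    then show "aff_dim (ball v e) \<noteq> 1" by simp
  qed (rule convex_ball)
  obtain K where K: "K \<in> \<S>" using S(2) by blast
  obtain y where y: "y \<in> ball v e" "y \<noteq> v" "\<forall>c\<in>K. 0 < bary K c y"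
    using star_direction[OF tS(2,3)[OF K], of "ball v e"] e(1) by auto
  have "y \<in> convex hull K" using y(3) by (simp add: hull_iff[OF tS(1)[OF K]] less_imp_le)
  then have "y \<in> ?U" using K by blast
  then have yi: "y \<in> interior ?U \<inter> ?B" using key y by blast
  have cl: "closed ?U" using S by (intro closed_hulls) auto
  have "?B \<subseteq> interior ?U \<union> - ?U" using key by blast
  then have "- ?U \<inter> ?B = {}"
  proof -
    have "open (- ?U)" using cl by (rule open_Compl)
    moreover have "interior ?U \<inter> - ?U \<inter> ?B = {}" using interior_subset[of ?U] by blast
    ultimately have "interior ?U \<inter> ?B = {} \<or> - ?U \<inter> ?B = {}"
      using \<open>?B \<subseteq> interior ?U \<union> - ?U\<close> by (intro connectedD[OF conn open_interior]) assumption+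
    then show ?thesis using yi by blast
  qed
  moreover have "v \<in> ?U" using K tS(3)[OF K] by (auto intro: hull_inc)
  ultimately have "ball v e \<subseteq> ?U" by blast
  then show int: "v \<in> interior ?U" using e(1) by (intro interiorI[of "ball v e"]) auto
  show "\<S> = {K \<in> \<K>. v \<in> K}"
  proof
    show "{K \<in> \<K>. v \<in> K} \<subseteq> \<S>"
    proof
      fix K assume "K \<in> {K \<in> \<K>. v \<in> K}"
      then have K: "K \<in> \<K>" "v \<in> K" by auto
      (* Another element at v would overlap the union in its interior. *)
      obtain z where z: "z \<in> interior ?U" "\<forall>c\<in>K. 0 < bary K c z"
        using star_direction[OF K open_interior int] by blast
      then obtain K'' where K'': "K'' \<in> \<S>" "z \<in> convex hull K''" using interior_subset[of ?U] by blast
      have "K = K''" by (rule element_eqI[OF K(1) tS(2)[OF K''(1)] K''(2)]) (use z(2) in blast)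
      then show "K \<in> \<S>" using K''(1) by simp
    qed
  qed (use S in auto)
qed

text \<open>If every edge of a nonempty finite set of elements were shared inside the set, the
  union would be open at edges and, by \<open>star_connected\<close>, at vertices. It would be a
  bounded nonempty subset of the plane that is open and closed.\<close>

lemma no_closed_subcomplex:
  assumes S: "\<S> \<subseteq> \<K>" "\<S> \<noteq> {}"
    and nb: "\<And>K v a. K \<in> \<S> \<Longrightarrow> v \<in> K \<Longrightarrow> a \<in> K \<Longrightarrow> v \<noteq> a \<Longrightarrow> \<exists>K'\<in>\<S>. K' \<noteq> K \<and> v \<in> K' \<and> a \<in> K'"
  shows False
proof -
  let ?U = "\<Union>K\<in>\<S>. convex hull K"
  have tS: "tri K" "K \<in> \<K>" if "K \<in> \<S>" for K using that S tris by auto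
  have vert: "v \<in> interior ?U" if "K \<in> \<S>" "v \<in> K" for K v
  proof -
    have "v \<in> interior (\<Union>K\<in>{K \<in> \<S>. v \<in> K}. convex hull K)"
    proof (rule star_connected(1))
      show "\<exists>K'\<in>{K \<in> \<S>. v \<in> K}. K' \<noteq> K \<and> a \<in> K'" if "K \<in> {K \<in> \<S>. v \<in> K}" "a \<in> K" "a \<noteq> v" for K a
        using nb[of K v a] that by blast
    qed (use that S in auto)
    moreover have "(\<Union>K\<in>{K \<in> \<S>. v \<in> K}. convex hull K) \<subseteq> ?U" by blast
    ultimately show ?thesis using interior_mono by blast
  qed
  have "x \<in> interior ?U" if xU: "x \<in> ?U" for x
  proof -
    obtain K where K: "K \<in> \<S>" "x \<in> convex hull K" using xU by blast
    note tK = tS[OF K(1)]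
    have nn: "\<And>c. c \<in> K \<Longrightarrow> 0 \<le> bary K c x" using K(2) hull_iff[OF tK(1)] by auto
    show ?thesis
    proof (cases "\<exists>c\<in>K. bary K c x = 0")
      case False
      let ?W = "\<Inter>c\<in>K. {x. 0 < bary K c x}"
      have "open ?W" using tK tri_finite by (intro open_INT ballI open_bary_pos) auto
      moreover have "x \<in> ?W" using False nn by (auto simp: less_le)
      moreover have "?W \<subseteq> convex hull K" by (auto simp: hull_iff[OF tK(1)] less_imp_le)
      then have "?W \<subseteq> ?U" using K(1) by blast
      ultimately show ?thesis using interiorI by blast
    next
      case True
      then obtain b where b: "b \<in> K" "bary K b x = 0" by blast
      obtain v a where va: "K = {b, v, a}" "cr (v - b) (a - b) \<noteq> 0" using tri_at[OF tK(1) b(1)] .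
      have dis: "b \<noteq> v" "v \<noteq> a" "b \<noteq> a" using cr_distinct[OF va(2)] by auto
      have s: "bary K v x + bary K a x = 1" "bary K v x *\<^sub>R v + bary K a x *\<^sub>R a = x"
        using bary_sum[OF tK(1), of x] b(2) unfolding sum_tri[OF va] by auto
      consider "bary K v x = 0" | "bary K a x = 0" | "0 < bary K v x" "0 < bary K a x"
        using nn[of v] nn[of a] va(1) by fastforce
      then show ?thesis
      proof cases
        case 1 then have "x = a" using s by simp
        then show ?thesis using vert[OF K(1), of a] va(1) by simp
      next
        case 2 then have "x = v" using s by simp
        then show ?thesis using vert[OF K(1), of v] va(1) by simp
      next
        case 3
        have "v \<in> K" "a \<in> K" using va(1) by auto
        obtain K' where K': "K' \<in> \<S>" "K' \<noteq> K" "v \<in> K'" "a \<in> K'" using nb[OF K(1) \<open>v \<in> K\<close> \<open>a \<in> K\<close> dis(2)] by blast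
        have z: "bary K c x = 0" if "c \<in> K" "c \<noteq> v" "c \<noteq> a" for c
          using that b(2) va(1) by auto
        have "x \<in> interior (convex hull K \<union> convex hull K')"
          by (rule edge_interior[OF tK(2) tS(2)[OF K'(1)] K'(2)[symmetric] \<open>v \<in> K\<close> \<open>a \<in> K\<close> K'(3,4) dis(2) K(2) 3 z])
        moreover have "convex hull K \<union> convex hull K' \<subseteq> ?U" using K(1) K'(1) by blast
        ultimately show ?thesis using interior_mono by blast
      qed
    qed
  qed
  then have "?U \<subseteq> interior ?U" by (rule subsetI)
  then have "interior ?U = ?U" by (rule subset_antisym[OF interior_subset])
  then have "open ?U" using open_interior[of ?U] by (simp only:)
  then have "?U = {} \<or> ?U = UNIV" by (rule clopen[THEN iffD1, OF conjI[OF closed_hulls[OF S(1)]]])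
  moreover have "?U \<noteq> {}"
  proof -
    obtain K where "K \<in> \<S>" using S(2) by blast
    moreover from this obtain a where "a \<in> K" using tS(1) tri_def by blast
    ultimately show ?thesis using hull_inc[of a K convex] by blast
  qed
  ultimately have "?U = UNIV" by (simp only: simp_thms)
  moreover have "bounded ?U"
  proof (rule bounded_UN)
    show "finite \<S>" using S(1) fin by (rule finite_subset)
    show "\<forall>K\<in>\<S>. bounded (convex hull K)"
    proof
      fix K assume "K \<in> \<S>"
      show "bounded (convex hull K)"
        by (rule bounded_convex_hull[OF finite_imp_bounded[OF tri_finite[OF tS(1)[OF \<open>K \<in> \<S>\<close>]]]])
    qed
  qed
  ultimately have "bounded (UNIV :: point set)" by (simp only:)
  then show False using not_bounded_UNIV by blast
qed

end

section \<open>Stresses and divergences on a mesh\<close>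

subsection \<open>Matrix- and vector-valued polynomials by components\<close>

definition unit_mat :: "2 \<Rightarrow> 2 \<Rightarrow> real ^ 2 ^ 2" where
  "unit_mat i j = (\<chi> p q. if p = i \<and> q = j then 1 else 0)"

lemma matrix_expand: "A = (\<Sum>i\<in>UNIV. \<Sum>j\<in>UNIV. A $ i $ j *\<^sub>R unit_mat i j)"
proof -
  have "(\<Sum>i\<in>UNIV. \<Sum>j\<in>UNIV. A $ i $ j *\<^sub>R unit_mat i j) $ p $ q = A $ p $ q" for p q
    using exhaust_2[of p] exhaust_2[of q] by (auto simp: UNIV_2 unit_mat_def)
  then show ?thesis by (simp add: vec_eq_iff)
qed

lemma poly_maps_matrix:
  fixes A :: "point \<Rightarrow> real ^ 2 ^ 2"
  assumes "\<And>i j. (\<lambda>x. A x $ i $ j) \<in> poly_maps k"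
  shows "A \<in> poly_maps k"
proof -
  have 1: "(\<lambda>x. A x $ i $ j *\<^sub>R unit_mat i j) \<in> poly_maps k" for i j
    using poly_maps_mult_scaleR[OF assms[of i j] poly_maps_const[of "unit_mat i j" 0]] by simp
  have "(\<lambda>x. \<Sum>i\<in>UNIV. \<Sum>j\<in>UNIV. A x $ i $ j *\<^sub>R unit_mat i j) \<in> poly_maps k"
    by (rule poly_maps_sum, rule poly_maps_sum, rule 1)
  then show ?thesis by (simp only: matrix_expand[symmetric])
qed

lemma van_matrix:
  fixes A :: "point \<Rightarrow> real ^ 2 ^ 2"
  assumes "\<And>i j. poly_map (\<lambda>x. A x $ i $ j)" "\<And>i j. van m v (\<lambda>x. A x $ i $ j)"
  shows "van m v A"
proof -
  have 1: "van m v (\<lambda>x. A x $ i $ j *\<^sub>R unit_mat i j)" for i j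
    using van_mult_scaleR[OF assms(1) poly_map_const assms(2) van_0, of i j "unit_mat i j"] by simp
  have 2: "poly_map (\<lambda>x. A x $ i $ j *\<^sub>R unit_mat i j)" for i j
    by (rule poly_map_mult_scaleR[OF assms(1) poly_map_const])
  have "van m v (\<lambda>x. \<Sum>i\<in>UNIV. \<Sum>j\<in>UNIV. A x $ i $ j *\<^sub>R unit_mat i j)"
    by (rule van_sum, rule poly_map_sum, rule 2, rule van_sum, rule 2, rule 1)
  then show ?thesis by (simp only: matrix_expand[symmetric])
qed

lemma vec_expand: "(x :: point) = (\<Sum>i\<in>UNIV. x $ i *\<^sub>R axis i 1)"
  by (intro point_eqI) (simp_all add: UNIV_2 axis_def)

lemma van_vec:
  fixes q :: "point \<Rightarrow> point"
  assumes "\<And>i. poly_map (\<lambda>x. q x $ i)" "\<And>i. van m v (\<lambda>x. q x $ i)"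
  shows "van m v q"
proof -
  have 1: "van m v (\<lambda>x. q x $ i *\<^sub>R axis i 1 :: point)" for i
    using van_mult_scaleR[OF assms(1) poly_map_const assms(2) van_0, of i "axis i 1"] by simp
  have 2: "poly_map (\<lambda>x. q x $ i *\<^sub>R axis i 1 :: point)" for i
    by (rule poly_map_mult_scaleR[OF assms(1) poly_map_const])
  have "van m v (\<lambda>x. \<Sum>i\<in>UNIV. q x $ i *\<^sub>R axis i 1 :: point)"
    by (rule van_sum, rule 2, rule 1)
  then show ?thesis by (simp only: vec_expand[symmetric])
qed

lemma poly_map_nth: "poly_map q \<Longrightarrow> poly_map (\<lambda>x. (q x :: point) $ i)"
  by (rule poly_map_linear[OF _ bounded_linear.linear[OF bounded_linear_vec_nth]])

lemma pd_nth: "poly_map q \<Longrightarrow> partial_deriv j (\<lambda>x. (q x :: point) $ i) = (\<lambda>x. partial_deriv j q x $ i)"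
  by (rule pd_linear[OF _ bounded_linear_vec_nth])

lemma poly_maps_poly:
  fixes R :: "real poly"
  assumes "degree R \<le> m" "l \<in> poly_maps 1"
  shows "(\<lambda>x. poly R (l x)) \<in> poly_maps m"
proof -
  have "(\<lambda>x. coeff R i * l x ^ i) \<in> poly_maps m" if "i \<le> degree R" for i
    by (rule poly_maps_cmult, rule poly_maps_mono[OF poly_maps_power[OF assms(2)]]) (use that assms in simp)
  then have "(\<lambda>x. \<Sum>i\<le>degree R. coeff R i * l x ^ i) \<in> poly_maps m"
    by (intro poly_maps_sum) auto
  then show ?thesis by (simp only: poly_altdef)
qed

subsection \<open>The trace on an edge\<close>

text \<open>A third-order zero at both endpoints makes the trace on the edge divisible by
  \<open>t^3 (1 - t)^3\<close>, and the cofactor is a polynomial of degree at most \<open>k -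
  6\<close> in the edge parameter.\<close>

lemma edge_trace:
  fixes \<sigma> :: "point \<Rightarrow> real ^ 2 ^ 2"
  assumes \<sigma>: "\<sigma> \<in> poly_maps k" "\<And>x. \<sigma> x \<in> sym_matrices" and van: "van 3 v \<sigma>" "van 3 a \<sigma>"
  obtains R :: "2 \<Rightarrow> 2 \<Rightarrow> real poly" where "\<And>i j. degree (R i j) \<le> k - 6" "\<And>i j. R i j = R j i"
    "\<And>i j t. \<sigma> (v + t *\<^sub>R (a - v)) $ i $ j = t ^ 3 * (1 - t) ^ 3 * poly (R i j) t"
proof -
  have e: "(\<lambda>x. \<sigma> x $ i $ j) \<in> poly_maps k" for i j
    by (rule poly_maps_linear[OF \<sigma>(1) bounded_linear.linear[OF bounded_linear_entry]])
  have ep: "poly_map (\<lambda>x. \<sigma> x $ i $ j)" for i j by (rule poly_mapI[OF e])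
  have ev: "van 3 w (\<lambda>x. \<sigma> x $ i $ j)" if "van 3 w \<sigma>" for w i j
    by (rule van_linear[OF poly_mapI[OF \<sigma>(1)] bounded_linear_entry that])
  have "\<forall>i j. \<exists>P. degree P \<le> k \<and> (\<forall>t. poly P t = \<sigma> (v + t *\<^sub>R (a - v)) $ i $ j)"
    using poly_maps_line[OF e] by blast
  then obtain P where P: "\<And>i j. degree (P i j) \<le> k" "\<And>i j t. poly (P i j) t = \<sigma> (v + t *\<^sub>R (a - v)) $ i $ j"
    by metis
  have Psym: "P i j = P j i" for i j
  proof -
    have "\<sigma> x $ i $ j = \<sigma> x $ j $ i" for x
      using \<sigma>(2)[of x] by (simp add: sym_matrices_def transpose_def vec_eq_iff)
    then have "poly (P i j) = poly (P j i)" by (intro ext) (simp add: P(2))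
    then show ?thesis by (simp add: poly_eq_poly_eq_iff)
  qed
  let ?M = "[:0, 1:] ^ 3 * [:-1, 1:] ^ 3 :: real poly"
  have M: "?M dvd P i j" for i j
  proof -
    have "[:- 0, 1:] ^ 3 dvd P i j"
      by (rule van_line_dvd[OF ep[of i j] P(2)]) (simp add: ev van)
    then obtain A where A: "P i j = [:0, 1:] ^ 3 * A" unfolding dvd_def by auto
    have d: "[:- 1, 1:] ^ 3 dvd P i j"
      by (rule van_line_dvd[OF ep[of i j] P(2)]) (simp add: ev van)
    have "[:- 1, 1:] ^ 3 dvd A"
    proof (cases "P i j = 0")
      case True
      then show ?thesis using A by simp
    next
      case False
      have "order 1 (P i j) = order 1 ([:0, 1:] ^ 3 :: real poly) + order 1 A"
        using False unfolding A by (rule order_mult)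
      moreover have "order 1 ([:0, 1:] ^ 3 :: real poly) = 0" by (rule order_0I) simp
      moreover have "3 \<le> order 1 (P i j)" using d False by (simp add: order_divides)
      ultimately show ?thesis by (simp add: order_divides)
    qed
    then show ?thesis unfolding A by (rule mult_dvd_mono[OF dvd_refl])
  qed
  define R where "R i j = - (P i j div ?M)" for i j
  have PM: "P i j = - (?M * R i j)" for i j using dvd_mult_div_cancel[OF M[of i j]] by (simp add: R_def)
  show thesis
  proof (rule that[of R])
    show "degree (R i j) \<le> k - 6" for i j
    proof (cases "R i j = 0")
      case False
      have d: "degree ([:0, 1:] ^ 3 :: real poly) = 3" "degree ([:-1, 1:] ^ 3 :: real poly) = 3"
        by (simp_all add: degree_power_eq)
      have "degree (P i j) = degree ([:0, 1:] ^ 3 :: real poly) + degree ([:-1, 1:] ^ 3 :: real poly) + degree (R i j)"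
        unfolding PM degree_minus using False by (subst degree_mult_eq; simp add: degree_mult_eq)
      then show ?thesis using P(1)[of i j] d by simp
    qed simp
    show "R i j = R j i" for i j by (simp add: R_def Psym[of i j])
    show "\<sigma> (v + t *\<^sub>R (a - v)) $ i $ j = t ^ 3 * (1 - t) ^ 3 * poly (R i j) t" for i j t
    proof -
      have "(t - 1) ^ 3 = - ((1 - t) ^ 3)" by (simp add: power3_eq_cube algebra_simps)
      then show ?thesis unfolding P(2)[symmetric] PM[of i j] by (simp del: power_mult_distrib)
    qed
  qed
qed

subsection \<open>Finite element families\<close>

definition single :: "point set \<Rightarrow> (point \<Rightarrow> 'b::zero) \<Rightarrow> point set \<Rightarrow> point \<Rightarrow> 'b" where
  "single K0 p K = (if K = K0 then p else (\<lambda>x. 0))"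

lemma sum_fun_apply2: "(\<Sum>i\<in>I. (f i :: 'a \<Rightarrow> 'c \<Rightarrow> 'b::real_vector)) K x = (\<Sum>i\<in>I. f i K x)"
  by (induction I rule: infinite_finite_induct) auto

context mesh
begin

text \<open>Stresses are encoded by one polynomial for each element, required to be zero for
  sets that are not elements so that the encoding is unique. Continuity is agreement on
  intersections of elements, and smoothness of order \<open>r\<close> at vertices is vanishing
  of order \<open>r + 1\<close> of the differences.\<close>

definition Sfam :: "nat \<Rightarrow> (point set \<Rightarrow> point \<Rightarrow> real ^ 2 ^ 2) set" where
  "Sfam r = {s. (\<forall>K\<in>\<K>. s K \<in> poly_maps k \<and> (\<forall>x. s K x \<in> sym_matrices)) \<and>
     (\<forall>K\<in>\<K>. \<forall>K'\<in>\<K>. \<forall>x. x \<in> convex hull K \<longrightarrow> x \<in> convex hull K' \<longrightarrow> s K x = s K' x) \<and>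
     (\<forall>K\<in>\<K>. \<forall>K'\<in>\<K>. \<forall>v. v \<in> K \<longrightarrow> v \<in> K' \<longrightarrow> van (Suc r) v (\<lambda>x. s K x - s K' x)) \<and>
     (\<forall>K. K \<notin> \<K> \<longrightarrow> s K = (\<lambda>x. 0))}"

definition Dfam :: "nat \<Rightarrow> (point set \<Rightarrow> point \<Rightarrow> point) set" where
  "Dfam r = (\<lambda>s K. pdiv (s K)) ` Sfam r"

definition Qfam :: "(point set \<Rightarrow> point \<Rightarrow> point) set" where
  "Qfam = {q. (\<forall>K\<in>\<K>. q K \<in> poly_maps (k - 1)) \<and> (\<forall>K. K \<notin> \<K> \<longrightarrow> q K = (\<lambda>x. 0))}"

text \<open>Families whose derivatives up to order \<open>r\<close> agree at the common
  vertices.\<close>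

definition Qsm :: "nat \<Rightarrow> (point set \<Rightarrow> point \<Rightarrow> point) set" where
  "Qsm r = {q \<in> Qfam. \<forall>K\<in>\<K>. \<forall>K'\<in>\<K>. \<forall>v. v \<in> K \<longrightarrow> v \<in> K' \<longrightarrow> van (Suc r) v (\<lambda>x. q K x - q K' x)}"

lemma SfamD:
  assumes "s \<in> Sfam r"
  shows "K \<in> \<K> \<Longrightarrow> s K \<in> poly_maps k" "K \<in> \<K> \<Longrightarrow> s K x \<in> sym_matrices"
    "K \<in> \<K> \<Longrightarrow> K' \<in> \<K> \<Longrightarrow> x \<in> convex hull K \<Longrightarrow> x \<in> convex hull K' \<Longrightarrow> s K x = s K' x"
    "K \<in> \<K> \<Longrightarrow> K' \<in> \<K> \<Longrightarrow> v \<in> K \<Longrightarrow> v \<in> K' \<Longrightarrow> van (Suc r) v (\<lambda>x. s K x - s K' x)"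
    "K \<notin> \<K> \<Longrightarrow> s K = (\<lambda>x. 0)" "poly_map (s K)"
proof -
  note c = assms[unfolded Sfam_def mem_Collect_eq]
  note h = c[THEN conjunct1] c[THEN conjunct2, THEN conjunct1] c[THEN conjunct2, THEN conjunct2, THEN conjunct1]
    c[THEN conjunct2, THEN conjunct2, THEN conjunct2]
  show "K \<in> \<K> \<Longrightarrow> s K \<in> poly_maps k" "K \<in> \<K> \<Longrightarrow> s K x \<in> sym_matrices"
    using h(1) by simp_all
  show "K \<in> \<K> \<Longrightarrow> K' \<in> \<K> \<Longrightarrow> x \<in> convex hull K \<Longrightarrow> x \<in> convex hull K' \<Longrightarrow> s K x = s K' x"
    using h(2)[rule_format] .
  show "K \<in> \<K> \<Longrightarrow> K' \<in> \<K> \<Longrightarrow> v \<in> K \<Longrightarrow> v \<in> K' \<Longrightarrow> van (Suc r) v (\<lambda>x. s K x - s K' x)"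
    using h(3)[rule_format] .
  show "K \<notin> \<K> \<Longrightarrow> s K = (\<lambda>x. 0)" using h(4) by simp
  show "poly_map (s K)"
  proof (cases "K \<in> \<K>")
    case True
    then show ?thesis using h(1) by (intro poly_mapI[of _ k]) simp
  next
    case False
    then show ?thesis using h(4) by simp
  qed
qed

lemma SfamI:
  assumes "\<And>K. K \<in> \<K> \<Longrightarrow> s K \<in> poly_maps k" "\<And>K x. K \<in> \<K> \<Longrightarrow> s K x \<in> sym_matrices"
    "\<And>K K' x. K \<in> \<K> \<Longrightarrow> K' \<in> \<K> \<Longrightarrow> x \<in> convex hull K \<Longrightarrow> x \<in> convex hull K' \<Longrightarrow> s K x = s K' x"
    "\<And>K K' v. K \<in> \<K> \<Longrightarrow> K' \<in> \<K> \<Longrightarrow> v \<in> K \<Longrightarrow> v \<in> K' \<Longrightarrow> van (Suc r) v (\<lambda>x. s K x - s K' x)"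
    "\<And>K. K \<notin> \<K> \<Longrightarrow> s K = (\<lambda>x. 0)"
  shows "s \<in> Sfam r"
  unfolding Sfam_def mem_Collect_eq
  by (intro conjI ballI allI impI) (rule assms; assumption)+

lemma QfamD:
  assumes "q \<in> Qfam"
  shows "K \<in> \<K> \<Longrightarrow> q K \<in> poly_maps (k - 1)" "K \<notin> \<K> \<Longrightarrow> q K = (\<lambda>x. 0)" "poly_map (q K)"
proof -
  show "K \<in> \<K> \<Longrightarrow> q K \<in> poly_maps (k - 1)" "K \<notin> \<K> \<Longrightarrow> q K = (\<lambda>x. 0)"
    using assms unfolding Qfam_def by simp_all
  then show "poly_map (q K)"
    by (cases "K \<in> \<K>") (simp_all add: poly_mapI[of _ "k - 1"])
qed

lemma subspace_Qfam: "subspace Qfam"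
  unfolding subspace_def Qfam_def zero_fun_def plus_fun_def scaleR_fun_def
  by (auto intro: poly_maps_add poly_maps_scaleR)

lemma subspace_Qsm: "subspace (Qsm r)"
proof (rule subspaceI)
  have z: "(0 :: point set \<Rightarrow> point \<Rightarrow> point) K = (\<lambda>x. 0)" for K by (simp add: zero_fun_def)
  show "0 \<in> Qsm r" using subspace_0[OF subspace_Qfam] by (simp add: Qsm_def z)
next
  fix p q assume pq: "p \<in> Qsm r" "q \<in> Qsm r"
  have "p + q \<in> Qfam" using pq subspace_add[OF subspace_Qfam] by (auto simp: Qsm_def)
  moreover have "van (Suc r) v (\<lambda>x. (p + q) K x - (p + q) K' x)" if "K \<in> \<K>" "K' \<in> \<K>" "v \<in> K" "v \<in> K'" for K K' v
  proof -
    have "van (Suc r) v (\<lambda>x. (p K x - p K' x) + (q K x - q K' x))"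
      by (rule van_add[OF poly_map_diff poly_map_diff]) (use pq that QfamD(3) in \<open>auto simp: Qsm_def\<close>)
    then show ?thesis by (simp add: algebra_simps)
  qed
  ultimately show "p + q \<in> Qsm r" unfolding Qsm_def by blast
next
  fix c q assume q: "q \<in> Qsm r"
  have "c *\<^sub>R q \<in> Qfam" using q subspace_scale[OF subspace_Qfam] by (auto simp: Qsm_def)
  moreover have "van (Suc r) v (\<lambda>x. (c *\<^sub>R q) K x - (c *\<^sub>R q) K' x)" if "K \<in> \<K>" "K' \<in> \<K>" "v \<in> K" "v \<in> K'" for K K' v
  proof -
    have "van (Suc r) v (\<lambda>x. c *\<^sub>R (q K x - q K' x))"
      by (rule van_scaleR[OF poly_map_diff]) (use q that QfamD(3) in \<open>auto simp: Qsm_def\<close>)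
    then show ?thesis by (simp add: scaleR_fun_def algebra_simps)
  qed
  ultimately show "c *\<^sub>R q \<in> Qsm r" unfolding Qsm_def by blast
qed

lemma Sfam_zero: "(\<lambda>K x. 0) \<in> Sfam r"
  by (rule SfamI) auto

lemma Sfam_add:
  assumes s: "s \<in> Sfam r" and t: "t \<in> Sfam r"
  shows "(\<lambda>K x. s K x + t K x) \<in> Sfam r"
proof (rule SfamI)
  fix K K' v assume *: "K \<in> \<K>" "K' \<in> \<K>" "v \<in> K" "v \<in> K'"
  have "van (Suc r) v (\<lambda>x. (s K x - s K' x) + (t K x - t K' x))"
    by (rule van_add[OF poly_map_diff[OF SfamD(6)[OF s] SfamD(6)[OF s]] poly_map_diff[OF SfamD(6)[OF t] SfamD(6)[OF t]]
         SfamD(4)[OF s *] SfamD(4)[OF t *]])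
  then show "van (Suc r) v (\<lambda>x. (s K x + t K x) - (s K' x + t K' x))" by (simp add: algebra_simps)
next
  fix K K' x assume *: "K \<in> \<K>" "K' \<in> \<K>" "x \<in> convex hull K" "x \<in> convex hull K'"
  show "s K x + t K x = s K' x + t K' x" using SfamD(3)[OF s *] SfamD(3)[OF t *] by simp
qed (use SfamD(1,2,5)[OF s] SfamD(1,2,5)[OF t] in \<open>auto intro!: poly_maps_add sym_add\<close>)

lemma Sfam_scaleR:
  assumes s: "s \<in> Sfam r"
  shows "(\<lambda>K x. c *\<^sub>R s K x) \<in> Sfam r"
proof (rule SfamI)
  fix K K' v assume *: "K \<in> \<K>" "K' \<in> \<K>" "v \<in> K" "v \<in> K'"
  have "van (Suc r) v (\<lambda>x. c *\<^sub>R (s K x - s K' x))"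
    by (rule van_scaleR[OF poly_map_diff[OF SfamD(6)[OF s] SfamD(6)[OF s]] SfamD(4)[OF s *]])
  then show "van (Suc r) v (\<lambda>x. c *\<^sub>R s K x - c *\<^sub>R s K' x)" by (simp add: algebra_simps)
next
  fix K K' x assume *: "K \<in> \<K>" "K' \<in> \<K>" "x \<in> convex hull K" "x \<in> convex hull K'"
  show "c *\<^sub>R s K x = c *\<^sub>R s K' x" using SfamD(3)[OF s *] by simp
qed (use SfamD(1,2,5)[OF s] in \<open>auto intro!: poly_maps_scaleR sym_scaleR\<close>)

lemma DfamI: "s \<in> Sfam r \<Longrightarrow> (\<lambda>K. pdiv (s K)) \<in> Dfam r"
  unfolding Dfam_def by (rule imageI)

lemma DfamE: "d \<in> Dfam r \<Longrightarrow> (\<And>s. s \<in> Sfam r \<Longrightarrow> d = (\<lambda>K. pdiv (s K)) \<Longrightarrow> thesis) \<Longrightarrow> thesis"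
  unfolding Dfam_def by blast

lemma subspace_Dfam: "subspace (Dfam r)"
proof (rule subspaceI)
  show "0 \<in> Dfam r" using DfamI[OF Sfam_zero[of r]] by (simp add: zero_fun_def)
next
  fix p q assume "p \<in> Dfam r" "q \<in> Dfam r"
  then obtain s t where st: "s \<in> Sfam r" "t \<in> Sfam r" "p = (\<lambda>K. pdiv (s K))" "q = (\<lambda>K. pdiv (t K))"
    by (elim DfamE)
  then show "p + q \<in> Dfam r"
    using DfamI[OF Sfam_add[OF st(1,2)]] SfamD(6)[OF st(1)] SfamD(6)[OF st(2)]
    by (simp add: pdiv_add plus_fun_def)
next
  fix c p assume "p \<in> Dfam r"
  then obtain s where s: "s \<in> Sfam r" "p = (\<lambda>K. pdiv (s K))" by (elim DfamE)
  then show "c *\<^sub>R p \<in> Dfam r"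
    using DfamI[OF Sfam_scaleR[OF s(1), of c]] SfamD(6)[OF s(1)] by (simp add: pdiv_scaleR scaleR_fun_def)
qed

lemma Sfam_antimono: "r \<le> r' \<Longrightarrow> Sfam r' \<subseteq> Sfam r"
proof
  fix s assume le: "r \<le> r'" and s: "s \<in> Sfam r'"
  show "s \<in> Sfam r"
  proof (rule SfamI)
    fix K K' v assume *: "K \<in> \<K>" "K' \<in> \<K>" "v \<in> K" "v \<in> K'"
    show "van (Suc r) v (\<lambda>x. s K x - s K' x)"
      by (rule van_mono[OF SfamD(4)[OF s *]]) (use le in simp)
  qed (rule SfamD[OF s]; assumption)+
qed

lemma Dfam_antimono: "r \<le> r' \<Longrightarrow> Dfam r' \<subseteq> Dfam r"
  unfolding Dfam_def by (rule image_mono[OF Sfam_antimono])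

lemma Dfam_Qfam: "Dfam r \<subseteq> Qfam"
proof
  fix d assume "d \<in> Dfam r"
  then obtain s where s: "s \<in> Sfam r" "d = (\<lambda>K. pdiv (s K))" by (elim DfamE)
  show "d \<in> Qfam" unfolding Qfam_def s(2) using SfamD(5)[OF s(1)] poly_maps_pdiv[OF SfamD(1)[OF s(1)]] by simp
qed

lemma Dfam_Qsm: "Dfam (Suc r) \<subseteq> Qsm r"
proof
  fix d assume d: "d \<in> Dfam (Suc r)"
  then obtain s where s: "s \<in> Sfam (Suc r)" "d = (\<lambda>K. pdiv (s K))" by (elim DfamE)
  have "van (Suc r) v (\<lambda>x. d K x - d K' x)" if "K \<in> \<K>" "K' \<in> \<K>" "v \<in> K" "v \<in> K'" for K K' v
    using van_pdiv[OF poly_map_diff SfamD(4)[OF s(1) that]] SfamD(6)[OF s(1)] s(2) by (simp add: pdiv_diff)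
  then show "d \<in> Qsm r" using d Dfam_Qfam unfolding Qsm_def by blast
qed

text \<open>A field that vanishes on all three edges may be extended by zero.\<close>

lemma Sfam_single:
  assumes K0: "K0 \<in> \<K>" and \<tau>: "\<tau> \<in> poly_maps k" "\<And>x. \<tau> x \<in> sym_matrices"
    and bd: "\<And>x c. c \<in> K0 \<Longrightarrow> bary K0 c x = 0 \<Longrightarrow> \<tau> x = 0" and van: "\<And>v. v \<in> K0 \<Longrightarrow> van (Suc r) v \<tau>"
  shows "single K0 \<tau> \<in> Sfam r"
proof (rule SfamI)
  have z: "\<tau> x = 0" if h: "K \<in> \<K>" "x \<in> convex hull K0" "x \<in> convex hull K" "K \<noteq> K0" for x K
  proof -
    obtain c where "c \<in> K0" "c \<notin> K" using tri_subset_eq[OF tris[OF K0] tris[OF h(1)]] h(4) by blast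
    then show ?thesis using bary_zero_outside[OF K0 h(1-3)] bd by blast
  qed
  fix K K' x assume "K \<in> \<K>" "K' \<in> \<K>" "x \<in> convex hull K" "x \<in> convex hull K'"
  then show "single K0 \<tau> K x = single K0 \<tau> K' x" using z by (auto simp: single_def)
next
  fix K K' v assume *: "K \<in> \<K>" "K' \<in> \<K>" "v \<in> K" "v \<in> K'"
  have "poly_map \<tau>" by (rule poly_mapI[OF \<tau>(1)])
  moreover have "van (Suc r) v (\<lambda>x. - \<tau> x)" if "v \<in> K0" by (rule van_uminus[OF poly_mapI[OF \<tau>(1)] van[OF that]])
  ultimately show "van (Suc r) v (\<lambda>x. single K0 \<tau> K x - single K0 \<tau> K' x)"
    using van[of v] * by (auto simp: single_def)
qed (use \<tau> K0 in \<open>auto simp: single_def\<close>)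

subsection \<open>Every triangle can be emptied\<close>

text \<open>An element can be emptied if every right-hand side supported on it with vanishing
  first-order jets at the vertices is the divergence of a stress on the whole mesh.\<close>

definition good :: "point set \<Rightarrow> bool" where
  "good K \<longleftrightarrow> (\<forall>q\<in>poly_maps (k - 1). (\<forall>v\<in>K. van 2 v q) \<longrightarrow> single K q \<in> Dfam 2)"

text \<open>Lift \<open>q\<close> on \<open>K\<close> with a stress that vanishes on the two
  edges other than the one from \<open>v\<close> to \<open>a\<close>. The trace on that edge
  extends, written in the barycentric coordinates of \<open>v\<close> and \<open>a\<close>, to
  every element that contains the edge and by zero to all others. The correction to the
  divergence lives on the neighbour across the edge, which can be emptied by assumption; on a
  boundary edge there is no correction.\<close>

lemma good_from_neighbour:
  assumes K: "K \<in> \<K>" "v \<in> K" "a \<in> K" "v \<noteq> a"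
    and nb: "\<And>L. L \<in> \<K> \<Longrightarrow> L \<noteq> K \<Longrightarrow> v \<in> L \<Longrightarrow> a \<in> L \<Longrightarrow> good L"
  shows "good K"
  unfolding good_def
proof (intro ballI impI)
  fix q :: "point \<Rightarrow> point" assume q: "q \<in> poly_maps (k - 1)" "\<forall>v\<in>K. van 2 v q"
  have tK: "tri K" using tris K by blast
  obtain b where b: "K = {v, a, b}" "cr (a - v) (b - v) \<noteq> 0" "b \<noteq> v" "b \<noteq> a"
    using tri_at2[OF tK K(2,3)] K(4) by metis
  have b': "K = {b, v, a}" "cr (v - b) (a - b) \<noteq> 0" using b by (auto simp: cr_def algebra_simps)
  obtain \<sigma> where \<sigma>: "\<sigma> \<in> poly_maps k" "\<forall>x. \<sigma> x \<in> sym_matrices" "pdiv \<sigma> = q" "\<forall>v\<in>K. van 3 v \<sigma>"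
      "\<forall>x. bary K v x = 0 \<or> bary K a x = 0 \<longrightarrow> \<sigma> x = 0"
    using triangle_lift[OF k7 q(1) b'] q(2) by blast
  obtain R :: "2 \<Rightarrow> 2 \<Rightarrow> real poly" where R: "\<And>i j. degree (R i j) \<le> k - 6" "\<And>i j. R i j = R j i"
    "\<And>i j t. \<sigma> (v + t *\<^sub>R (a - v)) $ i $ j = t ^ 3 * (1 - t) ^ 3 * poly (R i j) t"
    using edge_trace[OF \<sigma>(1) _ bspec[OF \<sigma>(4) K(2)] bspec[OF \<sigma>(4) K(3)]] \<sigma>(2) by metis
  (* The extension of the edge trace, with 1 - t replaced by the coordinate of v; it vanishes on
     elements that do not contain both endpoints. *)
  define e where "e L x = (\<chi> i j. bary L v x ^ 3 * bary L a x ^ 3 * poly (R i j) (bary L a x))" for L x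
  have ek: "e L \<in> poly_maps k" if "L \<in> \<K>" for L
  proof (rule poly_maps_matrix)
    fix i j
    have l: "bary L c \<in> poly_maps 1" for c by (rule bary_poly[OF tris[OF that]])
    have "(\<lambda>x. bary L v x ^ 3 * bary L a x ^ 3 * poly (R i j) (bary L a x)) \<in> poly_maps (1 * 3 + 1 * 3 + (k - 6))"
      by (intro poly_maps_mult poly_maps_power l poly_maps_poly R(1))
    then show "(\<lambda>x. e L x $ i $ j) \<in> poly_maps k" using k7 by (simp add: e_def)
  qed
  have es: "e L x \<in> sym_matrices" for L x
    using R(2) by (simp add: e_def sym_matrices_def transpose_def vec_eq_iff)
  have ev: "van 3 w (e L)" if L: "L \<in> \<K>" "w \<in> L" for L w
  proof (rule van_matrix)
    fix i j
    have l: "poly_map (bary L c)" for c by (rule bary_poly_map[OF tris[OF L(1)]])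
    have pl: "poly_map (\<lambda>x. poly (R i j) (bary L a x))"
      by (rule poly_mapI[OF poly_maps_poly[OF order_refl bary_poly[OF tris[OF L(1)]]]])
    show "poly_map (\<lambda>x. e L x $ i $ j)" by (simp add: e_def) (intro poly_map_mult poly_map_power l pl)
    have v1: "van 1 w (bary L c)" if "c \<noteq> w" for c
      by (rule van_1I) (use that bary_vertex[OF tris[OF L(1)] L(2), of c] in simp)
    have "van 3 w (\<lambda>x. bary L v x ^ 3 * bary L a x ^ 3)"
    proof (cases "w = v")
      case True
      have "van (0 + 1 * 3) w (\<lambda>x. bary L v x ^ 3 * bary L a x ^ 3)"
        by (intro van_mult van_power poly_map_power l v1 van_0) (use True K(4) in simp)
      then show ?thesis by simp
    next
      case False
      have "van (1 * 3 + 0) w (\<lambda>x. bary L v x ^ 3 * bary L a x ^ 3)"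
        by (intro van_mult van_power poly_map_power l v1 van_0) (use False in simp)
      then show ?thesis by simp
    qed
    then have "van (3 + 0) w (\<lambda>x. bary L v x ^ 3 * bary L a x ^ 3 * poly (R i j) (bary L a x))"
      by (intro van_mult poly_map_mult poly_map_power l pl van_0)
    then show "van 3 w (\<lambda>x. e L x $ i $ j)" by (simp add: e_def)
  qed
  (* On K the lift, elsewhere the extension of its trace. *)
  define s where "s L = (if L = K then \<sigma> else if L \<in> \<K> then e L else (\<lambda>x. 0))" for L
  have agree: "\<sigma> x = e L x" if L: "L \<in> \<K>" "L \<noteq> K" and x: "x \<in> convex hull K" "x \<in> convex hull L" for L x
  proof -
    obtain c where c: "c \<in> K" "c \<notin> L" using tri_subset_eq[of K L] tris L K by blast
    have c0: "bary K c x = 0" by (rule bary_zero_outside[OF K(1) L(1) x c(2)])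
    have bb: "bary L d x = bary K d x" for d by (rule bary_agree[OF L(1) K(1) x(2,1)])
    consider "c = v" | "c = a" | "c = b" using c(1) b(1) by blast
    then show ?thesis
    proof cases
      case 1
      have "bary K v x = 0" using c0 unfolding 1 .
      then show ?thesis using \<sigma>(5)[rule_format, of x] by (simp add: e_def vec_eq_iff bb)
    next
      case 2
      have "bary K a x = 0" using c0 unfolding 2 .
      then show ?thesis using \<sigma>(5)[rule_format, of x] by (simp add: e_def vec_eq_iff bb)
    next
      case 3
      define t where "t = bary K a x"
      have sm: "bary K v x + t = 1" "bary K v x *\<^sub>R v + t *\<^sub>R a = x"
        using bary_sum[OF tK, of x] c0 3 unfolding sum_tri[OF b'] t_def by auto
      then have bv: "bary K v x = 1 - t" by simp
      then have "x = (1 - t) *\<^sub>R v + t *\<^sub>R a" using sm(2) by simp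
      then have "x = v + t *\<^sub>R (a - v)" by (simp add: algebra_simps)
      then have "\<sigma> x $ i $ j = t ^ 3 * (1 - t) ^ 3 * poly (R i j) t" for i j
        by (simp only: R(3))
      then show ?thesis by (simp add: e_def vec_eq_iff bb t_def[symmetric] bv mult_ac)
    qed
  qed
  have "s \<in> Sfam 2"
  proof (rule SfamI)
    show "s L \<in> poly_maps k" "s L x \<in> sym_matrices" if "L \<in> \<K>" for L x
      using that by (simp_all add: s_def \<sigma>(1,2) ek es)
    show "s L = (\<lambda>x. 0)" if "L \<notin> \<K>" for L using that K(1) by (auto simp: s_def)
    show "s L x = s L' x" if "L \<in> \<K>" "L' \<in> \<K>" "x \<in> convex hull L" "x \<in> convex hull L'" for L L' x
    proof -
      have "e L x = e L' x" unfolding e_def using bary_agree[OF that] by simp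
      then show ?thesis
        using agree[of L x] agree[of L' x] that by (cases "L = K"; cases "L' = K") (simp_all add: s_def)
    qed
    fix L L' w assume L: "L \<in> \<K>" "L' \<in> \<K>" "w \<in> L" "w \<in> L'"
    have sv: "van 3 w (s M)" "poly_map (s M)" if "M \<in> \<K>" "w \<in> M" for M
      using that \<sigma>(4) ev[OF that] poly_mapI[OF ek[OF that(1)]] poly_mapI[OF \<sigma>(1)]
      by (cases "M = K"; simp add: s_def)+
    show "van (Suc 2) w (\<lambda>x. s L x - s L' x)"
      using van_diff[OF sv(2)[OF L(1,3)] sv(2)[OF L(2,4)] sv(1)[OF L(1,3)] sv(1)[OF L(2,4)]]
      by (simp add: numeral_3_eq_3 numeral_2_eq_2)
  qed
  then have D: "(\<lambda>L. pdiv (s L)) \<in> Dfam 2" by (rule DfamI)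
  define N where "N = {L \<in> \<K>. L \<noteq> K \<and> v \<in> L \<and> a \<in> L}"
  have finN: "finite N" unfolding N_def using fin by simp
  have "single L (pdiv (e L)) \<in> Dfam 2" if "L \<in> N" for L
  proof -
    have L: "L \<in> \<K>" "L \<noteq> K" "v \<in> L" "a \<in> L" using that by (auto simp: N_def)
    have "van (3 - 1) w (pdiv (e L))" if "w \<in> L" for w
      by (rule van_pdiv[OF poly_mapI[OF ek[OF L(1)]] ev[OF L(1) that]])
    then show ?thesis using nb[OF L] poly_maps_pdiv[OF ek[OF L(1)]] unfolding good_def by simp
  qed
  then have "(\<Sum>L\<in>N. single L (pdiv (e L))) \<in> Dfam 2" by (rule subspace_sum[OF subspace_Dfam])
  with D have "(\<lambda>L. pdiv (s L)) - (\<Sum>L\<in>N. single L (pdiv (e L))) \<in> Dfam 2" by (rule subspace_diff[OF subspace_Dfam])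
  moreover have "(\<lambda>L. pdiv (s L)) - (\<Sum>L\<in>N. single L (pdiv (e L))) = single K q"
  proof (intro ext)
    fix M x
    have "(\<Sum>L\<in>N. single L (pdiv (e L)) M x) = (\<Sum>L\<in>N. if M = L then pdiv (e M) x else 0)"
      by (rule sum.cong) (auto simp: single_def)
    also have "\<dots> = (if M \<in> N then pdiv (e M) x else 0)" using finN by simp
    finally have 1: "((\<lambda>L. pdiv (s L)) - (\<Sum>L\<in>N. single L (pdiv (e L)))) M x
        = pdiv (s M) x - (if M \<in> N then pdiv (e M) x else 0)" by (simp add: sum_fun_apply2)
    have "e M = (\<lambda>x. 0)" if "v \<notin> M \<or> a \<notin> M" using that by (auto simp: e_def vec_eq_iff fun_eq_iff)
    then have "M \<notin> N \<Longrightarrow> M \<noteq> K \<Longrightarrow> pdiv (s M) x = 0" unfolding N_def s_def by auto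
    moreover have "M \<in> N \<Longrightarrow> pdiv (s M) x = pdiv (e M) x" by (auto simp: N_def s_def)
    moreover have "K \<notin> N" by (simp add: N_def)
    moreover have "pdiv (s K) = q" by (simp add: s_def \<sigma>(3))
    ultimately show "((\<lambda>L. pdiv (s L)) - (\<Sum>L\<in>N. single L (pdiv (e L)))) M x = single K q M x"
      unfolding 1 by (auto simp: single_def)
  qed
  ultimately show "single K q \<in> Dfam 2" by simp
qed

text \<open>By \<open>good_from_neighbour\<close> the elements that cannot be emptied would form
  a nonempty set in which every edge is shared.\<close>

lemma all_good: "K \<in> \<K> \<Longrightarrow> good K"
proof (rule ccontr)
  assume "K \<in> \<K>" "\<not> good K"
  show False
  proof (rule no_closed_subcomplex)
    show "{K \<in> \<K>. \<not> good K} \<noteq> {}" using \<open>K \<in> \<K>\<close> \<open>\<not> good K\<close> by blast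
    show "\<exists>K'\<in>{K \<in> \<K>. \<not> good K}. K' \<noteq> K \<and> v \<in> K' \<and> a \<in> K'"
      if "K \<in> {K \<in> \<K>. \<not> good K}" "v \<in> K" "a \<in> K" "v \<noteq> a" for K v a
      using good_from_neighbour[of K v a] that by blast
  qed blast
qed

lemma Qfam_eq_sum_single: "q \<in> Qfam \<Longrightarrow> q = (\<Sum>K\<in>\<K>. single K (q K))"
proof (intro ext)
  fix M x assume q: "q \<in> Qfam"
  have "(\<Sum>L\<in>\<K>. single L (q L) M x) = (\<Sum>L\<in>\<K>. if M = L then q M x else 0)"
    by (rule sum.cong) (auto simp: single_def)
  also have "\<dots> = q M x" using fin QfamD(2)[OF q, of M] by auto
  finally show "q M x = (\<Sum>K\<in>\<K>. single K (q K)) M x" by (simp add: sum_fun_apply2)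
qed

lemma zero_jets_in_Dfam:
  assumes q: "q \<in> Qfam" and van: "\<And>K v. K \<in> \<K> \<Longrightarrow> v \<in> K \<Longrightarrow> van 2 v (q K)"
  shows "q \<in> Dfam 2"
proof -
  have "single K (q K) \<in> Dfam 2" if "K \<in> \<K>" for K
    using all_good[OF that] QfamD(1)[OF q that] van[OF that] unfolding good_def by blast
  then have "(\<Sum>K\<in>\<K>. single K (q K)) \<in> Dfam 2" by (rule subspace_sum[OF subspace_Dfam])
  then show ?thesis using Qfam_eq_sum_single[OF q] by simp
qed

end

subsection \<open>Prescribing smooth jets at the vertices\<close>

text \<open>The polynomial of least degree with a zero of order three at 0 and the value 1 to
  second order at 1; applied to a barycentric coordinate it is a cutoff at a vertex.\<close>

definition chi :: "real \<Rightarrow> real" where "chi l = l ^ 3 * (4 - 3 * l)"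

lemma chi_0 [simp]: "chi 0 = 0" by (simp add: chi_def)

lemma chi_minus_one: "chi l - 1 = (1 - l) ^ 2 * (- (1 + 2 * l + 3 * l ^ 2))"
  by (simp add: chi_def algebra_simps power2_eq_square power3_eq_cube)

lemma chi_poly: "l \<in> poly_maps 1 \<Longrightarrow> (\<lambda>x. chi (l x)) \<in> poly_maps 4"
proof -
  assume l: "l \<in> poly_maps 1"
  have "(\<lambda>x. l x ^ 3 * (4 - 3 * l x)) \<in> poly_maps (1 * 3 + 1)"
    by (rule poly_maps_mult[OF poly_maps_power[OF l] poly_maps_diff[OF poly_maps_const poly_maps_cmult[OF l]]])
  then show ?thesis by (simp add: chi_def)
qed

lemma van_chi:
  assumes "tri K" "v \<in> K"
  shows "van 2 v (\<lambda>x. chi (bary K v x) - 1)" "w \<in> K \<Longrightarrow> w \<noteq> v \<Longrightarrow> van 3 w (\<lambda>x. chi (bary K v x))"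
proof -
  have p: "poly_map (bary K v)" using assms by simp
  have p1: "poly_map (\<lambda>x. 1 - bary K v x)" by (rule poly_map_diff[OF poly_map_const p])
  have p2: "poly_map (\<lambda>x. - (1 + 2 * bary K v x + 3 * bary K v x ^ 2))"
    by (rule poly_map_uminus, rule poly_map_add, rule poly_map_add[OF poly_map_const poly_map_mult[OF poly_map_const p]],
        rule poly_map_mult[OF poly_map_const poly_map_power[OF p]])
  have "van 1 v (\<lambda>x. 1 - bary K v x)" by (rule van_1I) (simp add: bary_vertex assms)
  from van_mult[OF poly_map_power[OF p1] p2 van_power[OF p1 this, of 2] van_0]
  show "van 2 v (\<lambda>x. chi (bary K v x) - 1)" by (simp add: chi_minus_one)
  assume w: "w \<in> K" "w \<noteq> v"
  have "van 1 w (bary K v)" by (rule van_1I) (use w assms in \<open>simp add: bary_vertex\<close>)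
  from van_mult[OF poly_map_power[OF p] poly_map_diff[OF poly_map_const poly_map_mult[OF poly_map_const p]]
       van_power[OF p this, of 3] van_0, of 4 3]
  show "van 3 w (\<lambda>x. chi (bary K v x))" by (simp add: chi_def)
qed

text \<open>Integrate each component of the first-order Taylor polynomial of \<open>p\<close> in
  the coordinate with the same index and put the results on the diagonal.\<close>

lemma jet_potential:
  fixes p :: "point \<Rightarrow> point"
  assumes "poly_map p"
  shows "\<exists>\<tau>\<in>poly_maps 2. (\<forall>x. \<tau> x \<in> sym_matrices) \<and> \<tau> v = 0 \<and> van 2 v (\<lambda>x. p x - pdiv \<tau> x)"
proof -
  (* The first-order Taylor polynomial of component i. *)
  define t where "t i x = p v $ i + (partial_deriv 1 p v $ i * (x $ 1 - v $ 1) + partial_deriv 2 p v $ i * (x $ 2 - v $ 2))" for i :: 2 and x :: point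
  have xc: "(\<lambda>x :: point. r * (x $ j - v $ j)) \<in> poly_maps 1" for r j
    by (rule poly_maps_cmult[OF poly_maps_diff[OF poly_maps_coord[OF order_refl] poly_maps_const]])
  have tk: "t i \<in> poly_maps 1" for i
    unfolding t_def[abs_def] by (rule poly_maps_add[OF poly_maps_const poly_maps_add[OF xc xc]])
  have "\<forall>i. \<exists>P. P \<in> poly_maps (Suc 1) \<and> partial_deriv i P = t i"
    using poly_maps_antiderivative[OF tk] by blast
  from choice[OF this] obtain P where PP: "\<forall>i. P i \<in> poly_maps (Suc 1) \<and> partial_deriv i (P i) = t i" ..
  then have P: "P i \<in> poly_maps (Suc 1)" "partial_deriv i (P i) = t i" for i by simp_all
  define \<tau> :: "point \<Rightarrow> real ^ 2 ^ 2" where "\<tau> x = (\<chi> i j. if i = j then P i x - P i v else 0)" for x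
  have \<tau>k: "\<tau> \<in> poly_maps 2"
  proof (rule poly_maps_matrix)
    fix i j
    have "(\<lambda>x. P i x - P i v) \<in> poly_maps 2" using poly_maps_diff[OF P(1) poly_maps_const] by (simp add: numeral_2_eq_2)
    then show "(\<lambda>x. \<tau> x $ i $ j) \<in> poly_maps 2" by (cases "i = j") (simp_all add: \<tau>_def)
  qed
  have "(\<lambda>x. \<tau> x $ i $ j) = (if i = j then (\<lambda>x. P i x - P i v) else (\<lambda>x. 0))" for i j
    by (simp add: \<tau>_def fun_eq_iff)
  note \<tau>entry = this
  have Pt: "partial_deriv i (\<lambda>x. P i x - P i v) = t i" for i
  proof -
    have "partial_deriv i (\<lambda>x. P i x - P i v) = (\<lambda>x. partial_deriv i (P i) x - partial_deriv i (\<lambda>x. P i v) x)"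
      by (rule pd_diff[OF poly_mapI[OF P(1)] poly_map_const])
    then show ?thesis unfolding P(2) partial_deriv_const by simp
  qed
  have dv: "pdiv \<tau> x $ i = t i x" for x i
  proof -
    have "partial_deriv j (\<lambda>x. \<tau> x $ i $ j) x = (if i = j then t i x else 0)" for j
      unfolding \<tau>entry using Pt[of i] by (cases "i = j") simp_all
    then show ?thesis by (simp add: pdiv_def)
  qed
  have tp: "poly_map (t i)" for i by (rule poly_mapI[OF tk])
  have "van 2 v (\<lambda>x. p x - pdiv \<tau> x)"
  proof (rule van_vec)
    fix i
    have eq: "(\<lambda>x. (p x - pdiv \<tau> x) $ i) = (\<lambda>x. p x $ i - t i x)" by (simp add: dv)
    show pi: "poly_map (\<lambda>x. (p x - pdiv \<tau> x) $ i)"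
      unfolding eq by (rule poly_map_diff[OF poly_map_nth[OF assms] tp])
    have "partial_deriv j (t i) v = partial_deriv j p v $ i" for j
    proof -
      have "partial_deriv 1 (t i) v = partial_deriv 1 p v $ i" "partial_deriv 2 (t i) v = partial_deriv 2 p v $ i"
        unfolding t_def[abs_def]
        by (simp_all only: pd_simps poly_map_intros poly_map_coord poly_map_const partial_deriv_coord_simps partial_deriv_const)
           simp_all
      then show ?thesis using exhaust_2[of j] by auto
    qed
    then show "van 2 v (\<lambda>x. (p x - pdiv \<tau> x) $ i)"
      unfolding eq by (intro van_2I) (simp_all add: pd_diff poly_map_nth assms tp pd_nth, simp add: t_def)
  qed
  moreover have "\<tau> x \<in> sym_matrices" for x
    by (simp add: \<tau>_def sym_matrices_def transpose_def vec_eq_iff)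
  moreover have "\<tau> v = 0" by (simp add: \<tau>_def vec_eq_iff)
  ultimately show ?thesis using \<tau>k by blast
qed

context mesh
begin

text \<open>A quadratic stress, cut off at the vertex \<open>v\<close>.\<close>

definition vert :: "point \<Rightarrow> (point \<Rightarrow> real ^ 2 ^ 2) \<Rightarrow> point set \<Rightarrow> point \<Rightarrow> real ^ 2 ^ 2" where
  "vert v \<tau> K = (if K \<in> \<K> then \<lambda>x. chi (bary K v x) *\<^sub>R \<tau> x else (\<lambda>x. 0))"

lemma vert_jets:
  assumes \<tau>: "\<tau> \<in> poly_maps 2" "\<tau> v = 0" and K: "K \<in> \<K>" "w \<in> K"
  shows "vert v \<tau> K \<in> poly_maps k" "w \<noteq> v \<Longrightarrow> van 3 w (vert v \<tau> K)" "w = v \<Longrightarrow> van 3 w (\<lambda>x. vert v \<tau> K x - \<tau> x)"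
proof -
  have pt: "poly_map \<tau>" by (rule poly_mapI[OF \<tau>(1)])
  have pc: "(\<lambda>x. chi (bary K v x)) \<in> poly_maps 4" by (rule chi_poly[OF bary_poly[OF tris[OF K(1)]]])
  have pc1: "poly_map (\<lambda>x. chi (bary K v x) - 1)" by (rule poly_map_diff[OF poly_mapI[OF pc] poly_map_const])
  show "vert v \<tau> K \<in> poly_maps k"
    using poly_maps_mono[OF poly_maps_mult_scaleR[OF pc \<tau>(1)], of k] k7 K(1) by (simp add: vert_def)
  show "van 3 w (vert v \<tau> K)" if "w \<noteq> v"
  proof (cases "v \<in> K")
    case True
    from van_mult_scaleR[OF poly_mapI[OF pc] pt van_chi(2)[OF tris[OF K(1)] True K(2) that] van_0]
    show ?thesis using K(1) by (simp add: vert_def)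
  next
    case False
    then show ?thesis using K(1) by (simp add: vert_def)
  qed
  assume w: "w = v"
  have "van 1 v \<tau>" by (rule van_1I[of \<tau> v, OF \<tau>(2)])
  from van_mult_scaleR[OF pc1 pt van_chi(1)[OF tris[OF K(1)] K(2)[unfolded w]] this]
  show "van 3 w (\<lambda>x. vert v \<tau> K x - \<tau> x)"
    unfolding w using K(1) by (simp add: vert_def algebra_simps numeral_3_eq_3)
qed

lemma Sfam_vert:
  assumes \<tau>: "\<tau> \<in> poly_maps 2" "\<tau> v = 0" "\<And>x. \<tau> x \<in> sym_matrices"
  shows "vert v \<tau> \<in> Sfam 2"
proof (rule SfamI)
  have pt: "poly_map \<tau>" by (rule poly_mapI[OF \<tau>(1)])
  fix K assume K: "K \<in> \<K>"
  then obtain w where "w \<in> K" using tris tri_def by blast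
  show vk: "vert v \<tau> K \<in> poly_maps k" by (rule vert_jets(1)[OF \<tau>(1,2) K \<open>w \<in> K\<close>])
  show "vert v \<tau> K x \<in> sym_matrices" for x using \<tau>(3) by (simp add: vert_def sym_scaleR)
  fix K' assume K': "K' \<in> \<K>"
  show "vert v \<tau> K x = vert v \<tau> K' x" if "x \<in> convex hull K" "x \<in> convex hull K'" for x
    using bary_agree[OF K K' that] K K' by (simp add: vert_def)
  fix w assume w: "w \<in> K" "w \<in> K'"
  note p = poly_mapI[OF vert_jets(1)[OF \<tau>(1,2) K w(1)]] poly_mapI[OF vert_jets(1)[OF \<tau>(1,2) K' w(2)]]
  have "van 3 w (\<lambda>x. vert v \<tau> K x - vert v \<tau> K' x)"
  proof (cases "w = v")
    case True
    from van_diff[OF poly_map_diff[OF p(1) pt] poly_map_diff[OF p(2) pt]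
        vert_jets(3)[OF \<tau>(1,2) K w(1) True] vert_jets(3)[OF \<tau>(1,2) K' w(2) True]]
    show ?thesis by simp
  next
    case False
    show ?thesis by (rule van_diff[OF p vert_jets(2)[OF \<tau>(1,2) K w(1) False] vert_jets(2)[OF \<tau>(1,2) K' w(2) False]])
  qed
  then show "van (Suc 2) w (\<lambda>x. vert v \<tau> K x - vert v \<tau> K' x)" by (simp add: numeral_3_eq_3 numeral_2_eq_2)
qed (simp add: vert_def)

lemma pdiv_vert_jets:
  assumes \<tau>: "\<tau> \<in> poly_maps 2" "\<tau> v = 0" and K: "K \<in> \<K>" "w \<in> K"
  shows "w \<noteq> v \<Longrightarrow> van 2 w (pdiv (vert v \<tau> K))" "w = v \<Longrightarrow> van 2 w (\<lambda>x. pdiv (vert v \<tau> K) x - pdiv \<tau> x)"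
proof -
  note p = poly_mapI[OF vert_jets(1)[OF assms]] and pt = poly_mapI[OF \<tau>(1)]
  show "van 2 w (pdiv (vert v \<tau> K))" if "w \<noteq> v"
    using van_pdiv[OF p vert_jets(2)[OF assms that]] by simp
  show "van 2 w (\<lambda>x. pdiv (vert v \<tau> K) x - pdiv \<tau> x)" if "w = v"
    using van_pdiv[OF poly_map_diff[OF p pt] vert_jets(3)[OF assms that]] by (simp add: pdiv_diff[OF p pt])
qed

lemma finite_vertices: "finite (\<Union>\<K>)"
  using fin tri_finite[OF tris] by blast

text \<open>Cut off the given quadratic stresses at their vertices and add them up; since they
  vanish at the vertex to first order, the cutoff only changes third-order terms.\<close>

lemma correct_vertices:
  assumes \<tau>: "\<And>v. v \<in> \<Union>\<K> \<Longrightarrow> \<tau> v \<in> poly_maps 2" "\<And>v. v \<in> \<Union>\<K> \<Longrightarrow> \<tau> v v = 0"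
    "\<And>v x. v \<in> \<Union>\<K> \<Longrightarrow> \<tau> v x \<in> sym_matrices"
  shows "\<exists>d\<in>Dfam 2. \<forall>K\<in>\<K>. \<forall>v\<in>K. van 2 v (\<lambda>x. d K x - pdiv (\<tau> v) x)"
proof -
  define d where "d = (\<Sum>v\<in>\<Union>\<K>. (\<lambda>K. pdiv (vert v (\<tau> v) K)))"
  have "d \<in> Dfam 2" unfolding d_def
    by (rule subspace_sum[OF subspace_Dfam], rule DfamI, rule Sfam_vert) (simp_all only: \<tau>)
  moreover have "van 2 v (\<lambda>x. d K x - pdiv (\<tau> v) x)" if K: "K \<in> \<K>" "v \<in> K" for K v
  proof -
    have v: "v \<in> \<Union>\<K>" using K by blast
    have pv: "poly_map (pdiv (vert w (\<tau> w) K))" if "w \<in> \<Union>\<K>" for w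
      by (rule poly_map_pdiv[OF poly_mapI[OF vert_jets(1)[OF \<tau>(1)[OF that] \<tau>(2)[OF that] K]]])
    have "van 2 v (\<lambda>x. (\<Sum>w\<in>\<Union>\<K> - {v}. pdiv (vert w (\<tau> w) K) x))"
    proof (rule van_sum)
      fix w assume w: "w \<in> \<Union>\<K> - {v}"
      then have w': "w \<in> \<Union>\<K>" by blast
      show "poly_map (pdiv (vert w (\<tau> w) K))" by (rule pv[OF w'])
      show "van 2 v (pdiv (vert w (\<tau> w) K))"
        by (rule pdiv_vert_jets(1)[OF \<tau>(1)[OF w'] \<tau>(2)[OF w'] K]) (use w in blast)
    qed
    note vs = this
    have ps: "poly_map (\<lambda>x. \<Sum>w\<in>\<Union>\<K> - {v}. pdiv (vert w (\<tau> w) K) x)"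
      by (rule poly_map_sum, rule pv) blast
    have pd: "poly_map (\<lambda>x. pdiv (vert v (\<tau> v) K) x - pdiv (\<tau> v) x)"
      by (rule poly_map_diff[OF pv[OF v] poly_map_pdiv[OF poly_mapI[OF \<tau>(1)[OF v]]]])
    have "van 2 v (\<lambda>x. (\<Sum>w\<in>\<Union>\<K> - {v}. pdiv (vert w (\<tau> w) K) x) + (pdiv (vert v (\<tau> v) K) x - pdiv (\<tau> v) x))"
      by (rule van_add[OF ps pd vs pdiv_vert_jets(2)[OF \<tau>(1)[OF v] \<tau>(2)[OF v] K refl]])
    moreover have "d K x = (\<Sum>w\<in>\<Union>\<K> - {v}. pdiv (vert w (\<tau> w) K) x) + pdiv (vert v (\<tau> v) K) x" for x
      unfolding d_def sum_fun_apply2 by (subst sum.remove[OF finite_vertices v]) (rule add.commute)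
    ultimately show ?thesis by (simp only: add_diff_eq)
  qed
  ultimately show ?thesis by blast
qed

text \<open>At each vertex the first-order jet is common to all elements, so it is the
  divergence of a single quadratic stress. After subtracting these the first-order jets are zero
  and \<open>zero_jets_in_Dfam\<close> applies.\<close>

lemma Qsm1_subset: "Qsm 1 \<subseteq> Dfam 2"
proof
  fix q assume "q \<in> Qsm 1"
  then have q: "q \<in> Qfam" and j: "\<And>K K' v. K \<in> \<K> \<Longrightarrow> K' \<in> \<K> \<Longrightarrow> v \<in> K \<Longrightarrow> v \<in> K' \<Longrightarrow> van 2 v (\<lambda>x. q K x - q K' x)"
    unfolding Qsm_def by (simp_all add: numeral_2_eq_2)
  have "\<exists>\<tau>. \<tau> \<in> poly_maps 2 \<and> (\<forall>x. \<tau> x \<in> sym_matrices) \<and> \<tau> v = 0 \<and>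
      (\<forall>K\<in>\<K>. v \<in> K \<longrightarrow> van 2 v (\<lambda>x. q K x - pdiv \<tau> x))" if v: "v \<in> \<Union>\<K>" for v
  proof -
    obtain K0 where K0: "K0 \<in> \<K>" "v \<in> K0" using v by blast
    obtain \<tau> where \<tau>: "\<tau> \<in> poly_maps 2" "\<forall>x. \<tau> x \<in> sym_matrices" "\<tau> v = 0" "van 2 v (\<lambda>x. q K0 x - pdiv \<tau> x)"
      using jet_potential[OF QfamD(3)[OF q]] by blast
    note p = poly_map_pdiv[OF poly_mapI[OF \<tau>(1)]]
    have "van 2 v (\<lambda>x. q K x - pdiv \<tau> x)" if K: "K \<in> \<K>" "v \<in> K" for K
      using van_add[OF poly_map_diff[OF QfamD(3)[OF q] QfamD(3)[OF q]] poly_map_diff[OF QfamD(3)[OF q] p]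
          j[OF K(1) K0(1) K(2) K0(2)] \<tau>(4)] by simp
    then show ?thesis using \<tau> by blast
  qed
  then have "\<forall>v\<in>\<Union>\<K>. \<exists>\<tau>. \<tau> \<in> poly_maps 2 \<and> (\<forall>x. \<tau> x \<in> sym_matrices) \<and> \<tau> v = 0 \<and>
      (\<forall>K\<in>\<K>. v \<in> K \<longrightarrow> van 2 v (\<lambda>x. q K x - pdiv \<tau> x))" by (rule ballI)
  from bchoice[OF this] obtain \<tau> where T: "\<forall>v\<in>\<Union>\<K>. \<tau> v \<in> poly_maps 2 \<and> (\<forall>x. \<tau> v x \<in> sym_matrices) \<and> \<tau> v v = 0 \<and>
      (\<forall>K\<in>\<K>. v \<in> K \<longrightarrow> van 2 v (\<lambda>x. q K x - pdiv (\<tau> v) x))" ..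
  have \<tau>: "\<tau> v \<in> poly_maps 2" "\<tau> v x \<in> sym_matrices" "\<tau> v v = 0"
     "K \<in> \<K> \<Longrightarrow> v \<in> K \<Longrightarrow> van 2 v (\<lambda>x. q K x - pdiv (\<tau> v) x)" if "v \<in> \<Union>\<K>" for v x K
    using bspec[OF T that] by simp_all
  have "\<exists>d\<in>Dfam 2. \<forall>K\<in>\<K>. \<forall>v\<in>K. van 2 v (\<lambda>x. d K x - pdiv (\<tau> v) x)"
    by (rule correct_vertices) (simp_all only: \<tau>(1-3))
  then obtain d where d: "d \<in> Dfam 2" and dv: "\<forall>K\<in>\<K>. \<forall>v\<in>K. van 2 v (\<lambda>x. d K x - pdiv (\<tau> v) x)" ..
  have dQ: "d \<in> Qfam" using d Dfam_Qfam by (rule subsetD[rotated])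
  have "van 2 v ((q - d) K)" if K: "K \<in> \<K>" "v \<in> K" for K v
  proof -
    have v: "v \<in> \<Union>\<K>" using K by blast
    note p = poly_map_pdiv[OF poly_mapI[OF \<tau>(1)[OF v]]]
    from van_diff[OF poly_map_diff[OF QfamD(3)[OF q] p] poly_map_diff[OF QfamD(3)[OF dQ] p] \<tau>(4)[OF v K] dv[rule_format, OF K]]
    show ?thesis by (simp add: fun_diff_def)
  qed
  then have "q - d \<in> Dfam 2" by (rule zero_jets_in_Dfam[OF subspace_diff[OF subspace_Qfam q dQ]])
  then have "q - d + d \<in> Dfam 2" using d by (rule subspace_add[OF subspace_Dfam])
  then show "q \<in> Dfam 2" by simp
qed

lemma Dfam2_eq: "Dfam 2 = Qsm 1"
  using Qsm1_subset Dfam_Qsm[of 1] by (simp add: numeral_2_eq_2 subset_antisym)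

end

section \<open>Weights on the star of a vertex\<close>

text \<open>Rotation by a right angle; gradients of barycentric coordinates are rotated edge
  vectors, up to a factor.\<close>

definition rot :: "point \<Rightarrow> point" where "rot y = pt (y $ 2) (- y $ 1)"

lemma inner_rot: "rot y \<bullet> h = cr h y"
  by (simp add: rot_def inner_point cr_def algebra_simps)

lemma rot_linear: "rot (x + y) = rot x + rot y" "rot (r *\<^sub>R x) = r *\<^sub>R rot x" "rot (- x) = - rot x" "rot (x - y) = rot x - rot y"
  by (rule point_eqI; simp add: rot_def)+

lemma cr_linear:
  "cr (x + y) z = cr x z + cr y z" "cr z (x + y) = cr z x + cr z y"
  "cr (r *\<^sub>R x) z = r * cr x z" "cr z (r *\<^sub>R x) = r * cr z x" "cr (- x) z = - cr x z" "cr z (- x) = - cr z x"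
  "cr (x - y) z = cr x z - cr y z" "cr z (x - y) = cr z x - cr z y"
  by (simp_all add: cr_def algebra_simps)

lemma cr_self [simp]: "cr x x = 0" "cr 0 x = 0" "cr x 0 = 0"
  by (simp_all add: cr_def)

lemma cr_swap: "cr x y = - cr y x"
  by (simp add: cr_def)

lemma cr_parallel:
  assumes "cr d e = 0" "d \<noteq> 0"
  shows "e = ((e \<bullet> d) / (d \<bullet> d)) *\<^sub>R d"
proof -
  have n: "d \<bullet> d \<noteq> 0" using assms(2) by simp
  have z: "d $ 1 * e $ 2 = d $ 2 * e $ 1" using assms(1) by (simp add: cr_def)
  have "(d \<bullet> d) * e $ 1 = (e \<bullet> d) * d $ 1" "(d \<bullet> d) * e $ 2 = (e \<bullet> d) * d $ 2"
    using z by (simp_all add: inner_point algebra_simps)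
  then show ?thesis using n by (intro point_eqI) (simp_all add: field_simps)
qed

lemma cr_trans:
  assumes "cr x y = 0" "cr y z = 0" "y \<noteq> 0" shows "cr x z = 0"
proof -
  define s t where "s = (x \<bullet> y) / (y \<bullet> y)" and "t = (z \<bullet> y) / (y \<bullet> y)"
  have "x = s *\<^sub>R y" "z = t *\<^sub>R y"
    using cr_parallel[of y x] cr_parallel[of y z] assms cr_swap[of x y] by (simp_all add: s_def t_def)
  then show ?thesis by (simp add: cr_linear)
qed

lemma gr_rot:
  assumes "K = {v, a, b}" "cr (a - v) (b - v) \<noteq> 0"
  shows "gr K a = (1 / cr (a - v) (b - v)) *\<^sub>R rot (b - v)" "gr K b = (- 1 / cr (a - v) (b - v)) *\<^sub>R rot (a - v)"
proof -
  have K2: "K = {a, b, v}" "cr (b - a) (v - a) \<noteq> 0" and K3: "K = {b, v, a}" "cr (v - b) (a - b) \<noteq> 0"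
    using assms by (auto simp: cr_def algebra_simps)
  have D: "cr (b - a) (v - a) = cr (a - v) (b - v)" "cr (v - b) (a - b) = cr (a - v) (b - v)"
    by (auto simp: cr_def algebra_simps)
  show "gr K a = (1 / cr (a - v) (b - v)) *\<^sub>R rot (b - v)"
    by (rule point_eqI) (simp_all add: gr_nth[OF K2] D rot_def)
  show "gr K b = (- 1 / cr (a - v) (b - v)) *\<^sub>R rot (a - v)"
    by (rule point_eqI) (simp_all add: gr_nth[OF K3] D rot_def diff_divide_distrib)
qed

lemma inner_eqI: "(\<And>h. x \<bullet> h = y \<bullet> h) \<Longrightarrow> x = (y :: point)"
  by (rule vector_eq_rdot[THEN iffD1], rule allI)

lemma dual_expansion:
  assumes "K = {v, a, b}" "cr (a - v) (b - v) \<noteq> 0"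
  shows "w = (w \<bullet> (a - v)) *\<^sub>R gr K a + (w \<bullet> (b - v)) *\<^sub>R gr K b"
proof -
  let ?w = "(w \<bullet> (a - v)) *\<^sub>R gr K a + (w \<bullet> (b - v)) *\<^sub>R gr K b"
  have "w \<bullet> h = ?w \<bullet> h" for h
  proof -
    have "w \<bullet> h = w \<bullet> ((gr K a \<bullet> h) *\<^sub>R (a - v) + (gr K b \<bullet> h) *\<^sub>R (b - v))"
      using edge_expansion[OF assms, of h] by simp
    then show ?thesis by (simp add: inner_add_left inner_add_right mult.commute)
  qed
  then show ?thesis by (rule inner_eqI)
qed

lemma gr_dual:
  assumes "K = {v, a, b}" "cr (a - v) (b - v) \<noteq> 0"
  shows "gr K a \<bullet> (a - v) = 1" "gr K a \<bullet> (b - v) = 0" "gr K b \<bullet> (a - v) = 0" "gr K b \<bullet> (b - v) = 1"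
  unfolding gr_rot[OF assms] using assms(2) cr_swap[of "b - v" "a - v"]
  by (simp_all add: inner_rot)

lemma outer_vec: "outer x *v g = (g \<bullet> x) *\<^sub>R x"
  by (rule point_eqI) (simp_all add: matrix_vector_mult_def outer_def inner_point UNIV_2 algebra_simps)

lemma sym_inner: "A \<in> sym_matrices \<Longrightarrow> x \<bullet> (A *v y) = y \<bullet> (A *v x)"
proof -
  assume "A \<in> sym_matrices"
  then have "transpose A $ 2 $ 1 = A $ 2 $ 1" by (simp add: sym_matrices_def)
  then have "A $ 1 $ 2 = A $ 2 $ 1" by (simp add: transpose_def)
  then show ?thesis by (simp add: inner_point matrix_vector_mult_def UNIV_2 algebra_simps)
qed

text \<open>A product of two linear forms is zero only if a factor is.\<close>

lemma product_of_forms_zero: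
  assumes "\<And>x. (w \<bullet> x) * (g \<bullet> x) = 0" "(g :: point) \<noteq> 0" shows "w = 0"
proof (rule ccontr)
  assume "w \<noteq> 0"
  have wg: "w \<bullet> g = 0" using assms(1)[of g] assms(2) by simp
  have "(w \<bullet> w) * (g \<bullet> g) = 0"
    using assms(1)[of "w + g"] wg by (simp add: inner_add_right inner_commute)
  then show False using \<open>w \<noteq> 0\<close> assms(2) by simp
qed

lemma prod_link:
  assumes "K = {v, a, b}" "cr (a - v) (b - v) \<noteq> 0"
  shows "K - {v} = {a, b}" "(\<Prod>c\<in>K - {v}. f c) = f a * f b" "(\<Sum>c\<in>K - {v}. g c) = g a + g b"
proof -
  have d: "v \<noteq> a" "a \<noteq> b" "v \<noteq> b" using cr_distinct[OF assms(2)] by auto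
  then show *: "K - {v} = {a, b}" using assms(1) by auto
  show "(\<Prod>c\<in>K - {v}. f c) = f a * f b" "(\<Sum>c\<in>K - {v}. g c) = g a + g b"
    unfolding * using d by auto
qed

context mesh
begin

definition star :: "point \<Rightarrow> point set set" where "star v = {K \<in> \<K>. v \<in> K}"

definition neighbours :: "point \<Rightarrow> point set" where "neighbours v = {a. a \<noteq> v \<and> (\<exists>K\<in>star v. a \<in> K)}"

definition interior_vertex :: "point \<Rightarrow> bool" where "interior_vertex v \<longleftrightarrow> v \<in> interior (\<Union>K\<in>\<K>. convex hull K)"

text \<open>The condition on weights \<open>w\<close> under which the combination of the values
  \<open>w K \<bullet> q K v\<close> is zero for all divergences \<open>q\<close> of continuous
  stresses. By \<open>pdiv_edges\<close> the divergence at \<open>v\<close> only involves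
  tangential derivatives, and the derivative along the edge to \<open>a\<close> is an arbitrary
  symmetric matrix \<open>A\<close> common to all elements at that edge.\<close>

definition Ann :: "point \<Rightarrow> (point set \<Rightarrow> point) \<Rightarrow> bool" where
  "Ann v w \<longleftrightarrow> (\<forall>a. a \<noteq> v \<longrightarrow> (\<forall>A\<in>sym_matrices. (\<Sum>K\<in>{K\<in>star v. a \<in> K}. w K \<bullet> (A *v gr K a)) = 0))"

text \<open>The corresponding condition on weights for slopes of the divergence along the edges
  at \<open>v\<close>. The first part kills the mixed second derivative \<open>M\<close> inside
  an element, the second part kills the second tangential derivative \<open>A\<close>, which is
  common to the elements at the edge.\<close>

definition Ann2 :: "point \<Rightarrow> (point set \<Rightarrow> point \<Rightarrow> point) \<Rightarrow> bool" where
  "Ann2 v u \<longleftrightarrow>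
     (\<forall>K\<in>star v. \<forall>a b. K = {v, a, b} \<longrightarrow> (\<forall>M\<in>sym_matrices. u K a \<bullet> (M *v gr K b) + u K b \<bullet> (M *v gr K a) = 0)) \<and>
     (\<forall>a. a \<noteq> v \<longrightarrow> (\<forall>A\<in>sym_matrices. (\<Sum>K\<in>{K\<in>star v. a \<in> K}. u K a \<bullet> (A *v gr K a)) = 0))"

lemma star_finite [simp]: "finite (star v)" "finite {K\<in>star v. P K}"
  using fin by (auto simp: star_def)

lemma starD: "K \<in> star v \<Longrightarrow> K \<in> \<K>" "K \<in> star v \<Longrightarrow> v \<in> K" "K \<in> star v \<Longrightarrow> tri K"
  using tris by (auto simp: star_def)

lemma star_tri:
  assumes "K \<in> star v" obtains a b where "K = {v, a, b}" "cr (a - v) (b - v) \<noteq> 0"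
  using tri_at[OF starD(3)[OF assms] starD(2)[OF assms]] .

lemma star_tri2:
  assumes "K \<in> star v" "a \<in> K" "a \<noteq> v" obtains b where "K = {v, a, b}" "cr (a - v) (b - v) \<noteq> 0"
  using tri_at2[OF starD(3)[OF assms(1)] starD(2)[OF assms(1)] assms(2,3)] by metis

lemma edge_star_cases:
  assumes "K \<in> star v" "a \<in> K" "a \<noteq> v"
  obtains (one) "{L\<in>star v. a \<in> L} = {K}"
  | (two) K' where "K' \<in> star v" "a \<in> K'" "K' \<noteq> K" "{L\<in>star v. a \<in> L} = {K, K'}"
proof (cases "\<exists>K'\<in>star v. a \<in> K' \<and> K' \<noteq> K")
  case True
  then obtain K' where K': "K' \<in> star v" "a \<in> K'" "K' \<noteq> K" by blast
  have "L = K'" if L: "L \<in> star v" "a \<in> L" "L \<noteq> K" for L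
    using at_most_two[of K L K' v a] starD[OF L(1)] starD[OF K'(1)] starD[OF assms(1)] assms(2,3) L K' by metis
  then have "{L\<in>star v. a \<in> L} = {K, K'}" using K' assms(1,2) by blast
  then show thesis using two K' by blast
next
  case False
  then have "{L\<in>star v. a \<in> L} = {K}" using assms(1,2) by blast
  then show thesis by (rule one)
qed

text \<open>Near an interior vertex the edge to \<open>a\<close> runs in the interior of the
  domain, so there is an element on either side.\<close>

lemma interior_edge_two:
  assumes "interior_vertex v" "K \<in> star v" "a \<in> K" "a \<noteq> v"
  shows "\<exists>K'\<in>star v. a \<in> K' \<and> K' \<noteq> K"
proof -
  have tK: "tri K" "K \<in> \<K>" "v \<in> K" using starD[OF assms(2)] by auto
  let ?U = "interior (\<Union>K\<in>\<K>. convex hull K) \<inter> {x. 0 < bary K v x}"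
  have "open ?U" by (intro open_Int open_interior open_bary_pos tK)
  moreover have "v \<in> ?U" using assms(1) tK by (simp add: interior_vertex_def bary_vertex)
  ultimately obtain t where t: "0 < t" "v + t *\<^sub>R (a - v) \<in> ?U" using open_move by blast
  let ?x = "v + t *\<^sub>R (a - v)"
  obtain b where K: "K = {v, a, b}" "cr (a - v) (b - v) \<noteq> 0" using star_tri2[OF assms(2-4)] .
  have db: "b \<noteq> v" "a \<noteq> b" using cr_distinct[OF K(2)] by auto
  have ba: "bary K a ?x = t" "bary K b ?x = 0"
    using db assms(4) by (simp_all add: bary_affine[OF tK(1)] gr_dual[OF K] bary_vertex[OF tK(1,3)])
  have z: "bary K c ?x = 0" if "c \<in> K" "c \<noteq> v" "c \<noteq> a" for c
    using that ba K(1) by auto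
  have "?x \<in> convex hull K"
    unfolding hull_iff3[OF tK(1) K(1)] using t ba by auto
  then have "\<exists>K'\<in>\<K>. K' \<noteq> K \<and> v \<in> K' \<and> a \<in> K'"
    using t ba by (intro neighbour_exists[OF tK(2,3) assms(3) assms(4)[symmetric] _ _ _ z]) auto
  then show ?thesis by (auto simp: star_def)
qed

lemma star_connected':
  assumes "\<S> \<subseteq> star v" "\<S> \<noteq> {}" "\<And>K a. K \<in> \<S> \<Longrightarrow> a \<in> K \<Longrightarrow> a \<noteq> v \<Longrightarrow> \<exists>K'\<in>\<S>. K' \<noteq> K \<and> a \<in> K'"
  shows "interior_vertex v" "\<S> = star v"
proof -
  have "v \<in> interior (\<Union>K\<in>\<S>. convex hull K)"
    by (rule star_connected(1)) (use assms in \<open>auto simp: star_def\<close>)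
  moreover have "(\<Union>K\<in>\<S>. convex hull K) \<subseteq> (\<Union>K\<in>\<K>. convex hull K)" using assms(1) by (auto simp: star_def)
  ultimately show "interior_vertex v" unfolding interior_vertex_def using interior_mono by blast
  show "\<S> = star v"
    unfolding star_def by (rule star_connected(2)) (use assms in \<open>auto simp: star_def\<close>)
qed

text \<open>The elements with the property form a set in which every edge at \<open>v\<close> is
  shared, which is the whole star by \<open>star_connected\<close>.\<close>

lemma star_spread:
  assumes "interior_vertex v" "K0 \<in> star v" "P K0" "K \<in> star v"
    and step: "\<And>K K' a. K \<in> star v \<Longrightarrow> K' \<in> star v \<Longrightarrow> K \<noteq> K' \<Longrightarrow> a \<in> K \<Longrightarrow> a \<in> K' \<Longrightarrow> a \<noteq> v \<Longrightarrow> P K \<Longrightarrow> P K'"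
  shows "P K"
proof -
  have "{K \<in> star v. P K} = star v"
  proof (rule star_connected'(2))
    show "{K \<in> star v. P K} \<noteq> {}" using assms(2,3) by blast
    fix K a assume K: "K \<in> {K \<in> star v. P K}" "a \<in> K" "a \<noteq> v"
    then obtain K' where "K' \<in> star v" "a \<in> K'" "K' \<noteq> K" using interior_edge_two[OF assms(1), of K a] by blast
    then show "\<exists>K'\<in>{K \<in> star v. P K}. K' \<noteq> K \<and> a \<in> K'" using step[of K K' a] K by blast
  qed blast
  then show ?thesis using assms(4) by blast
qed

lemma opposite_sides:
  assumes "K \<in> star v" "K' \<in> star v" "K \<noteq> K'" and K: "K = {v, a, b}" "cr (a - v) (b - v) \<noteq> 0"
    and K': "K' = {v, a, b'}" "cr (a - v) (b' - v) \<noteq> 0"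
  obtains \<kappa> where "0 < \<kappa>" "gr K b = - \<kappa> *\<^sub>R gr K' b'" "cr (a - v) (b' - v) * cr (a - v) (b - v) < 0"
proof -
  obtain \<kappa> where \<kappa>: "0 < \<kappa>" "\<forall>x. bary K b x = - \<kappa> * bary K' b' x"
    using edge_sides[OF starD(1)[OF assms(1)] starD(1)[OF assms(2)] assms(3) K K'] by blast
  have "gr K b \<bullet> h = (- \<kappa> *\<^sub>R gr K' b') \<bullet> h" for h
  proof -
    have "gr K b \<bullet> h = bary K b (0 + h) - bary K b 0" unfolding bary_affine[OF starD(3)[OF assms(1)]] by simp
    also have "\<dots> = - \<kappa> * (bary K' b' (0 + h) - bary K' b' 0)" using \<kappa>(2) by (simp add: algebra_simps)
    also have "\<dots> = (- \<kappa> *\<^sub>R gr K' b') \<bullet> h" unfolding bary_affine[OF starD(3)[OF assms(2)]] by simp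
    finally show ?thesis .
  qed
  then have g: "gr K b = - \<kappa> *\<^sub>R gr K' b'" by (rule inner_eqI)
  have "gr K b \<bullet> (b' - v) = - \<kappa>" unfolding g using gr_dual(4)[OF K'] by simp
  moreover have "gr K b \<bullet> (b' - v) = cr (a - v) (b' - v) / cr (a - v) (b - v)"
    unfolding gr_rot(2)[OF K] using cr_swap[of "b' - v" "a - v"] by (simp add: inner_rot)
  ultimately have "cr (a - v) (b' - v) / cr (a - v) (b - v) < 0" using \<kappa>(1) by simp
  then have "cr (a - v) (b' - v) * cr (a - v) (b - v) < 0" by (simp add: divide_less_0_iff mult_less_0_iff)
  then show thesis using that \<kappa>(1) g by blast
qed

subsection \<open>Weights against values\<close>

lemma Ann_edge:
  assumes "Ann v w" "K \<in> star v" "K' \<in> star v" "K \<noteq> K'" "a \<in> K" "a \<in> K'" "a \<noteq> v" "A \<in> sym_matrices"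
  shows "w K \<bullet> (A *v gr K a) + w K' \<bullet> (A *v gr K' a) = 0"
proof -
  have eq: "{L\<in>star v. a \<in> L} = {K, K'}"
    by (rule edge_star_cases[OF assms(2,5,7)]) (use assms in blast)+
  have "(\<Sum>K\<in>{K\<in>star v. a \<in> K}. w K \<bullet> (A *v gr K a)) = 0"
    using assms(1,7,8) unfolding Ann_def by blast
  then show ?thesis unfolding eq using assms(4) by simp
qed

lemma gr_nonzero: "K \<in> star v \<Longrightarrow> a \<in> K \<Longrightarrow> a \<noteq> v \<Longrightarrow> gr K a \<noteq> 0"
  using star_tri2[of K v a] gr_dual(1)[of K v a] by (metis inner_zero_left zero_neq_one)

text \<open>Test with the matrices \<open>x x^T\<close>: they turn the condition into the
  vanishing of a product of two linear forms.\<close>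

lemma sym_test_zero:
  assumes "\<And>A. A \<in> sym_matrices \<Longrightarrow> w \<bullet> (A *v g) = 0" "g \<noteq> 0" shows "w = 0"
proof (rule product_of_forms_zero[OF _ assms(2)])
  fix x
  show "(w \<bullet> x) * (g \<bullet> x) = 0" using assms(1)[OF outer_sym[of x]] by (simp add: outer_vec mult.commute)
qed

text \<open>Across an edge a weight is zero if the neighbouring one is, and at a boundary edge
  it is zero anyway. So the elements with nonzero weight form a set in which every edge at
  \<open>v\<close> is shared: it is empty or the whole star of an interior vertex.\<close>

lemma Ann_zero:
  assumes "Ann v w" and "\<not> interior_vertex v \<or> (\<exists>K\<in>star v. w K = 0)" and "K \<in> star v"
  shows "w K = 0"
proof (rule ccontr)
  assume nz: "w K \<noteq> 0"
  have st: "\<exists>K'\<in>{K\<in>star v. w K \<noteq> 0}. K' \<noteq> K \<and> a \<in> K'" if K: "K \<in> {K\<in>star v. w K \<noteq> 0}" "a \<in> K" "a \<noteq> v" for K a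
  proof -
    have K1: "K \<in> star v" "w K \<noteq> 0" using K(1) by auto
    show ?thesis
    proof (rule edge_star_cases[OF K1(1) K(2,3)])
      assume one: "{L\<in>star v. a \<in> L} = {K}"
      have "w K \<bullet> (A *v gr K a) = 0" if "A \<in> sym_matrices" for A
      proof -
        have "(\<Sum>K\<in>{K\<in>star v. a \<in> K}. w K \<bullet> (A *v gr K a)) = 0"
          using assms(1) K(3) that unfolding Ann_def by blast
        then show ?thesis unfolding one by simp
      qed
      then have "w K = 0" using gr_nonzero[OF K1(1) K(2,3)] by (rule sym_test_zero)
      then show ?thesis using K1 by simp
    next
      fix K' assume K': "K' \<in> star v" "a \<in> K'" "K' \<noteq> K"
      have "w K' \<noteq> 0"
      proof
        assume "w K' = 0"
        then have "w K \<bullet> (A *v gr K a) = 0" if "A \<in> sym_matrices" for A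
          using Ann_edge[OF assms(1) K1(1) K'(1) K'(3)[symmetric] K(2) K'(2) K(3) that] by simp
        then have "w K = 0" using gr_nonzero[OF K1(1) K(2,3)] by (rule sym_test_zero)
        then show False using K1 by simp
      qed
      then show ?thesis using K' by blast
    qed
  qed
  have "{K\<in>star v. w K \<noteq> 0} \<subseteq> star v" "{K\<in>star v. w K \<noteq> 0} \<noteq> {}" using assms(3) nz by blast+
  note s = star_connected'[OF this st]
  show False using s assms(2) by blast
qed

text \<open>Testing with \<open>x x^T\<close> shows that the cubic forms \<open>(w K \<bullet>
  x) * (\<Prod>e. gr K e \<bullet> x)\<close> of two neighbouring elements are proportional,
  because their gradients normal to the common edge are. For \<open>x\<close> along an edge the
  form of an adjacent element vanishes, hence so do all of them.\<close>

lemma Ann_cubic: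
  assumes w: "Ann v w" and i: "interior_vertex v" and c: "c \<in> neighbours v" and K: "K \<in> star v"
  shows "(w K \<bullet> (c - v)) * (\<Prod>e\<in>K - {v}. gr K e \<bullet> (c - v)) = 0"
proof -
  obtain K0 where K0: "K0 \<in> star v" "c \<in> K0" "c \<noteq> v" using c by (auto simp: neighbours_def)
  obtain b where b: "K0 = {v, c, b}" "cr (c - v) (b - v) \<noteq> 0" using star_tri2[OF K0] .
  let ?P = "\<lambda>K. (w K \<bullet> (c - v)) * (\<Prod>e\<in>K - {v}. gr K e \<bullet> (c - v)) = 0"
  have P0: "?P K0" unfolding prod_link(2)[OF b] using gr_dual(3)[OF b] by simp
  show ?thesis
  proof (rule star_spread[OF i K0(1), of ?P, OF P0 K])
    fix K K' a assume *: "K \<in> star v" "K' \<in> star v" "K \<noteq> K'" "a \<in> K" "a \<in> K'" "a \<noteq> v" and P: "?P K"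
    obtain b where b: "K = {v, a, b}" "cr (a - v) (b - v) \<noteq> 0" using star_tri2[OF *(1,4,6)] .
    obtain b' where b': "K' = {v, a, b'}" "cr (a - v) (b' - v) \<noteq> 0" using star_tri2[OF *(2,5,6)] .
    obtain \<kappa> where \<kappa>: "0 < \<kappa>" "gr K b = - \<kappa> *\<^sub>R gr K' b'" using opposite_sides[OF *(1-3) b b'] .
    have "w K \<bullet> (outer (c - v) *v gr K a) + w K' \<bullet> (outer (c - v) *v gr K' a) = 0"
      by (rule Ann_edge[OF w * outer_sym])
    then have "(w K' \<bullet> (c - v)) * (gr K' a \<bullet> (c - v)) = - ((w K \<bullet> (c - v)) * (gr K a \<bullet> (c - v)))"
      by (simp add: outer_vec algebra_simps)
    then show "?P K'"
      using P \<kappa> unfolding prod_link(2)[OF b] prod_link(2)[OF b'] by auto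
  qed
qed

lemma Ann_combine:
  assumes "Ann v w" "Ann v w'" shows "Ann v (\<lambda>K. w K - t *\<^sub>R w' K)"
  unfolding Ann_def
proof (intro allI impI ballI)
  fix a A assume a: "a \<noteq> v" and A: "A \<in> sym_matrices"
  have "(\<Sum>K\<in>{K\<in>star v. a \<in> K}. (w K - t *\<^sub>R w' K) \<bullet> (A *v gr K a))
    = (\<Sum>K\<in>{K\<in>star v. a \<in> K}. w K \<bullet> (A *v gr K a)) - t * (\<Sum>K\<in>{K\<in>star v. a \<in> K}. w' K \<bullet> (A *v gr K a))"
    by (simp add: inner_diff_left sum_subtractf sum_distrib_left)
  then show "(\<Sum>K\<in>{K\<in>star v. a \<in> K}. (w K - t *\<^sub>R w' K) \<bullet> (A *v gr K a)) = 0"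
    using assms a A unfolding Ann_def by simp
qed

end

text \<open>The direction \<open>e\<close> is parallel to \<open>d1\<close>, \<open>d2\<close>
  or \<open>d1 + d2\<close>. Any three pairwise distinct lines through the origin have direction
  vectors of this form.\<close>

definition on_three_lines :: "point \<Rightarrow> point \<Rightarrow> point \<Rightarrow> bool" where
  "on_three_lines d1 d2 e \<longleftrightarrow> cr d1 e = 0 \<or> cr d2 e = 0 \<or> cr (d1 + d2) e = 0"

text \<open>Among \<open>d1\<close>, \<open>d2\<close> and \<open>- (d1 + d2)\<close> the vector
  on the line of \<open>e\<close>. The three vectors add up to zero, so each is minus the sum of
  the two others.\<close>

definition frame_dir :: "point \<Rightarrow> point \<Rightarrow> point \<Rightarrow> point" where
  "frame_dir d1 d2 e = (if cr d1 e = 0 then d1 else if cr d2 e = 0 then d2 else - (d1 + d2))"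

text \<open>The coefficient of \<open>e\<close> with respect to \<open>frame_dir\<close>, by
  orthogonal projection.\<close>

definition frame_coeff :: "point \<Rightarrow> point \<Rightarrow> point \<Rightarrow> real" where
  "frame_coeff d1 d2 e = (e \<bullet> frame_dir d1 d2 e) / (frame_dir d1 d2 e \<bullet> frame_dir d1 d2 e)"

text \<open>The value weights at a vertex with edges on three lines. In an element between two
  of the lines the weight is orthogonal to the third one; its sign changes with the orientation
  of the edges along the frame.\<close>

definition frame_weight :: "point \<Rightarrow> point \<Rightarrow> point \<Rightarrow> point set \<Rightarrow> point" where
  "frame_weight d1 d2 v K = sgn (\<Prod>c\<in>K - {v}. frame_coeff d1 d2 (c - v)) *\<^sub>R rot (- (\<Sum>c\<in>K - {v}. frame_dir d1 d2 (c - v)))"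

text \<open>The slope weights at a vertex with edges on two lines: multiples of the gradients
  whose sign alternates from sector to sector and between the two lines.\<close>

definition cross_weight :: "point \<Rightarrow> point \<Rightarrow> point \<Rightarrow> point set \<Rightarrow> point \<Rightarrow> point" where
  "cross_weight d1 d2 v K a = (sgn (\<Prod>c\<in>K - {v}. frame_coeff d1 d2 (c - v)) * (if cr d1 (a - v) = 0 then 1 else - 1)) *\<^sub>R gr K a"

lemma frame_dir_frame_coeff:
  assumes "cr d1 d2 \<noteq> 0" "on_three_lines d1 d2 e"
  shows "e = frame_coeff d1 d2 e *\<^sub>R frame_dir d1 d2 e"
  unfolding frame_coeff_def
proof (rule cr_parallel)
  show "cr (frame_dir d1 d2 e) e = 0" using assms(2) by (auto simp: frame_dir_def on_three_lines_def cr_linear)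
  have "- (d1 + d2) \<noteq> 0"
  proof
    assume "- (d1 + d2) = 0"
    then have "d2 = - d1" by (simp add: add_eq_0_iff)
    then show False using assms(1) by (simp add: cr_linear)
  qed
  then show "frame_dir d1 d2 e \<noteq> 0" using assms(1) unfolding frame_dir_def by (auto simp del: neg_equal_0_iff_equal)
qed

text \<open>The three vectors of a frame add up to zero, and \<open>y\<close> and
  \<open>z\<close> are not on the line of \<open>x\<close>.\<close>

lemma third_of_three:
  assumes "x \<in> {d1, d2, - (d1 + d2)}" "y \<in> {d1, d2, - (d1 + d2)}" "z \<in> {d1, d2, - (d1 + d2)}"
    and "cr x y \<noteq> 0" "cr x z \<noteq> 0"
  shows "z = y \<or> z = - (x + y)"
proof -
  have ne: "x \<noteq> y" "x \<noteq> z" using assms(4,5) by auto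
  have "- (d1 + - (d1 + d2)) = d2" "- (d2 + - (d1 + d2)) = d1" "- (- (d1 + d2) + d1) = d2" "- (- (d1 + d2) + d2) = d1" "- (d2 + d1) = - (d1 + d2)"
    by (simp_all add: algebra_simps)
  then show ?thesis using assms(1-3) ne unfolding insert_iff empty_iff by metis
qed

lemma frame_dir_third:
  assumes "cr (frame_dir d1 d2 x) (frame_dir d1 d2 y) \<noteq> 0" "cr (frame_dir d1 d2 x) (frame_dir d1 d2 z) \<noteq> 0"
  shows "frame_dir d1 d2 z = frame_dir d1 d2 y \<or> frame_dir d1 d2 z = - (frame_dir d1 d2 x + frame_dir d1 d2 y)"
proof -
  have m: "frame_dir d1 d2 t \<in> {d1, d2, - (d1 + d2)}" for t by (simp add: frame_dir_def)
  show ?thesis by (rule third_of_three[OF m m m assms])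
qed

lemma rot_nonzero: "x \<noteq> 0 \<Longrightarrow> rot x \<noteq> 0"
  by (auto simp: rot_def vec_eq_iff forall_2)

lemma cr_rot: "cr (rot x) (rot y) = cr x y"
  by (simp add: cr_def rot_def)

lemma perp_two:
  assumes "w \<bullet> x = 0" "w \<bullet> y = 0" "cr x y \<noteq> 0" shows "w = 0"
proof -
  have "cr x y * w $ 1 = (w \<bullet> x) * y $ 2 - (w \<bullet> y) * x $ 2" "cr x y * w $ 2 = (w \<bullet> y) * x $ 1 - (w \<bullet> x) * y $ 1"
    by (simp_all add: cr_def inner_point algebra_simps)
  then show ?thesis using assms by (intro point_eqI) simp_all
qed

lemma perp_parallel:
  assumes "w \<bullet> c = 0" "y \<bullet> c = 0" "c \<noteq> (0 :: point)" "y \<noteq> 0" shows "\<exists>t. w = t *\<^sub>R y"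
proof -
  have "cr y w * c $ 1 = (y \<bullet> c) * w $ 2 - (w \<bullet> c) * y $ 2" "cr y w * c $ 2 = (w \<bullet> c) * y $ 1 - (y \<bullet> c) * w $ 1"
    by (simp_all add: cr_def inner_point algebra_simps)
  then have "cr y w * c $ 1 = 0" "cr y w * c $ 2 = 0" using assms by simp_all
  then have "cr y w = 0" using assms(3) by (auto simp: vec_eq_iff forall_2)
  then show ?thesis using cr_parallel[OF _ assms(4)] by blast
qed

lemma cr_basis:
  assumes "cr x y \<noteq> 0" shows "w = (cr w y / cr x y) *\<^sub>R x + (cr x w / cr x y) *\<^sub>R y"
proof -
  have "cr x y * w $ 1 = cr w y * x $ 1 + cr x w * y $ 1" "cr x y * w $ 2 = cr w y * x $ 2 + cr x w * y $ 2"
    by (simp_all add: cr_def algebra_simps)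
  then show ?thesis using assms by (intro point_eqI) (simp_all add: field_simps)
qed

context mesh
begin

text \<open>All edges at \<open>v\<close> lie on three lines, one of which may be free of
  edges.\<close>

definition frame3 :: "point \<Rightarrow> point \<Rightarrow> point \<Rightarrow> bool" where
  "frame3 v d1 d2 \<longleftrightarrow> cr d1 d2 \<noteq> 0 \<and> (\<forall>a\<in>neighbours v. on_three_lines d1 d2 (a - v))"

text \<open>All edges at \<open>v\<close> lie on two lines.\<close>

definition frame2 :: "point \<Rightarrow> point \<Rightarrow> point \<Rightarrow> bool" where
  "frame2 v d1 d2 \<longleftrightarrow> cr d1 d2 \<noteq> 0 \<and> (\<forall>a\<in>neighbours v. cr d1 (a - v) = 0 \<or> cr d2 (a - v) = 0)"

definition typeI :: "point \<Rightarrow> bool" where "typeI v \<longleftrightarrow> interior_vertex v \<and> (\<exists>d1 d2. frame2 v d1 d2)"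

definition typeII :: "point \<Rightarrow> bool" where
  "typeII v \<longleftrightarrow> interior_vertex v \<and> \<not> (\<exists>d1 d2. frame2 v d1 d2) \<and> (\<exists>d1 d2. frame3 v d1 d2)"

lemma nbsI: "K \<in> star v \<Longrightarrow> a \<in> K \<Longrightarrow> a \<noteq> v \<Longrightarrow> a \<in> neighbours v"
  unfolding neighbours_def by blast

text \<open>Two lines extend to three in two ways, by the direction \<open>d1 + d2\<close> or by
  \<open>d1 - d2\<close>. This gives two independent value weights at a vertex with edges on two
  lines.\<close>

lemma frame2_frame3: "frame2 v d1 d2 \<Longrightarrow> frame3 v d1 d2" "frame2 v d1 d2 \<Longrightarrow> frame3 v d1 (- d2)"
  "frame2 v d1 d2 \<Longrightarrow> frame2 v d1 (- d2)"
  unfolding frame2_def frame3_def on_three_lines_def by (auto simp: cr_linear)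

lemma frame_dirs:
  assumes "frame3 v d1 d2" "K \<in> star v" and K: "K = {v, a, b}" "cr (a - v) (b - v) \<noteq> 0"
  shows "a - v = frame_coeff d1 d2 (a - v) *\<^sub>R frame_dir d1 d2 (a - v)" "b - v = frame_coeff d1 d2 (b - v) *\<^sub>R frame_dir d1 d2 (b - v)"
    "frame_coeff d1 d2 (a - v) \<noteq> 0" "frame_coeff d1 d2 (b - v) \<noteq> 0" "cr (frame_dir d1 d2 (a - v)) (frame_dir d1 d2 (b - v)) \<noteq> 0"
    "cr (a - v) (b - v) = frame_coeff d1 d2 (a - v) * frame_coeff d1 d2 (b - v) * cr (frame_dir d1 d2 (a - v)) (frame_dir d1 d2 (b - v))"
proof -
  have d: "v \<noteq> a" "a \<noteq> b" "v \<noteq> b" using cr_distinct[OF K(2)] by auto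
  have "a \<in> neighbours v" "b \<in> neighbours v" using nbsI[OF assms(2), of a] nbsI[OF assms(2), of b] K(1) d by auto
  then have o: "on_three_lines d1 d2 (a - v)" "on_three_lines d1 d2 (b - v)" and c: "cr d1 d2 \<noteq> 0" using assms(1) unfolding frame3_def by auto
  show 1: "a - v = frame_coeff d1 d2 (a - v) *\<^sub>R frame_dir d1 d2 (a - v)" by (rule frame_dir_frame_coeff[OF c o(1)])
  show 2: "b - v = frame_coeff d1 d2 (b - v) *\<^sub>R frame_dir d1 d2 (b - v)" by (rule frame_dir_frame_coeff[OF c o(2)])
  show e: "cr (a - v) (b - v) = frame_coeff d1 d2 (a - v) * frame_coeff d1 d2 (b - v) * cr (frame_dir d1 d2 (a - v)) (frame_dir d1 d2 (b - v))"
    using arg_cong2[OF 1 2, of cr] by (simp add: cr_linear)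
  show "frame_coeff d1 d2 (a - v) \<noteq> 0" "frame_coeff d1 d2 (b - v) \<noteq> 0" "cr (frame_dir d1 d2 (a - v)) (frame_dir d1 d2 (b - v)) \<noteq> 0"
    using K(2) unfolding e by auto
qed

lemma frame_gr:
  assumes "frame3 v d1 d2" "K \<in> star v" and K: "K = {v, a, b}" "cr (a - v) (b - v) \<noteq> 0"
  shows "gr K a = (1 / (frame_coeff d1 d2 (a - v) * cr (frame_dir d1 d2 (a - v)) (frame_dir d1 d2 (b - v)))) *\<^sub>R rot (frame_dir d1 d2 (b - v))"
proof -
  note f = frame_dirs[OF assms]
  have "rot (b - v) = frame_coeff d1 d2 (b - v) *\<^sub>R rot (frame_dir d1 d2 (b - v))"
    using arg_cong[OF f(2), of rot] by (simp add: rot_linear)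
  then show ?thesis unfolding gr_rot(1)[OF K] f(6) using f(3-5) by simp
qed

lemma frame_weight_eq:
  assumes "K = {v, a, b}" "cr (a - v) (b - v) \<noteq> 0"
  shows "frame_weight d1 d2 v K = sgn (frame_coeff d1 d2 (a - v) * frame_coeff d1 d2 (b - v)) *\<^sub>R rot (- (frame_dir d1 d2 (a - v) + frame_dir d1 d2 (b - v)))"
  unfolding frame_weight_def prod_link(2,3)[OF assms] ..

lemma frame_weight_nonzero:
  assumes "frame3 v d1 d2" "K \<in> star v" shows "frame_weight d1 d2 v K \<noteq> 0"
proof -
  obtain a b where K: "K = {v, a, b}" "cr (a - v) (b - v) \<noteq> 0" using star_tri[OF assms(2)] .
  note f = frame_dirs[OF assms K]
  have "- (frame_dir d1 d2 (a - v) + frame_dir d1 d2 (b - v)) \<noteq> 0"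
  proof
    assume "- (frame_dir d1 d2 (a - v) + frame_dir d1 d2 (b - v)) = 0"
    then have "frame_dir d1 d2 (b - v) = - frame_dir d1 d2 (a - v)" by (simp add: add_eq_0_iff)
    then show False using f(5) by (simp add: cr_linear)
  qed
  from rot_nonzero[OF this] show ?thesis
    unfolding frame_weight_eq[OF K] using f(3,4) by (simp add: sgn_zero_iff)
qed

lemma neg_of_mult: "(p :: real) * s < 0 \<Longrightarrow> 0 < s \<Longrightarrow> p < 0"
  and pos_of_mult: "(p :: real) * s > 0 \<Longrightarrow> 0 < s \<Longrightarrow> p > 0"
  by (simp_all add: mult_less_0_iff zero_less_mult_iff)

lemma matvec_uminus: "(A :: real ^ 2 ^ 2) *v (- x) = - (A *v x)"
  using matrix_vector_mult_scaleR[of A "-1" x] by simp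

lemma sgn_facts: "(x :: real) * y < 0 \<Longrightarrow> sgn (z * y) = - sgn (z * x)" "(x :: real) * y > 0 \<Longrightarrow> sgn (z * y) = sgn (z * x)"
  by (auto simp: sgn_mult zero_less_mult_iff mult_less_0_iff)

text \<open>Two elements at a common edge lie on different sides of it. So their other edges are
  opposite on one line, or they lie on the two other lines of the frame with coefficients of the
  same sign.\<close>

lemma frame_opposite:
  assumes f: "frame3 v d1 d2" and K: "K \<in> star v" "K' \<in> star v" "K \<noteq> K'"
    and k: "K = {v, a, b}" "cr (a - v) (b - v) \<noteq> 0" and k': "K' = {v, a, b'}" "cr (a - v) (b' - v) \<noteq> 0"
  shows "(frame_dir d1 d2 (b' - v) = frame_dir d1 d2 (b - v) \<and> frame_coeff d1 d2 (b - v) * frame_coeff d1 d2 (b' - v) < 0) \<or>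
     (frame_dir d1 d2 (b' - v) = - (frame_dir d1 d2 (a - v) + frame_dir d1 d2 (b - v)) \<and> frame_coeff d1 d2 (b - v) * frame_coeff d1 d2 (b' - v) > 0)"
proof -
  note F = frame_dirs[OF f K(1) k] and F' = frame_dirs[OF f K(2) k']
  let ?e = "frame_dir d1 d2 (a - v)" and ?f = "frame_dir d1 d2 (b - v)" and ?f' = "frame_dir d1 d2 (b' - v)"
  let ?\<alpha> = "frame_coeff d1 d2 (a - v)" and ?\<beta> = "frame_coeff d1 d2 (b - v)" and ?\<beta>' = "frame_coeff d1 d2 (b' - v)"
  obtain \<kappa> where "cr (a - v) (b' - v) * cr (a - v) (b - v) < 0" using opposite_sides[OF K k k'] .
  moreover have "cr (a - v) (b' - v) * cr (a - v) (b - v) = ((?\<beta> * ?\<beta>') * (cr ?e ?f * cr ?e ?f')) * (?\<alpha> * ?\<alpha>)"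
    unfolding F(6) F'(6) by (simp only: mult_ac)
  ultimately have "((?\<beta> * ?\<beta>') * (cr ?e ?f * cr ?e ?f')) * (?\<alpha> * ?\<alpha>) < 0" by (simp only:)
  moreover have "0 < ?\<alpha> * ?\<alpha>" using F(3) by (auto simp: zero_less_mult_iff linorder_neq_iff)
  ultimately have neg: "(?\<beta> * ?\<beta>') * (cr ?e ?f * cr ?e ?f') < 0" by (rule neg_of_mult)
  have sq: "0 < cr ?e ?f * cr ?e ?f" using F(5) by (auto simp: zero_less_mult_iff linorder_neq_iff)
  have "?f' = ?f \<or> ?f' = - (?e + ?f)" by (rule frame_dir_third[OF F(5) F'(5)])
  then show ?thesis
  proof
    assume e: "?f' = ?f"
    have "?\<beta> * ?\<beta>' < 0" by (rule neg_of_mult[OF neg[unfolded e] sq])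
    then show ?thesis using e by blast
  next
    assume e: "?f' = - (?e + ?f)"
    then have "cr ?e ?f' = - cr ?e ?f" by (simp add: cr_linear)
    then have "(?\<beta> * ?\<beta>') * (cr ?e ?f * cr ?e ?f) > 0" using neg by simp
    then have "?\<beta> * ?\<beta>' > 0" by (rule pos_of_mult[OF _ sq])
    then show ?thesis using e by blast
  qed
qed

text \<open>By \<open>frame_opposite\<close> there are two cases at an edge. If the other edges
  are opposite, gradient and weight agree up to the sign of the weight. Otherwise weight and
  gradient exchange their roles up to a sign, and the sum cancels because \<open>A\<close> is
  symmetric.\<close>

lemma Ann_frame_weight:
  assumes i: "interior_vertex v" and f: "frame3 v d1 d2" shows "Ann v (frame_weight d1 d2 v)"
  unfolding Ann_def
proof (intro allI impI ballI)
  fix a A assume a: "a \<noteq> v" and A: "A \<in> sym_matrices"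
  show "(\<Sum>K\<in>{K\<in>star v. a \<in> K}. frame_weight d1 d2 v K \<bullet> (A *v gr K a)) = 0"
  proof (cases "\<exists>K\<in>star v. a \<in> K")
    case False
    then have "{K\<in>star v. a \<in> K} = {}" by blast
    then show ?thesis by (simp only: sum.empty)
  next
    case True
    then obtain K where K: "K \<in> star v" "a \<in> K" by blast
    obtain K' where K': "K' \<in> star v" "a \<in> K'" "K' \<noteq> K" using interior_edge_two[OF i K a] by blast
    have eq: "{L\<in>star v. a \<in> L} = {K, K'}"
      by (rule edge_star_cases[OF K a]) (use K' in blast)+
    obtain b where k: "K = {v, a, b}" "cr (a - v) (b - v) \<noteq> 0" using star_tri2[OF K a] .
    obtain b' where k': "K' = {v, a, b'}" "cr (a - v) (b' - v) \<noteq> 0" using star_tri2[OF K'(1,2) a] .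
    define e e' \<alpha> where "e = frame_dir d1 d2 (a - v)" and "e' = frame_dir d1 d2 (b - v)" and "\<alpha> = frame_coeff d1 d2 (a - v)"
    define s where "s = sgn (frame_coeff d1 d2 (a - v) * frame_coeff d1 d2 (b - v))"
    have w: "frame_weight d1 d2 v K = s *\<^sub>R rot (- (e + e'))" unfolding frame_weight_eq[OF k] s_def e_def e'_def ..
    have g: "gr K a = (1 / (\<alpha> * cr e e')) *\<^sub>R rot e'"
      unfolding frame_gr[OF f K(1) k] e_def e'_def \<alpha>_def ..
    have "frame_weight d1 d2 v K \<bullet> (A *v gr K a) + frame_weight d1 d2 v K' \<bullet> (A *v gr K' a) = 0"
      using frame_opposite[OF f K(1) K'(1) K'(3)[symmetric] k k']
    proof
      assume h: "frame_dir d1 d2 (b' - v) = frame_dir d1 d2 (b - v) \<and> frame_coeff d1 d2 (b - v) * frame_coeff d1 d2 (b' - v) < 0"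
      have w': "frame_weight d1 d2 v K' = - s *\<^sub>R rot (- (e + e'))"
        unfolding frame_weight_eq[OF k'] s_def e_def e'_def conjunct1[OF h] sgn_facts(1)[OF conjunct2[OF h]] ..
      have g': "gr K' a = (1 / (\<alpha> * cr e e')) *\<^sub>R rot e'"
        unfolding frame_gr[OF f K'(1) k'] e_def e'_def \<alpha>_def conjunct1[OF h] ..
      show ?thesis unfolding w w' g g' by simp
    next
      assume h: "frame_dir d1 d2 (b' - v) = - (frame_dir d1 d2 (a - v) + frame_dir d1 d2 (b - v)) \<and> frame_coeff d1 d2 (b - v) * frame_coeff d1 d2 (b' - v) > 0"
      have d: "frame_dir d1 d2 (b' - v) = - (e + e')" using h by (simp add: e_def e'_def)
      have w': "frame_weight d1 d2 v K' = s *\<^sub>R rot e'"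
        unfolding frame_weight_eq[OF k'] d sgn_facts(2)[OF conjunct2[OF h]] s_def[symmetric] e_def[symmetric] by simp
      have "cr e (- (e + e')) = - cr e e'" by (simp add: cr_linear)
      then have g': "gr K' a = - (1 / (\<alpha> * cr e e')) *\<^sub>R rot (- (e + e'))"
        unfolding frame_gr[OF f K'(1) k'] d e_def[symmetric] \<alpha>_def[symmetric] by simp
      have "rot e' \<bullet> (A *v rot (- (e + e'))) = rot (- (e + e')) \<bullet> (A *v rot e')" by (rule sym_inner[OF A])
      then show ?thesis unfolding w w' g g' by (simp add: matrix_vector_mult_scaleR matvec_uminus)
    qed
    then show ?thesis unfolding eq using K'(3) by simp
  qed
qed

text \<open>In \<open>Ann_cubic\<close> both gradients are nonzero on a direction off the two
  lines of \<open>K\<close>, so the weight is orthogonal to it.\<close>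

lemma third_line:
  assumes w: "Ann v w" and i: "interior_vertex v" and c: "c \<in> neighbours v" and K: "K \<in> star v"
    and k: "K = {v, a, b}" "cr (a - v) (b - v) \<noteq> 0" and n: "cr (a - v) (c - v) \<noteq> 0" "cr (b - v) (c - v) \<noteq> 0"
  shows "w K \<bullet> (c - v) = 0"
proof -
  have "gr K a \<bullet> (c - v) \<noteq> 0" "gr K b \<bullet> (c - v) \<noteq> 0"
    unfolding gr_rot[OF k] using n k(2) cr_swap[of "c - v"] by (simp_all add: inner_rot)
  then show ?thesis using Ann_cubic[OF w i c K] unfolding prod_link(2)[OF k] by simp
qed

lemma off_lines:
  assumes "\<not> frame2 v (a - v) (b - v)" "cr (a - v) (b - v) \<noteq> 0"
  obtains c where "c \<in> neighbours v" "cr (a - v) (c - v) \<noteq> 0" "cr (b - v) (c - v) \<noteq> 0"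
  using assms unfolding frame2_def by blast

text \<open>At a boundary vertex this is \<open>Ann_zero\<close>. Otherwise, with at least four
  lines, there are two more beside the two lines of \<open>K\<close>; the weight is orthogonal
  to both.\<close>

lemma Ann_regular:
  assumes w: "Ann v w" and n: "\<not> typeI v" "\<not> typeII v" and K: "K \<in> star v"
  shows "w K = 0"
proof (cases "interior_vertex v")
  case False
  then show ?thesis using Ann_zero[OF w _ K] by blast
next
  case True
  obtain a b where k: "K = {v, a, b}" "cr (a - v) (b - v) \<noteq> 0" using star_tri[OF K] .
  have nf: "\<not> frame2 v x y" "\<not> frame3 v x y" for x y using n True unfolding typeI_def typeII_def by blast+
  obtain c where c: "c \<in> neighbours v" "cr (a - v) (c - v) \<noteq> 0" "cr (b - v) (c - v) \<noteq> 0"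
    using off_lines[OF nf(1) k(2)] .
  (* Scale the edge vectors of K so that their sum is c - v. Since the edges do not lie on three
     lines, there is a neighbour c' off the three lines of this frame. *)
  define p q where "p = gr K a \<bullet> (c - v)" and "q = gr K b \<bullet> (c - v)"
  have cpq: "c - v = p *\<^sub>R (a - v) + q *\<^sub>R (b - v)" unfolding p_def q_def by (rule edge_expansion[OF k])
  have pq: "p \<noteq> 0" "q \<noteq> 0"
  proof -
    show "p \<noteq> 0" using c(3) cpq by (auto simp: cr_linear)
    show "q \<noteq> 0" using c(2) cpq by (auto simp: cr_linear)
  qed
  have "cr (p *\<^sub>R (a - v)) (q *\<^sub>R (b - v)) \<noteq> 0" using pq k(2) by (simp only: cr_linear) simp
  then obtain c' where c': "c' \<in> neighbours v" "\<not> on_three_lines (p *\<^sub>R (a - v)) (q *\<^sub>R (b - v)) (c' - v)"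
    using nf(2)[of "p *\<^sub>R (a - v)" "q *\<^sub>R (b - v)"] unfolding frame3_def by blast
  have n': "cr (a - v) (c' - v) \<noteq> 0" "cr (b - v) (c' - v) \<noteq> 0" "cr (c - v) (c' - v) \<noteq> 0"
    using c'(2) unfolding on_three_lines_def cpq[symmetric] cr_linear(3) by simp_all
  have "w K = 0"
    by (rule perp_two[OF third_line[OF w True c(1) K k c(2,3)] third_line[OF w True c'(1) K k n'(1,2)] n'(3)])
  then show ?thesis .
qed

text \<open>The weight of one element is orthogonal to the third line, so it is a multiple of
  the \<open>frame_weight\<close>. The difference vanishes on that element and by
  \<open>Ann_zero\<close> on the whole star.\<close>

lemma Ann_typeII:
  assumes w: "Ann v w" and t: "typeII v" and f: "frame3 v d1 d2"
  shows "\<exists>t. \<forall>K\<in>star v. w K = t *\<^sub>R frame_weight d1 d2 v K"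
proof (cases "star v = {}")
  case False
  then obtain K where K: "K \<in> star v" by blast
  have i: "interior_vertex v" and nf: "\<not> frame2 v x y" for x y using t unfolding typeII_def by blast+
  obtain a b where k: "K = {v, a, b}" "cr (a - v) (b - v) \<noteq> 0" using star_tri[OF K] .
  obtain c where c: "c \<in> neighbours v" "cr (a - v) (c - v) \<noteq> 0" "cr (b - v) (c - v) \<noteq> 0"
    using off_lines[OF nf k(2)] .
  have "c - v \<noteq> 0" using c(2) by auto
  from perp_parallel[OF third_line[OF w i c(1) K k c(2,3)] third_line[OF Ann_frame_weight[OF i f] i c(1) K k c(2,3)] this frame_weight_nonzero[OF f K]]
  obtain t where t: "w K = t *\<^sub>R frame_weight d1 d2 v K" ..
  have "w K - t *\<^sub>R frame_weight d1 d2 v K = 0" by (simp only: right_minus_eq) (rule t)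
  then have ex: "\<exists>K\<in>star v. w K - t *\<^sub>R frame_weight d1 d2 v K = 0" using K by (rule bexI)
  have "w L - t *\<^sub>R frame_weight d1 d2 v L = 0" if "L \<in> star v" for L
    by (rule Ann_zero[OF Ann_combine[OF w Ann_frame_weight[OF i f], of t] disjI2[OF ex] that])
  then have "\<forall>L\<in>star v. w L = t *\<^sub>R frame_weight d1 d2 v L" by (simp only: right_minus_eq) (rule ballI)
  then show ?thesis by (rule exI)
qed simp

lemma frame2_links:
  assumes "frame2 v d1 d2" "K \<in> star v"
  obtains a b where "K = {v, a, b}" "cr (a - v) (b - v) \<noteq> 0" "cr d1 (a - v) = 0" "cr d1 (b - v) \<noteq> 0" "cr d2 (b - v) = 0"
proof -
  obtain a b where K: "K = {v, a, b}" "cr (a - v) (b - v) \<noteq> 0" using star_tri[OF assms(2)] .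
  have d: "v \<noteq> a" "a \<noteq> b" "v \<noteq> b" using cr_distinct[OF K(2)] by auto
  have "a \<in> neighbours v" "b \<in> neighbours v" using nbsI[OF assms(2), of a] nbsI[OF assms(2), of b] K(1) d by auto
  then have o: "cr d1 (a - v) = 0 \<or> cr d2 (a - v) = 0" "cr d1 (b - v) = 0 \<or> cr d2 (b - v) = 0" and c: "cr d1 d2 \<noteq> 0"
    using assms(1) unfolding frame2_def by auto
  have n: "d1 \<noteq> 0" "d2 \<noteq> 0" using c by auto
  have nn: "\<not> (cr d (a - v) = 0 \<and> cr d (b - v) = 0)" if "d \<noteq> 0" for d
    using cr_trans[of "a - v" d "b - v"] that K(2) cr_swap[of d "a - v"] by auto
  have K2: "K = {v, b, a}" "cr (b - v) (a - v) \<noteq> 0" using K cr_swap[of "b - v" "a - v"] by (auto simp: insert_commute)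
  show thesis
  proof (cases "cr d1 (a - v) = 0")
    case True
    then show thesis using that[OF K] nn[OF n(1)] o by blast
  next
    case False
    then show thesis using that[OF K2] nn[OF n(2)] o by blast
  qed
qed

lemma frame_weight_pair_independent:
  assumes f: "frame2 v d1 d2" and K: "K \<in> star v"
  shows "cr (frame_weight d1 d2 v K) (frame_weight d1 (- d2) v K) \<noteq> 0"
proof -
  obtain a b where k: "K = {v, a, b}" "cr (a - v) (b - v) \<noteq> 0" "cr d1 (a - v) = 0" "cr d1 (b - v) \<noteq> 0" "cr d2 (b - v) = 0"
    using frame2_links[OF assms] .
  have d: "frame_dir d1 d2 (a - v) = d1" "frame_dir d1 d2 (b - v) = d2" "frame_dir d1 (- d2) (a - v) = d1" "frame_dir d1 (- d2) (b - v) = - d2"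
    using k by (simp_all add: frame_dir_def cr_linear)
  have c: "cr d1 d2 \<noteq> 0" using f unfolding frame2_def by blast
  note m = frame_dirs(3,4)[OF frame2_frame3(1)[OF f] K k(1,2)] frame_dirs(3,4)[OF frame2_frame3(2)[OF f] K k(1,2)]
  have "cr (rot (- (d1 + d2))) (rot (- (d1 + - d2))) \<noteq> 0" unfolding cr_rot using c cr_swap[of d2 d1] by (simp add: cr_linear)
  then show ?thesis unfolding frame_weight_eq[OF k(1,2)] d cr_linear(3,4) using m by (simp add: sgn_zero_iff)
qed

text \<open>The two frame weights form a basis of the plane on one element; subtract the right
  combination and apply \<open>Ann_zero\<close>.\<close>

lemma Ann_typeI:
  assumes w: "Ann v w" and t: "typeI v" and f: "frame2 v d1 d2"
  shows "\<exists>t1 t2. \<forall>K\<in>star v. w K = t1 *\<^sub>R frame_weight d1 d2 v K + t2 *\<^sub>R frame_weight d1 (- d2) v K"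
proof (cases "star v = {}")
  case False
  then obtain K where K: "K \<in> star v" by blast
  have i: "interior_vertex v" using t unfolding typeI_def by blast
  note a1 = Ann_frame_weight[OF i frame2_frame3(1)[OF f]] and a2 = Ann_frame_weight[OF i frame2_frame3(2)[OF f]]
  define t1 where "t1 = cr (w K) (frame_weight d1 (- d2) v K) / cr (frame_weight d1 d2 v K) (frame_weight d1 (- d2) v K)"
  define t2 where "t2 = cr (frame_weight d1 d2 v K) (w K) / cr (frame_weight d1 d2 v K) (frame_weight d1 (- d2) v K)"
  have t: "w K = t1 *\<^sub>R frame_weight d1 d2 v K + t2 *\<^sub>R frame_weight d1 (- d2) v K"
    unfolding t1_def t2_def by (rule cr_basis[OF frame_weight_pair_independent[OF f K]])
  let ?w = "\<lambda>K. w K - t1 *\<^sub>R frame_weight d1 d2 v K - t2 *\<^sub>R frame_weight d1 (- d2) v K"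
  have "?w K = 0" by (simp only: diff_diff_add right_minus_eq) (rule t)
  then have ex: "\<exists>K\<in>star v. ?w K = 0" using K by (rule bexI)
  have "?w L = 0" if "L \<in> star v" for L
    by (rule Ann_zero[OF Ann_combine[OF Ann_combine[OF w a1, of t1] a2, of t2] disjI2[OF ex] that])
  then have "\<forall>L\<in>star v. w L = t1 *\<^sub>R frame_weight d1 d2 v L + t2 *\<^sub>R frame_weight d1 (- d2) v L"
    by (simp only: diff_diff_add right_minus_eq) (rule ballI)
  then show ?thesis by (intro exI)
qed simp

subsection \<open>Weights against slopes\<close>

lemma Ann2_combine:
  assumes "Ann2 v u" "Ann2 v u'" shows "Ann2 v (\<lambda>K a. u K a - t *\<^sub>R u' K a)"
  unfolding Ann2_def
proof (intro conjI allI impI ballI)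
  fix a A assume a: "a \<noteq> v" and A: "A \<in> sym_matrices"
  have "(\<Sum>K\<in>{K\<in>star v. a \<in> K}. (u K a - t *\<^sub>R u' K a) \<bullet> (A *v gr K a))
    = (\<Sum>K\<in>{K\<in>star v. a \<in> K}. u K a \<bullet> (A *v gr K a)) - t * (\<Sum>K\<in>{K\<in>star v. a \<in> K}. u' K a \<bullet> (A *v gr K a))"
    by (simp add: inner_diff_left sum_subtractf sum_distrib_left)
  then show "(\<Sum>K\<in>{K\<in>star v. a \<in> K}. (u K a - t *\<^sub>R u' K a) \<bullet> (A *v gr K a)) = 0"
    using assms a A unfolding Ann2_def by simp
next
  fix K a b M assume K: "K \<in> star v" "K = {v, a, b}" and M: "M \<in> sym_matrices"
  have 1: "u K a \<bullet> (M *v gr K b) + u K b \<bullet> (M *v gr K a) = 0" "u' K a \<bullet> (M *v gr K b) + u' K b \<bullet> (M *v gr K a) = 0"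
    using assms(1)[unfolded Ann2_def, THEN conjunct1, rule_format, OF K M]
      assms(2)[unfolded Ann2_def, THEN conjunct1, rule_format, OF K M] .
  have "(u K a - t *\<^sub>R u' K a) \<bullet> (M *v gr K b) + (u K b - t *\<^sub>R u' K b) \<bullet> (M *v gr K a)
     = (u K a \<bullet> (M *v gr K b) + u K b \<bullet> (M *v gr K a)) - t * (u' K a \<bullet> (M *v gr K b) + u' K b \<bullet> (M *v gr K a))"
    by (simp add: inner_diff_left distrib_left)
  then show "(u K a - t *\<^sub>R u' K a) \<bullet> (M *v gr K b) + (u K b - t *\<^sub>R u' K b) \<bullet> (M *v gr K a) = 0"
    unfolding 1 by simp
qed

text \<open>The condition on mixed derivatives, tested with \<open>x x^T\<close>, is a quadratic
  form identity that determines both weights up to one common factor.\<close>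

lemma Ann2_form:
  assumes u: "Ann2 v u" and K: "K \<in> star v" and k: "K = {v, a, b}" "cr (a - v) (b - v) \<noteq> 0"
  shows "u K a = (u K a \<bullet> (a - v)) *\<^sub>R gr K a" "u K b = - (u K a \<bullet> (a - v)) *\<^sub>R gr K b"
proof -
  have q: "(u K a \<bullet> x) * (gr K b \<bullet> x) + (u K b \<bullet> x) * (gr K a \<bullet> x) = 0" for x
  proof -
    have "u K a \<bullet> (outer x *v gr K b) + u K b \<bullet> (outer x *v gr K a) = 0"
      by (rule u[unfolded Ann2_def, THEN conjunct1, rule_format, OF K k(1) outer_sym])
    then show ?thesis by (simp add: outer_vec mult.commute)
  qed
  have ab: "u K a \<bullet> (b - v) = 0" using q[of "b - v"] gr_dual[OF k] by simp
  have ba: "u K b \<bullet> (a - v) = 0" using q[of "a - v"] gr_dual[OF k] by simp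
  have "u K a \<bullet> (a - v) + u K b \<bullet> (b - v) = 0"
    using q[of "(a - v) + (b - v)"] unfolding inner_add_right gr_dual[OF k] ab ba by simp
  then have "u K b \<bullet> (b - v) = - (u K a \<bullet> (a - v))" by simp
  then show "u K a = (u K a \<bullet> (a - v)) *\<^sub>R gr K a" "u K b = - (u K a \<bullet> (a - v)) *\<^sub>R gr K b"
    using dual_expansion[OF k, of "u K a"] dual_expansion[OF k, of "u K b"] unfolding ab ba by simp_all
qed

text \<open>At the edge to \<open>a\<close> the squares of two linear forms must cancel. So
  there is a second element, and both forms have the same kernel: the other edges of the two
  elements are on one line.\<close>

lemma Ann2_neighbour:
  assumes u: "Ann2 v u" and K: "K \<in> star v" and k: "K = {v, a, b}" "cr (a - v) (b - v) \<noteq> 0" and nz: "u K a \<noteq> 0"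
  obtains K' b' where "K' \<in> star v" "K' \<noteq> K" "K' = {v, a, b'}" "cr (a - v) (b' - v) \<noteq> 0" "u K' a \<noteq> 0" "cr (b - v) (b' - v) = 0"
proof -
  have d: "v \<noteq> a" "a \<noteq> b" "v \<noteq> b" using cr_distinct[OF k(2)] by auto
  have a: "a \<in> K" "a \<noteq> v" using k(1) d by auto
  have s: "(\<Sum>K\<in>{K\<in>star v. a \<in> K}. u K a \<bullet> (A *v gr K a)) = 0" if "A \<in> sym_matrices" for A
    by (rule u[unfolded Ann2_def, THEN conjunct2, rule_format, OF a(2) that])
  note uK = Ann2_form(1)[OF u K k]
  have knz: "u K a \<bullet> (a - v) \<noteq> 0" using uK nz by auto
  have st: "u K a \<bullet> (outer x *v gr K a) = (u K a \<bullet> (a - v)) * (gr K a \<bullet> x)\<^sup>2" for x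
    by (subst uK) (simp add: outer_vec power2_eq_square)
  show thesis
  proof (rule edge_star_cases[OF K a])
    assume one: "{L\<in>star v. a \<in> L} = {K}"
    have "u K a \<bullet> (outer (a - v) *v gr K a) = 0" using s[OF outer_sym, of "a - v"] unfolding one by simp
    then have False unfolding st using knz gr_dual[OF k] by simp
    then show thesis ..
  next
    fix K' assume K': "K' \<in> star v" "a \<in> K'" "K' \<noteq> K" and two: "{L\<in>star v. a \<in> L} = {K, K'}"
    obtain b' where k': "K' = {v, a, b'}" "cr (a - v) (b' - v) \<noteq> 0" using star_tri2[OF K'(1,2) a(2)] .
    note uK' = Ann2_form(1)[OF u K'(1) k']
    have st': "u K' a \<bullet> (outer x *v gr K' a) = (u K' a \<bullet> (a - v)) * (gr K' a \<bullet> x)\<^sup>2" for x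
      by (subst uK') (simp add: outer_vec power2_eq_square)
    have e: "(u K a \<bullet> (a - v)) * (gr K a \<bullet> x)\<^sup>2 + (u K' a \<bullet> (a - v)) * (gr K' a \<bullet> x)\<^sup>2 = 0" for x
      using s[OF outer_sym, of x] unfolding two st[symmetric] st'[symmetric] using K'(3) by simp
    have k2: "u K' a \<bullet> (a - v) \<noteq> 0" using e[of "a - v"] knz unfolding gr_dual[OF k] gr_dual[OF k'] by auto
    then have n: "u K' a \<noteq> 0" by auto
    have "gr K' a \<bullet> (b - v) = 0" using e[of "b - v"] k2 unfolding gr_dual[OF k] by simp
    then have "cr (b - v) (b' - v) = 0" unfolding gr_rot[OF k'] using k'(2) by (simp add: inner_rot)
    then show thesis using that[OF K'(1,3) k' n] by blast
  qed
qed

text \<open>Nonzero slope weights spread to all elements at the vertex by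
  \<open>Ann2_neighbour\<close>. Crossing an edge keeps the pair of lines, so all edges are on
  two lines and the vertex is interior.\<close>

lemma Ann2_zero:
  assumes u: "Ann2 v u" and h: "\<not> typeI v \<or> (\<exists>K\<in>star v. \<exists>a\<in>K. a \<noteq> v \<and> u K a = 0)"
    and K: "K \<in> star v" "a \<in> K" "a \<noteq> v"
  shows "u K a = 0"
proof (rule ccontr)
  assume nz: "u K a \<noteq> 0"
  have both: "u L c \<noteq> 0" if L: "L \<in> star v" "c \<in> L" "c \<noteq> v" "e \<in> L" "e \<noteq> v" "u L e \<noteq> 0" for L c e
  proof -
    obtain f where k: "L = {v, e, f}" "cr (e - v) (f - v) \<noteq> 0" using star_tri2[OF L(1,4,5)] .
    note F = Ann2_form[OF u L(1) k]
    have "u L e \<bullet> (e - v) \<noteq> 0" using F(1) L(6) by auto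
    moreover have "gr L f \<noteq> 0" using gr_dual(4)[OF k] by auto
    ultimately have "u L f \<noteq> 0" using F(2) by simp
    then show ?thesis using L k(1) by auto
  qed
  (* Within an element one nonzero weight forces the other, so this set is closed under crossing
     any edge. *)
  let ?S = "{L \<in> star v. \<exists>c\<in>L. c \<noteq> v \<and> u L c \<noteq> 0}"
  have step: "\<exists>K'\<in>?S. K' \<noteq> L \<and> c \<in> K'" if L: "L \<in> ?S" "c \<in> L" "c \<noteq> v" for L c
  proof -
    have L1: "L \<in> star v" and "u L c \<noteq> 0" using L both by blast+
    obtain f where k: "L = {v, c, f}" "cr (c - v) (f - v) \<noteq> 0" using star_tri2[OF L1 L(2,3)] .
    obtain K' f' where "K' \<in> star v" "K' \<noteq> L" "K' = {v, c, f'}" "u K' c \<noteq> 0"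
      using Ann2_neighbour[OF u L1 k \<open>u L c \<noteq> 0\<close>] .
    then show ?thesis using L(3) by (intro bexI[of _ K']) auto
  qed
  have S: "?S \<subseteq> star v" "?S \<noteq> {}" using K nz by blast+
  have conn: "interior_vertex v" "?S = star v"
    by (rule star_connected'(1)[OF S], erule (2) step) (rule star_connected'(2)[OF S], erule (2) step)
  have all: "u L c \<noteq> 0" if "L \<in> star v" "c \<in> L" "c \<noteq> v" for L c
    using both[OF that] conn(2) that(1) by blast
  obtain b where k: "K = {v, a, b}" "cr (a - v) (b - v) \<noteq> 0" using star_tri2[OF K] .
  let ?P = "\<lambda>L. \<forall>c\<in>L. c \<noteq> v \<longrightarrow> cr (a - v) (c - v) = 0 \<or> cr (b - v) (c - v) = 0"
  have P0: "?P K" using k(1) by auto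
  have P: "?P L" if L: "L \<in> star v" for L
  proof (rule star_spread[OF conn(1) K(1), of ?P, OF P0 L])
    fix L L' c assume *: "L \<in> star v" "L' \<in> star v" "L \<noteq> L'" "c \<in> L" "c \<in> L'" "c \<noteq> v" "?P L"
    obtain f where kf: "L = {v, c, f}" "cr (c - v) (f - v) \<noteq> 0" using star_tri2[OF *(1,4,6)] .
    obtain M f' where M: "M \<in> star v" "M \<noteq> L" "M = {v, c, f'}" "cr (c - v) (f' - v) \<noteq> 0" "u M c \<noteq> 0" "cr (f - v) (f' - v) = 0"
      using Ann2_neighbour[OF u *(1) kf all[OF *(1,4,6)]] .
    have "c \<in> M" using M(3) by blast
    have "M = L'" using at_most_two[of L M L' v c] starD[OF *(1)] starD[OF *(2)] starD[OF M(1)] * M(2) \<open>c \<in> M\<close> by metis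
    have "f \<in> L" "f \<noteq> v" using kf cr_distinct[OF kf(2)] by auto
    then have "cr (a - v) (f - v) = 0 \<or> cr (b - v) (f - v) = 0" using *(7) by blast
    then have "cr (a - v) (f' - v) = 0 \<or> cr (b - v) (f' - v) = 0"
      using cr_trans[of _ "f - v" "f' - v"] M(6) \<open>f \<noteq> v\<close> by auto
    moreover have "cr (a - v) (c - v) = 0 \<or> cr (b - v) (c - v) = 0" using * by blast
    ultimately show "?P L'" unfolding \<open>M = L'\<close>[symmetric] M(3) by auto
  qed
  then have "frame2 v (a - v) (b - v)" using k(2) unfolding frame2_def neighbours_def by blast
  then have "typeI v" unfolding typeI_def using conn(1) by blast
  then show False using h all by blast
qed

lemma cross_weight_eq:
  assumes "K = {v, a, b}" "cr (a - v) (b - v) \<noteq> 0"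
  shows "cross_weight d1 d2 v K c = (sgn (frame_coeff d1 d2 (a - v) * frame_coeff d1 d2 (b - v)) * (if cr d1 (c - v) = 0 then 1 else - 1)) *\<^sub>R gr K c"
  unfolding cross_weight_def prod_link(2)[OF assms] ..

text \<open>At a vertex with edges on two lines the other edges of two neighbouring elements are
  opposite, so the gradients at the common edge agree and the weights have opposite signs.
  Inside an element the two weights are opposite multiples of the gradients, and the symmetry of
  \<open>M\<close> makes the mixed terms cancel.\<close>

lemma Ann2_cross_weight:
  assumes i: "interior_vertex v" and f: "frame2 v d1 d2" shows "Ann2 v (cross_weight d1 d2 v)"
  unfolding Ann2_def
proof (intro conjI allI impI ballI)
  note f3 = frame2_frame3(1)[OF f]
  fix a A assume a: "a \<noteq> v" and A: "A \<in> sym_matrices"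
  show "(\<Sum>K\<in>{K\<in>star v. a \<in> K}. cross_weight d1 d2 v K a \<bullet> (A *v gr K a)) = 0"
  proof (cases "\<exists>K\<in>star v. a \<in> K")
    case False
    then have "{K\<in>star v. a \<in> K} = {}" by blast
    then show ?thesis by (simp only: sum.empty)
  next
    case True
    then obtain K where K: "K \<in> star v" "a \<in> K" by blast
    obtain K' where K': "K' \<in> star v" "a \<in> K'" "K' \<noteq> K" using interior_edge_two[OF i K a] by blast
    have eq: "{L\<in>star v. a \<in> L} = {K, K'}"
      by (rule edge_star_cases[OF K a]) (use K' in blast)+
    obtain b where k: "K = {v, a, b}" "cr (a - v) (b - v) \<noteq> 0" using star_tri2[OF K a] .
    obtain b' where k': "K' = {v, a, b'}" "cr (a - v) (b' - v) \<noteq> 0" using star_tri2[OF K'(1,2) a] .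
    note F = frame_dirs[OF f3 K(1) k] and F' = frame_dirs[OF f3 K'(1) k']
    have cd: "cr d1 d2 \<noteq> 0" using f unfolding frame2_def by blast
    have two: "frame_dir d1 d2 (c - v) = d1 \<or> frame_dir d1 d2 (c - v) = d2" if "c \<in> neighbours v" for c
      using f that unfolding frame2_def frame_dir_def by auto
    have nb: "a \<in> neighbours v" "b \<in> neighbours v" "b' \<in> neighbours v"
      using nbsI[OF K(1)] nbsI[OF K'(1)] k k' cr_distinct[OF k(2)] cr_distinct[OF k'(2)] by blast+
    have nsum: "d1 \<noteq> - (d1 + d2)" "d2 \<noteq> - (d1 + d2)"
    proof -
      show "d1 \<noteq> - (d1 + d2)"
      proof
        assume "d1 = - (d1 + d2)"
        then have "cr d1 d1 = cr d1 (- (d1 + d2))" by (rule arg_cong)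
        then show False using cd by (simp add: cr_linear)
      qed
      show "d2 \<noteq> - (d1 + d2)"
      proof
        assume "d2 = - (d1 + d2)"
        then have "cr d2 d2 = cr d2 (- (d1 + d2))" by (rule arg_cong)
        then show False using cd cr_swap[of d1 d2] by (simp add: cr_linear)
      qed
    qed
    have ne: "frame_dir d1 d2 (b' - v) \<noteq> - (frame_dir d1 d2 (a - v) + frame_dir d1 d2 (b - v))"
    proof -
      have ab: "frame_dir d1 d2 (a - v) \<noteq> frame_dir d1 d2 (b - v)" using F(5) by auto
      have "frame_dir d1 d2 (a - v) + frame_dir d1 d2 (b - v) = d1 + d2"
        using two[OF nb(1)] two[OF nb(2)] ab by (auto simp: add.commute)
      then show ?thesis using two[OF nb(3)] nsum by auto
    qed
    then have h: "frame_dir d1 d2 (b' - v) = frame_dir d1 d2 (b - v)" "frame_coeff d1 d2 (b - v) * frame_coeff d1 d2 (b' - v) < 0"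
      using frame_opposite[OF f3 K(1) K'(1) K'(3)[symmetric] k k'] by blast+
    have g: "gr K' a = gr K a" unfolding frame_gr[OF f3 K(1) k] frame_gr[OF f3 K'(1) k'] h(1) ..
    have "cross_weight d1 d2 v K' a = - cross_weight d1 d2 v K a"
      unfolding cross_weight_eq[OF k] cross_weight_eq[OF k'] g sgn_facts(1)[OF h(2)] by simp
    then have "cross_weight d1 d2 v K a \<bullet> (A *v gr K a) + cross_weight d1 d2 v K' a \<bullet> (A *v gr K' a) = 0" unfolding g by simp
    then show ?thesis unfolding eq using K'(3) by simp
  qed
next
  fix K a b M assume K: "K \<in> star v" "K = {v, a, b}" and M: "M \<in> sym_matrices"
  show "cross_weight d1 d2 v K a \<bullet> (M *v gr K b) + cross_weight d1 d2 v K b \<bullet> (M *v gr K a) = 0"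
  proof -
    obtain x y where k: "K = {v, x, y}" "cr (x - v) (y - v) \<noteq> 0" "cr d1 (x - v) = 0" "cr d1 (y - v) \<noteq> 0"
      using frame2_links[OF f K(1)] .
    note d = cr_distinct[OF k(2)]
    define s where "s = sgn (frame_coeff d1 d2 (x - v) * frame_coeff d1 d2 (y - v))"
    have ux: "cross_weight d1 d2 v K x = s *\<^sub>R gr K x" and uy: "cross_weight d1 d2 v K y = - s *\<^sub>R gr K y"
      unfolding cross_weight_eq[OF k(1,2)] s_def using k(3,4) by simp_all
    have sy: "gr K x \<bullet> (M *v gr K y) = gr K y \<bullet> (M *v gr K x)" by (rule sym_inner[OF M])
    have "{v, a, b} = {v, x, y}" using K(2) k(1) by simp
    then have "{x, y} \<subseteq> {v, a, b}" "card {v, a, b} = 3" using d by auto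
    then have "(a = x \<and> b = y) \<or> (a = y \<and> b = x)" using d by auto
    then show ?thesis using ux uy sy by auto
  qed
qed

lemma Ann2_typeI:
  assumes u: "Ann2 v u" and t: "typeI v" and f: "frame2 v d1 d2"
  shows "\<exists>t. \<forall>K\<in>star v. \<forall>a\<in>K. a \<noteq> v \<longrightarrow> u K a = t *\<^sub>R cross_weight d1 d2 v K a"
proof (cases "star v = {}")
  case False
  then obtain K where K: "K \<in> star v" by blast
  have i: "interior_vertex v" using t unfolding typeI_def by blast
  obtain a b where k: "K = {v, a, b}" "cr (a - v) (b - v) \<noteq> 0" using star_tri[OF K] .
  note F = frame_dirs[OF frame2_frame3(1)[OF f] K k]
  define s where "s = sgn (frame_coeff d1 d2 (a - v) * frame_coeff d1 d2 (b - v)) * (if cr d1 (a - v) = 0 then 1 else - 1)"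
  have s0: "s \<noteq> 0" using F(3,4) by (simp add: s_def sgn_zero_iff)
  have cross_weight: "cross_weight d1 d2 v K a = s *\<^sub>R gr K a" unfolding cross_weight_eq[OF k] s_def ..
  define t where "t = (u K a \<bullet> (a - v)) / s"
  have "u K a = t *\<^sub>R cross_weight d1 d2 v K a"
    unfolding cross_weight using Ann2_form(1)[OF u K k] s0 by (simp add: t_def)
  then have z: "u K a - t *\<^sub>R cross_weight d1 d2 v K a = 0" by (simp only: diff_self)
  have "a \<in> K" "a \<noteq> v" using k(1) cr_distinct[OF k(2)] by auto
  then have ex: "\<exists>K\<in>star v. \<exists>a\<in>K. a \<noteq> v \<and> u K a - t *\<^sub>R cross_weight d1 d2 v K a = 0" using K z by blast
  have "u L c - t *\<^sub>R cross_weight d1 d2 v L c = 0" if "L \<in> star v" "c \<in> L" "c \<noteq> v" for L c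
    using Ann2_zero[OF Ann2_combine[OF u Ann2_cross_weight[OF i f], of t] disjI2[OF ex] that] .
  then have "\<forall>L\<in>star v. \<forall>c\<in>L. c \<noteq> v \<longrightarrow> u L c = t *\<^sub>R cross_weight d1 d2 v L c"
    by (simp only: right_minus_eq) (intro ballI impI)
  then show ?thesis by (rule exI)
qed simp

end

section \<open>The range of the divergence by duality\<close>

subsection \<open>Linear algebra\<close>

text \<open>Extend a basis of the subspace by \<open>x\<close>.\<close>

lemma separating_functional:
  fixes x :: "'a::real_vector"
  assumes "subspace S" "x \<notin> S"
  obtains f :: "'a \<Rightarrow> real" where "linear f" "\<And>y. y \<in> S \<Longrightarrow> f y = 0" "f x = 1"
proof -
  obtain B where B: "B \<subseteq> S" "independent B" "S \<subseteq> span B" using maximal_independent_subset[of S] by blast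
  have spB: "span B \<subseteq> S" by (rule span_minimal[OF B(1) assms(1)])
  then have xB: "x \<notin> span B" using assms(2) by blast
  then have "x \<notin> B" using span_base by blast
  have "independent (insert x B)" using B(2) xB by (simp add: independent_insert \<open>x \<notin> B\<close>)
  from linear_independent_extend[OF this, of "\<lambda>y. if y = x then 1 else 0 :: real"]
  obtain g where g: "linear g" "\<forall>y\<in>insert x B. g y = (if y = x then 1 else 0 :: real)" by blast
  have "g y = 0" if "y \<in> B" for y using g(2) that \<open>x \<notin> B\<close> by auto
  then have "g y = 0" if "y \<in> span B" for y using linear_eq_0_on_span[OF g(1) _ that] by blast
  then have "g y = 0" if "y \<in> S" for y using that B(3) by blast
  moreover have "g x = 1" using g(2) by simp
  ultimately show thesis using that g(1) by blast
qed

text \<open>A basis of the kernel together with a vector outside it.\<close>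

lemma dim_kernel_of_functional:
  fixes V :: "'a::real_vector set"
  assumes V: "subspace V" "finite B" "V \<subseteq> span B"
    and add: "\<And>x y. x \<in> V \<Longrightarrow> y \<in> V \<Longrightarrow> f (x + y) = f x + (f y :: real)"
    and scale: "\<And>c x. x \<in> V \<Longrightarrow> f (c *\<^sub>R x) = c * f x"
    and b: "b \<in> V" "f b = 1"
  shows "dim V = Suc (dim {x \<in> V. f x = 0})"
proof -
  let ?W = "{x \<in> V. f x = 0}"
  have f0: "f 0 = 0" using scale[OF b(1), of 0] by simp
  have sW: "subspace ?W"
    by (rule subspaceI) (use V(1) add scale f0 in \<open>simp_all add: subspace_0 subspace_add subspace_scale\<close>)
  obtain C where C: "C \<subseteq> ?W" "independent C" "?W \<subseteq> span C" "card C = dim ?W" using basis_exists[of ?W] by blast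
  have fC: "finite C" using independent_span_bound[OF V(2) C(2)] C(1) V(3) by blast
  have "span C \<subseteq> ?W" by (rule span_minimal[OF C(1) sW])
  then have bC: "b \<notin> span C" using b(2) by auto
  then have "b \<notin> C" using span_base by blast
  have "dim V = card (insert b C)"
  proof (rule dim_unique)
    show "insert b C \<subseteq> V" using b(1) C(1) by blast
    show "independent (insert b C)" using C(2) bC by (simp add: independent_insert \<open>b \<notin> C\<close>)
    show "V \<subseteq> span (insert b C)"
    proof
      fix x assume x: "x \<in> V"
      have m: "- f x *\<^sub>R b \<in> V" by (rule subspace_scale[OF V(1) b(1)])
      have "x + - f x *\<^sub>R b \<in> V" by (rule subspace_add[OF V(1) x m])
      moreover have "f (x + - f x *\<^sub>R b) = 0" unfolding add[OF x m] scale[OF b(1)] b(2) by simp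
      ultimately have "x + - f x *\<^sub>R b \<in> span C" using C(3) by blast
      then have "x + - f x *\<^sub>R b \<in> span (insert b C)" using span_mono[of C "insert b C"] by blast
      then have "(x + - f x *\<^sub>R b) + f x *\<^sub>R b \<in> span (insert b C)"
        by (rule span_add) (intro span_scale span_base insertI1)
      then show "x \<in> span (insert b C)" by simp
    qed
  qed simp
  then show ?thesis using fC C(4) \<open>b \<notin> C\<close> by simp
qed

lemma dim_joint_kernel:
  fixes V :: "'a::real_vector set"
  assumes V: "subspace V" "finite B" "V \<subseteq> span B" and I: "finite I"
    and add: "\<And>i x y. i \<in> I \<Longrightarrow> x \<in> V \<Longrightarrow> y \<in> V \<Longrightarrow> f i (x + y) = f i x + (f i y :: real)"
    and scale: "\<And>i c x. i \<in> I \<Longrightarrow> x \<in> V \<Longrightarrow> f i (c *\<^sub>R x) = c * f i x"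
    and b: "\<And>i. i \<in> I \<Longrightarrow> \<exists>b\<in>V. f i b = 1 \<and> (\<forall>j\<in>I. j \<noteq> i \<longrightarrow> f j b = 0)"
  shows "dim V = dim {x \<in> V. \<forall>i\<in>I. f i x = 0} + card I"
proof -
  have "dim V = dim {x \<in> V. \<forall>i\<in>J. f i x = 0} + card J" if "finite J" "J \<subseteq> I" for J
    using that
  proof (induction J rule: finite_induct)
    case (insert i J)
    let ?W = "{x \<in> V. \<forall>i\<in>J. f i x = 0}"
    have i: "i \<in> I" and JI: "\<And>j. j \<in> J \<Longrightarrow> j \<in> I" using insert.prems by auto
    have f0: "f j 0 = 0" if "j \<in> I" for j using scale[OF that subspace_0[OF V(1)], of 0] by simp
    have sW: "subspace ?W"
    proof (rule subspaceI)
      show "0 \<in> ?W" using subspace_0[OF V(1)] f0 JI by auto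
      show "x + y \<in> ?W" if "x \<in> ?W" "y \<in> ?W" for x y
        using that add JI subspace_add[OF V(1)] by simp
      show "c *\<^sub>R x \<in> ?W" if "x \<in> ?W" for c x
        using that scale JI subspace_scale[OF V(1)] by simp
    qed
    obtain e where e: "e \<in> V" "f i e = 1" "\<forall>j\<in>I. j \<noteq> i \<longrightarrow> f j e = 0" using b[OF i] by blast
    have "f j e = 0" if "j \<in> J" for j
    proof -
      have "j \<noteq> i" using that insert.hyps(2) by blast
      then show ?thesis using e(3) JI[OF that] by blast
    qed
    then have eW: "e \<in> ?W" using e(1) by simp
    have "dim ?W = Suc (dim {x \<in> ?W. f i x = 0})"
    proof (rule dim_kernel_of_functional[OF sW V(2), of "f i" e])
      show "e \<in> ?W" by (rule eW)
      show "f i e = 1" by (rule e(2))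
      show "?W \<subseteq> span B" using V(3) by blast
      show "f i (x + y) = f i x + f i y" if "x \<in> ?W" "y \<in> ?W" for x y using add[OF i] that by simp
      show "f i (c *\<^sub>R x) = c * f i x" if "x \<in> ?W" for c x using scale[OF i] that by simp
    qed
    moreover have "{x \<in> ?W. f i x = 0} = {x \<in> V. \<forall>j\<in>insert i J. f j x = 0}" by auto
    ultimately show ?case using insert by simp
  qed simp
  from this[OF I subset_refl] show ?thesis .
qed

subsection \<open>Jets of families\<close>

lemma van2_D:
  assumes "van 2 v f" shows "f v = 0" "dird h f v = 0"
  using van_2D[OF assms] by (simp_all add: dird_two)

lemma van2_diff_D:
  assumes "poly_map f" "poly_map g" "van 2 v (\<lambda>x. f x - g x)"
  shows "f v = g v" "dird h f v = dird h g v"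
proof -
  show "f v = g v" using van2_D(1)[OF assms(3)] by simp
  have "dird h (\<lambda>x. f x - g x) = (\<lambda>x. dird h f x - dird h g x)"
    by (rule ext) (simp add: dird_def pd_diff[OF assms(1,2)] scaleR_diff_right sum_subtractf)
  then show "dird h f v = dird h g v" using van2_D(2)[OF assms(3), of h] by simp
qed

definition grd :: "(point \<Rightarrow> real) \<Rightarrow> point \<Rightarrow> point" where "grd f x = (\<chi> j. partial_deriv j f x)"

lemma pdiv_const_mult:
  assumes "poly_map f" shows "pdiv (\<lambda>x. f x *\<^sub>R A) = (\<lambda>x. A *v grd f x)"
proof
  fix x
  have "partial_deriv j (\<lambda>x. f x *\<^sub>R A) = (\<lambda>x. partial_deriv j f x *\<^sub>R A)" for j
    using pd_mult[OF assms poly_map_const[of A], of j] by simp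
  then show "pdiv (\<lambda>x. f x *\<^sub>R A) x = A *v grd f x"
    by (simp add: pdiv_eq poly_map_mult_scaleR[OF assms poly_map_const] UNIV_2 vec_eq_iff matrix_vector_mult_def axis_def grd_def algebra_simps)
qed

lemma grd_bary: "tri K \<Longrightarrow> grd (bary K a) = (\<lambda>x. gr K a)"
  by (rule ext) (simp add: grd_def pd_bary_gr vec_eq_iff)

lemma grd_mult: "poly_map f \<Longrightarrow> poly_map g \<Longrightarrow> grd (\<lambda>x. f x * g x) = (\<lambda>x. f x *\<^sub>R grd g x + g x *\<^sub>R grd f x)"
  by (rule ext) (simp add: grd_def pd_mult_real vec_eq_iff)

lemma dird_grd: "dird h f x = grd f x \<bullet> h"
  by (simp add: dird_two grd_def inner_point)

lemma dird_bary:
  fixes c :: "'b::real_normed_vector"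
  shows "tri K \<Longrightarrow> dird h (\<lambda>x. bary K a x *\<^sub>R c) = (\<lambda>x. (gr K a \<bullet> h) *\<^sub>R c)"
proof -
  assume t: "tri K"
  have "dird h (\<lambda>x. c) = (\<lambda>x. 0)" for c :: 'b by (rule ext) (simp add: dird_def)
  then show ?thesis using dird_mult_scaleR[OF bary_poly_map[OF t] poly_map_const[of c], of h a]
    by (simp add: dird_grd grd_bary[OF t])
qed

lemma van_bary: "tri K \<Longrightarrow> w \<in> K \<Longrightarrow> a \<noteq> w \<Longrightarrow> van 1 w (bary K a)"
  by (rule van_1I) (simp add: bary_vertex)

text \<open>The cubic Hermite function with value \<open>c\<close> at \<open>v\<close> and
  otherwise vanishing first-order jets at the vertices.\<close>

definition d0 :: "point set \<Rightarrow> point \<Rightarrow> point \<Rightarrow> point \<Rightarrow> point" where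
  "d0 K v c x = (bary K v x ^ 2 * (3 - 2 * bary K v x)) *\<^sub>R c"

text \<open>The cubic Hermite function whose derivative at \<open>v\<close> along the edge to
  \<open>a\<close> is \<open>c\<close>, with otherwise vanishing values and edge derivatives at
  the vertices.\<close>

definition d1 :: "point set \<Rightarrow> point \<Rightarrow> point \<Rightarrow> point \<Rightarrow> point \<Rightarrow> point" where
  "d1 K v a c x = (bary K a x * bary K v x ^ 2) *\<^sub>R c"

lemma d0_jets:
  assumes K: "tri K" "v \<in> K"
  shows "d0 K v c \<in> poly_maps 3" "van 2 v (\<lambda>x. d0 K v c x - c)" "w \<in> K \<Longrightarrow> w \<noteq> v \<Longrightarrow> van 2 w (d0 K v c)"
proof -
  note bp = bary_poly[OF K(1), of v]
  note b = bary_poly_map[OF K(1), of v]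
  have l: "(\<lambda>x. 3 - 2 * bary K v x) \<in> poly_maps 1"
    by (rule poly_maps_diff[OF poly_maps_const poly_maps_cmult[OF bp]])
  have "(\<lambda>x. (bary K v x ^ 2 * (3 - 2 * bary K v x)) *\<^sub>R c) \<in> poly_maps (1 * 2 + 1 + 0)"
    by (rule poly_maps_mult_scaleR[OF poly_maps_mult[OF poly_maps_power[OF bp] l] poly_maps_const])
  then show "d0 K v c \<in> poly_maps 3" by (simp add: d0_def[abs_def])
  have b1: "poly_map (\<lambda>x. 1 - bary K v x)" by (rule poly_map_diff[OF poly_map_const b])
  have v1: "van 1 v (\<lambda>x. 1 - bary K v x)" by (rule van_1I) (simp add: bary_vertex[OF K])
  have p2: "poly_map (\<lambda>x. - (1 + 2 * bary K v x))"
    by (rule poly_map_uminus[OF poly_map_add[OF poly_map_const poly_map_mult[OF poly_map_const b]]])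
  have "van (1 * 2 + 0 + 0) v (\<lambda>x. ((1 - bary K v x) ^ 2 * (- (1 + 2 * bary K v x))) *\<^sub>R c)"
    by (rule van_mult_scaleR[OF poly_map_mult[OF poly_map_power[OF b1] p2] poly_map_const
         van_mult[OF poly_map_power[OF b1] p2 van_power[OF b1 v1] van_0] van_0])
  moreover have "(\<lambda>x. ((1 - bary K v x) ^ 2 * (- (1 + 2 * bary K v x))) *\<^sub>R c) = (\<lambda>x. d0 K v c x - c)"
  proof
    fix x
    have "(1 - l) ^ 2 * (- (1 + 2 * l)) = l ^ 2 * (3 - 2 * l) - 1" for l :: real
      by (simp add: power2_eq_square algebra_simps)
    then show "((1 - bary K v x) ^ 2 * (- (1 + 2 * bary K v x))) *\<^sub>R c = d0 K v c x - c"
      by (simp only: d0_def scaleR_diff_left scaleR_one)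
  qed
  ultimately show "van 2 v (\<lambda>x. d0 K v c x - c)" by simp
  assume w: "w \<in> K" "w \<noteq> v"
  have "van (1 * 2 + 0 + 0) w (\<lambda>x. (bary K v x ^ 2 * (3 - 2 * bary K v x)) *\<^sub>R c)"
    by (rule van_mult_scaleR[OF poly_map_mult[OF poly_map_power[OF b] poly_mapI[OF l]] poly_map_const
         van_mult[OF poly_map_power[OF b] poly_mapI[OF l] van_power[OF b van_bary[OF K(1) w(1) w(2)[symmetric]]] van_0] van_0])
  then show "van 2 w (d0 K v c)" by (simp add: d0_def[abs_def])
qed

lemma van_power_minus_one:
  assumes "tri K" "v \<in> K" shows "van 1 v (\<lambda>x. bary K v x ^ n - 1)"
  by (rule van_1I) (simp add: bary_vertex[OF assms])

lemma d1_jets: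
  assumes K: "tri K" "v \<in> K" "a \<noteq> v"
  shows "d1 K v a c \<in> poly_maps 3" "van 2 v (\<lambda>x. d1 K v a c x - bary K a x *\<^sub>R c)" "w \<in> K \<Longrightarrow> w \<noteq> v \<Longrightarrow> van 2 w (d1 K v a c)"
proof -
  note bp = bary_poly[OF K(1)] and b = bary_poly_map[OF K(1)]
  have "(\<lambda>x. (bary K a x * bary K v x ^ 2) *\<^sub>R c) \<in> poly_maps (1 + 1 * 2 + 0)"
    by (rule poly_maps_mult_scaleR[OF poly_maps_mult[OF bp poly_maps_power[OF bp]] poly_maps_const])
  then show "d1 K v a c \<in> poly_maps 3" by (simp add: d1_def[abs_def] numeral_3_eq_3)
  have p: "poly_map (\<lambda>x. bary K v x ^ 2 - 1)" by (rule poly_map_diff[OF poly_map_power[OF b] poly_map_const])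
  have "van (1 + 1 + 0) v (\<lambda>x. (bary K a x * (bary K v x ^ 2 - 1)) *\<^sub>R c)"
    by (rule van_mult_scaleR[OF poly_map_mult[OF b p] poly_map_const
         van_mult[OF b p van_bary[OF K] van_power_minus_one[OF K(1,2)]] van_0])
  then show "van 2 v (\<lambda>x. d1 K v a c x - bary K a x *\<^sub>R c)"
    by (simp add: d1_def algebra_simps numeral_2_eq_2)
  assume w: "w \<in> K" "w \<noteq> v"
  have "van (0 + 1 * 2 + 0) w (\<lambda>x. (bary K a x * bary K v x ^ 2) *\<^sub>R c)"
    by (rule van_mult_scaleR[OF poly_map_mult[OF b poly_map_power[OF b]] poly_map_const
         van_mult[OF b poly_map_power[OF b] van_0 van_power[OF b van_bary[OF K(1) w(1) w(2)[symmetric]]]] van_0])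
  then show "van 2 w (d1 K v a c)" by (simp add: d1_def[abs_def] numeral_2_eq_2)
qed

text \<open>Cubic Hermite interpolation of the first-order jets at the three vertices.\<close>

definition jet_interp :: "point set \<Rightarrow> (point \<Rightarrow> point) \<Rightarrow> point \<Rightarrow> point" where
  "jet_interp K q x = (\<Sum>v\<in>K. d0 K v (q v) x + (\<Sum>a\<in>K - {v}. d1 K v a (dird (a - v) q v) x))"

lemma jet_interp_poly: "tri K \<Longrightarrow> jet_interp K q \<in> poly_maps 3"
  unfolding jet_interp_def[abs_def]
  by (rule poly_maps_sum, rule poly_maps_add, rule d0_jets(1), assumption, assumption,
      rule poly_maps_sum, rule d1_jets(1)) auto

lemma jet_interp_jets:
  assumes K: "tri K" "w \<in> K" and q: "poly_map q"
  shows "van 2 w (\<lambda>x. q x - jet_interp K q x)"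
proof -
  obtain a b where k: "K = {w, a, b}" "cr (a - w) (b - w) \<noteq> 0" using tri_at[OF K] .
  let ?t = "\<lambda>v x. d0 K v (q v) x + (\<Sum>c\<in>K - {v}. d1 K v c (dird (c - v) q v) x)"
  have ps: "poly_map (\<lambda>x. \<Sum>c\<in>K - {v}. d1 K v c (dird (c - v) q v) x)" if "v \<in> K" for v
    by (rule poly_map_sum, rule poly_mapI, rule d1_jets(1)[OF K(1) that]) auto
  have pt: "poly_map (?t v)" if "v \<in> K" for v
    by (rule poly_map_add[OF poly_mapI[OF d0_jets(1)[OF K(1) that]] ps[OF that]])
  have vt: "van 2 w (?t v)" if "v \<in> K" "v \<noteq> w" for v
  proof (rule van_add[OF poly_mapI[OF d0_jets(1)[OF K(1) that(1)]] ps[OF that(1)] d0_jets(3)[OF K(1) that(1) K(2) that(2)[symmetric]]])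
    show "van 2 w (\<lambda>x. \<Sum>c\<in>K - {v}. d1 K v c (dird (c - v) q v) x)"
    proof (rule van_sum)
      fix c assume "c \<in> K - {v}"
      then have c: "c \<noteq> v" by blast
      show "poly_map (d1 K v c (dird (c - v) q v))" by (rule poly_mapI[OF d1_jets(1)[OF K(1) that(1) c]])
      show "van 2 w (d1 K v c (dird (c - v) q v))" by (rule d1_jets(3)[OF K(1) that(1) c K(2) that(2)[symmetric]])
    qed
  qed
  have dab: "a \<noteq> w" "b \<noteq> w" using cr_distinct[OF k(2)] by auto
  let ?A = "dird (a - w) q w" and ?B = "dird (b - w) q w"
  have tw: "?t w x = d0 K w (q w) x + (d1 K w a ?A x + d1 K w b ?B x)" for x
    by (simp only: prod_link(3)[OF k])
  note pa = poly_mapI[OF d1_jets(1)[OF K dab(1), of ?A]] and pb = poly_mapI[OF d1_jets(1)[OF K dab(2), of ?B]]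
    and p0 = poly_mapI[OF d0_jets(1)[OF K, of "q w"]]
  have ba: "poly_map (\<lambda>x. bary K c x *\<^sub>R C)" for c and C :: point
    by (rule poly_map_mult_scaleR[OF bary_poly_map[OF K(1)] poly_map_const])
  let ?lin = "\<lambda>x. q w + (bary K a x *\<^sub>R ?A + bary K b x *\<^sub>R ?B)"
  have pl: "poly_map ?lin" by (rule poly_map_add[OF poly_map_const poly_map_add[OF ba ba]])
  have "van 2 w (\<lambda>x. (d0 K w (q w) x - q w) + ((d1 K w a ?A x - bary K a x *\<^sub>R ?A) + (d1 K w b ?B x - bary K b x *\<^sub>R ?B)))"
    by (rule van_add[OF poly_map_diff[OF p0 poly_map_const] poly_map_add[OF poly_map_diff[OF pa ba] poly_map_diff[OF pb ba]]
        d0_jets(2)[OF K] van_add[OF poly_map_diff[OF pa ba] poly_map_diff[OF pb ba] d1_jets(2)[OF K dab(1)] d1_jets(2)[OF K dab(2)]]])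
  then have v1: "van 2 w (\<lambda>x. ?t w x - ?lin x)" unfolding tw by (simp add: algebra_simps)
  have v2: "van 2 w (\<lambda>x. q x - ?lin x)"
  proof (rule van_2I)
    show "q w - ?lin w = 0" using dab by (simp add: bary_vertex[OF K])
    have pz: "partial_deriv j (\<lambda>x. q x - ?lin x) w = 0" for j
    proof -
      have "partial_deriv j (\<lambda>x. q x - ?lin x) w = partial_deriv j q w - partial_deriv j ?lin w"
        by (simp only: pd_diff[OF q pl])
      also have "partial_deriv j ?lin w = gr K a $ j *\<^sub>R ?A + gr K b $ j *\<^sub>R ?B"
        unfolding partial_deriv_dird dird_add[OF poly_map_const poly_map_add[OF ba ba]] dird_add[OF ba ba] dird_bary[OF K(1)]
        by (simp add: inner_axis) (simp add: dird_def)
      also have "\<dots> = dird (gr K a $ j *\<^sub>R (a - w) + gr K b $ j *\<^sub>R (b - w)) q w"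
        using linear_add[OF linear_dird_dir] linear_scale[OF linear_dird_dir] by metis
      also have "gr K a $ j *\<^sub>R (a - w) + gr K b $ j *\<^sub>R (b - w) = axis j 1"
        using edge_expansion[OF k, of "axis j 1"] by (simp add: inner_axis)
      finally show ?thesis by (simp add: partial_deriv_dird)
    qed
    show "partial_deriv 1 (\<lambda>x. q x - ?lin x) w = 0" "partial_deriv 2 (\<lambda>x. q x - ?lin x) w = 0" by (rule pz)+
  qed
  have pr: "poly_map (\<lambda>x. \<Sum>v\<in>K - {w}. ?t v x)" by (rule poly_map_sum, rule pt) blast
  have vr: "van 2 w (\<lambda>x. \<Sum>v\<in>K - {w}. ?t v x)"
    by (rule van_sum, rule pt, blast, rule vt) blast+
  have "van 2 w (\<lambda>x. ((q x - ?lin x) - (?t w x - ?lin x)) - (\<Sum>v\<in>K - {w}. ?t v x))"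
    by (rule van_diff[OF poly_map_diff[OF poly_map_diff[OF q pl] poly_map_diff[OF pt[OF K(2)] pl]] pr
        van_diff[OF poly_map_diff[OF q pl] poly_map_diff[OF pt[OF K(2)] pl] v2 v1] vr])
  moreover have "jet_interp K q x = ?t w x + (\<Sum>v\<in>K - {w}. ?t v x)" for x
    unfolding jet_interp_def by (rule sum.remove[OF tri_finite[OF K(1)] K(2)])
  ultimately show ?thesis by (simp only: diff_diff_eq2 diff_diff_add) (simp add: algebra_simps)
qed

context mesh
begin

lemma single_linear:
  "single K (\<lambda>x. p x + q x :: 'b::real_normed_vector) = single K p + single K q" "single K (\<lambda>x. r *\<^sub>R p x) = r *\<^sub>R single K p"
  by (intro ext; simp add: single_def scaleR_fun_def)+

lemma single_sum: "single K (\<lambda>x. \<Sum>i\<in>I. (p i x :: 'b::real_normed_vector)) = (\<Sum>i\<in>I. single K (p i))"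
proof (intro ext)
  fix L x show "single K (\<lambda>x. \<Sum>i\<in>I. p i x) L x = (\<Sum>i\<in>I. single K (p i)) L x"
    unfolding sum_fun_apply2 by (simp add: single_def)
qed

lemma sum_star: "(\<Sum>K\<in>\<K>. \<Sum>v\<in>K. g K v) = (\<Sum>v\<in>\<Union>\<K>. \<Sum>K\<in>star v. g K v)" for g :: "point set \<Rightarrow> point \<Rightarrow> real"
proof -
  have "(\<Sum>K\<in>\<K>. \<Sum>v\<in>K. g K v) = (\<Sum>K\<in>\<K>. \<Sum>v | v \<in> \<Union>\<K> \<and> v \<in> K. g K v)"
    by (intro sum.cong refl) blast
  also have "\<dots> = (\<Sum>v\<in>\<Union>\<K>. \<Sum>K | K \<in> \<K> \<and> v \<in> K. g K v)"
    by (rule sum.swap_restrict[OF fin finite_vertices])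
  finally show ?thesis unfolding star_def .
qed

lemma sum_links:
  "(\<Sum>K\<in>star v. \<Sum>a\<in>K - {v}. g K a) = (\<Sum>a\<in>\<Union>\<K> - {v}. \<Sum>K\<in>{K\<in>star v. a \<in> K}. g K a)" for g :: "point set \<Rightarrow> point \<Rightarrow> real"
proof -
  have "K - {v} = {a. a \<in> \<Union>\<K> - {v} \<and> a \<in> K}" if "K \<in> star v" for K using starD(1)[OF that] by blast
  then have "(\<Sum>K\<in>star v. \<Sum>a\<in>K - {v}. g K a) = (\<Sum>K\<in>star v. \<Sum>a | a \<in> \<Union>\<K> - {v} \<and> a \<in> K. g K a)"
    by (intro sum.cong refl) simp
  also have "\<dots> = (\<Sum>a\<in>\<Union>\<K> - {v}. \<Sum>K | K \<in> star v \<and> a \<in> K. g K a)"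
    by (rule sum.swap_restrict[OF star_finite(1)]) (simp add: finite_vertices)
  finally show ?thesis .
qed

subsection \<open>Functionals that vanish on divergences\<close>

text \<open>Weighted sum of the values that a family takes at \<open>v\<close> from the elements
  at \<open>v\<close>.\<close>

definition value_form :: "point \<Rightarrow> (point set \<Rightarrow> point) \<Rightarrow> (point set \<Rightarrow> point \<Rightarrow> point) \<Rightarrow> real" where
  "value_form v w q = (\<Sum>K\<in>star v. w K \<bullet> q K v)"

text \<open>Weighted sum of the derivatives at \<open>v\<close> along the edges at
  \<open>v\<close>.\<close>

definition slope_form :: "point \<Rightarrow> (point set \<Rightarrow> point \<Rightarrow> point) \<Rightarrow> (point set \<Rightarrow> point \<Rightarrow> point) \<Rightarrow> real" where
  "slope_form v u q = (\<Sum>K\<in>star v. \<Sum>a\<in>K - {v}. u K a \<bullet> dird (a - v) (q K) v)"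

lemma dird_entry:
  fixes \<sigma> :: "point \<Rightarrow> real ^ 2 ^ 2"
  shows "poly_map \<sigma> \<Longrightarrow> dird d (\<lambda>y. \<sigma> y $ i $ j) = (\<lambda>x. dird d \<sigma> x $ i $ j)"
  by (rule dird_linear[OF _ bounded_linear_entry])

lemma matrix_eqI: "(\<And>i j. A $ i $ j = B $ i $ j) \<Longrightarrow> A = (B :: real ^ 2 ^ 2)"
  by (simp add: vec_eq_iff)

text \<open>A continuous stress has one trace on a common edge, hence the tangential derivatives
  agree.\<close>

lemma tangential_agree:
  assumes s: "s \<in> Sfam r" and K: "K \<in> star v" "K' \<in> star v" "a \<in> K" "a \<in> K'"
  shows "dird (a - v) (s K) v = dird (a - v) (s K') v"
    "dird (a - v) (dird (a - v) (s K)) v = dird (a - v) (dird (a - v) (s K')) v"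
proof -
  note p = SfamD(6)[OF s]
  have seg: "x \<in> convex hull L" if "x \<in> closed_segment v a" "L \<in> star v" "a \<in> L" for x L
    using hull_mono[of "{v, a}" L convex] starD(2)[OF that(2)] that unfolding segment_convex_hull by blast
  have e: "s K x $ i $ j = s K' x $ i $ j" if "x \<in> closed_segment v a" for x i j
    using SfamD(3)[OF s starD(1)[OF K(1)] starD(1)[OF K(2)] seg[OF that K(1,3)] seg[OF that K(2,4)]] by simp
  note d = dird_eq_of_segment_eq[OF poly_map_entry[OF p] poly_map_entry[OF p] e]
  show "dird (a - v) (s K) v = dird (a - v) (s K') v"
    by (rule matrix_eqI) (use d(1) in \<open>simp add: dird_entry[OF p]\<close>)
  show "dird (a - v) (dird (a - v) (s K)) v = dird (a - v) (dird (a - v) (s K')) v"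
    by (rule matrix_eqI) (use d(2) in \<open>simp add: dird_entry[OF p] dird_entry[OF poly_map_dird[OF p]]\<close>)
qed

lemma dird_sym:
  assumes "poly_map \<sigma>" "\<And>x. \<sigma> x \<in> sym_matrices" shows "dird d \<sigma> x \<in> sym_matrices"
proof -
  have "(\<lambda>y. \<sigma> y $ i $ j) = (\<lambda>y. \<sigma> y $ j $ i)" for i j
  proof
    fix y
    have "transpose (\<sigma> y) $ i $ j = \<sigma> y $ i $ j" using assms(2)[of y] by (simp add: sym_matrices_def)
    then show "\<sigma> y $ i $ j = \<sigma> y $ j $ i" by (simp add: transpose_def)
  qed
  then have "dird d \<sigma> x $ i $ j = dird d \<sigma> x $ j $ i" for i j
    using dird_entry[OF assms(1), of d i j] dird_entry[OF assms(1), of d j i] by metis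
  then show ?thesis unfolding sym_matrices_def mem_Collect_eq
    by (intro matrix_eqI) (simp add: transpose_def)
qed

text \<open>Write the divergence at \<open>v\<close> through tangential derivatives and collect
  the terms by edges; at each edge the tangential derivatives agree and \<open>Ann\<close> makes
  the sum vanish.\<close>

lemma value_form_div:
  assumes w: "Ann v w" and s: "s \<in> Sfam 0" shows "value_form v w (\<lambda>K. pdiv (s K)) = 0"
proof -
  have "w K \<bullet> pdiv (s K) v = (\<Sum>a\<in>K - {v}. w K \<bullet> (dird (a - v) (s K) v *v gr K a))" if K: "K \<in> star v" for K
  proof -
    obtain a b where k: "K = {v, a, b}" "cr (a - v) (b - v) \<noteq> 0" using star_tri[OF K] .
    show ?thesis unfolding prod_link(3)[OF k] pdiv_edges[OF k SfamD(6)[OF s]] by (rule inner_add_right)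
  qed
  then have "value_form v w (\<lambda>K. pdiv (s K)) = (\<Sum>K\<in>star v. \<Sum>a\<in>K - {v}. w K \<bullet> (dird (a - v) (s K) v *v gr K a))"
    unfolding value_form_def by (intro sum.cong refl) simp
  also have "\<dots> = (\<Sum>a\<in>\<Union>\<K> - {v}. \<Sum>K\<in>{K\<in>star v. a \<in> K}. w K \<bullet> (dird (a - v) (s K) v *v gr K a))" by (rule sum_links)
  also have "\<dots> = 0"
  proof (rule sum.neutral, rule ballI)
    fix a assume "a \<in> \<Union>\<K> - {v}"
    then have a: "a \<noteq> v" by blast
    show "(\<Sum>K\<in>{K\<in>star v. a \<in> K}. w K \<bullet> (dird (a - v) (s K) v *v gr K a)) = 0"
    proof (cases "\<exists>K\<in>star v. a \<in> K")
      case False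
      then have "{K\<in>star v. a \<in> K} = {}" by blast
      then show ?thesis by (simp only: sum.empty)
    next
      case True
      then obtain K0 where K0: "K0 \<in> star v" "a \<in> K0" by blast
      have "(\<Sum>K\<in>{K\<in>star v. a \<in> K}. w K \<bullet> (dird (a - v) (s K) v *v gr K a))
         = (\<Sum>K\<in>{K\<in>star v. a \<in> K}. w K \<bullet> (dird (a - v) (s K0) v *v gr K a))"
      proof (rule sum.cong[OF refl])
        fix K assume "K \<in> {K\<in>star v. a \<in> K}"
        then have K: "K \<in> star v" "a \<in> K" by blast+
        show "w K \<bullet> (dird (a - v) (s K) v *v gr K a) = w K \<bullet> (dird (a - v) (s K0) v *v gr K a)"
          unfolding tangential_agree(1)[OF s K(1) K0(1) K(2) K0(2)] ..
      qed
      also have "\<dots> = 0"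
        by (rule w[unfolded Ann_def, rule_format, OF a dird_sym[OF SfamD(6)[OF s] SfamD(2)[OF s starD(1)[OF K0(1)]]]])
      finally show ?thesis .
    qed
  qed
  finally show ?thesis .
qed

text \<open>The derivative of the divergence along an edge contains the second tangential
  derivative, which is common to the elements at the edge, and the mixed derivative, which
  occurs twice in the same element. The two parts of \<open>Ann2\<close> cancel them.\<close>

lemma slope_form_div:
  assumes u: "Ann2 v u" and s: "s \<in> Sfam 0" shows "slope_form v u (\<lambda>K. pdiv (s K)) = 0"
proof -
  let ?H = "\<lambda>K a. dird (a - v) (dird (a - v) (s K)) v"
  have "(\<Sum>a\<in>K - {v}. u K a \<bullet> dird (a - v) (pdiv (s K)) v) = (\<Sum>a\<in>K - {v}. u K a \<bullet> (?H K a *v gr K a))" if K: "K \<in> star v" for K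
  proof -
    obtain a b where k: "K = {v, a, b}" "cr (a - v) (b - v) \<noteq> 0" using star_tri[OF K] .
    note p = SfamD(6)[OF s, of K]
    have mv: "bounded_linear (\<lambda>A :: real ^ 2 ^ 2. A *v g)" for g by (rule matvec_linear)
    have pm: "poly_map (\<lambda>x. dird c (s K) x *v g)" for c g
      by (rule poly_map_linear[OF poly_map_dird[OF p] bounded_linear.linear[OF mv]])
    have dd: "dird c (pdiv (s K)) v = dird c (dird (a - v) (s K)) v *v gr K a + dird c (dird (b - v) (s K)) v *v gr K b" for c
      unfolding pdiv_edges[OF k p] dird_add[OF pm pm] dird_linear[OF poly_map_dird[OF p] mv] ..
    define M where "M = dird (a - v) (dird (b - v) (s K)) v"
    have M2: "dird (b - v) (dird (a - v) (s K)) v = M" unfolding M_def dird_commute[OF p, of "b - v"] ..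
    have Ms: "M \<in> sym_matrices"
      unfolding M_def by (rule dird_sym[OF poly_map_dird[OF p] dird_sym[OF p SfamD(2)[OF s starD(1)[OF K]]]])
    have z: "u K a \<bullet> (M *v gr K b) + u K b \<bullet> (M *v gr K a) = 0"
      by (rule u[unfolded Ann2_def, THEN conjunct1, rule_format, OF K k(1) Ms])
    show ?thesis unfolding prod_link(3)[OF k] dd M2 M_def[symmetric] inner_add_right using z by simp
  qed
  then have "slope_form v u (\<lambda>K. pdiv (s K)) = (\<Sum>K\<in>star v. \<Sum>a\<in>K - {v}. u K a \<bullet> (?H K a *v gr K a))"
    unfolding slope_form_def by (rule sum.cong[OF refl])
  also have "\<dots> = (\<Sum>a\<in>\<Union>\<K> - {v}. \<Sum>K\<in>{K\<in>star v. a \<in> K}. u K a \<bullet> (?H K a *v gr K a))" by (rule sum_links)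
  also have "\<dots> = 0"
  proof (rule sum.neutral, rule ballI)
    fix a assume "a \<in> \<Union>\<K> - {v}"
    then have a: "a \<noteq> v" by blast
    show "(\<Sum>K\<in>{K\<in>star v. a \<in> K}. u K a \<bullet> (?H K a *v gr K a)) = 0"
    proof (cases "\<exists>K\<in>star v. a \<in> K")
      case False
      then have "{K\<in>star v. a \<in> K} = {}" by blast
      then show ?thesis by (simp only: sum.empty)
    next
      case True
      then obtain K0 where K0: "K0 \<in> star v" "a \<in> K0" by blast
      have "(\<Sum>K\<in>{K\<in>star v. a \<in> K}. u K a \<bullet> (?H K a *v gr K a))
         = (\<Sum>K\<in>{K\<in>star v. a \<in> K}. u K a \<bullet> (?H K0 a *v gr K a))"
      proof (rule sum.cong[OF refl])
        fix K assume "K \<in> {K\<in>star v. a \<in> K}"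
        then have K: "K \<in> star v" "a \<in> K" by blast+
        show "u K a \<bullet> (?H K a *v gr K a) = u K a \<bullet> (?H K0 a *v gr K a)"
          unfolding tangential_agree(2)[OF s K(1) K0(1) K(2) K0(2)] ..
      qed
      also have "\<dots> = 0"
        by (rule u[unfolded Ann2_def, THEN conjunct2, rule_format, OF a
            dird_sym[OF poly_map_dird[OF SfamD(6)[OF s]] dird_sym[OF SfamD(6)[OF s] SfamD(2)[OF s starD(1)[OF K0(1)]]]]])
      finally show ?thesis .
    qed
  qed
  finally show ?thesis .
qed

subsection \<open>Duality\<close>

text \<open>The coefficients by which a functional acts on vertex values, read off from the
  Hermite functions.\<close>

definition value_weights :: "((point set \<Rightarrow> point \<Rightarrow> point) \<Rightarrow> real) \<Rightarrow> point \<Rightarrow> point set \<Rightarrow> point" where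
  "value_weights l v K = (\<chi> i. l (single K (d0 K v (axis i 1))))"

definition slope_weights :: "((point set \<Rightarrow> point \<Rightarrow> point) \<Rightarrow> real) \<Rightarrow> point \<Rightarrow> point set \<Rightarrow> point \<Rightarrow> point" where
  "slope_weights l v K a = (\<chi> i. l (single K (d1 K v a (axis i 1))))"

lemma value_weights_apply:
  assumes "linear l" shows "l (single K (d0 K v c)) = value_weights l v K \<bullet> c"
proof -
  have "d0 K v c = (\<lambda>x. c $ 1 *\<^sub>R d0 K v (axis 1 1) x + c $ 2 *\<^sub>R d0 K v (axis 2 1) x)"
    by (intro ext point_eqI) (simp_all add: d0_def axis_def)
  then have "single K (d0 K v c) = c $ 1 *\<^sub>R single K (d0 K v (axis 1 1)) + c $ 2 *\<^sub>R single K (d0 K v (axis 2 1))"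
    by (simp only: single_linear)
  then show ?thesis
    by (simp only: linear_add[OF assms] linear_scale[OF assms]) (simp add: value_weights_def inner_point mult.commute)
qed

lemma slope_weights_apply:
  assumes "linear l" shows "l (single K (d1 K v a c)) = slope_weights l v K a \<bullet> c"
proof -
  have "d1 K v a c = (\<lambda>x. c $ 1 *\<^sub>R d1 K v a (axis 1 1) x + c $ 2 *\<^sub>R d1 K v a (axis 2 1) x)"
    by (intro ext point_eqI) (simp_all add: d1_def axis_def)
  then have "single K (d1 K v a c) = c $ 1 *\<^sub>R single K (d1 K v a (axis 1 1)) + c $ 2 *\<^sub>R single K (d1 K v a (axis 2 1))"
    by (simp only: single_linear)
  then show ?thesis
    by (simp only: linear_add[OF assms] linear_scale[OF assms]) (simp add: slope_weights_def inner_point mult.commute)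
qed

lemma Qfam_single: "K \<in> \<K> \<Longrightarrow> p \<in> poly_maps (k - 1) \<Longrightarrow> single K p \<in> Qfam"
  unfolding Qfam_def by (simp add: single_def)

text \<open>The difference of \<open>q\<close> and its Hermite interpolant has vanishing
  first-order jets at the vertices, so it is a divergence by \<open>zero_jets_in_Dfam\<close>.
  The functional therefore only depends on the values and slopes at the vertices.\<close>

lemma functional_sees_jets:
  assumes l: "linear l" "\<And>d. d \<in> Dfam 2 \<Longrightarrow> l d = (0::real)" and q: "q \<in> Qfam"
  shows "l q = (\<Sum>v\<in>\<Union>\<K>. value_form v (value_weights l v) q + slope_form v (slope_weights l v) q)"
proof -
  (* The family of Hermite interpolants, of degree 3 < k. *)
  define p where "p = (\<Sum>K\<in>\<K>. single K (jet_interp K (q K)))"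
  have rk: "jet_interp K (q K) \<in> poly_maps (k - 1)" if "K \<in> \<K>" for K
    by (rule poly_maps_mono[OF jet_interp_poly[OF tris[OF that]]]) (use k7 in simp)
  have pQ: "p \<in> Qfam" unfolding p_def by (rule subspace_sum[OF subspace_Qfam], rule Qfam_single, assumption, rule rk)
  have pK: "p K = jet_interp K (q K)" if "K \<in> \<K>" for K
  proof
    fix x
    have "(\<Sum>L\<in>\<K>. single L (jet_interp L (q L)) K x) = (\<Sum>L\<in>\<K>. if K = L then jet_interp K (q K) x else 0)"
      by (rule sum.cong) (auto simp: single_def)
    then show "p K x = jet_interp K (q K) x" unfolding p_def sum_fun_apply2 using fin that by simp
  qed
  have "q - p \<in> Dfam 2"
  proof (rule zero_jets_in_Dfam[OF subspace_diff[OF subspace_Qfam q pQ]])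
    fix K v assume K: "K \<in> \<K>" "v \<in> K"
    show "van 2 v ((q - p) K)"
      using jet_interp_jets[OF tris[OF K(1)] K(2) QfamD(3)[OF q]] by (simp add: fun_diff_def pK[OF K(1)])
  qed
  from l(2)[OF this] have "l q = l p" by (simp add: linear_diff[OF l(1)])
  also have "\<dots> = (\<Sum>K\<in>\<K>. l (single K (jet_interp K (q K))))" unfolding p_def by (rule linear_sum[OF l(1)])
  also have "\<dots> = (\<Sum>K\<in>\<K>. \<Sum>v\<in>K. value_weights l v K \<bullet> q K v + (\<Sum>a\<in>K - {v}. slope_weights l v K a \<bullet> dird (a - v) (q K) v))"
  proof (rule sum.cong[OF refl])
    fix K
    have "single K (jet_interp K (q K)) = (\<Sum>v\<in>K. single K (d0 K v (q K v)) + (\<Sum>a\<in>K - {v}. single K (d1 K v a (dird (a - v) (q K) v))))"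
      unfolding jet_interp_def[abs_def] single_sum single_linear(1) ..
    then show "l (single K (jet_interp K (q K))) = (\<Sum>v\<in>K. value_weights l v K \<bullet> q K v + (\<Sum>a\<in>K - {v}. slope_weights l v K a \<bullet> dird (a - v) (q K) v))"
      by (simp only: linear_sum[OF l(1)] linear_add[OF l(1)] value_weights_apply[OF l(1)] slope_weights_apply[OF l(1)])
  qed
  also have "\<dots> = (\<Sum>v\<in>\<Union>\<K>. \<Sum>K\<in>star v. value_weights l v K \<bullet> q K v + (\<Sum>a\<in>K - {v}. slope_weights l v K a \<bullet> dird (a - v) (q K) v))"
    by (rule sum_star)
  also have "\<dots> = (\<Sum>v\<in>\<Union>\<K>. value_form v (value_weights l v) q + slope_form v (slope_weights l v) q)"
    unfolding value_form_def slope_form_def sum.distrib ..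
  finally show ?thesis .
qed

text \<open>If the first-order jets vanish at all vertices but one, only that vertex
  contributes.\<close>

lemma functional_local:
  assumes l: "linear l" "\<And>d. d \<in> Dfam 2 \<Longrightarrow> l d = (0::real)" and q: "q \<in> Qfam" and v: "v \<in> \<Union>\<K>"
    and z: "\<And>K w. K \<in> \<K> \<Longrightarrow> w \<in> K \<Longrightarrow> w \<noteq> v \<Longrightarrow> van 2 w (q K)"
  shows "l q = value_form v (value_weights l v) q + slope_form v (slope_weights l v) q"
proof -
  have "(\<Sum>w\<in>\<Union>\<K> - {v}. value_form w (value_weights l w) q + slope_form w (slope_weights l w) q) = 0"
  proof (rule sum.neutral, rule ballI)
    fix w assume w: "w \<in> \<Union>\<K> - {v}"
    have "van 2 w (q K)" if "K \<in> star w" for K using z[OF starD(1,2)[OF that]] w by blast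
    note van2_D[OF this]
    then show "value_form w (value_weights l w) q + slope_form w (slope_weights l w) q = 0" unfolding value_form_def slope_form_def by simp
  qed
  moreover have "l q = (\<Sum>w\<in>\<Union>\<K>. value_form w (value_weights l w) q + slope_form w (slope_weights l w) q)" by (rule functional_sees_jets[OF l q])
  moreover have "\<dots> = (value_form v (value_weights l v) q + slope_form v (slope_weights l v) q) + (\<Sum>w\<in>\<Union>\<K> - {v}. value_form w (value_weights l w) q + slope_form w (slope_weights l w) q)"
    by (rule sum.remove[OF finite_vertices v])
  ultimately show ?thesis by simp
qed

subsection \<open>Edge and element test stresses\<close>

text \<open>Test stress with tangential derivative \<open>A\<close> at \<open>v\<close> on the
  edge to \<open>a\<close> and zero on the other edges at \<open>v\<close>. It is only
  continuous.\<close>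

definition edge_stress :: "point \<Rightarrow> point \<Rightarrow> real ^ 2 ^ 2 \<Rightarrow> point set \<Rightarrow> point \<Rightarrow> real ^ 2 ^ 2" where
  "edge_stress v a A K = (if K \<in> \<K> then \<lambda>x. (bary K a x * chi (bary K v x)) *\<^sub>R A else (\<lambda>x. 0))"

text \<open>Test stress with second tangential derivative \<open>2 A\<close> at \<open>v\<close>
  on the edge to \<open>a\<close>. Its value and gradient at \<open>v\<close> are zero.\<close>

definition edge_stress2 :: "point \<Rightarrow> point \<Rightarrow> real ^ 2 ^ 2 \<Rightarrow> point set \<Rightarrow> point \<Rightarrow> real ^ 2 ^ 2" where
  "edge_stress2 v a A K = (if K \<in> \<K> then \<lambda>x. (bary K a x ^ 2 * bary K v x ^ 3) *\<^sub>R A else (\<lambda>x. 0))"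

text \<open>Test stress on a single element with mixed derivative \<open>A\<close> at
  \<open>v\<close>; it vanishes on all edges.\<close>

definition corner_stress :: "point \<Rightarrow> point \<Rightarrow> point \<Rightarrow> real ^ 2 ^ 2 \<Rightarrow> point set \<Rightarrow> point \<Rightarrow> real ^ 2 ^ 2" where
  "corner_stress v a b A K x = (bary K a x * bary K b x * bary K v x ^ 3) *\<^sub>R A"

lemma van_smult: "poly_map f \<Longrightarrow> van m v f \<Longrightarrow> van m v (\<lambda>x. f x *\<^sub>R A)"
  using van_mult_scaleR[of f "\<lambda>x. A" m v 0] by simp

lemma chi_polymap: "tri K \<Longrightarrow> poly_map (\<lambda>x. chi (bary K v x))"
  by (rule poly_mapI[OF chi_poly[OF bary_poly]])

lemma van_chi_other:
  assumes "tri K" "w \<in> K" "w \<noteq> v" shows "van 3 w (\<lambda>x. chi (bary K v x))"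
  by (cases "v \<in> K") (use van_chi(2)[OF assms(1) _ assms(2,3)] in simp_all)

lemma edge_stress_facts:
  assumes av: "a \<noteq> v" and A: "A \<in> sym_matrices"
  shows "edge_stress v a A \<in> Sfam 0"
    "K \<in> \<K> \<Longrightarrow> w \<in> K \<Longrightarrow> w \<noteq> v \<Longrightarrow> van 2 w (pdiv (edge_stress v a A K))"
    "K \<in> star v \<Longrightarrow> van 2 v (\<lambda>x. pdiv (edge_stress v a A K) x - A *v gr K a)"
proof -
  have e: "edge_stress v a A K = (\<lambda>x. (bary K a x * chi (bary K v x)) *\<^sub>R A)" if "K \<in> \<K>" for K using that by (simp add: edge_stress_def)
  have pf: "poly_map (\<lambda>x. bary K a x * chi (bary K v x))" if "K \<in> \<K>" for K
    by (rule poly_map_mult[OF bary_poly_map[OF tris[OF that]] chi_polymap[OF tris[OF that]]])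
  have pk: "edge_stress v a A K \<in> poly_maps k" if K: "K \<in> \<K>" for K
  proof -
    have "(\<lambda>x. (bary K a x * chi (bary K v x)) *\<^sub>R A) \<in> poly_maps (1 + 4 + 0)"
      by (rule poly_maps_mult_scaleR[OF poly_maps_mult[OF bary_poly[OF tris[OF K]] chi_poly[OF bary_poly[OF tris[OF K]]]] poly_maps_const])
    then show ?thesis unfolding e[OF K] by (rule poly_maps_mono) (use k7 in simp)
  qed
  have v3: "van 3 w (edge_stress v a A K)" if K: "K \<in> \<K>" "w \<in> K" "w \<noteq> v" for K w
  proof -
    have "van (0 + 3) w (\<lambda>x. bary K a x * chi (bary K v x))"
      by (rule van_mult[OF bary_poly_map[OF tris[OF K(1)]] chi_polymap[OF tris[OF K(1)]] van_0 van_chi_other[OF tris[OF K(1)] K(2,3)]])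
    then show ?thesis unfolding e[OF K(1)] by (intro van_smult[OF pf[OF K(1)]]) simp
  qed
  have v1: "van 1 w (edge_stress v a A K)" if K: "K \<in> \<K>" "w \<in> K" for K w
  proof (rule van_1I)
    show "edge_stress v a A K w = 0" unfolding e[OF K(1)] using av by (auto simp: bary_vertex[OF tris[OF K(1)] K(2)])
  qed
  show "edge_stress v a A \<in> Sfam 0"
  proof (rule SfamI)
    fix K K' w assume K: "K \<in> \<K>" "K' \<in> \<K>" "w \<in> K" "w \<in> K'"
    have "van 1 w (\<lambda>x. edge_stress v a A K x - edge_stress v a A K' x)"
      by (rule van_diff[OF poly_mapI[OF pk[OF K(1)]] poly_mapI[OF pk[OF K(2)]] v1[OF K(1,3)] v1[OF K(2,4)]])
    then show "van (Suc 0) w (\<lambda>x. edge_stress v a A K x - edge_stress v a A K' x)" by simp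
  next
    fix K K' x assume K: "K \<in> \<K>" "K' \<in> \<K>" "x \<in> convex hull K" "x \<in> convex hull K'"
    show "edge_stress v a A K x = edge_stress v a A K' x" unfolding e[OF K(1)] e[OF K(2)] bary_agree[OF K] ..
  next
    fix K x assume K: "K \<in> \<K>"
    show "edge_stress v a A K \<in> poly_maps k" by (rule pk[OF K])
    show "edge_stress v a A K x \<in> sym_matrices" unfolding e[OF K] by (rule sym_scaleR[OF A])
  qed (simp add: edge_stress_def)
  show "van 2 w (pdiv (edge_stress v a A K))" if K: "K \<in> \<K>" "w \<in> K" "w \<noteq> v" for K w
    using van_pdiv[OF poly_mapI[OF pk[OF K(1)]] v3[OF K]] by simp
  show "van 2 v (\<lambda>x. pdiv (edge_stress v a A K) x - A *v gr K a)" if Ks: "K \<in> star v" for K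
  proof -
    note K = starD(1,2)[OF Ks] and t = starD(3)[OF Ks]
    note b = bary_poly_map[OF t]
    have p: "poly_map (\<lambda>x. chi (bary K v x) - 1)" by (rule poly_map_diff[OF chi_polymap[OF t] poly_map_const])
    have "van (1 + 2) v (\<lambda>x. bary K a x * (chi (bary K v x) - 1))"
      by (rule van_mult[OF b p van_bary[OF t K(2) av] van_chi(1)[OF t K(2)]])
    from van_smult[OF poly_map_mult[OF b p] this, of A]
    have "van 3 v (\<lambda>x. edge_stress v a A K x - bary K a x *\<^sub>R A)" unfolding e[OF K(1)] by (simp add: algebra_simps numeral_3_eq_3)
    from van_pdiv[OF poly_map_diff[OF poly_mapI[OF pk[OF K(1)]] poly_map_mult_scaleR[OF b poly_map_const]] this]
    show ?thesis
      by (simp add: pdiv_diff[OF poly_mapI[OF pk[OF K(1)]] poly_map_mult_scaleR[OF b poly_map_const]]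
          pdiv_const_mult[OF b] grd_bary[OF t])
  qed
qed

lemma edge_stress2_facts:
  assumes av: "a \<noteq> v" and A: "A \<in> sym_matrices"
  shows "edge_stress2 v a A \<in> Sfam 1"
    "K \<in> \<K> \<Longrightarrow> w \<in> K \<Longrightarrow> w \<noteq> v \<Longrightarrow> van 2 w (pdiv (edge_stress2 v a A K))"
    "K \<in> star v \<Longrightarrow> van 2 v (\<lambda>x. pdiv (edge_stress2 v a A K) x - bary K a x *\<^sub>R (2 *\<^sub>R (A *v gr K a)))"
proof -
  have e: "edge_stress2 v a A K = (\<lambda>x. (bary K a x ^ 2 * bary K v x ^ 3) *\<^sub>R A)" if "K \<in> \<K>" for K using that by (simp add: edge_stress2_def)
  have pf: "poly_map (\<lambda>x. bary K a x ^ 2 * bary K v x ^ 3)" if "K \<in> \<K>" for K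
    by (rule poly_map_mult[OF poly_map_power[OF bary_poly_map[OF tris[OF that]]] poly_map_power[OF bary_poly_map[OF tris[OF that]]]])
  have pk: "edge_stress2 v a A K \<in> poly_maps k" if K: "K \<in> \<K>" for K
  proof -
    note b = bary_poly[OF tris[OF K]]
    have "(\<lambda>x. (bary K a x ^ 2 * bary K v x ^ 3) *\<^sub>R A) \<in> poly_maps (1 * 2 + 1 * 3 + 0)"
      by (rule poly_maps_mult_scaleR[OF poly_maps_mult[OF poly_maps_power[OF b] poly_maps_power[OF b]] poly_maps_const])
    then show ?thesis unfolding e[OF K] by (rule poly_maps_mono) (use k7 in simp)
  qed
  have v3: "van 3 w (edge_stress2 v a A K)" if K: "K \<in> \<K>" "w \<in> K" "w \<noteq> v" for K w
  proof -
    note b = bary_poly_map[OF tris[OF K(1)]]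
    have "van (0 + 1 * 3) w (\<lambda>x. bary K a x ^ 2 * bary K v x ^ 3)"
      by (rule van_mult[OF poly_map_power[OF b] poly_map_power[OF b] van_0 van_power[OF b van_bary[OF tris[OF K(1)] K(2) K(3)[symmetric]]]])
    then show ?thesis unfolding e[OF K(1)] by (intro van_smult[OF pf[OF K(1)]]) simp
  qed
  have v2: "van 2 w (edge_stress2 v a A K)" if K: "K \<in> \<K>" "w \<in> K" for K w
  proof (cases "w = v")
    case True
    note b = bary_poly_map[OF tris[OF K(1)]]
    have "van (1 * 2 + 0) w (\<lambda>x. bary K a x ^ 2 * bary K v x ^ 3)"
      by (rule van_mult[OF poly_map_power[OF b] poly_map_power[OF b] van_power[OF b van_bary[OF tris[OF K(1)] K(2)]] van_0])
        (use True av in simp)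
    then show ?thesis unfolding e[OF K(1)] by (intro van_smult[OF pf[OF K(1)]]) simp
  next
    case False
    show ?thesis by (rule van_mono[OF v3[OF K False]]) simp
  qed
  show "edge_stress2 v a A \<in> Sfam 1"
  proof (rule SfamI)
    fix K K' w assume K: "K \<in> \<K>" "K' \<in> \<K>" "w \<in> K" "w \<in> K'"
    have "van 2 w (\<lambda>x. edge_stress2 v a A K x - edge_stress2 v a A K' x)"
      by (rule van_diff[OF poly_mapI[OF pk[OF K(1)]] poly_mapI[OF pk[OF K(2)]] v2[OF K(1,3)] v2[OF K(2,4)]])
    then show "van (Suc 1) w (\<lambda>x. edge_stress2 v a A K x - edge_stress2 v a A K' x)" by (simp add: numeral_2_eq_2)
  next
    fix K K' x assume K: "K \<in> \<K>" "K' \<in> \<K>" "x \<in> convex hull K" "x \<in> convex hull K'"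
    show "edge_stress2 v a A K x = edge_stress2 v a A K' x" unfolding e[OF K(1)] e[OF K(2)] bary_agree[OF K] ..
  next
    fix K x assume K: "K \<in> \<K>"
    show "edge_stress2 v a A K \<in> poly_maps k" by (rule pk[OF K])
    show "edge_stress2 v a A K x \<in> sym_matrices" unfolding e[OF K] by (rule sym_scaleR[OF A])
  qed (simp add: edge_stress2_def)
  show "van 2 w (pdiv (edge_stress2 v a A K))" if K: "K \<in> \<K>" "w \<in> K" "w \<noteq> v" for K w
    using van_pdiv[OF poly_mapI[OF pk[OF K(1)]] v3[OF K]] by simp
  show "van 2 v (\<lambda>x. pdiv (edge_stress2 v a A K) x - bary K a x *\<^sub>R (2 *\<^sub>R (A *v gr K a)))" if Ks: "K \<in> star v" for K
  proof -
    note K = starD(1,2)[OF Ks] and t = starD(3)[OF Ks]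
    note b = bary_poly_map[OF t]
    have p: "poly_map (\<lambda>x. bary K v x ^ 3 - 1)" by (rule poly_map_diff[OF poly_map_power[OF b] poly_map_const])
    have "van (1 * 2 + 1) v (\<lambda>x. bary K a x ^ 2 * (bary K v x ^ 3 - 1))"
      by (rule van_mult[OF poly_map_power[OF b] p van_power[OF b van_bary[OF t K(2) av]] van_power_minus_one[OF t K(2)]])
    from van_smult[OF poly_map_mult[OF poly_map_power[OF b] p] this, of A]
    have "van 3 v (\<lambda>x. edge_stress2 v a A K x - (bary K a x * bary K a x) *\<^sub>R A)"
      unfolding e[OF K(1)] by (simp add: algebra_simps numeral_3_eq_3 power2_eq_square)
    from van_pdiv[OF poly_map_diff[OF poly_mapI[OF pk[OF K(1)]] poly_map_mult_scaleR[OF poly_map_mult[OF b b] poly_map_const]] this]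
    have "van 2 v (\<lambda>x. pdiv (edge_stress2 v a A K) x - A *v (bary K a x *\<^sub>R gr K a + bary K a x *\<^sub>R gr K a))"
      by (simp add: pdiv_diff[OF poly_mapI[OF pk[OF K(1)]] poly_map_mult_scaleR[OF poly_map_mult[OF b b] poly_map_const]]
          pdiv_const_mult[OF poly_map_mult[OF b b]] grd_mult[OF b b] grd_bary[OF t])
    moreover have "A *v (bary K a x *\<^sub>R gr K a + bary K a x *\<^sub>R gr K a) = bary K a x *\<^sub>R (2 *\<^sub>R (A *v gr K a))" for x
      by (simp add: scaleR_left_distrib[symmetric] matrix_vector_mult_scaleR)
    ultimately show ?thesis by simp
  qed
qed

lemma corner_stress_facts:
  assumes Ks: "K \<in> star v" and k: "K = {v, a, b}" "cr (a - v) (b - v) \<noteq> 0" and A: "A \<in> sym_matrices"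
  shows "single K (corner_stress v a b A K) \<in> Sfam 1"
    "w \<in> K \<Longrightarrow> w \<noteq> v \<Longrightarrow> van 2 w (pdiv (corner_stress v a b A K))"
    "van 2 v (\<lambda>x. pdiv (corner_stress v a b A K) x - (bary K a x *\<^sub>R (A *v gr K b) + bary K b x *\<^sub>R (A *v gr K a)))"
    "poly_map (corner_stress v a b A K)"
proof -
  note K = starD(1,2)[OF Ks] and t = starD(3)[OF Ks]
  note b = bary_poly_map[OF t] and bp = bary_poly[OF t]
  have dab: "a \<noteq> v" "b \<noteq> v" using cr_distinct[OF k(2)] by auto
  have e: "corner_stress v a b A K = (\<lambda>x. (bary K a x * bary K b x * bary K v x ^ 3) *\<^sub>R A)" by (rule ext) (simp add: corner_stress_def)
  note pab = poly_map_mult[OF b b, of a b]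
  have pf: "poly_map (\<lambda>x. bary K a x * bary K b x * bary K v x ^ 3)"
    by (rule poly_map_mult[OF pab poly_map_power[OF b]])
  have pk: "corner_stress v a b A K \<in> poly_maps k"
  proof -
    have "(\<lambda>x. (bary K a x * bary K b x * bary K v x ^ 3) *\<^sub>R A) \<in> poly_maps (1 + 1 + 1 * 3 + 0)"
      by (rule poly_maps_mult_scaleR[OF poly_maps_mult[OF poly_maps_mult[OF bp bp] poly_maps_power[OF bp]] poly_maps_const])
    then show ?thesis unfolding e by (rule poly_maps_mono) (use k7 in simp)
  qed
  show pp: "poly_map (corner_stress v a b A K)" by (rule poly_mapI[OF pk])
  have v3: "van 3 w (corner_stress v a b A K)" if w: "w \<in> K" "w \<noteq> v" for w
  proof -
    have "van (0 + 1 * 3) w (\<lambda>x. bary K a x * bary K b x * bary K v x ^ 3)"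
      by (rule van_mult[OF pab poly_map_power[OF b] van_0 van_power[OF b van_bary[OF t w(1) w(2)[symmetric]]]])
    then show ?thesis unfolding e by (intro van_smult[OF pf]) simp
  qed
  have vab: "van 2 v (\<lambda>x. bary K a x * bary K b x)"
    using van_mult[OF b b van_bary[OF t K(2) dab(1)] van_bary[OF t K(2) dab(2)]] by (simp add: numeral_2_eq_2)
  have v2: "van 2 w (corner_stress v a b A K)" if w: "w \<in> K" for w
  proof (cases "w = v")
    case True
    have "van (2 + 0) v (\<lambda>x. bary K a x * bary K b x * bary K v x ^ 3)"
      by (rule van_mult[OF pab poly_map_power[OF b] vab van_0])
    then show ?thesis unfolding e True by (intro van_smult[OF pf]) simp
  next
    case False
    show ?thesis by (rule van_mono[OF v3[OF w False]]) simp
  qed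
  show "single K (corner_stress v a b A K) \<in> Sfam 1"
  proof (rule Sfam_single[OF K(1) pk])
    show "corner_stress v a b A K x \<in> sym_matrices" for x unfolding e by (rule sym_scaleR[OF A])
    show "corner_stress v a b A K x = 0" if "c \<in> K" "bary K c x = 0" for c x
    proof -
      have "c = v \<or> c = a \<or> c = b" using that(1) k(1) by blast
      then show ?thesis unfolding e using that(2) by auto
    qed
    show "van (Suc 1) w (corner_stress v a b A K)" if "w \<in> K" for w using v2[OF that] by (simp add: numeral_2_eq_2)
  qed
  show "van 2 w (pdiv (corner_stress v a b A K))" if "w \<in> K" "w \<noteq> v"
    using van_pdiv[OF pp v3[OF that]] by simp
  have p: "poly_map (\<lambda>x. bary K v x ^ 3 - 1)" by (rule poly_map_diff[OF poly_map_power[OF b] poly_map_const])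
  have "van (2 + 1) v (\<lambda>x. bary K a x * bary K b x * (bary K v x ^ 3 - 1))"
    by (rule van_mult[OF pab p vab van_power_minus_one[OF t K(2)]])
  from van_smult[OF poly_map_mult[OF pab p] this, of A]
  have "van 3 v (\<lambda>x. corner_stress v a b A K x - (bary K a x * bary K b x) *\<^sub>R A)"
    unfolding e by (simp add: algebra_simps numeral_3_eq_3)
  from van_pdiv[OF poly_map_diff[OF pp poly_map_mult_scaleR[OF pab poly_map_const]] this]
  have "van 2 v (\<lambda>x. pdiv (corner_stress v a b A K) x - A *v (bary K a x *\<^sub>R gr K b + bary K b x *\<^sub>R gr K a))"
    by (simp add: pdiv_diff[OF pp poly_map_mult_scaleR[OF pab poly_map_const]]
        pdiv_const_mult[OF pab] grd_mult[OF b b] grd_bary[OF t])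
  then show "van 2 v (\<lambda>x. pdiv (corner_stress v a b A K) x - (bary K a x *\<^sub>R (A *v gr K b) + bary K b x *\<^sub>R (A *v gr K a)))"
    by (simp add: matrix_vector_right_distrib matrix_vector_mult_scaleR)
qed

end

context mesh
begin

lemma inner_zero_sum: "(\<And>K. K \<in> star v \<Longrightarrow> w K = 0) \<Longrightarrow> value_form v w q = 0"
  unfolding value_form_def by (rule sum.neutral) simp

lemma value_form_restrict:
  assumes "\<And>K. K \<in> star v \<Longrightarrow> a \<notin> K \<Longrightarrow> f K = (0::real)"
  shows "(\<Sum>K\<in>star v. f K) = (\<Sum>K\<in>{K\<in>star v. a \<in> K}. f K)"
  by (rule sum.mono_neutral_right) (use assms in auto)

text \<open>Test the functional with the divergence of \<open>edge_stress\<close>.\<close>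

lemma Ann_functional:
  assumes l: "linear l" "\<And>d. d \<in> Dfam 0 \<Longrightarrow> l d = (0::real)" and v: "v \<in> \<Union>\<K>"
  shows "Ann v (value_weights l v)"
  unfolding Ann_def
proof (intro allI impI ballI)
  fix a A assume a: "a \<noteq> v" and A: "A \<in> sym_matrices"
  note f = edge_stress_facts[OF a A]
  let ?d = "\<lambda>K. pdiv (edge_stress v a A K)"
  have l2: "l d = 0" if "d \<in> Dfam 2" for d by (rule l(2)) (use that Dfam_antimono[of 0 2] in blast)
  have d: "?d \<in> Dfam 0" by (rule DfamI[OF f(1)])
  have dQ: "?d \<in> Qfam" using d Dfam_Qfam by (rule subsetD[rotated])
  have "0 = value_form v (value_weights l v) ?d + slope_form v (slope_weights l v) ?d"
    using functional_local[OF l(1) l2 dQ v f(2)] l(2)[OF d] by simp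
  moreover have "?d K v = A *v gr K a" "dird h (?d K) v = 0" if K: "K \<in> star v" for K h
  proof -
    note D = van2_diff_D[OF QfamD(3)[OF dQ] poly_map_const f(3)[OF K]]
    show "?d K v = A *v gr K a" by (rule D(1))
    show "dird h (?d K) v = 0" unfolding D(2) by (simp add: dird_def)
  qed
  note D = this
  have "slope_form v (slope_weights l v) ?d = 0" unfolding slope_form_def by (rule sum.neutral) (simp add: D(2))
  moreover have "value_form v (value_weights l v) ?d = (\<Sum>K\<in>star v. value_weights l v K \<bullet> (A *v gr K a))"
    unfolding value_form_def by (rule sum.cong[OF refl]) (simp only: D(1))
  moreover have "\<dots> = (\<Sum>K\<in>{K\<in>star v. a \<in> K}. value_weights l v K \<bullet> (A *v gr K a))"
    by (rule value_form_restrict) simp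
  ultimately show "(\<Sum>K\<in>{K\<in>star v. a \<in> K}. value_weights l v K \<bullet> (A *v gr K a)) = 0" by simp
qed

lemma value_form_single: "value_form v w (single K p) = (if K \<in> star v then w K \<bullet> p v else 0)"
proof -
  have "value_form v w (single K p) = (\<Sum>L\<in>star v. if L = K then w K \<bullet> p v else 0)"
    unfolding value_form_def by (rule sum.cong[OF refl]) (simp add: single_def)
  then show ?thesis by simp
qed

lemma slope_form_single: "slope_form v u (single K p) = (if K \<in> star v then \<Sum>a\<in>K - {v}. u K a \<bullet> dird (a - v) p v else 0)"
proof -
  have z: "dird h (\<lambda>x. 0 :: point) v = 0" for h by (simp add: dird_def)
  have "slope_form v u (single K p) = (\<Sum>L\<in>star v. if L = K then \<Sum>a\<in>K - {v}. u K a \<bullet> dird (a - v) p v else 0)"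
    unfolding slope_form_def by (rule sum.cong[OF refl]) (simp add: single_def z)
  then show ?thesis by simp
qed

text \<open>Test the functional with the divergences of \<open>edge_stress2\<close> and
  \<open>corner_stress\<close>. They are continuously differentiable at the vertices, which is
  why this already holds for functionals that vanish on \<open>Dfam 1\<close>.\<close>

lemma Ann2_functional:
  assumes l: "linear l" "\<And>d. d \<in> Dfam 1 \<Longrightarrow> l d = (0::real)" and v: "v \<in> \<Union>\<K>"
  shows "Ann2 v (slope_weights l v)"
  unfolding Ann2_def
proof (intro conjI allI impI ballI)
  have l2: "l d = 0" if "d \<in> Dfam 2" for d by (rule l(2)) (use that Dfam_antimono[of 1 2] in auto)
  {
    fix a A assume a: "a \<noteq> v" and A: "A \<in> sym_matrices"
    note f = edge_stress2_facts[OF a A]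
    let ?d = "\<lambda>K. pdiv (edge_stress2 v a A K)"
    have d: "?d \<in> Dfam 1" by (rule DfamI[OF f(1)])
    have dQ: "?d \<in> Qfam" using d Dfam_Qfam by (rule subsetD[rotated])
    have eq: "0 = value_form v (value_weights l v) ?d + slope_form v (slope_weights l v) ?d"
      using functional_local[OF l(1) l2 dQ v f(2)] l(2)[OF d] by simp
    have D: "?d K v = 0" "dird h (?d K) v = (gr K a \<bullet> h) *\<^sub>R (2 *\<^sub>R (A *v gr K a))" if K: "K \<in> star v" for K h
    proof -
      note pb = poly_map_mult_scaleR[OF bary_poly_map[OF starD(3)[OF K]] poly_map_const]
      note D = van2_diff_D[OF QfamD(3)[OF dQ] pb f(3)[OF K]]
      show "?d K v = 0" unfolding D(1) using a by (simp add: bary_vertex[OF starD(3,2)[OF K]])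
      show "dird h (?d K) v = (gr K a \<bullet> h) *\<^sub>R (2 *\<^sub>R (A *v gr K a))"
        unfolding D(2) dird_bary[OF starD(3)[OF K]] ..
    qed
    have "value_form v (value_weights l v) ?d = 0" unfolding value_form_def by (rule sum.neutral) (simp add: D(1))
    moreover have "slope_form v (slope_weights l v) ?d = (\<Sum>K\<in>star v. if a \<in> K then 2 * (slope_weights l v K a \<bullet> (A *v gr K a)) else 0)"
      unfolding slope_form_def
    proof (rule sum.cong[OF refl])
      fix K assume K: "K \<in> star v"
      have "(\<Sum>c\<in>K - {v}. slope_weights l v K c \<bullet> dird (c - v) (?d K) v)
         = (\<Sum>c\<in>K - {v}. if c = a then 2 * (slope_weights l v K a \<bullet> (A *v gr K a)) else 0)"
      proof (rule sum.cong[OF refl])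
        fix c assume c: "c \<in> K - {v}"
        show "slope_weights l v K c \<bullet> dird (c - v) (?d K) v = (if c = a then 2 * (slope_weights l v K a \<bullet> (A *v gr K a)) else 0)"
        proof (cases "a \<in> K")
          case True
          have "gr K a \<bullet> (c - v) = (if c = a then 1 else 0)"
            by (rule gr_edge[OF starD(3,2)[OF K] True a]) (use c in blast)
          then show ?thesis unfolding D(2)[OF K] by simp
        next
          case False
          then show ?thesis unfolding D(2)[OF K] using c by auto
        qed
      qed
      also have "\<dots> = (if a \<in> K then 2 * (slope_weights l v K a \<bullet> (A *v gr K a)) else 0)"
        using a tri_finite[OF starD(3)[OF K]] by simp
      finally show "(\<Sum>c\<in>K - {v}. slope_weights l v K c \<bullet> dird (c - v) (?d K) v) = (if a \<in> K then 2 * (slope_weights l v K a \<bullet> (A *v gr K a)) else 0)" .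
    qed
    moreover have "\<dots> = (\<Sum>K\<in>{K\<in>star v. a \<in> K}. if a \<in> K then 2 * (slope_weights l v K a \<bullet> (A *v gr K a)) else 0)"
      by (rule value_form_restrict) simp
    moreover have "\<dots> = (\<Sum>K\<in>{K\<in>star v. a \<in> K}. 2 * (slope_weights l v K a \<bullet> (A *v gr K a)))"
      by (rule sum.cong[OF refl]) simp
    ultimately have "2 * (\<Sum>K\<in>{K\<in>star v. a \<in> K}. slope_weights l v K a \<bullet> (A *v gr K a)) = 0"
      using eq by (simp add: sum_distrib_left)
    then show "(\<Sum>K\<in>{K\<in>star v. a \<in> K}. slope_weights l v K a \<bullet> (A *v gr K a)) = 0" by simp
  next
    fix K a b M assume K: "K \<in> star v" and k1: "K = {v, a, b}" and M: "M \<in> sym_matrices"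
    have k2: "cr (a - v) (b - v) \<noteq> 0"
    proof -
      obtain x y where xy: "K = {v, x, y}" "cr (x - v) (y - v) \<noteq> 0" using star_tri[OF K] .
      have "x \<in> {v, a, b}" "y \<in> {v, a, b}" using xy(1) k1 by blast+
      then show ?thesis using xy(2) cr_distinct[OF xy(2)] cr_swap[of "a - v" "b - v"] by auto
    qed
    note k = k1 k2 and t = starD(3)[OF K]
    note f = corner_stress_facts[OF K k M]
    let ?p = "pdiv (corner_stress v a b M K)"
    have dab: "a \<noteq> v" "b \<noteq> v" "a \<noteq> b" using cr_distinct[OF k(2)] by auto
    have "(\<lambda>L. pdiv (single K (corner_stress v a b M K) L)) = single K ?p" by (rule ext) (simp add: single_def)
    then have d: "single K ?p \<in> Dfam 1" using DfamI[OF f(1)] by simp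
    have dQ: "single K ?p \<in> Qfam" using d Dfam_Qfam by (rule subsetD[rotated])
    have z: "van 2 w (single K ?p L)" if "L \<in> \<K>" "w \<in> L" "w \<noteq> v" for L w
    proof (cases "L = K")
      case True
      then show ?thesis using f(2)[of w] that by (simp add: single_def)
    next
      case False
      then have "single K ?p L = (\<lambda>x. 0)" by (simp add: single_def)
      then show ?thesis using van_zero by simp
    qed
    have eq: "0 = value_form v (value_weights l v) (single K ?p) + slope_form v (slope_weights l v) (single K ?p)"
      using functional_local[OF l(1) l2 dQ v z] l(2)[OF d] by simp
    note pb = poly_map_mult_scaleR[OF bary_poly_map[OF t] poly_map_const]
    note D = van2_diff_D[OF poly_map_pdiv[OF f(4)] poly_map_add[OF pb pb] f(3)]
    have D1: "?p v = 0" unfolding D(1) using dab by (simp add: bary_vertex[OF t starD(2)[OF K]])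
    have D2: "dird h ?p v = (gr K a \<bullet> h) *\<^sub>R (M *v gr K b) + (gr K b \<bullet> h) *\<^sub>R (M *v gr K a)" for h
      unfolding D(2) dird_add[OF pb pb] dird_bary[OF t] ..
    have "value_form v (value_weights l v) (single K ?p) = 0" unfolding value_form_single D1 by simp
    moreover have "slope_form v (slope_weights l v) (single K ?p) = slope_weights l v K a \<bullet> (M *v gr K b) + slope_weights l v K b \<bullet> (M *v gr K a)"
      unfolding slope_form_single prod_link(3)[OF k] D2 gr_dual[OF k] using K by simp
    ultimately show "slope_weights l v K a \<bullet> (M *v gr K b) + slope_weights l v K b \<bullet> (M *v gr K a) = 0" using eq by simp
  }
qed

text \<open>A constant vector at one vertex, and zero at the others, is the first-order jet of
  the divergence of a smooth stress, by \<open>jet_potential\<close> and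
  \<open>vert\<close>.\<close>

lemma value_weights_sum_zero:
  assumes l: "linear l" "\<And>d. d \<in> Dfam 2 \<Longrightarrow> l d = (0::real)" and v: "v \<in> \<Union>\<K>"
  shows "(\<Sum>K\<in>star v. value_weights l v K) \<bullet> c = 0"
proof -
  obtain \<tau> where \<tau>: "\<tau> \<in> poly_maps 2" "\<forall>x. \<tau> x \<in> sym_matrices" "\<tau> v = 0" "van 2 v (\<lambda>x. c - pdiv \<tau> x)"
    using jet_potential[OF poly_map_const[of c], of v] by blast
  let ?d = "\<lambda>K. pdiv (vert v \<tau> K)"
  have "vert v \<tau> \<in> Sfam 2" by (rule Sfam_vert[OF \<tau>(1,3) \<tau>(2)[rule_format]])
  then have d: "?d \<in> Dfam 2" by (rule DfamI)
  have dQ: "?d \<in> Qfam" using d Dfam_Qfam by (rule subsetD[rotated])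
  have "0 = value_form v (value_weights l v) ?d + slope_form v (slope_weights l v) ?d"
    using functional_local[OF l dQ v pdiv_vert_jets(1)[OF \<tau>(1,3)]] l(2)[OF d] by simp
  moreover have D: "?d K v = c" "dird h (?d K) v = 0" if K: "K \<in> star v" for K h
  proof -
    note p = poly_map_pdiv[OF poly_mapI[OF \<tau>(1)]]
    note D = van2_diff_D[OF QfamD(3)[OF dQ] p pdiv_vert_jets(2)[OF \<tau>(1,3) starD(1,2)[OF K] refl]]
    note D' = van2_diff_D[OF poly_map_const p \<tau>(4)]
    show "?d K v = c" unfolding D(1) D'(1)[symmetric] ..
    show "dird h (?d K) v = 0" unfolding D(2) D'(2)[symmetric] by (simp add: dird_def)
  qed
  moreover have "slope_form v (slope_weights l v) ?d = 0" unfolding slope_form_def by (rule sum.neutral) (simp add: D(2))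
  moreover have "value_form v (value_weights l v) ?d = (\<Sum>K\<in>star v. value_weights l v K \<bullet> c)"
    unfolding value_form_def by (rule sum.cong[OF refl]) (simp only: D(1))
  ultimately show ?thesis by (simp add: inner_sum_left)
qed

subsection \<open>The defining functionals of the range\<close>

text \<open>A choice of direction vectors for the lines at a singular vertex.\<close>

definition chosen_frame :: "point \<Rightarrow> point \<times> point" where
  "chosen_frame v = (SOME p. (typeI v \<longrightarrow> frame2 v (fst p) (snd p)) \<and> (typeII v \<longrightarrow> frame3 v (fst p) (snd p)))"

lemma chosen_frame_frame: "typeI v \<Longrightarrow> frame2 v (fst (chosen_frame v)) (snd (chosen_frame v))" "typeII v \<Longrightarrow> frame3 v (fst (chosen_frame v)) (snd (chosen_frame v))"
proof -
  have "\<exists>p. (typeI v \<longrightarrow> frame2 v (fst p) (snd p)) \<and> (typeII v \<longrightarrow> frame3 v (fst p) (snd p))"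
  proof (cases "typeI v")
    case True
    then obtain d1 d2 where "frame2 v d1 d2" unfolding typeI_def by blast
    then show ?thesis using True unfolding typeII_def by (intro exI[of _ "(d1, d2)"]) auto
  next
    case False
    then show ?thesis
    proof (cases "typeII v")
      case True
      then obtain d1 d2 where "frame3 v d1 d2" unfolding typeII_def by blast
      then show ?thesis using False by (intro exI[of _ "(d1, d2)"]) auto
    qed simp
  qed
  from someI_ex[OF this, folded chosen_frame_def]
  show "typeI v \<Longrightarrow> frame2 v (fst (chosen_frame v)) (snd (chosen_frame v))" "typeII v \<Longrightarrow> frame3 v (fst (chosen_frame v)) (snd (chosen_frame v))"
    by blast+
qed

lemma not_both: "typeI v \<Longrightarrow> \<not> typeII v"
  unfolding typeI_def typeII_def by blast

text \<open>The functionals that cut out the ranges, indexed by a singular vertex and a number: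
  0 and 1 are the value weights of the two completions of a frame, 2 is the slope weight. At a
  vertex of Type II only number 0 is used.\<close>

definition obstruction :: "point \<times> nat \<Rightarrow> (point set \<Rightarrow> point \<Rightarrow> point) \<Rightarrow> real" where
  "obstruction i q = (let v = fst i; d = fst (chosen_frame v); e = snd (chosen_frame v) in
     if snd i = 0 then value_form v (frame_weight d e v) q else if snd i = 1 then value_form v (frame_weight d (- e) v) q else slope_form v (cross_weight d e v) q)"

lemma obstruction_simps:
  "obstruction (v, 0) q = value_form v (frame_weight (fst (chosen_frame v)) (snd (chosen_frame v)) v) q"
  "obstruction (v, Suc 0) q = value_form v (frame_weight (fst (chosen_frame v)) (- snd (chosen_frame v)) v) q"
  "obstruction (v, 2) q = slope_form v (cross_weight (fst (chosen_frame v)) (snd (chosen_frame v)) v) q"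
  by (simp_all add: obstruction_def Let_def)

text \<open>One obstruction at each vertex of Type II and three at each vertex of Type I for
  stresses that are merely continuous.\<close>

definition obstructions0 :: "(point \<times> nat) set" where
  "obstructions0 = {v \<in> \<Union>\<K>. typeII v} \<times> {0} \<union> {v \<in> \<Union>\<K>. typeI v} \<times> {0, Suc 0, 2}"

text \<open>Stresses of class one at the vertices only meet the slope obstruction.\<close>

definition obstructions1 :: "(point \<times> nat) set" where "obstructions1 = {v \<in> \<Union>\<K>. typeI v} \<times> {2}"

lemma I_card: "finite obstructions0" "finite obstructions1" "obstructions1 \<subseteq> obstructions0" "card obstructions1 = card {v \<in> \<Union>\<K>. typeI v}"
  "card obstructions0 = card {v \<in> \<Union>\<K>. typeII v} + 3 * card {v \<in> \<Union>\<K>. typeI v}"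
proof -
  have f: "finite {v \<in> \<Union>\<K>. typeI v}" "finite {v \<in> \<Union>\<K>. typeII v}"
    by (rule finite_subset[OF _ finite_vertices], blast)+
  show "finite obstructions0" "finite obstructions1" unfolding obstructions0_def obstructions1_def using f by auto
  show "obstructions1 \<subseteq> obstructions0" unfolding obstructions0_def obstructions1_def by blast
  show "card obstructions1 = card {v \<in> \<Union>\<K>. typeI v}" unfolding obstructions1_def by (simp add: card_cartesian_product)
  have "card obstructions0 = card ({v \<in> \<Union>\<K>. typeII v} \<times> {0::nat}) + card ({v \<in> \<Union>\<K>. typeI v} \<times> {0, Suc 0, 2})"
    unfolding obstructions0_def by (rule card_Un_disjoint) (use f not_both in auto)
  then show "card obstructions0 = card {v \<in> \<Union>\<K>. typeII v} + 3 * card {v \<in> \<Union>\<K>. typeI v}"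
    by (simp add: card_cartesian_product)
qed

lemma interior_vertex_types: "typeI v \<Longrightarrow> interior_vertex v" "typeII v \<Longrightarrow> interior_vertex v"
  unfolding typeI_def typeII_def by blast+

lemma obstruction_Dfam:
  assumes i: "i \<in> obstructions0" and d: "d \<in> Dfam 0" shows "obstruction i d = 0"
proof -
  obtain s where s: "s \<in> Sfam 0" "d = (\<lambda>K. pdiv (s K))" using d by (rule DfamE)
  obtain v n where vn: "i = (v, n)" by fastforce
  have "(typeII v \<and> n = 0) \<or> (typeI v \<and> (n = 0 \<or> n = Suc 0 \<or> n = 2))" using i unfolding vn obstructions0_def by auto
  then show ?thesis
  proof (elim disjE conjE)
    assume t: "typeII v" and n: "n = 0"
    show ?thesis unfolding vn n obstruction_simps s(2) by (rule value_form_div[OF Ann_frame_weight[OF interior_vertex_types(2)[OF t] chosen_frame_frame(2)[OF t]] s(1)])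
  next
    assume t: "typeI v" and n: "n = 0"
    show ?thesis unfolding vn n obstruction_simps s(2)
      by (rule value_form_div[OF Ann_frame_weight[OF interior_vertex_types(1)[OF t] frame2_frame3(1)[OF chosen_frame_frame(1)[OF t]]] s(1)])
  next
    assume t: "typeI v" and n: "n = Suc 0"
    show ?thesis unfolding vn n obstruction_simps s(2)
      by (rule value_form_div[OF Ann_frame_weight[OF interior_vertex_types(1)[OF t] frame2_frame3(2)[OF chosen_frame_frame(1)[OF t]]] s(1)])
  next
    assume t: "typeI v" and n: "n = 2"
    show ?thesis unfolding vn n obstruction_simps s(2)
      by (rule slope_form_div[OF Ann2_cross_weight[OF interior_vertex_types(1)[OF t] chosen_frame_frame(1)[OF t]] s(1)])
  qed
qed

lemma value_form_cong_weights: "(\<And>K. K \<in> star v \<Longrightarrow> w K = w' K) \<Longrightarrow> value_form v w q = value_form v w' q"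
  unfolding value_form_def by (rule sum.cong[OF refl]) simp

lemma slope_form_cong_weights: "(\<And>K a. K \<in> star v \<Longrightarrow> a \<in> K \<Longrightarrow> a \<noteq> v \<Longrightarrow> u K a = u' K a) \<Longrightarrow> slope_form v u q = slope_form v u' q"
  unfolding slope_form_def by (rule sum.cong[OF refl], rule sum.cong[OF refl]) simp

lemma value_form_weights_linear: "value_form v (\<lambda>K. t *\<^sub>R w K) q = t * value_form v w q" "value_form v (\<lambda>K. w K + w' K) q = value_form v w q + value_form v w' q"
  unfolding value_form_def by (simp_all add: sum_distrib_left inner_add_left sum.distrib)

lemma slope_form_weights_linear: "slope_form v (\<lambda>K a. t *\<^sub>R u K a) q = t * slope_form v u q"
  unfolding slope_form_def by (simp add: sum_distrib_left)

lemma slope_form_zero: "(\<And>K a. K \<in> star v \<Longrightarrow> a \<in> K \<Longrightarrow> a \<noteq> v \<Longrightarrow> u K a = 0) \<Longrightarrow> slope_form v u q = 0"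
  unfolding slope_form_def by (rule sum.neutral, rule ballI, rule sum.neutral) simp

lemma slope_form_killed:
  assumes u: "Ann2 v u" and q: "typeI v \<Longrightarrow> obstruction (v, 2) q = 0" shows "slope_form v u q = 0"
proof (cases "typeI v")
  case False
  show ?thesis by (rule slope_form_zero, rule Ann2_zero[OF u]) (use False in blast)+
next
  case True
  from Ann2_typeI[OF u True chosen_frame_frame(1)[OF True]]
  obtain t where t: "\<forall>K\<in>star v. \<forall>a\<in>K. a \<noteq> v \<longrightarrow> u K a = t *\<^sub>R cross_weight (fst (chosen_frame v)) (snd (chosen_frame v)) v K a" ..
  have "slope_form v u q = slope_form v (\<lambda>K a. t *\<^sub>R cross_weight (fst (chosen_frame v)) (snd (chosen_frame v)) v K a) q"
    by (rule slope_form_cong_weights) (rule t[rule_format])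
  then show ?thesis unfolding slope_form_weights_linear using q[OF True] by (simp add: obstruction_simps)
qed

lemma value_form_killed:
  assumes w: "Ann v w" and q: "typeI v \<or> typeII v \<Longrightarrow> obstruction (v, 0) q = 0" "typeI v \<Longrightarrow> obstruction (v, Suc 0) q = 0"
  shows "value_form v w q = 0"
proof -
  consider "\<not> typeI v" "\<not> typeII v" | "typeI v" | "typeII v" by blast
  then show ?thesis
  proof cases
    case 1
    show ?thesis by (rule inner_zero_sum, rule Ann_regular[OF w 1])
  next
    case 2
    obtain t1 t2 where t: "\<forall>K\<in>star v. w K = t1 *\<^sub>R frame_weight (fst (chosen_frame v)) (snd (chosen_frame v)) v K + t2 *\<^sub>R frame_weight (fst (chosen_frame v)) (- snd (chosen_frame v)) v K"
      using Ann_typeI[OF w 2 chosen_frame_frame(1)[OF 2]] by (elim exE)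
    have "value_form v w q = value_form v (\<lambda>K. t1 *\<^sub>R frame_weight (fst (chosen_frame v)) (snd (chosen_frame v)) v K + t2 *\<^sub>R frame_weight (fst (chosen_frame v)) (- snd (chosen_frame v)) v K) q"
      by (rule value_form_cong_weights) (rule t[rule_format])
    then show ?thesis unfolding value_form_weights_linear using q 2 by (simp add: obstruction_simps)
  next
    case 3
    obtain t where t: "\<forall>K\<in>star v. w K = t *\<^sub>R frame_weight (fst (chosen_frame v)) (snd (chosen_frame v)) v K"
      using Ann_typeII[OF w 3 chosen_frame_frame(2)[OF 3]] by (elim exE)
    have "value_form v w q = value_form v (\<lambda>K. t *\<^sub>R frame_weight (fst (chosen_frame v)) (snd (chosen_frame v)) v K) q"
      by (rule value_form_cong_weights) (rule t[rule_format])
    then show ?thesis unfolding value_form_weights_linear using q 3 by (simp add: obstruction_simps)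
  qed
qed

text \<open>A functional that vanishes on the range is a sum of value and slope forms by
  \<open>functional_sees_jets\<close>, with weights that satisfy \<open>Ann\<close> and
  \<open>Ann2\<close>. These weights are classified, so the functional vanishes wherever the
  obstructions do; a point outside the range is separated from it by some functional.\<close>

lemma range0: "Dfam 0 = {q \<in> Qfam. \<forall>i\<in>obstructions0. obstruction i q = 0}"
proof (intro subset_antisym subsetI)
  fix q assume "q \<in> Dfam 0"
  then show "q \<in> {q \<in> Qfam. \<forall>i\<in>obstructions0. obstruction i q = 0}" using obstruction_Dfam Dfam_Qfam by blast
next
  fix q assume "q \<in> {q \<in> Qfam. \<forall>i\<in>obstructions0. obstruction i q = 0}"
  then have q: "q \<in> Qfam" and ph: "\<And>i. i \<in> obstructions0 \<Longrightarrow> obstruction i q = 0" by auto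
  show "q \<in> Dfam 0"
  proof (rule ccontr)
    assume "q \<notin> Dfam 0"
    obtain l :: "(point set \<Rightarrow> point \<Rightarrow> point) \<Rightarrow> real" where l: "linear l" "\<And>y. y \<in> Dfam 0 \<Longrightarrow> l y = 0" "l q = 1"
      using separating_functional[OF subspace_Dfam \<open>q \<notin> Dfam 0\<close>] by blast
    have l1: "l d = 0" if "d \<in> Dfam 1" for d by (rule l(2)) (use that Dfam_antimono[of 0 1] in auto)
    have l2: "l d = 0" if "d \<in> Dfam 2" for d by (rule l(2)) (use that Dfam_antimono[of 0 2] in auto)
    have "value_form v (value_weights l v) q + slope_form v (slope_weights l v) q = 0" if v: "v \<in> \<Union>\<K>" for v
    proof -
      have "slope_form v (slope_weights l v) q = 0"
        by (rule slope_form_killed[OF Ann2_functional[OF l(1) l1 v]], assumption, rule ph) (use v in \<open>simp add: obstructions0_def\<close>)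
      moreover have "value_form v (value_weights l v) q = 0"
        by (rule value_form_killed[OF Ann_functional[OF l(1,2) v]], assumption) (rule ph; use v in \<open>auto simp: obstructions0_def\<close>)+
      ultimately show ?thesis by simp
    qed
    then have "(\<Sum>v\<in>\<Union>\<K>. value_form v (value_weights l v) q + slope_form v (slope_weights l v) q) = 0" by (intro sum.neutral ballI)
    then have "l q = 0" using functional_sees_jets[OF l(1) l2 q] by simp
    then show False using l(3) by simp
  qed
qed

text \<open>As for \<open>range0\<close>, but the weights of values are only known to have sum
  zero. This suffices because the values at a vertex agree.\<close>

lemma range1: "Dfam 1 = {q \<in> Qsm 0. \<forall>i\<in>obstructions1. obstruction i q = 0}"
proof (intro subset_antisym subsetI)
  fix q assume q: "q \<in> Dfam 1"
  have "q \<in> Qsm 0" using q Dfam_Qsm[of 0] by auto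
  moreover have "q \<in> Dfam 0" using q Dfam_antimono[of 0 1] by auto
  ultimately show "q \<in> {q \<in> Qsm 0. \<forall>i\<in>obstructions1. obstruction i q = 0}" using obstruction_Dfam I_card(3) by blast
next
  fix q assume "q \<in> {q \<in> Qsm 0. \<forall>i\<in>obstructions1. obstruction i q = 0}"
  then have qs: "q \<in> Qsm 0" and ph: "\<And>i. i \<in> obstructions1 \<Longrightarrow> obstruction i q = 0" by auto
  have q: "q \<in> Qfam" using qs by (simp add: Qsm_def)
  show "q \<in> Dfam 1"
  proof (rule ccontr)
    assume "q \<notin> Dfam 1"
    obtain l :: "(point set \<Rightarrow> point \<Rightarrow> point) \<Rightarrow> real" where l: "linear l" "\<And>y. y \<in> Dfam 1 \<Longrightarrow> l y = 0" "l q = 1"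
      using separating_functional[OF subspace_Dfam \<open>q \<notin> Dfam 1\<close>] by blast
    have l2: "l d = 0" if "d \<in> Dfam 2" for d by (rule l(2)) (use that Dfam_antimono[of 1 2] in auto)
    have "value_form v (value_weights l v) q + slope_form v (slope_weights l v) q = 0" if v: "v \<in> \<Union>\<K>" for v
    proof -
      have "slope_form v (slope_weights l v) q = 0"
        by (rule slope_form_killed[OF Ann2_functional[OF l(1,2) v]], assumption, rule ph) (use v in \<open>simp add: obstructions1_def\<close>)
      moreover have "value_form v (value_weights l v) q = 0"
      proof -
        obtain K0 where K0: "K0 \<in> \<K>" "v \<in> K0" using v by blast
        have "q K v = q K0 v" if "K \<in> star v" for K
        proof -
          have "van (Suc 0) v (\<lambda>x. q K x - q K0 x)"
            using qs starD(1,2)[OF that] K0 unfolding Qsm_def by blast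
          from van_value[OF this] show ?thesis by simp
        qed
        then have "value_form v (value_weights l v) q = (\<Sum>K\<in>star v. value_weights l v K \<bullet> q K0 v)"
          unfolding value_form_def by (intro sum.cong refl) simp
        also have "\<dots> = (\<Sum>K\<in>star v. value_weights l v K) \<bullet> q K0 v" by (simp add: inner_sum_left)
        also have "\<dots> = 0" by (rule value_weights_sum_zero[OF l(1) l2 v])
        finally show ?thesis .
      qed
      ultimately show ?thesis by simp
    qed
    then have "(\<Sum>v\<in>\<Union>\<K>. value_form v (value_weights l v) q + slope_form v (slope_weights l v) q) = 0" by (intro sum.neutral ballI)
    then have "l q = 0" using functional_sees_jets[OF l(1) l2 q] by simp
    then show False using l(3) by simp
  qed
qed

end

section \<open>Codimensions\<close>

lemma dual_vector: "cr w1 w2 \<noteq> 0 \<Longrightarrow> \<exists>c. w1 \<bullet> c = 1 \<and> w2 \<bullet> c = (0::real)"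
  by (rule exI[of _ "(1 / cr w1 w2) *\<^sub>R rot w2"]) (simp add: inner_rot inner_commute[of _ "rot w2"] cr_def)

lemma dual_vector_single: "w \<noteq> 0 \<Longrightarrow> \<exists>c. (w :: point) \<bullet> c = 1"
  by (rule exI[of _ "(1 / (w \<bullet> w)) *\<^sub>R w"]) simp

context mesh
begin

text \<open>Monomials in one component on one element.\<close>

lemma Qfam_span: obtains B where "finite B" "Qfam \<subseteq> span B"
proof
  let ?m = "\<lambda>(K, i, j, s :: 2). single K (\<lambda>x :: point. (x $ 1 ^ i * x $ 2 ^ j) *\<^sub>R (axis s 1 :: point))"
  let ?B = "?m ` (\<K> \<times> {..k} \<times> {..k} \<times> UNIV)"
  show "finite ?B" using fin by simp
  have s: "single K p \<in> span ?B" if p: "p \<in> poly_maps (k - 1)" and K: "K \<in> \<K>" for K and p :: "point \<Rightarrow> point"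
    using p
  proof (induction rule: poly_maps_induct)
    case (monomial i j c)
    have c: "c = (\<Sum>s\<in>UNIV. c $ s *\<^sub>R axis s 1)" by (rule vec_expand)
    have "(\<lambda>x :: point. (x $ 1 ^ i * x $ 2 ^ j) *\<^sub>R c) = (\<lambda>x. \<Sum>s\<in>UNIV. c $ s *\<^sub>R ((x $ 1 ^ i * x $ 2 ^ j) *\<^sub>R axis s 1))"
      by (rule ext, subst c) (simp add: scaleR_sum_right mult.commute)
    then have "single K (\<lambda>x :: point. (x $ 1 ^ i * x $ 2 ^ j) *\<^sub>R c) = (\<Sum>s\<in>UNIV. c $ s *\<^sub>R ?m (K, i, j, s))"
      by (simp only: single_sum single_linear split)
    also have "\<dots> \<in> span ?B"
    proof (rule span_sum, rule span_scale, rule span_base, rule imageI)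
      fix s :: 2 show "(K, i, j, s) \<in> \<K> \<times> {..k} \<times> {..k} \<times> UNIV" using monomial K by auto
    qed
    finally show ?case .
  next
    case zero
    have "single K (\<lambda>x. 0 :: point) = 0" by (rule ext, rule ext) (simp add: single_def)
    then show ?case by (simp only: span_zero)
  next
    case (add p q)
    then show ?case unfolding single_linear(1) by (intro span_add)
  qed
  show "Qfam \<subseteq> span ?B"
  proof
    fix q assume q: "q \<in> Qfam"
    have "(\<Sum>K\<in>\<K>. single K (q K)) \<in> span ?B"
      by (rule span_sum) (rule s[OF QfamD(1)[OF q]])
    then show "q \<in> span ?B" by (simp only: Qfam_eq_sum_single[OF q, symmetric])
  qed
qed

lemma value_form_linear: "value_form v w (p + q) = value_form v w p + value_form v w q" "value_form v w (t *\<^sub>R q) = t * value_form v w q"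
  unfolding value_form_def by (simp_all add: scaleR_fun_def inner_add_right sum.distrib sum_distrib_left)

lemma slope_form_linear:
  assumes "p \<in> Qfam" "q \<in> Qfam"
  shows "slope_form v u (p + q) = slope_form v u p + slope_form v u q" "slope_form v u (t *\<^sub>R q) = t * slope_form v u q"
proof -
  have a: "dird h ((p + q) K) x = dird h (p K) x + dird h (q K) x" for h K x
    using dird_add[OF QfamD(3)[OF assms(1)] QfamD(3)[OF assms(2)], of h K K] by (simp add: plus_fun_def)
  have b: "dird h ((t *\<^sub>R q) K) x = t *\<^sub>R dird h (q K) x" for h K x
    using dird_scaleR[OF QfamD(3)[OF assms(2)], of h t K] by (simp add: scaleR_fun_def)
  show "slope_form v u (p + q) = slope_form v u p + slope_form v u q" "slope_form v u (t *\<^sub>R q) = t * slope_form v u q"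
    unfolding slope_form_def a b by (simp_all add: inner_add_right sum.distrib sum_distrib_left)
qed

lemma obstruction_linear:
  assumes "p \<in> Qfam" "q \<in> Qfam"
  shows "obstruction i (p + q) = obstruction i p + obstruction i q" "obstruction i (t *\<^sub>R q) = t * obstruction i q"
  unfolding obstruction_def Let_def by (simp_all only: value_form_linear slope_form_linear[OF assms] split: if_splits) simp_all

text \<open>Only the value form at \<open>v\<close> sees \<open>d0\<close>.\<close>

lemma d0_functionals:
  assumes K: "K \<in> star v"
  shows "value_form v' w (single K (d0 K v c)) = (if v' = v then w K \<bullet> c else 0)" "slope_form v' u (single K (d0 K v c)) = 0"
proof -
  note j = d0_jets(1,2)[OF starD(3,2)[OF K], of c] d0_jets(3)[OF starD(3,2)[OF K], where c = c]
  have pm: "poly_map (d0 K v c)" by (rule poly_mapI[OF j(1)])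
  note A = van2_diff_D[OF pm poly_map_const j(2)]
  have B: "d0 K v c v' = 0" "dird h (d0 K v c) v' = 0" if "K \<in> star v'" "v' \<noteq> v" for h
    using van2_D[OF j(3)[OF starD(2)[OF that(1)] that(2)]] by auto
  have C: "dird h (d0 K v c) v = 0" for h unfolding A(2) by (simp add: dird_def)
  show "value_form v' w (single K (d0 K v c)) = (if v' = v then w K \<bullet> c else 0)"
    unfolding value_form_single using A(1) B(1) K by auto
  show "slope_form v' u (single K (d0 K v c)) = 0"
    unfolding slope_form_single using C B(2) by (cases "v' = v") simp_all
qed

text \<open>Only the slope form at \<open>v\<close> sees \<open>d1\<close>, through the edge to
  \<open>a\<close> of the element \<open>K\<close>.\<close>

lemma d1_functionals:
  assumes K: "K \<in> star v" and a: "a \<in> K" "a \<noteq> v"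
  shows "value_form v' w (single K (d1 K v a c)) = 0" "slope_form v' u (single K (d1 K v a c)) = (if v' = v then u K a \<bullet> c else 0)"
    "z \<in> K \<Longrightarrow> d1 K v a c z = 0"
proof -
  note t = starD(3)[OF K]
  note j = d1_jets(1,2)[OF t starD(2)[OF K] a(2), of c] d1_jets(3)[OF t starD(2)[OF K] a(2), where c = c]
  have pm: "poly_map (d1 K v a c)" by (rule poly_mapI[OF j(1)])
  note A = van2_diff_D[OF pm poly_map_mult_scaleR[OF bary_poly_map[OF t] poly_map_const] j(2)]
  have A1: "d1 K v a c v = 0" unfolding A(1) using a(2) by (simp add: bary_vertex[OF t starD(2)[OF K]])
  have B: "d1 K v a c v' = 0" "dird h (d1 K v a c) v' = 0" if "v' \<in> K" "v' \<noteq> v" for v' h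
    using van2_D[OF j(3)[OF that]] by auto
  show z: "d1 K v a c z = 0" if "z \<in> K" for z using A1 B(1)[OF that] by blast
  have C: "dird h (d1 K v a c) v = (gr K a \<bullet> h) *\<^sub>R c" for h unfolding A(2) dird_bary[OF t] ..
  show "value_form v' w (single K (d1 K v a c)) = 0"
    unfolding value_form_single using z starD(2) by auto
  have "(\<Sum>b\<in>K - {v}. u K b \<bullet> dird (b - v) (d1 K v a c) v) = (\<Sum>b\<in>K - {v}. if b = a then u K a \<bullet> c else 0)"
    by (rule sum.cong[OF refl]) (simp add: C gr_edge[OF t starD(2)[OF K] a])
  also have "\<dots> = u K a \<bullet> c" using a tri_finite[OF t] by simp
  finally have D: "(\<Sum>b\<in>K - {v}. u K b \<bullet> dird (b - v) (d1 K v a c) v) = u K a \<bullet> c" .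
  show "slope_form v' u (single K (d1 K v a c)) = (if v' = v then u K a \<bullet> c else 0)"
  proof (cases "v' = v")
    case True
    then show ?thesis unfolding slope_form_single using D K by simp
  next
    case False
    show ?thesis unfolding slope_form_single
    proof (cases "K \<in> star v'")
      case True
      have "dird h (d1 K v a c) v' = 0" for h by (rule B(2)[OF starD(2)[OF True] False])
      then show "(if K \<in> star v' then \<Sum>aa\<in>K - {v'}. u K aa \<bullet> dird (aa - v') (d1 K v a c) v' else 0) = (if v' = v then u K a \<bullet> c else 0)"
        using False by simp
    qed (use False in simp)
  qed
qed

lemma d_in_Qfam: "K \<in> star v \<Longrightarrow> single K (d0 K v c) \<in> Qfam" "K \<in> star v \<Longrightarrow> a \<noteq> v \<Longrightarrow> single K (d1 K v a c) \<in> Qfam"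
  using k7 by (auto intro!: Qfam_single starD(1) poly_maps_mono[OF d0_jets(1)] poly_maps_mono[OF d1_jets(1)] starD)

lemma obstruction_cases:
  assumes "j \<in> obstructions0"
  obtains "j = (fst j, 0)" "typeI (fst j) \<or> typeII (fst j)" | "j = (fst j, Suc 0)" "typeI (fst j)" | "j = (fst j, 2)" "typeI (fst j)"
  using assms unfolding obstructions0_def by auto

text \<open>The Hermite function \<open>d1\<close> at one element of the star is dual to the
  slope obstruction. Its values at the vertices are zero, so it is continuous at the
  vertices.\<close>

lemma slope_dual:
  assumes v: "v \<in> \<Union>\<K>" "typeI v"
  shows "\<exists>b\<in>Qsm 0. obstruction (v, 2) b = 1 \<and> (\<forall>j\<in>obstructions0. j \<noteq> (v, 2) \<longrightarrow> obstruction j b = 0)"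
proof -
  obtain K where K: "K \<in> star v" using v(1) by (auto simp: star_def)
  obtain a b where k: "K = {v, a, b}" "cr (a - v) (b - v) \<noteq> 0" using star_tri[OF K] .
  have a: "a \<in> K" "a \<noteq> v" using k cr_distinct[OF k(2)] by auto
  let ?u = "\<lambda>v. cross_weight (fst (chosen_frame v)) (snd (chosen_frame v)) v"
  note f = frame_dirs[OF frame2_frame3(1)[OF chosen_frame_frame(1)[OF v(2)]] K k]
  have "?u v K a \<noteq> 0" unfolding cross_weight_eq[OF k] using f(3,4) gr_nonzero[OF K a] by (simp add: sgn_zero_iff)
  then obtain c where c: "?u v K a \<bullet> c = 1" using dual_vector_single by blast
  let ?b = "single K (d1 K v a c)"
  have q: "?b \<in> Qfam" by (rule d_in_Qfam(2)[OF K a(2)])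
  have z: "?b L z = 0" if "z \<in> L" for L and z :: point using d1_functionals(3)[OF K a, of z c] that by (cases "L = K") (simp_all add: single_def)
  have "?b \<in> Qsm 0" unfolding Qsm_def mem_Collect_eq
  proof (intro conjI q ballI allI impI)
    fix L L' and z :: point assume "z \<in> L" "z \<in> L'"
    then have "van 1 z (\<lambda>x. ?b L x - ?b L' x)" by (intro van_1I) (simp add: z)
    then show "van (Suc 0) z (\<lambda>x. ?b L x - ?b L' x)" by simp
  qed
  moreover have "obstruction (v, 2) ?b = 1" unfolding obstruction_simps d1_functionals(2)[OF K a] using c by simp
  moreover have "obstruction j ?b = 0" if j: "j \<in> obstructions0" "j \<noteq> (v, 2)" for j
    using j(1)
  proof (cases rule: obstruction_cases)
    case 1
    show ?thesis by (subst 1(1)) (simp only: obstruction_simps d1_functionals(1)[OF K a])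
  next
    case 2
    show ?thesis by (subst 2(1)) (simp only: obstruction_simps d1_functionals(1)[OF K a])
  next
    case 3
    then have "fst j \<noteq> v" using j(2) by auto
    then show ?thesis by (subst 3(1)) (simp only: obstruction_simps d1_functionals(2)[OF K a] if_False)
  qed
  ultimately show ?thesis by blast
qed

lemma obstruction_d0:
  assumes K: "K \<in> star v" and j: "j \<in> obstructions0" and c: "\<And>n. j = (v, n) \<Longrightarrow> n \<noteq> 2 \<Longrightarrow>
     frame_weight (fst (chosen_frame v)) (if n = 0 then snd (chosen_frame v) else - snd (chosen_frame v)) v K \<bullet> c = (if j = i then 1 else 0)" and i: "i = (v, m)" "m \<noteq> 2"
  shows "obstruction j (single K (d0 K v c)) = (if j = i then 1 else 0)"
  using j
proof (cases rule: obstruction_cases)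
  case 1
  show ?thesis
  proof (cases "fst j = v")
    case True
    then have e: "j = (v, 0)" using 1(1) by simp
    show ?thesis using c[OF e] unfolding e obstruction_simps d0_functionals(1)[OF K] by simp
  next
    case False
    then show ?thesis by (subst 1(1)) (use i in \<open>auto simp: obstruction_simps d0_functionals(1)[OF K]\<close>)
  qed
next
  case 2
  show ?thesis
  proof (cases "fst j = v")
    case True
    then have e: "j = (v, Suc 0)" using 2(1) by simp
    show ?thesis using c[OF e] unfolding e obstruction_simps d0_functionals(1)[OF K] by simp
  next
    case False
    then show ?thesis by (subst 2(1)) (use i in \<open>auto simp: obstruction_simps d0_functionals(1)[OF K]\<close>)
  qed
next
  case 3
  have "j \<noteq> i" using 3(1) i by (metis snd_conv)
  then show ?thesis by (subst 3(1)) (simp add: obstruction_simps d0_functionals(2)[OF K])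
qed

text \<open>Value obstructions are dual to Hermite functions \<open>d0\<close> supported on one
  element of the star, since on each element the weights are nonzero, and independent in the
  case of two value obstructions at one vertex.\<close>

lemma dual_elements:
  assumes i: "i \<in> obstructions0"
  shows "\<exists>b\<in>Qfam. obstruction i b = 1 \<and> (\<forall>j\<in>obstructions0. j \<noteq> i \<longrightarrow> obstruction j b = 0)"
proof -
  have v: "fst i \<in> \<Union>\<K>" using i unfolding obstructions0_def by auto
  then obtain K where K: "K \<in> star (fst i)" by (auto simp: star_def)
  let ?w = "\<lambda>n. frame_weight (fst (chosen_frame (fst i))) (if n = (0::nat) then snd (chosen_frame (fst i)) else - snd (chosen_frame (fst i))) (fst i) K"
  have main: ?thesis if i2: "i = (fst i, m)" "m \<noteq> 2"
    and c: "\<And>n. (fst i, n) \<in> obstructions0 \<Longrightarrow> n \<noteq> 2 \<Longrightarrow> ?w n \<bullet> c = (if n = m then 1 else 0)" for c m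
  proof -
    have "obstruction j (single K (d0 K (fst i) c)) = (if j = i then 1 else 0)" if j: "j \<in> obstructions0" for j
    proof (rule obstruction_d0[OF K j _ i2])
      fix n assume n: "j = (fst i, n)" "n \<noteq> 2"
      have "(j = i) = (n = m)" using n(1) i2(1) by (metis snd_conv)
      then show "?w n \<bullet> c = (if j = i then 1 else 0)" using c[of n] n j by simp
    qed
    note P = this
    show ?thesis by (rule bexI[OF _ d_in_Qfam(1)[OF K, of c]]) (use P i in \<open>simp del: split_paired_All\<close>)
  qed
  show ?thesis using i
  proof (cases rule: obstruction_cases)
    case 3
    then show ?thesis using slope_dual[OF v 3(2)] unfolding Qsm_def by auto
  next
    case 2
    have "cr (?w 0) (?w 1) \<noteq> 0" using frame_weight_pair_independent[OF chosen_frame_frame(1)[OF 2(2)] K] by simp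
    then have "cr (?w 1) (?w 0) \<noteq> 0" using cr_swap[of "?w 1" "?w 0"] by simp
    then obtain c where c: "?w 1 \<bullet> c = 1" "?w 0 \<bullet> c = 0" using dual_vector by blast
    show ?thesis
    proof (rule main[OF 2(1), of c])
      fix n assume "(fst i, n) \<in> obstructions0" "n \<noteq> 2"
      then have "n = 0 \<or> n = 1" unfolding obstructions0_def by auto
      then show "?w n \<bullet> c = (if n = Suc 0 then 1 else 0)" using c by auto
    qed simp
  next
    case 1
    show ?thesis
    proof (cases "typeI (fst i)")
      case True
      have "cr (?w 0) (?w 1) \<noteq> 0" using frame_weight_pair_independent[OF chosen_frame_frame(1)[OF True] K] by simp
      then obtain c where c: "?w 0 \<bullet> c = 1" "?w 1 \<bullet> c = 0" using dual_vector by blast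
      show ?thesis
      proof (rule main[OF 1(1), of c])
        fix n assume "(fst i, n) \<in> obstructions0" "n \<noteq> 2"
        then have "n = 0 \<or> n = 1" unfolding obstructions0_def by auto
        then show "?w n \<bullet> c = (if n = 0 then 1 else 0)" using c by auto
      qed simp
    next
      case False
      then have II: "typeII (fst i)" using 1(2) by blast
      have "?w 0 \<noteq> 0" using frame_weight_nonzero[OF chosen_frame_frame(2)[OF II] K] by simp
      then obtain c where c: "?w 0 \<bullet> c = 1" using dual_vector_single by blast
      show ?thesis
      proof (rule main[OF 1(1), of c])
        fix n assume "(fst i, n) \<in> obstructions0" "n \<noteq> 2"
        then have "n = 0" using False unfolding obstructions0_def by auto
        then show "?w n \<bullet> c = (if n = 0 then 1 else 0)" using c by auto
      qed simp
    qed
  qed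
qed

text \<open>The ranges are joint kernels of obstructions which have dual elements, hence the
  codimension is the number of obstructions.\<close>

theorem family_dims:
  "dim Qfam = dim (Dfam 0) + (card {v \<in> \<Union>\<K>. typeII v} + 3 * card {v \<in> \<Union>\<K>. typeI v})"
  "dim (Qsm 0) = dim (Dfam 1) + card {v \<in> \<Union>\<K>. typeI v}"
proof -
  obtain B where B: "finite B" "Qfam \<subseteq> span B" by (rule Qfam_span)
  have sm: "Qsm 0 \<subseteq> Qfam" unfolding Qsm_def by blast
  have "dim Qfam = dim {q \<in> Qfam. \<forall>i\<in>obstructions0. obstruction i q = 0} + card obstructions0"
    by (rule dim_joint_kernel[OF subspace_Qfam B I_card(1) obstruction_linear(1) obstruction_linear(2) dual_elements])
  then show "dim Qfam = dim (Dfam 0) + (card {v \<in> \<Union>\<K>. typeII v} + 3 * card {v \<in> \<Union>\<K>. typeI v})"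
    unfolding range0 I_card(5) .
  have "dim (Qsm 0) = dim {q \<in> Qsm 0. \<forall>i\<in>obstructions1. obstruction i q = 0} + card obstructions1"
  proof (rule dim_joint_kernel[OF subspace_Qsm B(1) subset_trans[OF sm B(2)] I_card(2)])
    fix i assume i: "i \<in> obstructions1"
    show "obstruction i (x + y) = obstruction i x + obstruction i y" if "x \<in> Qsm 0" "y \<in> Qsm 0" for x y
      by (rule obstruction_linear(1)) (use that sm in blast)+
    show "obstruction i (c *\<^sub>R x) = c * obstruction i x" if "x \<in> Qsm 0" for c x
      by (rule obstruction_linear(2)) (use that sm in blast)+
    obtain v where v: "i = (v, 2)" "v \<in> \<Union>\<K>" "typeI v" using i unfolding obstructions1_def by auto
    show "\<exists>b\<in>Qsm 0. obstruction i b = 1 \<and> (\<forall>j\<in>obstructions1. j \<noteq> i \<longrightarrow> obstruction j b = 0)"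
      using slope_dual[OF v(2,3)] I_card(3) unfolding v(1) by blast
  qed
  then show "dim (Qsm 0) = dim (Dfam 1) + card {v \<in> \<Union>\<K>. typeI v}"
    unfolding range1 I_card(4) .
qed

theorem family_surjective:
  "{v \<in> \<Union>\<K>. typeI v} = {} \<Longrightarrow> Dfam 1 = Qsm 0"
  "{v \<in> \<Union>\<K>. typeI v} = {} \<Longrightarrow> {v \<in> \<Union>\<K>. typeII v} = {} \<Longrightarrow> Dfam 0 = Qfam"
proof -
  assume e: "{v \<in> \<Union>\<K>. typeI v} = {}"
  show "Dfam 1 = Qsm 0" unfolding range1 obstructions1_def e by simp
  assume e2: "{v \<in> \<Union>\<K>. typeII v} = {}"
  show "Dfam 0 = Qfam" unfolding range0 obstructions0_def e e2 by simp
qed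

end

section \<open>Triangulations as meshes\<close>

text \<open>Barycentric coordinates are unique, so a relation between the vertices is
  trivial.\<close>

lemma tri_affine_independent: assumes "tri K" shows "\<not> affine_dependent K"
proof
  assume "affine_dependent K"
  then obtain u where u: "sum u K = 0" "\<exists>v\<in>K. u v \<noteq> 0" "(\<Sum>v\<in>K. u v *\<^sub>R v) = 0"
    unfolding affine_dependent_explicit_finite[OF tri_finite[OF assms]] by blast
  then obtain b where b: "b \<in> K" "u b \<noteq> 0" by blast
  have "bary K b b = bary K b b + u b"
  proof (rule bary_unique[OF assms _ _ b(1), where u = "\<lambda>a. bary K a b + u a"])
    show "(\<Sum>a\<in>K. bary K a b + u a) = 1" using bary_sum(1)[OF assms] u(1) by (simp add: sum.distrib)
    show "b = (\<Sum>a\<in>K. (bary K a b + u a) *\<^sub>R a)"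
      using bary_sum(2)[OF assms] u(3) by (simp add: sum.distrib scaleR_left_distrib)
  qed
  then show False using b(2) by simp
qed

lemma tri_of_affine_independent: assumes "\<not> affine_dependent K" "card K = 3" shows "tri K"
proof -
  obtain a b c where K: "K = {a, b, c}" "a \<noteq> b" "a \<noteq> c" "b \<noteq> c" using assms(2) by (auto simp: card_3_iff)
  have "cr (b - a) (c - a) \<noteq> 0"
  proof
    assume "cr (b - a) (c - a) = 0"
    moreover have "b - a \<noteq> 0" using K(2) by simp
    ultimately obtain t where "c - a = t *\<^sub>R (b - a)" using cr_parallel by blast
    then have "c = (1 - t) *\<^sub>R a + t *\<^sub>R b" by (simp add: algebra_simps)
    then have "c \<in> affine hull {a, b}" unfolding affine_hull_2 by (intro CollectI exI[of _ "1 - t"] exI[of _ t]) simp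
    moreover have "K - {c} = {a, b}" using K by auto
    ultimately have "affine_dependent K" unfolding affine_dependent_def using K(1) by auto
    then show False using assms(1) by blast
  qed
  then show ?thesis unfolding tri_def by (intro exI conjI) (rule K(1))
qed

lemma tri_hull_inj: "tri K \<Longrightarrow> tri K' \<Longrightarrow> convex hull K = convex hull K' \<Longrightarrow> K = K'"
proof -
  assume t: "tri K" "tri K'" "convex hull K = convex hull K'"
  have e: "{x. x extreme_point_of convex hull L} = L" if "tri L" for L
    using extreme_point_of_convex_hull_affine_independent[OF tri_affine_independent[OF that]] by simp
  show "K = K'" by (rule trans[OF e[OF t(1), unfolded t(3), symmetric] e[OF t(2)]])
qed

text \<open>The elements of a triangulation by their vertex sets.\<close>

definition cells :: "mesh \<Rightarrow> point set set" where "cells \<T> = {K. tri K \<and> convex hull K \<in> \<T>}"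

text \<open>A frontier point lies on a simple closed curve in the frontier. By the
  Jordan-Brouwer theorem the curve separates the plane and bounds each component of its
  complement. The connected set \<open>\<Omega>\<close> lies in one component, and every
  neighbourhood of the point meets another one, so it is not contained in the closure of
  \<open>\<Omega>\<close>.\<close>

lemma interior_closure_polygonal:
  assumes "polygonal_domain \<Omega>" shows "interior (closure \<Omega>) = \<Omega>"
proof
  have o: "open \<Omega>" "connected \<Omega>" using assms unfolding polygonal_domain_def by auto
  show "\<Omega> \<subseteq> interior (closure \<Omega>)" by (rule interior_maximal[OF closure_subset o(1)])
  show "interior (closure \<Omega>) \<subseteq> \<Omega>"
  proof (rule subsetI, rule ccontr)
    fix x assume x: "x \<in> interior (closure \<Omega>)" "x \<notin> \<Omega>"
    have "x \<in> closure \<Omega>" by (rule subsetD[OF interior_subset x(1)])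
    then have xf: "x \<in> frontier \<Omega>" using x(2) unfolding frontier_def interior_open[OF o(1)] by simp
    obtain \<P> where \<P>: "\<forall>P\<in>\<P>. simple_closed_polygon P" "frontier \<Omega> = \<Union>\<P>"
      using assms[unfolded polygonal_domain_def] by (elim conjE exE) (rule that; assumption)
    obtain P where P0: "P \<in> \<P>" "x \<in> P" using xf unfolding \<P>(2) by (rule UnionE)
    have P: "x \<in> P" "P \<subseteq> frontier \<Omega>" "simple_closed_polygon P"
      using P0 \<P>(1) unfolding \<P>(2) by auto
    obtain g where g: "simple_path g" "pathfinish g = pathstart g" "path_image g = P"
      using P(3) unfolding simple_closed_polygon_def by blast
    have "P homeomorphic sphere (0 :: complex) 1"
      using homeomorphic_simple_path_image_circle[OF g(1,2), of 1] g(3) by simp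
    moreover have "sphere (0 :: complex) 1 homeomorphic sphere (0 :: point) 1"
      by (rule homeomorphic_spheres_gen) auto
    ultimately have h: "P homeomorphic sphere (0 :: point) 1" by (rule homeomorphic_trans)
    have "compact P" using g(1,3) compact_simple_path_image by blast
    then have oP: "open (- P)" by (simp add: compact_imp_closed open_Compl)
    have "\<Omega> \<inter> frontier \<Omega> = {}" unfolding frontier_def interior_open[OF o(1)] by blast
    then have OP: "\<Omega> \<subseteq> - P" using P(2) by blast
    have "\<Omega> \<noteq> {}" by (rule assms[unfolded polygonal_domain_def, THEN conjunct2, THEN conjunct2, THEN conjunct2, THEN conjunct1])
    then obtain w where w: "w \<in> \<Omega>" by blast
    (* The component of the complement of the curve that contains the domain, and below a
       different one. *)
    let ?C = "connected_component_set (- P) w"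
    have C: "?C \<in> components (- P)" using w OP by (auto simp: components_def)
    have OC: "\<Omega> \<subseteq> ?C" by (rule connected_component_maximal[OF w o(2) OP])
    have "\<not> connected (- P)" by (rule Jordan_Brouwer_separation[OF h]) simp
    moreover have "connected ?C" "?C \<subseteq> - P" using connected_component_subset by auto
    ultimately have "?C \<noteq> - P" by metis
    with \<open>?C \<subseteq> - P\<close> obtain y where y: "y \<in> - P" "y \<notin> ?C" by blast
    let ?D = "connected_component_set (- P) y"
    have D: "?D \<in> components (- P)" using y by (auto simp: components_def)
    have "?D \<inter> ?C = {}" using y
      by (metis connected_component_disjoint)
    then have dj: "?D \<inter> \<Omega> = {}" using OC by blast
    have oD: "open ?D" using oP by (rule open_connected_component)
    have "?D \<inter> closure \<Omega> = {}" using open_Int_closure_eq_empty[OF oD] dj by blast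
    moreover have "frontier ?D = P" by (rule Jordan_Brouwer_frontier[OF h D]) simp
    then have "x \<in> closure ?D" using P(1) unfolding frontier_def by blast
    then have "interior (closure \<Omega>) \<inter> ?D \<noteq> {}"
      using open_Int_closure_eq_empty[OF open_interior, of "closure \<Omega>" ?D] x(1) by blast
    ultimately show False using interior_subset by blast
  qed
qed

locale triangulated_domain =
  fixes \<Omega> :: "point set" and \<T> :: mesh and k :: nat
  assumes dom: "polygonal_domain \<Omega>" and ct: "conforming_triangulation \<T> \<Omega>" and k_ge: "k \<ge> 7"
begin

abbreviation "\<C> \<equiv> cells \<T>"

lemma cellD: "K \<in> \<C> \<Longrightarrow> tri K" "K \<in> \<C> \<Longrightarrow> convex hull K \<in> \<T>" unfolding cells_def by auto

lemma element_cell: assumes "T \<in> \<T>" obtains K where "K \<in> \<C>" "T = convex hull K"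
proof -
  have "2 simplex T" using ct assms unfolding conforming_triangulation_def by blast
  then obtain K where K: "\<not> affine_dependent K" "int (card K) = 2 + 1" "T = convex hull K" unfolding simplex_def by blast
  from K(2) have "card K = 3" by linarith
  from tri_of_affine_independent[OF K(1) this] have "K \<in> \<C>" using K(3) assms by (simp add: cells_def)
  then show thesis using that K(3) by blast
qed

lemma cells_image: "(\<lambda>K. convex hull K) ` \<C> = \<T>"
proof (intro subset_antisym subsetI)
  fix T assume "T \<in> \<T>"
  then obtain K where "K \<in> \<C>" "T = convex hull K" by (rule element_cell)
  then show "T \<in> (\<lambda>K. convex hull K) ` \<C>" by (rule rev_image_eqI)
next
  fix T assume "T \<in> (\<lambda>K. convex hull K) ` \<C>"
  then show "T \<in> \<T>" using cellD(2) by auto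
qed

lemma cells_finite: "finite \<C>"
proof (rule finite_imageD)
  show "finite ((\<lambda>K. convex hull K) ` \<C>)" unfolding cells_image
    using ct[unfolded conforming_triangulation_def triangulation_def] by (elim conjE)
  show "inj_on (\<lambda>K. convex hull K) \<C>" by (rule inj_onI) (rule tri_hull_inj; (rule cellD(1))?; assumption)
qed

text \<open>The intersection is a face of both elements, spanned by a set of vertices of either
  one; a simplex determines its vertices as extreme points.\<close>

lemma cells_conform:
  assumes K: "K \<in> \<C>" "K' \<in> \<C>" shows "convex hull K \<inter> convex hull K' \<subseteq> convex hull (K \<inter> K')"
proof -
  have tr: "\<forall>T T'. T \<in> \<T> \<and> T' \<in> \<T> \<longrightarrow> (T \<inter> T') face_of T"
    using ct[unfolded conforming_triangulation_def triangulation_def] by (elim conjE)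
  have f: "(convex hull L \<inter> convex hull L') face_of convex hull L" if "L \<in> \<C>" "L' \<in> \<C>" for L L'
    by (rule tr[rule_format], rule conjI, rule cellD(2)[OF that(1)], rule cellD(2)[OF that(2)])
  have i: "\<not> affine_dependent L" if "L \<in> \<C>" for L by (rule tri_affine_independent[OF cellD(1)[OF that]])
  have "\<exists>c. c \<subseteq> K \<and> convex hull K \<inter> convex hull K' = convex hull c"
    by (rule iffD1[OF face_of_convex_hull_affine_independent[OF i[OF K(1)]] f[OF K]])
  then obtain c where c: "c \<subseteq> K" "convex hull K \<inter> convex hull K' = convex hull c" by blast
  have "\<exists>c. c \<subseteq> K' \<and> convex hull K' \<inter> convex hull K = convex hull c"
    by (rule iffD1[OF face_of_convex_hull_affine_independent[OF i[OF K(2)]] f[OF K(2,1)]])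
  then obtain c' where c': "c' \<subseteq> K'" "convex hull K' \<inter> convex hull K = convex hull c'" by blast
  have e: "{x. x extreme_point_of convex hull d} = d" if "d \<subseteq> L" "L \<in> \<C>" for d L
    using extreme_point_of_convex_hull_affine_independent[OF affine_independent_subset[OF i[OF that(2)] that(1)]] by simp
  have h: "convex hull c = convex hull c'" by (rule trans[OF c(2)[symmetric] trans[OF Int_commute c'(2)]])
  have "c = c'" by (rule trans[OF e[OF c(1) K(1), unfolded h, symmetric] e[OF c'(1) K(2)]])
  then have "c \<subseteq> K'" using c'(1) by (rule ssubst)
  from hull_mono[OF Int_greatest[OF c(1) this]] show ?thesis unfolding c(2) .
qed

lemma mesh_cells: "mesh (cells \<T>) k"
proof (rule mesh.intro)
  show "finite \<C>" by (rule cells_finite)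
  show "tri K" if "K \<in> \<C>" for K by (rule cellD(1)[OF that])
  show "convex hull K \<inter> convex hull K' \<subseteq> convex hull (K \<inter> K')" if "K \<in> \<C>" "K' \<in> \<C>" for K K'
    by (rule cells_conform[OF that])
  show "7 \<le> k" by (rule k_ge)
qed

sublocale mesh "cells \<T>" k
  by (rule mesh_cells)

lemma hulls_union: "(\<Union>K\<in>\<C>. convex hull K) = closure \<Omega>"
  using ct cells_image unfolding conforming_triangulation_def by metis

lemma vertices_eq: "mesh_vertices \<T> = \<Union>\<C>"
proof -
  have "mesh_vertices \<T> = {v. \<exists>K\<in>\<C>. v extreme_point_of convex hull K}"
    unfolding mesh_vertices_def by (subst cells_image[symmetric]) blast
  also have "\<dots> = {v. \<exists>K\<in>\<C>. v \<in> K}"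
    by (intro Collect_cong bex_cong refl extreme_point_of_convex_hull_affine_independent tri_affine_independent cellD(1))
  finally show ?thesis by blast
qed

text \<open>A vertex of the mesh that lies in a face of an element is a vertex of that face,
  because the mesh is conforming.\<close>

lemma vertex_subhull:
  assumes "v \<in> \<Union>\<C>" "K \<in> \<C>" "L \<subseteq> K" "v \<in> convex hull L" shows "v \<in> L"
proof -
  obtain K' where K': "K' \<in> \<C>" "v \<in> K'" using assms(1) by blast
  have vK: "v \<in> convex hull K" using assms(3,4) hull_mono by blast
  have "v \<in> convex hull (K' \<inter> K)" using cells_conform[OF K'(1) assms(2)] vK hull_inc[OF K'(2)] by blast
  then have "\<forall>a\<in>K' - K' \<inter> K. bary K' a v = 0" using subhull_iff[OF cellD(1)[OF K'(1)], of "K' \<inter> K" v] by blast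
  then have "v \<in> K" using K'(2) bary_vertex[OF cellD(1)[OF K'(1)] K'(2), of v] by force
  moreover have "\<forall>a\<in>K - L. bary K a v = 0" using subhull_iff[OF cellD(1)[OF assms(2)] assms(3), of v] assms(4) by blast
  ultimately show ?thesis using bary_vertex[OF cellD(1)[OF assms(2)], of v v] by force
qed

lemma interior_vertex_iff: "interior_vertex v \<longleftrightarrow> v \<in> \<Omega>"
  unfolding interior_vertex_def hulls_union interior_closure_polygonal[OF dom] ..

subsection \<open>Counting edge directions\<close>

text \<open>The edges at \<open>v\<close> are the segments from \<open>v\<close> to the
  neighbouring vertices.\<close>

lemma lines_at_eq:
  assumes v: "v \<in> \<Union>\<C>" shows "lines_at \<T> v = (\<lambda>a. affine hull {v, a}) ` neighbours v"
proof (intro subset_antisym subsetI)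
  fix l assume "l \<in> lines_at \<T> v"
  then obtain e T where e: "l = affine hull e" "T \<in> \<T>" "e edge_of T" "v \<in> e"
    unfolding lines_at_def mesh_edges_def by blast
  obtain K where K: "K \<in> \<C>" "T = convex hull K" using element_cell[OF e(2)] .
  note i = tri_affine_independent[OF cellD(1)[OF K(1)]]
  have "e face_of convex hull K" "aff_dim e = 1" using e(3) unfolding K(2) edge_of_def by simp_all
  from iffD1[OF face_of_convex_hull_affine_independent[OF i] this(1)]
  obtain c where c: "c \<subseteq> K" "e = convex hull c" by (elim exE conjE) (rule that; assumption)
  have "aff_dim c = int (card c) - 1" using aff_dim_affine_independent[OF affine_independent_subset[OF i c(1)]] by simp
  moreover have "aff_dim c = 1" using \<open>aff_dim e = 1\<close> c(2) by (simp add: aff_dim_convex_hull)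
  ultimately have "card c = 2" by linarith
  moreover have vc: "v \<in> c" using vertex_subhull[OF v K(1) c(1)] e(4) c(2) by blast
  ultimately obtain a where a: "c = {v, a}" "a \<noteq> v"
    unfolding card_2_iff by (elim exE conjE) (auto simp: insert_commute)
  have "a \<in> neighbours v" using a c(1) K(1) by (auto simp: neighbours_def star_def)
  moreover have "l = affine hull {v, a}" using e(1) c(2) a(1) by simp
  ultimately show "l \<in> (\<lambda>a. affine hull {v, a}) ` neighbours v" by blast
next
  fix l assume "l \<in> (\<lambda>a. affine hull {v, a}) ` neighbours v"
  then obtain a where l: "l = affine hull {v, a}" and "a \<in> neighbours v" by (rule imageE)
  from this(2) obtain K where a: "a \<noteq> v" "K \<in> star v" "a \<in> K" unfolding neighbours_def by auto
  note K = starD(1,2)[OF a(2)]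
  note i = tri_affine_independent[OF cellD(1)[OF K(1)]]
  have "convex hull {v, a} face_of convex hull K"
    by (rule iffD2[OF face_of_convex_hull_affine_independent[OF i]], rule exI[of _ "{v, a}"]) (use K(2) a(3) in simp)
  moreover have "aff_dim (convex hull {v, a}) = 1" using a(1) by (simp add: aff_dim_convex_hull aff_dim_2)
  ultimately have "(convex hull {v, a}) edge_of convex hull K" by (simp add: edge_of_def)
  then have "convex hull {v, a} \<in> mesh_edges \<T>" unfolding mesh_edges_def by (intro CollectI bexI[OF _ cellD(2)[OF K(1)]])
  moreover have "v \<in> convex hull {v, a}" by (simp add: hull_inc)
  moreover have "l = affine hull (convex hull {v, a})" using l by simp
  ultimately show "l \<in> lines_at \<T> v" unfolding lines_at_def by (intro CollectI exI conjI)
qed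

lemma line_direction:
  assumes "cr d (a - v) = 0" "d \<noteq> 0" "a \<noteq> v" shows "affine hull {v, a} = range (\<lambda>t. v + t *\<^sub>R d)"
proof -
  obtain s where s: "a - v = s *\<^sub>R d" using cr_parallel[OF assms(1,2)] by blast
  then have s0: "s \<noteq> 0" using assms(3) by auto
  have "x *\<^sub>R v + y *\<^sub>R a = v + (y * s) *\<^sub>R d" if "x + y = 1" for x y
  proof -
    have "a = v + s *\<^sub>R d" using s by (simp add: algebra_simps)
    then have "x *\<^sub>R v + y *\<^sub>R a = (x + y) *\<^sub>R v + (y * s) *\<^sub>R d" by (simp add: algebra_simps)
    then show ?thesis using that by simp
  qed
  note e = this
  show ?thesis
  proof (intro subset_antisym subsetI)
    fix z assume "z \<in> affine hull {v, a}"
    then show "z \<in> range (\<lambda>t. v + t *\<^sub>R d)" unfolding affine_hull_2 using e by blast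
  next
    fix z assume "z \<in> range (\<lambda>t. v + t *\<^sub>R d)"
    then obtain t where z: "z = v + t *\<^sub>R d" by blast
    have "(1 - t / s) *\<^sub>R v + (t / s) *\<^sub>R a = z" using e[of "1 - t / s" "t / s"] s0 z by simp
    then show "z \<in> affine hull {v, a}" unfolding affine_hull_2
      by (intro CollectI exI[of _ "1 - t / s"] exI[of _ "t / s"]) simp
  qed
qed

lemma line_same_dir: "affine hull {v, a} = affine hull {v, b} \<Longrightarrow> a \<noteq> v \<Longrightarrow> cr (a - v) (b - v) = 0"
proof -
  assume e: "affine hull {v, a} = affine hull {v, b}" and a: "a \<noteq> v"
  have "b \<in> affine hull {v, a}" unfolding e by (simp add: hull_inc)
  then obtain t where "b = v + t *\<^sub>R (a - v)"
    using line_direction[of "a - v" a v] a by (auto simp: cr_def)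
  then show ?thesis by (simp add: cr_def)
qed

lemma lines_card_le:
  assumes "finite D" "\<And>a. a \<in> neighbours v \<Longrightarrow> \<exists>d\<in>D. cr d (a - v) = 0" "0 \<notin> D"
  shows "card ((\<lambda>a. affine hull {v, a}) ` neighbours v) \<le> card D"
proof -
  have "(\<lambda>a. affine hull {v, a}) ` neighbours v \<subseteq> (\<lambda>d. range (\<lambda>t. v + t *\<^sub>R d)) ` D"
  proof
    fix l assume "l \<in> (\<lambda>a. affine hull {v, a}) ` neighbours v"
    then obtain a where a: "l = affine hull {v, a}" "a \<in> neighbours v" by blast
    then have "a \<noteq> v" by (simp add: neighbours_def)
    obtain d where d: "d \<in> D" "cr d (a - v) = 0" using assms(2)[OF a(2)] by blast
    have "d \<noteq> 0" using d(1) assms(3) by blast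
    then show "l \<in> (\<lambda>d. range (\<lambda>t. v + t *\<^sub>R d)) ` D"
      using line_direction[OF d(2) _ \<open>a \<noteq> v\<close>] a(1) d(1) by blast
  qed
  then have "card ((\<lambda>a. affine hull {v, a}) ` neighbours v) \<le> card ((\<lambda>d. range (\<lambda>t. v + t *\<^sub>R d)) ` D)"
    using assms(1) by (intro card_mono) auto
  then show ?thesis using card_image_le[OF assms(1)] le_trans by blast
qed

lemma neighbours_finite: "finite (neighbours v)"
proof (rule finite_subset[OF _ finite_vertices])
  show "neighbours v \<subseteq> \<Union>\<C>" unfolding neighbours_def star_def by blast
qed

text \<open>The two edges at \<open>v\<close> of one element are not parallel.\<close>

lemma two_lines:
  assumes "v \<in> \<Union>\<C>"
  obtains a b where "a \<in> neighbours v" "b \<in> neighbours v" "cr (a - v) (b - v) \<noteq> 0" "affine hull {v, a} \<noteq> affine hull {v, b}"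
proof -
  obtain K where K: "K \<in> star v" using assms by (auto simp: star_def)
  obtain a b where k: "K = {v, a, b}" "cr (a - v) (b - v) \<noteq> 0" using star_tri[OF K] .
  have d: "a \<noteq> v" "b \<noteq> v" using cr_distinct[OF k(2)] by auto
  have "a \<in> neighbours v" "b \<in> neighbours v" using K k(1) d nbsI[OF K] by auto
  moreover have "affine hull {v, a} \<noteq> affine hull {v, b}" using line_same_dir[OF _ d(1)] k(2) by blast
  ultimately show thesis using that k(2) by blast
qed

lemma cr_nonzero_ne: "cr d e \<noteq> 0 \<Longrightarrow> d \<noteq> 0 \<and> e \<noteq> 0" by (auto simp: cr_def)

lemma frame2_iff:
  assumes v: "v \<in> \<Union>\<C>" shows "(\<exists>d1 d2. frame2 v d1 d2) \<longleftrightarrow> card (lines_at \<T> v) \<le> 2"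
proof
  assume "\<exists>d1 d2. frame2 v d1 d2"
  then obtain d1 d2 where f: "cr d1 d2 \<noteq> 0" "\<And>a. a \<in> neighbours v \<Longrightarrow> cr d1 (a - v) = 0 \<or> cr d2 (a - v) = 0"
    unfolding frame2_def by blast
  have "card (lines_at \<T> v) \<le> card {d1, d2}" unfolding lines_at_eq[OF v]
    by (rule lines_card_le) (use f(2) cr_nonzero_ne[OF f(1)] in auto)
  also have "\<dots> \<le> 2" by (simp add: card_insert_if)
  finally show "card (lines_at \<T> v) \<le> 2" .
next
  assume c: "card (lines_at \<T> v) \<le> 2"
  let ?L = "\<lambda>a. affine hull {v, a}"
  obtain a b where ab: "a \<in> neighbours v" "b \<in> neighbours v" "cr (a - v) (b - v) \<noteq> 0" "?L a \<noteq> ?L b" by (rule two_lines[OF v])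
  have "{?L a, ?L b} = lines_at \<T> v"
    by (rule card_seteq) (use ab c neighbours_finite in \<open>auto simp: lines_at_eq[OF v]\<close>)
  then have "?L e = ?L a \<or> ?L e = ?L b" if "e \<in> neighbours v" for e using that unfolding lines_at_eq[OF v] by blast
  moreover have "a \<noteq> v" "b \<noteq> v" using ab by (auto simp: neighbours_def)
  ultimately have "cr (a - v) (e - v) = 0 \<or> cr (b - v) (e - v) = 0" if "e \<in> neighbours v" for e
    using line_same_dir that by metis
  then show "\<exists>d1 d2. frame2 v d1 d2" unfolding frame2_def using ab(3) by blast
qed

text \<open>Scale the directions of two lines so that their sum is the direction of the
  third.\<close>

lemma frame3_iff:
  assumes v: "v \<in> \<Union>\<C>" and n2: "\<not> (\<exists>d1 d2. frame2 v d1 d2)"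
  shows "(\<exists>d1 d2. frame3 v d1 d2) \<longleftrightarrow> card (lines_at \<T> v) = 3"
proof
  assume "\<exists>d1 d2. frame3 v d1 d2"
  then obtain d1 d2 where f: "cr d1 d2 \<noteq> 0" "\<And>a. a \<in> neighbours v \<Longrightarrow> on_three_lines d1 d2 (a - v)"
    unfolding frame3_def by blast
  have "d1 + d2 \<noteq> 0" using f(1) by (auto simp: add_eq_0_iff cr_def)
  then have "card (lines_at \<T> v) \<le> card {d1, d2, d1 + d2}" unfolding lines_at_eq[OF v]
    by (intro lines_card_le) (use f(2) cr_nonzero_ne[OF f(1)] in \<open>auto simp: on_three_lines_def\<close>)
  also have "\<dots> \<le> 3" by (simp add: card_insert_if)
  finally have "card (lines_at \<T> v) \<le> 3" .
  moreover have "\<not> card (lines_at \<T> v) \<le> 2" using n2 frame2_iff[OF v] by blast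
  ultimately show "card (lines_at \<T> v) = 3" by linarith
next
  assume c: "card (lines_at \<T> v) = 3"
  let ?L = "\<lambda>a. affine hull {v, a}"
  obtain a b where ab: "a \<in> neighbours v" "b \<in> neighbours v" "cr (a - v) (b - v) \<noteq> 0" "?L a \<noteq> ?L b" by (rule two_lines[OF v])
  have "\<exists>e\<in>neighbours v. ?L e \<noteq> ?L a \<and> ?L e \<noteq> ?L b"
  proof (rule ccontr)
    assume "\<not> (\<exists>e\<in>neighbours v. ?L e \<noteq> ?L a \<and> ?L e \<noteq> ?L b)"
    then have "lines_at \<T> v \<subseteq> {?L a, ?L b}" unfolding lines_at_eq[OF v] by blast
    then have "card (lines_at \<T> v) \<le> card {?L a, ?L b}" by (rule card_mono[rotated]) simp
    then show False using c ab(4) by simp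
  qed
  then obtain e where e: "e \<in> neighbours v" "?L e \<noteq> ?L a" "?L e \<noteq> ?L b" by blast
  have nv: "a \<noteq> v" "b \<noteq> v" "e \<noteq> v" using ab e by (auto simp: neighbours_def)
  have cre: "cr (a - v) (e - v) \<noteq> 0" "cr (e - v) (b - v) \<noteq> 0"
  proof -
    show "cr (a - v) (e - v) \<noteq> 0"
      using line_direction[of "a - v" e v] line_direction[of "a - v" a v] nv e(2) by (auto simp: cr_def)
    show "cr (e - v) (b - v) \<noteq> 0"
      using line_direction[of "e - v" b v] line_direction[of "e - v" e v] nv e(3) by (auto simp: cr_def)
  qed
  have "{?L a, ?L b, ?L e} = lines_at \<T> v"
    by (rule card_seteq) (use ab e c neighbours_finite in \<open>auto simp: lines_at_eq[OF v]\<close>)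
  then have "?L z = ?L a \<or> ?L z = ?L b \<or> ?L z = ?L e" if "z \<in> neighbours v" for z using that unfolding lines_at_eq[OF v] by blast
  then have z: "cr (a - v) (z - v) = 0 \<or> cr (b - v) (z - v) = 0 \<or> cr (e - v) (z - v) = 0" if "z \<in> neighbours v" for z
    using line_same_dir nv that by metis
  (* Coordinates of e - v in the basis of the two other directions. *)
  define s where "s = cr (e - v) (b - v) / cr (a - v) (b - v)"
  define t where "t = cr (a - v) (e - v) / cr (a - v) (b - v)"
  have st: "s \<noteq> 0" "t \<noteq> 0" using cre ab(3) by (auto simp: s_def t_def)
  have ex: "e - v = s *\<^sub>R (a - v) + t *\<^sub>R (b - v)" unfolding s_def t_def by (rule cr_basis[OF ab(3)])
  have "frame3 v (s *\<^sub>R (a - v)) (t *\<^sub>R (b - v))"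
    unfolding frame3_def on_three_lines_def ex[symmetric] using z ab(3) st by (auto simp: cr_linear)
  then show "\<exists>d1 d2. frame3 v d1 d2" by blast
qed

lemma type_I_eq: "type_I_vertices \<Omega> \<T> = {v \<in> \<Union>\<C>. typeI v}"
  unfolding type_I_vertices_def typeI_def interior_vertex_iff vertices_eq using frame2_iff by blast

lemma type_II_eq: "type_II_vertices \<Omega> \<T> = {v \<in> \<Union>\<C>. typeII v}"
proof -
  have "(\<not> (\<exists>d1 d2. frame2 v d1 d2) \<and> (\<exists>d1 d2. frame3 v d1 d2)) \<longleftrightarrow> card (lines_at \<T> v) = 3" if v: "v \<in> \<Union>\<C>" for v
  proof (cases "\<exists>d1 d2. frame2 v d1 d2")
    case True
    then show ?thesis using frame2_iff[OF v] by auto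
  next
    case False
    then show ?thesis using frame3_iff[OF v False] by blast
  qed
  then show ?thesis unfolding type_II_vertices_def typeII_def interior_vertex_iff vertices_eq by blast
qed

end

section \<open>Piecewise polynomial functions on the domain\<close>

subsection \<open>Differentiating on open sets\<close>

lemma partial_deriv_cong_open:
  assumes "open S" "\<And>x. x \<in> S \<Longrightarrow> f x = g x" "x \<in> S" shows "partial_deriv j f x = partial_deriv j g x"
proof -
  have "(f has_derivative D) (at x) \<longleftrightarrow> (g has_derivative D) (at x)" for D
    using has_derivative_transform_within_open[of f D x UNIV S g] has_derivative_transform_within_open[of g D x UNIV S f]
      assms by auto
  then show ?thesis unfolding partial_deriv_def frechet_derivative_def by simp
qed

lemma iterated_deriv_cong_open:
  assumes "open S" "\<And>x. x \<in> S \<Longrightarrow> f x = g x" "x \<in> S"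
  shows "foldr partial_deriv js f x = foldr partial_deriv js g x"
  using assms(3)
proof (induction js arbitrary: x)
  case (Cons j js)
  then show ?case by (auto intro: partial_deriv_cong_open[OF assms(1)])
qed (simp add: assms(2))

lemma iterated_deriv_diff:
  assumes "poly_map f" "poly_map g"
  shows "foldr partial_deriv js (\<lambda>x. f x - g x) = (\<lambda>x. foldr partial_deriv js f x - foldr partial_deriv js g x)"
  by (induction js) (simp_all add: pd_diff[OF poly_map_iterated[OF assms(1)] poly_map_iterated[OF assms(2)]])

lemma van_diff_iff:
  assumes "poly_map f" "poly_map g"
  shows "van (Suc r) v (\<lambda>x. f x - g x) \<longleftrightarrow> (\<forall>js. length js \<le> r \<longrightarrow> foldr partial_deriv js f v = foldr partial_deriv js g v)"
  unfolding van_def iterated_deriv_diff[OF assms] by (simp add: less_Suc_eq_le)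

lemma dim_injective_image:
  assumes "linear f" "subspace S" "inj_on f S" shows "dim (f ` S) = dim S"
proof -
  obtain B where B: "B \<subseteq> S" "independent B" "S \<subseteq> span B" "card B = dim S" using basis_exists[of S] by blast
  have sB: "span B \<subseteq> S" by (rule span_minimal[OF B(1) assms(2)])
  have i: "inj_on f (span B)" by (rule inj_on_subset[OF assms(3) sB])
  show ?thesis
  proof (rule dim_unique)
    show "f ` B \<subseteq> f ` S" using B(1) by blast
    show "f ` S \<subseteq> span (f ` B)" unfolding linear_span_image[OF assms(1)] using B(3) by blast
    show "independent (f ` B)" using linear_dependent_inj_imageD[OF assms(1) _ i] B(2) by blast
    show "card (f ` B) = dim S" using card_image[OF inj_on_subset[OF assms(3) B(1)]] B(4) by simp
  qed
qed

text \<open>At a point with a zero coordinate one may leave the triangle along an edge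
  vector.\<close>

lemma interior_hull_iff:
  assumes t: "tri K" shows "x \<in> interior (convex hull K) \<longleftrightarrow> (\<forall>a\<in>K. 0 < bary K a x)"
proof
  assume x: "x \<in> interior (convex hull K)"
  show "\<forall>a\<in>K. 0 < bary K a x"
  proof (rule ballI, rule ccontr)
    fix a assume a: "a \<in> K" "\<not> 0 < bary K a x"
    obtain c b where k: "K = {a, c, b}" "cr (c - a) (b - a) \<noteq> 0" using tri_at[OF t a(1)] .
    have c: "c \<in> K" "a \<noteq> c" using k cr_distinct[OF k(2)] by auto
    obtain s where s: "0 < s" "x + s *\<^sub>R (c - a) \<in> interior (convex hull K)"
      using open_move[OF open_interior x] by blast
    have "gr K a \<bullet> (c - a) = - (gr K a \<bullet> (a - c))" by (simp add: inner_diff_right)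
    also have "\<dots> = - 1" using gr_edge[OF t c(1) a(1) c(2) a(1)] by simp
    finally have "bary K a (x + s *\<^sub>R (c - a)) = bary K a x - s" by (simp add: bary_affine[OF t])
    moreover have "0 \<le> bary K a (x + s *\<^sub>R (c - a))"
      using subsetD[OF interior_subset s(2)] a(1) unfolding hull_iff[OF t] by blast
    ultimately show False using a(2) s(1) by linarith
  qed
next
  assume x: "\<forall>a\<in>K. 0 < bary K a x"
  have "open (\<Inter>a\<in>K. {x. 0 < bary K a x})"
    by (rule open_INT[OF tri_finite[OF t]]) (rule ballI, rule open_bary_pos[OF t])
  moreover have "(\<Inter>a\<in>K. {x. 0 < bary K a x}) \<subseteq> convex hull K"
  proof
    fix y assume "y \<in> (\<Inter>a\<in>K. {x. 0 < bary K a x})"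
    then have "\<forall>a\<in>K. 0 \<le> bary K a y" by (auto intro: less_imp_le)
    then show "y \<in> convex hull K" unfolding hull_iff[OF t] .
  qed
  ultimately have "(\<Inter>a\<in>K. {x. 0 < bary K a x}) \<subseteq> interior (convex hull K)" by (rule interior_maximal[rotated])
  then show "x \<in> interior (convex hull K)" using x by blast
qed

lemma poly_map_eq_of_open:
  fixes f :: "point \<Rightarrow> point"
  assumes "poly_map f" "poly_map g" "open S" "x0 \<in> S" "\<And>x. x \<in> S \<Longrightarrow> f x = g x" shows "f = g"
proof
  fix x
  have "f x $ i = g x $ i" for i
  proof -
    have "(\<lambda>x. f x $ i - g x $ i) x = 0"
      by (rule poly_map_eq_zero_of_open[OF poly_map_diff[OF poly_map_nth[OF assms(1)] poly_map_nth[OF assms(2)]] assms(3,4)])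
        (simp add: assms(5))
    then show ?thesis by simp
  qed
  then show "f x = g x" by (simp add: vec_eq_iff)
qed

context triangulated_domain
begin

abbreviation cell_int :: "point set \<Rightarrow> point set" where "cell_int K \<equiv> interior (convex hull K)"

lemma cell_int_unique: "K \<in> \<C> \<Longrightarrow> K' \<in> \<C> \<Longrightarrow> x \<in> cell_int K \<Longrightarrow> x \<in> convex hull K' \<Longrightarrow> K = K'"
proof -
  assume *: "K \<in> \<C>" "K' \<in> \<C>" "x \<in> cell_int K" "x \<in> convex hull K'"
  show "K = K'"
  proof (rule element_eqI[OF *(1,2,4)])
    show "0 < bary K a x" if "a \<in> K" for a using *(3) that unfolding interior_hull_iff[OF cellD(1)[OF *(1)]] by blast
  qed
qed

lemma mesh_interior_eq: "mesh_interior \<T> = (\<Union>K\<in>\<C>. cell_int K)"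
  unfolding mesh_interior_def by (subst cells_image[symmetric]) (rule image_image[THEN arg_cong])

lemma cell_int_near_vertex:
  assumes "K \<in> \<C>" "v \<in> K" shows "v islimpt cell_int K"
proof (rule islimptI)
  fix U assume U: "v \<in> U" "open U"
  obtain y where y: "y \<in> U" "y \<noteq> v" "\<forall>c\<in>K. 0 < bary K c y" using star_direction[OF assms U(2,1)] by blast
  have "y \<in> cell_int K" unfolding interior_hull_iff[OF cellD(1)[OF assms(1)]] by (rule y(3))
  then show "\<exists>y\<in>cell_int K. y \<in> U \<and> y \<noteq> v" using y(1,2) by blast
qed

text \<open>On the open interior the function and the polynomial have the same derivatives, and
  those of the polynomial are continuous up to the vertex.\<close>

lemma derivative_limit:
  fixes f p :: "point \<Rightarrow> 'b::real_normed_vector"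
  assumes p: "poly_map p" and f: "\<And>x. x \<in> cell_int K \<Longrightarrow> f x = p x"
  shows "(foldr partial_deriv js f \<longlongrightarrow> foldr partial_deriv js p v) (at v within cell_int K)"
proof -
  have "continuous_on UNIV (foldr partial_deriv js p)" by (rule poly_map_continuous[OF poly_map_iterated[OF p]])
  then have "isCont (foldr partial_deriv js p) v" by (simp add: continuous_on_eq_continuous_at)
  then have "(foldr partial_deriv js p \<longlongrightarrow> foldr partial_deriv js p v) (at v within cell_int K)"
    by (rule tendsto_within_subset[OF isContD]) simp
  moreover have "eventually (\<lambda>x. foldr partial_deriv js p x = foldr partial_deriv js f x) (at v within cell_int K)"
    unfolding eventually_at_topological
    by (intro exI[of _ UNIV]) (simp add: iterated_deriv_cong_open[OF open_interior f])
  ultimately show ?thesis by (rule Lim_transform_eventually)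
qed

text \<open>The limit of a derivative from an element is the derivative of the polynomial on
  that element, so the limits agree exactly when the differences of the polynomials vanish to
  the order required.\<close>

lemma smooth_iff:
  fixes f :: "point \<Rightarrow> 'b::real_normed_vector"
  assumes p: "\<And>K. K \<in> \<C> \<Longrightarrow> poly_map (p K)" and f: "\<And>K x. K \<in> \<C> \<Longrightarrow> x \<in> cell_int K \<Longrightarrow> f x = p K x"
  shows "smooth_at_vertices r \<T> f \<longleftrightarrow>
    (\<forall>K\<in>\<C>. \<forall>K'\<in>\<C>. \<forall>v. v \<in> K \<longrightarrow> v \<in> K' \<longrightarrow> van (Suc r) v (\<lambda>x. p K x - p K' x))"
proof
  have lim: "(foldr partial_deriv js f \<longlongrightarrow> foldr partial_deriv js (p K) v) (at v within cell_int K)"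
    if "K \<in> \<C>" for js v K by (rule derivative_limit[OF p[OF that] f[OF that]])
  assume s: "smooth_at_vertices r \<T> f"
  show "\<forall>K\<in>\<C>. \<forall>K'\<in>\<C>. \<forall>v. v \<in> K \<longrightarrow> v \<in> K' \<longrightarrow> van (Suc r) v (\<lambda>x. p K x - p K' x)"
  proof (intro ballI allI impI)
    fix K K' v assume K: "K \<in> \<C>" "K' \<in> \<C>" "v \<in> K" "v \<in> K'"
    show "van (Suc r) v (\<lambda>x. p K x - p K' x)" unfolding van_diff_iff[OF p[OF K(1)] p[OF K(2)]]
    proof (intro allI impI)
      fix js :: "2 list" assume js: "length js \<le> r"
      have "v \<in> mesh_vertices \<T>" unfolding vertices_eq using K(1,3) by (rule UnionI)
      then obtain l where l: "\<And>T. T \<in> \<T> \<Longrightarrow> v \<in> T \<Longrightarrow> (foldr partial_deriv js f \<longlongrightarrow> l) (at v within interior T)"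
        using s js unfolding smooth_at_vertices_def by metis
      have "foldr partial_deriv js (p L) v = l" if L: "L \<in> \<C>" "v \<in> L" for L
      proof (rule tendsto_unique)
        show "at v within cell_int L \<noteq> bot" using cell_int_near_vertex[OF L] by (simp add: trivial_limit_within)
        show "(foldr partial_deriv js f \<longlongrightarrow> foldr partial_deriv js (p L) v) (at v within cell_int L)"
          by (rule lim[OF L(1)])
        show "(foldr partial_deriv js f \<longlongrightarrow> l) (at v within cell_int L)"
          by (rule l[OF cellD(2)[OF L(1)] hull_inc[OF L(2)]])
      qed
      then show "foldr partial_deriv js (p K) v = foldr partial_deriv js (p K') v" using K by simp
    qed
  qed
next
  have lim: "(foldr partial_deriv js f \<longlongrightarrow> foldr partial_deriv js (p K) v) (at v within cell_int K)"
    if "K \<in> \<C>" for js v K by (rule derivative_limit[OF p[OF that] f[OF that]])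
  assume s: "\<forall>K\<in>\<C>. \<forall>K'\<in>\<C>. \<forall>v. v \<in> K \<longrightarrow> v \<in> K' \<longrightarrow> van (Suc r) v (\<lambda>x. p K x - p K' x)"
  show "smooth_at_vertices r \<T> f" unfolding smooth_at_vertices_def
  proof (intro ballI allI impI)
    fix v and js :: "2 list" assume v: "v \<in> mesh_vertices \<T>" and js: "length js \<le> r"
    have vu: "v \<in> \<Union>\<C>" using v unfolding vertices_eq .
    then obtain K where K: "K \<in> \<C>" "v \<in> K" by blast
    show "\<exists>l. \<forall>T\<in>\<T>. v \<in> T \<longrightarrow> (foldr partial_deriv js f \<longlongrightarrow> l) (at v within interior T)"
    proof (intro exI ballI impI)
      fix T assume T: "T \<in> \<T>" "v \<in> T"
      obtain L where L: "L \<in> \<C>" "T = convex hull L" using element_cell[OF T(1)] .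
      have vL: "v \<in> L" by (rule vertex_subhull[OF vu L(1) subset_refl]) (use T(2) L(2) in simp)
      have "foldr partial_deriv js (p L) v = foldr partial_deriv js (p K) v"
        using s[rule_format, OF L(1) K(1) vL K(2)] js unfolding van_diff_iff[OF p[OF L(1)] p[OF K(1)]] by blast
      then show "(foldr partial_deriv js f \<longlongrightarrow> foldr partial_deriv js (p K) v) (at v within interior T)"
        using lim[OF L(1), of js v] unfolding L(2) by simp
    qed
  qed
qed

text \<open>The function that a family represents: the polynomial of an element on its interior,
  and zero on the edges and outside. The sum has at most one nonzero term.\<close>

definition realize :: "(point set \<Rightarrow> point \<Rightarrow> point) \<Rightarrow> point \<Rightarrow> point" where
  "realize q x = (\<Sum>K\<in>\<C>. if x \<in> cell_int K then q K x else 0)"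

lemma realize_on: assumes "K \<in> \<C>" "x \<in> cell_int K" shows "realize q x = q K x"
proof -
  have "realize q x = (\<Sum>L\<in>\<C>. if L = K then q K x else 0)" unfolding realize_def
  proof (rule sum.cong[OF refl])
    fix L assume L: "L \<in> \<C>"
    have "x \<in> cell_int L \<longleftrightarrow> L = K"
      using cell_int_unique[OF L assms(1) _ subsetD[OF interior_subset assms(2)]] assms(2) by blast
    then show "(if x \<in> cell_int L then q L x else 0) = (if L = K then q K x else 0)" by simp
  qed
  then show ?thesis using cells_finite assms(1) by simp
qed

lemma realize_off: assumes "x \<notin> mesh_interior \<T>" shows "realize q x = 0"
  unfolding realize_def by (rule sum.neutral) (use assms in \<open>auto simp: mesh_interior_eq\<close>)

lemma realize_eqI:
  assumes "\<And>K x. K \<in> \<C> \<Longrightarrow> x \<in> cell_int K \<Longrightarrow> f x = q K x" "\<And>x. x \<notin> mesh_interior \<T> \<Longrightarrow> f x = 0"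
  shows "realize q = f"
proof
  fix x show "realize q x = f x"
  proof (cases "x \<in> mesh_interior \<T>")
    case True
    then obtain K where K: "K \<in> \<C>" "x \<in> cell_int K" unfolding mesh_interior_eq by (rule UN_E)
    then show ?thesis by (simp add: realize_on assms(1))
  next
    case False
    then show ?thesis by (simp add: realize_off assms(2))
  qed
qed

lemma realize_linear: "linear realize"
proof (rule linearI)
  show "realize (p + q) = realize p + realize q" for p q
    by (rule realize_eqI) (simp_all add: realize_on realize_off)
  show "realize (r *\<^sub>R q) = r *\<^sub>R realize q" for r q
    by (rule realize_eqI) (simp_all add: realize_on realize_off scaleR_fun_def)
qed

text \<open>A polynomial is determined by its values on the interior of an element.\<close>

lemma realize_inj: "inj_on realize Qfam"
proof (rule inj_onI, rule ext)
  fix p q K assume pq: "p \<in> Qfam" "q \<in> Qfam" "realize p = realize q"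
  show "p K = q K"
  proof (cases "K \<in> \<C>")
    case True
    obtain a b c where "K = {a, b, c}" using cellD(1)[OF True] unfolding tri_def by (elim exE conjE)
    then have "a \<in> K" by simp
    obtain x0 where x0: "\<forall>c\<in>K. 0 < bary K c x0" using star_direction[OF True \<open>a \<in> K\<close> open_UNIV UNIV_I] by blast
    show ?thesis
    proof (rule poly_map_eq_of_open[OF QfamD(3)[OF pq(1)] QfamD(3)[OF pq(2)] open_interior])
      show "x0 \<in> cell_int K" unfolding interior_hull_iff[OF cellD(1)[OF True]] by (rule x0)
      show "p K x = q K x" if "x \<in> cell_int K" for x
        using realize_on[OF True that, of p] realize_on[OF True that, of q] pq(3) by simp
    qed
  next
    case False
    then show ?thesis using QfamD(2)[OF pq(1) False] QfamD(2)[OF pq(2) False] by simp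
  qed
qed

lemma realize_L2: assumes q: "q \<in> Qfam" shows "realize q \<in> L2_functions \<Omega>"
proof -
  have \<Omega>: "open \<Omega>" "bounded \<Omega>" using dom unfolding polygonal_domain_def by simp_all
  interpret finite_measure "lebesgue_on \<Omega>" by (rule finite_measure_lebesgue_on[OF lmeasurable_open[OF \<Omega>(2,1)]])
  have c: "continuous_on S (q K)" for K S by (rule poly_map_continuous[OF QfamD(3)[OF q]])
  have "realize q \<in> borel_measurable borel" unfolding realize_def[abs_def]
  proof (rule borel_measurable_sum, rule measurable_If_set)
    show "q K \<in> borel_measurable borel" for K by (rule borel_measurable_continuous_onI[OF c])
  qed auto
  then have "realize q \<in> borel_measurable lborel" by simp
  then have m: "realize q \<in> borel_measurable (lebesgue_on \<Omega>)"
    by (intro measurable_restrict_space1 measurable_completion)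
  have "\<exists>B. \<forall>x\<in>convex hull K. norm (q K x) \<le> B" if "K \<in> \<C>" for K
  proof -
    have "compact (convex hull K)" by (rule finite_imp_compact_convex_hull[OF tri_finite[OF cellD(1)[OF that]]])
    then have "bounded (q K ` (convex hull K))" by (intro compact_imp_bounded compact_continuous_image c)
    then show ?thesis unfolding bounded_iff by blast
  qed
  then obtain B where B: "\<And>K x. K \<in> \<C> \<Longrightarrow> x \<in> convex hull K \<Longrightarrow> norm (q K x) \<le> B K" by metis
  let ?M = "\<Sum>K\<in>\<C>. \<bar>B K\<bar>"
  have b: "norm (realize q x) \<le> ?M" for x
    unfolding realize_def
  proof (rule sum_norm_le)
    fix K assume K: "K \<in> \<C>"
    show "norm (if x \<in> cell_int K then q K x else 0) \<le> \<bar>B K\<bar>"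
      using B[OF K, of x] subsetD[OF interior_subset, of x "convex hull K"] by auto
  qed
  have "integrable (lebesgue_on \<Omega>) (\<lambda>x. (norm (realize q x))\<^sup>2)"
  proof (rule integrable_const_bound)
    show "AE x in lebesgue_on \<Omega>. norm ((norm (realize q x))\<^sup>2) \<le> ?M\<^sup>2"
      using power_mono[OF b norm_ge_zero] by (intro AE_I2) simp
    show "(\<lambda>x. (norm (realize q x))\<^sup>2) \<in> borel_measurable (lebesgue_on \<Omega>)"
      by (rule borel_measurable_power[OF measurable_compose[OF m borel_measurable_norm]])
  qed
  then show ?thesis using m unfolding L2_functions_def by simp
qed

lemma realize_Q_broken: "realize ` Qfam = Q_broken \<Omega> \<T> (k - 1)"
proof (intro subset_antisym subsetI)
  fix f assume "f \<in> realize ` Qfam"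
  then obtain q where f: "f = realize q" and q: "q \<in> Qfam" by (rule imageE)
  show "f \<in> Q_broken \<Omega> \<T> (k - 1)" unfolding f Q_broken_def
  proof (intro CollectI conjI allI impI ballI)
    show "realize q \<in> L2_functions \<Omega>" by (rule realize_L2[OF q])
    show "realize q x = 0" if "x \<notin> mesh_interior \<T>" for x by (rule realize_off[OF that])
    fix T assume "T \<in> \<T>"
    then obtain K where K: "K \<in> \<C>" "T = convex hull K" by (rule element_cell)
    show "\<exists>p\<in>poly_maps (k - 1). \<forall>x\<in>interior T. realize q x = p x"
      by (rule bexI[OF _ QfamD(1)[OF q K(1)]]) (simp add: K(2) realize_on[OF K(1)])
  qed
next
  fix f assume f: "f \<in> Q_broken \<Omega> \<T> (k - 1)"
  have "\<exists>p\<in>poly_maps (k - 1). \<forall>x\<in>cell_int K. f x = p x" if "K \<in> \<C>" for K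
    using f cellD(2)[OF that] unfolding Q_broken_def by simp
  then have "\<forall>K\<in>\<C>. \<exists>p. p \<in> poly_maps (k - 1) \<and> (\<forall>x\<in>cell_int K. f x = p x)" unfolding Bex_def by (rule ballI)
  from bchoice[OF this] obtain p where p: "\<forall>K\<in>\<C>. p K \<in> poly_maps (k - 1) \<and> (\<forall>x\<in>cell_int K. f x = p K x)" ..
  define q where "q K = (if K \<in> \<C> then p K else (\<lambda>x. 0))" for K
  have "realize q = f"
  proof (rule realize_eqI)
    show "f x = q K x" if "K \<in> \<C>" "x \<in> cell_int K" for K x using p that by (simp add: q_def)
    show "f x = 0" if "x \<notin> mesh_interior \<T>" for x using f that unfolding Q_broken_def by simp
  qed
  moreover have "q \<in> Qfam" unfolding Qfam_def using p by (simp add: q_def)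
  ultimately show "f \<in> realize ` Qfam" by (rule image_eqI[OF sym])
qed

lemma realize_smooth:
  assumes "q \<in> Qfam" shows "smooth_at_vertices r \<T> (realize q) \<longleftrightarrow> q \<in> Qsm r"
proof -
  have "smooth_at_vertices r \<T> (realize q) \<longleftrightarrow>
    (\<forall>K\<in>\<C>. \<forall>K'\<in>\<C>. \<forall>v. v \<in> K \<longrightarrow> v \<in> K' \<longrightarrow> van (Suc r) v (\<lambda>x. q K x - q K' x))"
    by (rule smooth_iff) (rule QfamD(3)[OF assms], rule realize_on)
  then show ?thesis unfolding Qsm_def using assms by simp
qed

lemma realize_Q_space: "realize ` Qsm r = Q_space \<Omega> \<T> (k - 1) r"
proof -
  have "Q_space \<Omega> \<T> (k - 1) r = {f \<in> realize ` Qfam. smooth_at_vertices r \<T> f}"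
    unfolding Q_space_def realize_Q_broken ..
  also have "\<dots> = realize ` {q \<in> Qfam. smooth_at_vertices r \<T> (realize q)}" by blast
  also have "{q \<in> Qfam. smooth_at_vertices r \<T> (realize q)} = Qsm r"
    using realize_smooth[of _ r] by (auto simp: Qsm_def)
  finally show ?thesis by (rule sym)
qed

lemma mesh_div_realize:
  assumes "\<And>K x. K \<in> \<C> \<Longrightarrow> x \<in> cell_int K \<Longrightarrow> \<sigma> x = s K x"
  shows "mesh_div \<T> \<sigma> = realize (\<lambda>K. pdiv (s K))"
proof (rule sym, rule realize_eqI)
  fix K x assume K: "K \<in> \<C>" "x \<in> cell_int K"
  then have "x \<in> mesh_interior \<T>" unfolding mesh_interior_eq by (rule UN_I)
  moreover have "partial_deriv j (\<lambda>y. \<sigma> y $ i $ j) x = partial_deriv j (\<lambda>y. s K y $ i $ j) x" for i j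
    by (rule partial_deriv_cong_open[OF open_interior _ K(2)]) (simp add: assms[OF K(1)])
  ultimately show "mesh_div \<T> \<sigma> x = pdiv (s K) x" by (simp add: mesh_div_def pdiv_def)
qed (simp add: mesh_div_def)

lemma closure_cell: assumes "x \<in> closure \<Omega>" obtains K where "K \<in> \<C>" "x \<in> convex hull K"
  using assms unfolding hulls_union[symmetric] by (rule UN_E)

lemma cell_closure: "K \<in> \<C> \<Longrightarrow> x \<in> convex hull K \<Longrightarrow> x \<in> closure \<Omega>"
  unfolding hulls_union[symmetric] by (rule UN_I)

text \<open>On each element the polynomial given for a stress is symmetric on the element only;
  its symmetric part is symmetric everywhere and has the same values there.\<close>

definition sympart :: "(point \<Rightarrow> real ^ 2 ^ 2) \<Rightarrow> point \<Rightarrow> real ^ 2 ^ 2" where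
  "sympart p x = (1 / 2) *\<^sub>R (p x + transpose (p x))"

lemma linear_sympart: "linear (\<lambda>A :: real ^ 2 ^ 2. (1 / 2) *\<^sub>R (A + transpose A))"
  by (rule linearI) (simp_all add: vec_eq_iff transpose_def algebra_simps)

lemma sympart_sym: "sympart p x \<in> sym_matrices" "p x \<in> sym_matrices \<Longrightarrow> sympart p x = p x"
  by (simp_all add: sympart_def sym_matrices_def transpose_def vec_eq_iff)

lemma Sigma_to_Sfam:
  assumes \<sigma>: "\<sigma> \<in> Sigma_space \<Omega> \<T> k r"
  obtains s where "s \<in> Sfam r" "\<And>K x. K \<in> \<C> \<Longrightarrow> x \<in> convex hull K \<Longrightarrow> \<sigma> x = s K x"
proof -
  note S = \<sigma>[unfolded Sigma_space_def mem_Collect_eq]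
  have sy: "\<forall>x\<in>closure \<Omega>. \<sigma> x \<in> sym_matrices" and po: "\<forall>T\<in>\<T>. \<exists>p\<in>poly_maps k. \<forall>x\<in>T. \<sigma> x = p x"
    and sm: "smooth_at_vertices r \<T> \<sigma>" using S by simp_all
  have "\<forall>K\<in>\<C>. \<exists>p. p \<in> poly_maps k \<and> (\<forall>x\<in>convex hull K. \<sigma> x = p x)"
    using po cellD(2) unfolding Bex_def by blast
  from bchoice[OF this] obtain p where p: "\<forall>K\<in>\<C>. p K \<in> poly_maps k \<and> (\<forall>x\<in>convex hull K. \<sigma> x = p K x)" ..
  define s where "s K = (if K \<in> \<C> then sympart (p K) else (\<lambda>x. 0))" for K
  have s: "s K \<in> poly_maps k" "\<And>x. s K x \<in> sym_matrices" if K: "K \<in> \<C>" for K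
    using poly_maps_linear[OF p[rule_format, OF K, THEN conjunct1] linear_sympart] K
    by (simp_all add: s_def sympart_sym(1)) (simp add: sympart_def[abs_def])
  have eq: "\<sigma> x = s K x" if K: "K \<in> \<C>" "x \<in> convex hull K" for K x
  proof -
    have "\<sigma> x = p K x" using p K by blast
    moreover have "\<sigma> x \<in> sym_matrices" using sy cell_closure[OF K] by blast
    ultimately show ?thesis using K(1) by (simp add: s_def sympart_sym(2))
  qed
  have "s \<in> Sfam r"
  proof (rule SfamI)
    fix K K' v assume K: "K \<in> \<C>" "K' \<in> \<C>" "v \<in> K" "v \<in> K'"
    have "\<forall>K\<in>\<C>. \<forall>K'\<in>\<C>. \<forall>v. v \<in> K \<longrightarrow> v \<in> K' \<longrightarrow> van (Suc r) v (\<lambda>x. s K x - s K' x)"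
    proof (rule iffD1[OF smooth_iff sm])
      show "poly_map (s K)" if "K \<in> \<C>" for K by (rule poly_mapI[OF s(1)[OF that]])
      show "\<sigma> x = s K x" if "K \<in> \<C>" "x \<in> cell_int K" for K x
        by (rule eq[OF that(1) subsetD[OF interior_subset that(2)]])
    qed
    then show "van (Suc r) v (\<lambda>x. s K x - s K' x)" using K by blast
  next
    fix K K' x assume K: "K \<in> \<C>" "K' \<in> \<C>" "x \<in> convex hull K" "x \<in> convex hull K'"
    show "s K x = s K' x" using eq[OF K(1,3)] eq[OF K(2,4)] by simp
  next
    fix K x assume K: "K \<in> \<C>"
    show "s K \<in> poly_maps k" by (rule s(1)[OF K])
    show "s K x \<in> sym_matrices" by (rule s(2)[OF K])
  qed (simp add: s_def)
  then show thesis by (rule that[OF _ eq])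
qed

text \<open>The polynomials agree on intersections, so any element that contains a point may be
  used for the value at that point.\<close>

lemma Sfam_to_Sigma:
  assumes s: "s \<in> Sfam r"
  obtains \<sigma> where "\<sigma> \<in> Sigma_space \<Omega> \<T> k r" "\<And>K x. K \<in> \<C> \<Longrightarrow> x \<in> convex hull K \<Longrightarrow> \<sigma> x = s K x"
proof -
  define \<sigma> where "\<sigma> x = (if x \<in> closure \<Omega> then s (SOME K. K \<in> \<C> \<and> x \<in> convex hull K) x else 0)" for x
  have eq: "\<sigma> x = s K x" if K: "K \<in> \<C>" "x \<in> convex hull K" for K x
  proof -
    let ?L = "SOME L. L \<in> \<C> \<and> x \<in> convex hull L"
    have "?L \<in> \<C> \<and> x \<in> convex hull ?L" by (rule someI[of _ K]) (use K in simp)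
    then have "s ?L x = s K x" by (intro SfamD(3)[OF s]) (use K in auto)
    then show ?thesis using cell_closure[OF K] by (simp add: \<sigma>_def)
  qed
  have "\<sigma> \<in> Sigma_space \<Omega> \<T> k r" unfolding Sigma_space_def
  proof (intro CollectI conjI ballI allI impI)
    show "continuous_on (closure \<Omega>) \<sigma>" unfolding hulls_union[symmetric]
    proof (rule continuous_on_closed_Union[OF cells_finite])
      fix K assume K: "K \<in> \<C>"
      show "closed (convex hull K)"
        by (rule compact_imp_closed[OF finite_imp_compact_convex_hull[OF tri_finite[OF cellD(1)[OF K]]]])
      show "continuous_on (convex hull K) \<sigma>"
        using poly_map_continuous[OF SfamD(6)[OF s]] by (simp add: eq[OF K] cong: continuous_on_cong)
    qed
    show "\<sigma> x \<in> sym_matrices" if x: "x \<in> closure \<Omega>" for x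
    proof -
      obtain K where K: "K \<in> \<C>" "x \<in> convex hull K" using x by (rule closure_cell)
      show ?thesis unfolding eq[OF K] by (rule SfamD(2)[OF s K(1)])
    qed
    show "\<sigma> x = 0" if "x \<notin> closure \<Omega>" for x using that by (simp add: \<sigma>_def)
    show "\<exists>p\<in>poly_maps k. \<forall>x\<in>T. \<sigma> x = p x" if T: "T \<in> \<T>" for T
    proof -
      obtain K where K: "K \<in> \<C>" "T = convex hull K" using T by (rule element_cell)
      show ?thesis by (rule bexI[OF _ SfamD(1)[OF s K(1)]]) (simp add: K(2) eq[OF K(1)])
    qed
    show "smooth_at_vertices r \<T> \<sigma>"
    proof (rule iffD2[OF smooth_iff])
      show "poly_map (s K)" for K by (rule SfamD(6)[OF s])
      show "\<sigma> x = s K x" if "K \<in> \<C>" "x \<in> cell_int K" for K x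
        by (rule eq[OF that(1) subsetD[OF interior_subset that(2)]])
      show "\<forall>K\<in>\<C>. \<forall>K'\<in>\<C>. \<forall>v. v \<in> K \<longrightarrow> v \<in> K' \<longrightarrow> van (Suc r) v (\<lambda>x. s K x - s K' x)"
        by (intro ballI allI impI) (rule SfamD(4)[OF s])
    qed
  qed
  then show thesis by (rule that[OF _ eq])
qed

lemma realize_Dfam: "mesh_div \<T> ` Sigma_space \<Omega> \<T> k r = realize ` Dfam r"
proof (intro subset_antisym subsetI)
  fix d assume "d \<in> mesh_div \<T> ` Sigma_space \<Omega> \<T> k r"
  then obtain \<sigma> where d: "d = mesh_div \<T> \<sigma>" and \<sigma>: "\<sigma> \<in> Sigma_space \<Omega> \<T> k r" by (rule imageE)
  obtain s where s: "s \<in> Sfam r" "\<And>K x. K \<in> \<C> \<Longrightarrow> x \<in> convex hull K \<Longrightarrow> \<sigma> x = s K x" using Sigma_to_Sfam[OF \<sigma>] by metis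
  have "d = realize (\<lambda>K. pdiv (s K))" unfolding d
    by (rule mesh_div_realize) (rule s(2)[OF _ subsetD[OF interior_subset]])
  then show "d \<in> realize ` Dfam r" by (rule image_eqI[OF _ DfamI[OF s(1)]])
next
  fix d assume "d \<in> realize ` Dfam r"
  then obtain q where d: "d = realize q" and "q \<in> Dfam r" by (rule imageE)
  from this(2) obtain s where s: "s \<in> Sfam r" "q = (\<lambda>K. pdiv (s K))" by (rule DfamE)
  obtain \<sigma> where \<sigma>: "\<sigma> \<in> Sigma_space \<Omega> \<T> k r" "\<And>K x. K \<in> \<C> \<Longrightarrow> x \<in> convex hull K \<Longrightarrow> \<sigma> x = s K x"
    using Sfam_to_Sigma[OF s(1)] by metis
  have "mesh_div \<T> \<sigma> = realize (\<lambda>K. pdiv (s K))"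
    by (rule mesh_div_realize) (rule \<sigma>(2)[OF _ subsetD[OF interior_subset]])
  then have "d = mesh_div \<T> \<sigma>" unfolding d s(2) by (rule sym)
  then show "d \<in> mesh_div \<T> ` Sigma_space \<Omega> \<T> k r" by (rule image_eqI[OF _ \<sigma>(1)])
qed

lemma dim_realize: "subspace S \<Longrightarrow> S \<subseteq> Qfam \<Longrightarrow> dim (realize ` S) = dim S"
  by (rule dim_injective_image[OF realize_linear _ inj_on_subset[OF realize_inj]])

theorem divergence_ranges:
  "mesh_div \<T> ` Sigma_space \<Omega> \<T> k 2 = Q_space \<Omega> \<T> (k - 1) 1"
  "type_I_vertices \<Omega> \<T> = {} \<Longrightarrow> mesh_div \<T> ` Sigma_space \<Omega> \<T> k 1 = Q_space \<Omega> \<T> (k - 1) 0"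
  "type_I_vertices \<Omega> \<T> = {} \<Longrightarrow> type_II_vertices \<Omega> \<T> = {} \<Longrightarrow>
     mesh_div \<T> ` Sigma_space \<Omega> \<T> k 0 = Q_broken \<Omega> \<T> (k - 1)"
  "dim (Q_space \<Omega> \<T> (k - 1) 0) = dim (mesh_div \<T> ` Sigma_space \<Omega> \<T> k 1) + card (type_I_vertices \<Omega> \<T>)"
  "dim (Q_broken \<Omega> \<T> (k - 1)) = dim (mesh_div \<T> ` Sigma_space \<Omega> \<T> k 0)
     + (card (type_II_vertices \<Omega> \<T>) + 3 * card (type_I_vertices \<Omega> \<T>))"
proof -
  show "mesh_div \<T> ` Sigma_space \<Omega> \<T> k 2 = Q_space \<Omega> \<T> (k - 1) 1"
    unfolding realize_Dfam Dfam2_eq realize_Q_space ..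
  show "mesh_div \<T> ` Sigma_space \<Omega> \<T> k 1 = Q_space \<Omega> \<T> (k - 1) 0" if "type_I_vertices \<Omega> \<T> = {}"
    unfolding realize_Dfam family_surjective(1)[OF that[unfolded type_I_eq]] realize_Q_space ..
  show "mesh_div \<T> ` Sigma_space \<Omega> \<T> k 0 = Q_broken \<Omega> \<T> (k - 1)"
    if "type_I_vertices \<Omega> \<T> = {}" "type_II_vertices \<Omega> \<T> = {}"
    unfolding realize_Dfam family_surjective(2)[OF that[unfolded type_I_eq type_II_eq]] realize_Q_broken ..
  have Qs: "Qsm 0 \<subseteq> Qfam" unfolding Qsm_def by blast
  show "dim (Q_space \<Omega> \<T> (k - 1) 0) = dim (mesh_div \<T> ` Sigma_space \<Omega> \<T> k 1) + card (type_I_vertices \<Omega> \<T>)"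
    unfolding realize_Dfam realize_Q_space[symmetric] dim_realize[OF subspace_Qsm Qs] dim_realize[OF subspace_Dfam Dfam_Qfam]
      type_I_eq by (rule family_dims(2))
  show "dim (Q_broken \<Omega> \<T> (k - 1)) = dim (mesh_div \<T> ` Sigma_space \<Omega> \<T> k 0)
     + (card (type_II_vertices \<Omega> \<T>) + 3 * card (type_I_vertices \<Omega> \<T>))"
    unfolding realize_Dfam realize_Q_broken[symmetric] dim_realize[OF subspace_Qfam subset_refl] dim_realize[OF subspace_Dfam Dfam_Qfam]
      type_I_eq type_II_eq by (rule family_dims(1))
qed

end

theorem theorem3p1:
  fixes \<Omega> :: "point set" and \<T> :: mesh and k :: nat
  assumes "k \<ge> 7"
    and "polygonal_domain \<Omega>" and "contractible \<Omega>"
    and "conforming_triangulation \<T> \<Omega>"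
  shows "mesh_div \<T> ` Sigma_space \<Omega> \<T> k 2 = Q_space \<Omega> \<T> (k - 1) 1 \<and>
    (type_I_vertices \<Omega> \<T> = {} \<longrightarrow>
       mesh_div \<T> ` Sigma_space \<Omega> \<T> k 1 = Q_space \<Omega> \<T> (k - 1) 0) \<and>
    (type_I_vertices \<Omega> \<T> = {} \<and> type_II_vertices \<Omega> \<T> = {} \<longrightarrow>
       mesh_div \<T> ` Sigma_space \<Omega> \<T> k 0 = Q_broken \<Omega> \<T> (k - 1)) \<and>
    int (dim (Q_space \<Omega> \<T> (k - 1) 0)) - int (dim (mesh_div \<T> ` Sigma_space \<Omega> \<T> k 1))
      = int (card (type_I_vertices \<Omega> \<T>)) \<and>
    int (dim (Q_broken \<Omega> \<T> (k - 1))) - int (dim (mesh_div \<T> ` Sigma_space \<Omega> \<T> k 0))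
      = int (card (type_II_vertices \<Omega> \<T>)) + 3 * int (card (type_I_vertices \<Omega> \<T>))"
proof -
  interpret triangulated_domain \<Omega> \<T> k by (rule triangulated_domain.intro[OF assms(2,4,1)])
  note R = divergence_ranges
  show ?thesis
  proof (intro conjI impI)
    show "mesh_div \<T> ` Sigma_space \<Omega> \<T> k 2 = Q_space \<Omega> \<T> (k - 1) 1" by (rule R(1))
    show "mesh_div \<T> ` Sigma_space \<Omega> \<T> k 1 = Q_space \<Omega> \<T> (k - 1) 0" if "type_I_vertices \<Omega> \<T> = {}"
      by (rule R(2)[OF that])
    show "mesh_div \<T> ` Sigma_space \<Omega> \<T> k 0 = Q_broken \<Omega> \<T> (k - 1)"
      if "type_I_vertices \<Omega> \<T> = {} \<and> type_II_vertices \<Omega> \<T> = {}"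
      by (rule R(3)[OF that[THEN conjunct1] that[THEN conjunct2]])
    show "int (dim (Q_space \<Omega> \<T> (k - 1) 0)) - int (dim (mesh_div \<T> ` Sigma_space \<Omega> \<T> k 1))
        = int (card (type_I_vertices \<Omega> \<T>))"
      unfolding R(4) by simp
    show "int (dim (Q_broken \<Omega> \<T> (k - 1))) - int (dim (mesh_div \<T> ` Sigma_space \<Omega> \<T> k 0))
        = int (card (type_II_vertices \<Omega> \<T>)) + 3 * int (card (type_I_vertices \<Omega> \<T>))"
      unfolding R(5) by simp
  qed
qed

end
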